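(* Let $A_1,A_2\subset\mathbb Z^3$ be finite sets, and let $B_1,B_2\subset\mathbb Z$ be their projections to the last coordinate line; assume that each of $B_1,B_2$ has at least two elements. Let $f_1,f_2$ be generic complex (or real) Laurent polynomials in three variables supported at $A_1$ and $A_2$ respectively, so that $f_1=f_2=0$ defines a smooth spatial algebraic curve in $(\mathbb C^* )^3$ (or $(\mathbb R^* )^3$). Let $C$ be the closure, in $(\mathbb C^* )^2$ (or $(\mathbb R^* )^2$), of the projection of this curve to the first coordinate plane (i.e. to the first two coordinates). Then $C$ has no singularities of types other than $\mathcal A_1$, unless $B_1$ and $B_2$ satisfy at least one of the following conditions: (1) One can shift $B_1$ and $B_2$ to the same proper sublattice $k\mathbb Z\subset\mathbb Z$ with $k\geqslant 2$. (2) One can split one of the $B_i$'s (say, $B_1$) into $B'\sqcup B''$ so that $B'$, $B''$ and the other set (say, $B_2$) can be shifted to the same sublattice $k\mathbb Z\subset\mathbb Z$ with $k\geqslant 3$. (3) For every $i=1,2$, the two leftmost (smallest) elements of $B_i$ differ by more than 1. (4) For every $i=1,2$, the two rightmost (largest) elements of $B_i$ differ by more than 1. (5) The number of elements in one of the $B_i$'s (say, $B_1$) is 2, and for the other set (say, $B_2$) $\max B_2-\min B_2>2$.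
   Context: A Laurent polynomial is supported at a finite set $A\subset\mathbb Z^3$ if it is a linear combination of the monomials with exponents in $A$; generic means that the coefficients are generic. A singular point of a plane curve is of type $\mathcal A_1$ if the curve is there locally the union of two smooth branches intersecting transversally. "Sets can be shifted to the same sublattice $k\mathbb Z$" means that each of the sets can be translated, by an integer depending on the set, so as to lie in $k\mathbb Z$ (with the same $k$ for all the sets). *)

theory Defs
  imports "HOL-Analysis.Analysis"
begin

type_synonym exponent = "int \<times> int \<times> int"

section \<open>Generic points\<close>

text \<open>Polynomial functions of the variables \<open>c i\<close>, \<open>i \<in> I\<close>. Over an infinite field such as
  \<open>\<real>\<close> or \<open>\<complex>\<close> these are the same as polynomials, so a polynomial is nonzero
  iff its function takes a nonzero value.\<close>

inductive_set polynomial_funs :: "'i set \<Rightarrow> (('i \<Rightarrow> 'a::field) \<Rightarrow> 'a) set"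
  for I :: "'i set" where
  const: "(\<lambda>_. s) \<in> polynomial_funs I"
| var: "i \<in> I \<Longrightarrow> (\<lambda>c. c i) \<in> polynomial_funs I"
| add: "\<lbrakk>P \<in> polynomial_funs I; Q \<in> polynomial_funs I\<rbrakk> \<Longrightarrow> (\<lambda>c. P c + Q c) \<in> polynomial_funs I"
| mult: "\<lbrakk>P \<in> polynomial_funs I; Q \<in> polynomial_funs I\<rbrakk> \<Longrightarrow> (\<lambda>c. P c * Q c) \<in> polynomial_funs I"

text \<open>\<open>\<Phi>\<close> holds for generic \<open>(c i)\<close>, \<open>i \<in> I\<close>: it holds on a nonempty Zariski open set,
  i.e. off the zero set of a nonzero polynomial.\<close>

definition holds_generically :: "'i set \<Rightarrow> (('i \<Rightarrow> 'a::field) \<Rightarrow> bool) \<Rightarrow> bool" where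
  "holds_generically I \<Phi> \<longleftrightarrow>
     (\<exists>P \<in> polynomial_funs I. (\<exists>c. P c \<noteq> 0) \<and> (\<forall>c. P c \<noteq> 0 \<longrightarrow> \<Phi> c))"

section \<open>The spatial curve and its projection\<close>

definition laurent :: "exponent set \<Rightarrow> (exponent \<Rightarrow> 'a::field) \<Rightarrow> 'a \<times> 'a \<times> 'a \<Rightarrow> 'a" where
  "laurent A c = (\<lambda>(x, y, z). \<Sum>(i, j, k)\<in>A. c (i, j, k) * x powi i * y powi j * z powi k)"

definition spatial_curve ::
    "('a \<times> 'a \<times> 'a \<Rightarrow> 'a::field) \<Rightarrow> ('a \<times> 'a \<times> 'a \<Rightarrow> 'a) \<Rightarrow> ('a \<times> 'a \<times> 'a) set" where
  "spatial_curve f1 f2 =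
     {(x, y, z). x \<noteq> 0 \<and> y \<noteq> 0 \<and> z \<noteq> 0 \<and> f1 (x, y, z) = 0 \<and> f2 (x, y, z) = 0}"

text \<open>The system \<open>f1 = f2 = 0\<close> defines a smooth curve (possibly empty) in the torus: the
  differentials of \<open>f1\<close> and \<open>f2\<close> are linearly independent at every solution. Over \<open>\<complex>\<close> the
  (real) derivative \<open>D\<close> below is automatically complex linear.\<close>

definition defines_smooth_curve ::
    "('a \<times> 'a \<times> 'a \<Rightarrow> 'a::real_normed_field) \<Rightarrow> ('a \<times> 'a \<times> 'a \<Rightarrow> 'a) \<Rightarrow> bool" where
  "defines_smooth_curve f1 f2 \<longleftrightarrow>
     (\<forall>q \<in> spatial_curve f1 f2. \<exists>D. ((\<lambda>q. (f1 q, f2 q)) has_derivative D) (at q) \<and> surj D)"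

text \<open>The closure is the topological one, relative to the torus; over \<open>\<complex>\<close> it coincides with the
  Zariski closure, the projection being a constructible set.\<close>

definition projected_curve ::
    "('a \<times> 'a \<times> 'a \<Rightarrow> 'a::real_normed_field) \<Rightarrow> ('a \<times> 'a \<times> 'a \<Rightarrow> 'a) \<Rightarrow> ('a \<times> 'a) set" where
  "projected_curve f1 f2 =
     closure ((\<lambda>(x, y, z). (x, y)) ` spatial_curve f1 f2) \<inter> {(x, y). x \<noteq> 0 \<and> y \<noteq> 0}"

section \<open>Singularities of plane curves\<close>

text \<open>Analyticity in two variables at a point: real analytic over \<open>\<real>\<close>, holomorphic
  over \<open>\<complex>\<close>.\<close>

definition analytic2_at :: "('a \<times> 'a \<Rightarrow> 'a::real_normed_field) \<Rightarrow> 'a \<times> 'a \<Rightarrow> bool" where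
  "analytic2_at g p \<longleftrightarrow>
     (\<exists>a :: nat \<times> nat \<Rightarrow> 'a. \<exists>r>0. \<forall>h k. norm h < r \<and> norm k < r \<longrightarrow>
        ((\<lambda>(m, n). a (m, n) * h ^ m * k ^ n) has_sum g (fst p + h, snd p + k)) UNIV)"

text \<open>Near \<open>p\<close> the set \<open>S\<close> is one smooth branch through \<open>p\<close>: the zero set of an analytic
  function \<open>g\<close> whose differential at \<open>p\<close> is the nonzero covector \<open>(u, v)\<close>. The tangent line of
  the branch is the kernel of \<open>(u, v)\<close>.\<close>

definition smooth_branch_at ::
    "('a \<times> 'a::real_normed_field) set \<Rightarrow> 'a \<times> 'a \<Rightarrow> 'a \<times> 'a \<Rightarrow> bool" where
  "smooth_branch_at S p = (\<lambda>(u, v). (u, v) \<noteq> (0, 0) \<and>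
     (\<exists>g. analytic2_at g p \<and> g p = 0 \<and>
          (g has_derivative (\<lambda>(h, k). u * h + v * k)) (at p) \<and>
          (\<forall>\<^sub>F q in nhds p. q \<in> S \<longleftrightarrow> g q = 0)))"

definition singular_point :: "('a \<times> 'a::real_normed_field) set \<Rightarrow> 'a \<times> 'a \<Rightarrow> bool" where
  "singular_point C p \<longleftrightarrow> p \<in> C \<and> \<not> (\<exists>w. smooth_branch_at C p w)"

text \<open>Type \<open>\<A>\<^sub>1\<close>: locally the union of two smooth branches with distinct tangent lines.\<close>

definition type_A1_at :: "('a \<times> 'a::real_normed_field) set \<Rightarrow> 'a \<times> 'a \<Rightarrow> bool" where
  "type_A1_at C p \<longleftrightarrow>
     (\<exists>S S' u v u' v'. smooth_branch_at S p (u, v) \<and> smooth_branch_at S' p (u', v') \<and>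
        u * v' - v * u' \<noteq> 0 \<and> (\<forall>\<^sub>F q in nhds p. q \<in> C \<longleftrightarrow> q \<in> S \<union> S'))"

definition only_A1_singularities :: "('a \<times> 'a::real_normed_field) set \<Rightarrow> bool" where
  "only_A1_singularities C \<longleftrightarrow> (\<forall>p. singular_point C p \<longrightarrow> type_A1_at C p)"

section \<open>The conditions on the projections to the last coordinate\<close>

definition last_coords :: "exponent set \<Rightarrow> int set" where
  "last_coords A = (\<lambda>(i, j, k). k) ` A"

definition shiftable :: "int \<Rightarrow> int set \<Rightarrow> bool" where
  "shiftable k B \<longleftrightarrow> (\<exists>s. \<forall>b\<in>B. k dvd b + s)"

definition common_sublattice :: "int set \<Rightarrow> int set \<Rightarrow> bool" where
  "common_sublattice B1 B2 \<longleftrightarrow> (\<exists>k\<ge>2. shiftable k B1 \<and> shiftable k B2)"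

text \<open>The following two conditions are not symmetric; the theorem uses them in both orders.\<close>

definition split_sublattice :: "int set \<Rightarrow> int set \<Rightarrow> bool" where
  "split_sublattice B1 B2 \<longleftrightarrow>
     (\<exists>k\<ge>3. \<exists>B' B''. B1 = B' \<union> B'' \<and> B' \<inter> B'' = {} \<and> B' \<noteq> {} \<and> B'' \<noteq> {} \<and>
        shiftable k B' \<and> shiftable k B'' \<and> shiftable k B2)"

definition two_and_long :: "int set \<Rightarrow> int set \<Rightarrow> bool" where
  "two_and_long B1 B2 \<longleftrightarrow> card B1 = 2 \<and> Max B2 - Min B2 > 2"

definition left_gap :: "int set \<Rightarrow> int" where
  "left_gap B = Min (B - {Min B}) - Min B"

definition right_gap :: "int set \<Rightarrow> int" where
  "right_gap B = Max B - Max (B - {Max B})"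

end

theory Submission
  imports Defs "HOL-Complex_Analysis.Complex_Analysis" "HOL-Computational_Algebra.Fundamental_Theorem_Algebra"
begin

text \<open>Each degeneracy to be excluded says that a system of equations, linear in the coefficients
  \<open>c\<close>, is solvable for some parameters \<open>s\<close> (a point of the plane, roots over it, a direction). If its
  rows are independent, Cramer's rule parametrises the pairs \<open>(c, s)\<close> by as many quantities as there are
  coefficients; a further equation on \<open>s\<close>, or a critical point of the parametrisation, then forces a
  polynomial relation on \<open>c\<close>, because there are more monomials of bounded degree in \<open>c\<close> than in the
  remaining quantities. Rows for two roots \<open>z\<close>, \<open>\<tau> z\<close> are dependent only if \<open>\<tau>\<close> is a root of unity
  adapted to a sublattice, which is what (1) and (2) control; dependent triples of roots lie over
  finitely many ratios by (3) and (4), and (5) treats a binomial \<open>f\<^sub>i\<close>.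

  For generic \<open>c\<close> there are thus at most two, simple and transversal, common roots over each point
  \<open>p\<close>. Near \<open>p\<close> the curve \<open>C\<close> is the union of one branch per root, each obtained by solving one
  equation for \<open>z\<close> by Newton's iteration and substituting in the other. A root escaping to \<open>z = 0\<close> or
  \<open>z = \<infinity>\<close> at \<open>p\<close> is the only root there, and gives a smooth branch since by (3) and (4) one of the
  equations has a nonzero linear term in \<open>z\<close> or \<open>1 / z\<close>.\<close>

section \<open>Polynomial functions\<close>

text \<open>The two fields share one algebraic core, \<open>nice_pair\<close>: it is established
  over the complex numbers, survives restriction to real coefficients because |P|^2 is a nonzero
  real polynomial there, and descends since real roots and directions are complex ones. The supports
  being arbitrary, two independence questions shape the proof. Rows that involve only the last
  exponents become dependent for special ratios of roots, so three roots over a point are treated by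
  the ranks of the two row triples: ranks 3 and 3 give six equations in five unknowns, ranks 2 and 3
  give five equations plus a vanishing minor, ranks 2 and 2 confine a ratio to a set that is finite
  because it is constructible and bounded. Gradients in all three directions have no such uniform
  rank, so smoothness of the spatial curve gets a count of its own, in which the Lagrange
  multipliers act as additional characters.\<close>

lemma polynomial_funs_uminus: "P \<in> polynomial_funs I ==> (\<lambda>c. - P c) \<in> polynomial_funs I"
 using polynomial_funs.mult[OF polynomial_funs.const[of "-1"]] by fastforce

lemma polynomial_funs_diff:
 "P \<in> polynomial_funs I ==> Q \<in> polynomial_funs I ==> (\<lambda>c. P c - Q c) \<in> polynomial_funs I"
 using polynomial_funs.add[OF _ polynomial_funs_uminus] by fastforce

lemma polynomial_funs_sum:
 "(\<And>x. x \<in> S ==> f x \<in> polynomial_funs I) ==> (\<lambda>c. \<Sum>x\<in>S. f x c) \<in> polynomial_funs I"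
 by (induction S rule: infinite_finite_induct)
   (auto intro: polynomial_funs.const[of 0] polynomial_funs.add)

lemma polynomial_funs_prod:
 "(\<And>x. x \<in> S ==> f x \<in> polynomial_funs I) ==> (\<lambda>c. \<Prod>x\<in>S. f x c) \<in> polynomial_funs I"
 by (induction S rule: infinite_finite_induct)
   (auto intro: polynomial_funs.const[of 1] polynomial_funs.mult)

lemma polynomial_funs_power:
 "P \<in> polynomial_funs I ==> (\<lambda>c. P c ^ n) \<in> polynomial_funs I"
 by (induction n) (auto intro: polynomial_funs.const[of 1] polynomial_funs.mult)

lemmas polynomial_funs_intros =
 polynomial_funs.intros polynomial_funs_uminus polynomial_funs_diff polynomial_funs_sum
 polynomial_funs_prod polynomial_funs_power

lemma polynomial_funs_compose:
 assumes "P \<in> polynomial_funs I" and "\<And>i. i \<in> I ==> g i \<in> polynomial_funs J"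
 shows "(\<lambda>c. P (\<lambda>i. g i c)) \<in> polynomial_funs J"
 using assms by (induction P rule: polynomial_funs.induct) (auto intro: polynomial_funs.intros)

lemma polynomial_funs_mono: "P \<in> polynomial_funs I ==> I \<subseteq> J ==> P \<in> polynomial_funs J"
 by (induction P rule: polynomial_funs.induct) (auto intro: polynomial_funs.intros)

lemma polynomial_funs_cong:
 "P \<in> polynomial_funs I ==> (\<And>i. i \<in> I ==> c i = c' i) ==> P c = P c'"
 by (induction P rule: polynomial_funs.induct) auto

text \<open>Nonvanishing of products, openness along lines and differentiability are all reduced to
  univariate polynomials through this restriction.\<close>

lemma polynomial_funs_line:
 assumes "P \<in> polynomial_funs I"
 shows "\<exists>p. \<forall>t. P (\<lambda>i. a i + t * b i) = poly p t"
 using assms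
proof (induction P rule: polynomial_funs.induct)
 case (const s)
 show ?case by (rule exI[of _ "[:s:]"]) simp
next
 case (var i)
 show ?case by (rule exI[of _ "[:a i, b i:]"]) simp
next
 case (add P Q)
 then obtain p q where "\<forall>t. P (\<lambda>i. a i + t * b i) = poly p t" "\<forall>t. Q (\<lambda>i. a i + t * b i) = poly q t"
  by blast
 then show ?case by (intro exI[of _ "p + q"]) simp
next
 case (mult P Q)
 then obtain p q where "\<forall>t. P (\<lambda>i. a i + t * b i) = poly p t" "\<forall>t. Q (\<lambda>i. a i + t * b i) = poly q t"
  by blast
 then show ?case by (intro exI[of _ "p * q"]) simp
qed

text \<open>On the line joining a nonzero point of \<open>P\<close> to one of \<open>Q\<close>, both
  restrict to nonzero univariate polynomials; their product is nonzero and the field is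
  infinite.\<close>

lemma polynomial_funs_mult_nonzero:
 fixes P :: "('i => 'a::field_char_0) => 'a"
 assumes "P \<in> polynomial_funs I" "Q \<in> polynomial_funs I" "P c ~= 0" "Q d ~= 0"
 shows "\<exists>x. P x * Q x ~= 0"
proof -
 obtain p where p: "\<And>t. P (\<lambda>i. c i + t * (d i - c i)) = poly p t"
  using polynomial_funs_line[OF assms(1), of c "\<lambda>i. d i - c i"] by blast
 obtain q where q: "\<And>t. Q (\<lambda>i. c i + t * (d i - c i)) = poly q t"
  using polynomial_funs_line[OF assms(2), of c "\<lambda>i. d i - c i"] by blast
 have "p ~= 0" using p[of 0] assms(3) by auto
 moreover have "q ~= 0" using q[of 1] assms(4) by auto
 ultimately have "p * q ~= 0" by simp
 then obtain t where "poly (p * q) t ~= 0" using poly_all_0_iff_0 by blast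
 then show ?thesis using p q by (metis poly_mult)
qed

lemma polynomial_funs_prod_nonzero:
 fixes P :: "'b => ('i => 'a::field_char_0) => 'a"
 assumes "finite S" "\<And>x. x \<in> S ==> P x \<in> polynomial_funs I" "\<And>x. x \<in> S ==> \<exists>c. P x c ~= 0"
 shows "\<exists>c. (\<Prod>x\<in>S. P x c) ~= 0"
 using assms
proof (induction S rule: finite_induct)
 case (insert x F)
 then obtain c d where "P x c ~= 0" "(\<Prod>x\<in>F. P x d) ~= 0" by blast
 then have "\<exists>e. P x e * (\<Prod>x\<in>F. P x e) ~= 0"
  using insert.prems by (intro polynomial_funs_mult_nonzero[of _ I]) (auto intro: polynomial_funs_prod)
 then show ?case using insert.hyps by simp
qed simp

text \<open>The coefficients are again polynomial functions, so the leading one can be inverted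
  where it is nonzero and handled by induction where it vanishes. Setting \<open>b j\<close> to zero
  beyond \<open>d\<close> lets expansions of different lengths be aligned.\<close>

lemma polynomial_funs_expand:
 fixes h :: "('i => 'a::field) => 'a"
 assumes "h \<in> polynomial_funs (insert v S)"
 shows "\<exists>d b. (\<forall>j. b j \<in> polynomial_funs S) \<and> (\<forall>j>d. b j = (\<lambda>_. 0)) \<and>
      (\<forall>s. h s = (\<Sum>j\<le>d. b j s * s v ^ j))"
 using assms
proof (induction h rule: polynomial_funs.induct)
 case (const s)
 show ?case
  by (rule exI[of _ 0], rule exI[of _ "\<lambda>j. if j = 0 then (\<lambda>_. s) else (\<lambda>_. 0)"])
    (auto intro: polynomial_funs.intros)
next
 case (var i)
 show ?case
 proof (cases "i = v")
  case True
  show ?thesis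
   by (rule exI[of _ 1], rule exI[of _ "\<lambda>j. if j = 1 then (\<lambda>_. 1) else (\<lambda>_. 0)"])
     (auto intro: polynomial_funs.intros simp: True)
 next
  case False
  then show ?thesis using var
   by (intro exI[of _ 0] exI[of _ "\<lambda>j. if j = 0 then (\<lambda>c. c i) else (\<lambda>_. 0)"])
     (auto intro: polynomial_funs.intros)
 qed
next
 case (add P Q)
 then obtain d b e b' where
  b: "\<forall>j. b j \<in> polynomial_funs S" "\<forall>j>d. b j = (\<lambda>_. 0)" "\<forall>s. P s = (\<Sum>j\<le>d. b j s * s v ^ j)" and
  b': "\<forall>j. b' j \<in> polynomial_funs S" "\<forall>j>e. b' j = (\<lambda>_. 0)" "\<forall>s. Q s = (\<Sum>j\<le>e. b' j s * s v ^ j)"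
  by blast
 have "P s = (\<Sum>j\<le>max d e. b j s * s v ^ j)" for s
  unfolding b(3)[rule_format] by (intro sum.mono_neutral_left) (auto simp: b(2) not_le)
 moreover have "Q s = (\<Sum>j\<le>max d e. b' j s * s v ^ j)" for s
  unfolding b'(3)[rule_format] by (intro sum.mono_neutral_left) (auto simp: b'(2) not_le)
 ultimately show ?case using b b'
  by (intro exI[of _ "max d e"] exI[of _ "\<lambda>j s. b j s + b' j s"])
    (auto intro: polynomial_funs.intros simp: algebra_simps sum.distrib)
next
 case (mult P Q)
 then obtain d b e b' where
  b: "\<forall>j. b j \<in> polynomial_funs S" "\<forall>j>d. b j = (\<lambda>_. 0)" "\<forall>s. P s = (\<Sum>j\<le>d. b j s * s v ^ j)" and
  b': "\<forall>j. b' j \<in> polynomial_funs S" "\<forall>j>e. b' j = (\<lambda>_. 0)" "\<forall>s. Q s = (\<Sum>j\<le>e. b' j s * s v ^ j)"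
  by blast
 have "P s * Q s = (\<Sum>r\<le>d + e. (\<Sum>k\<le>r. b k s * b' (r - k) s) * s v ^ r)" for s
  using b b' by (simp add: polynomial_product)
 moreover have "(\<lambda>s. \<Sum>k\<le>r. b k s * b' (r - k) s) = (\<lambda>_. 0)" if "r > d + e" for r
 proof
  fix s
  have "b k s * b' (r - k) s = 0" if "k \<le> r" for k
  proof (cases "k > d")
   case True
   then show ?thesis using b(2) by simp
  next
   case False
   then have "r - k > e" using \<open>r > d + e\<close> by linarith
   then show ?thesis using b'(2) by simp
  qed
  then show "(\<Sum>k\<le>r. b k s * b' (r - k) s) = 0" by (intro sum.neutral) simp
 qed
 ultimately show ?case using b b'
  by (intro exI[of _ "d + e"] exI[of _ "\<lambda>r s. \<Sum>k\<le>r. b k s * b' (r - k) s"])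
    (auto intro!: polynomial_funs_intros)
qed

text \<open>Induction on the variables: with the others fixed, the sum is a polynomial in one
  variable with infinitely many real zeros, so each of its coefficients vanishes and is a sum of the
  same kind in fewer variables.\<close>

lemma monomials_independent:
 fixes \<mu> :: "('i => nat) => complex"
 assumes "finite I"
  and "\<And>x. (\<And>i. x i \<in> \<real>) ==> (\<Sum>\<alpha>\<in>PiE I (\<lambda>_. {..N}). \<mu> \<alpha> * (\<Prod>i\<in>I. x i ^ \<alpha> i)) = 0"
  and "\<alpha> \<in> PiE I (\<lambda>_. {..N})"
 shows "\<mu> \<alpha> = 0"
 using assms
proof (induction I arbitrary: \<mu> \<alpha> rule: finite_induct)
 case empty
 then show ?case using empty(1)[of "\<lambda>_. 0"] by simp
next
 case (insert i I)
 let ?E = "PiE I (\<lambda>_. {..N})"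
 \<comment> \<open>Functions in \<open>?E\<close> take the value \<open>undefined\<close> at
   \<open>i\<close>, so overwriting that value loses nothing.\<close>
 have inj: "inj_on (\<lambda>(y, g). g(i := y)) ({..N} \<times> ?E)"
 proof (rule inj_onI, clarify)
  fix y g y' g' assume g: "g \<in> ?E" "g' \<in> ?E" and eq: "g(i := y) = g'(i := y')"
  have "g j = g' j" for j
  proof (cases "j = i")
   case True
   then show ?thesis using g insert.hyps by (auto simp: PiE_def extensional_def)
  next
   case False
   then show ?thesis using fun_cong[OF eq, of j] by simp
  qed
  then show "y = y' \<and> g = g'" using fun_cong[OF eq, of i] by auto
 qed
 have *: "(\<Sum>g\<in>?E. \<mu> (g(i := y)) * (\<Prod>j\<in>I. x j ^ g j)) = 0"
  if x: "\<And>j. x j \<in> \<real>" and y: "y \<le> N" for x y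
 proof -
  let ?c = "\<lambda>y. \<Sum>g\<in>?E. \<mu> (g(i := y)) * (\<Prod>j\<in>I. x j ^ g j)"
  have "(\<Sum>y\<le>N. ?c y * t ^ y) = 0" if t: "t \<in> \<real>" for t
  proof -
   have "0 = (\<Sum>\<alpha>\<in>PiE (insert i I) (\<lambda>_. {..N}). \<mu> \<alpha> * (\<Prod>j\<in>insert i I. (x(i := t)) j ^ \<alpha> j))"
    using insert.prems(1)[of "x(i := t)"] x t by simp
   also have "\<dots> = (\<Sum>(y, g)\<in>{..N} \<times> ?E. \<mu> (g(i := y)) * (\<Prod>j\<in>insert i I. (x(i := t)) j ^ (g(i := y)) j))"
    unfolding PiE_insert_eq by (subst sum.reindex[OF inj]) (simp add: case_prod_unfold)
   also have "\<dots> = (\<Sum>(y, g)\<in>{..N} \<times> ?E. \<mu> (g(i := y)) * (\<Prod>j\<in>I. x j ^ g j) * t ^ y)"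
   proof (rule sum.cong, simp, clarify)
    fix y g
    have "(\<Prod>j\<in>I. (x(i := t)) j ^ (g(i := y)) j) = (\<Prod>j\<in>I. x j ^ g j)"
     using insert.hyps by (intro prod.cong) auto
    then show "\<mu> (g(i := y)) * (\<Prod>j\<in>insert i I. (x(i := t)) j ^ (g(i := y)) j) =
      \<mu> (g(i := y)) * (\<Prod>j\<in>I. x j ^ g j) * t ^ y"
     using insert.hyps by (simp add: mult_ac)
   qed
   also have "\<dots> = (\<Sum>y\<le>N. ?c y * t ^ y)"
    by (simp add: sum.cartesian_product[symmetric] sum_distrib_right)
   finally show ?thesis by simp
  qed
  then have "\<real> \<subseteq> {t. (\<Sum>y\<le>N. ?c y * t ^ y) = 0}" by auto
  moreover have "infinite (\<real> :: complex set)"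
   unfolding Reals_def using finite_imageD[of complex_of_real UNIV] infinite_UNIV_char_0[where 'a=real]
   by (auto simp: inj_on_def)
  ultimately have "infinite {t. (\<Sum>y\<le>N. ?c y * t ^ y) = 0}" using finite_subset by blast
  then show ?thesis using polyfun_roots_finite[of ?c y N] y by blast
 qed
 obtain y g where yg: "y \<le> N" "g \<in> ?E" "\<alpha> = g(i := y)"
  using insert.prems(2) unfolding PiE_insert_eq by auto
 have "\<mu> (g(i := y)) = 0"
  by (rule insert.IH[of "\<lambda>g. \<mu> (g(i := y))", OF *[OF _ yg(1)] yg(2)])
 then show ?case by (simp only: yg(3))
qed

section \<open>Dependence by counting\<close>

text \<open>Gaussian elimination: an equation with a nonzero entry removes the unknown
  \<open>a0\<close>, leaving one unknown and one equation fewer.\<close>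

lemma underdetermined_system:
 fixes M :: "'a => 'b => 'c::field"
 assumes "finite B" "finite A" "card B < card A"
 shows "\<exists>\<mu>. (\<exists>a\<in>A. \<mu> a ~= 0) \<and> (\<forall>b\<in>B. (\<Sum>a\<in>A. \<mu> a * M a b) = 0)"
 using assms
proof (induction B arbitrary: A M rule: finite_induct)
 case empty
 then obtain a where "a \<in> A" by fastforce
 then show ?case by (intro exI[of _ "\<lambda>_. 1"]) auto
next
 case (insert b B)
 show ?case
 proof (cases "\<forall>a\<in>A. M a b = 0")
  case True
  then show ?thesis using insert.IH[of A M] insert.prems insert.hyps by auto
 next
  case False
  then obtain a0 where a0: "a0 \<in> A" "M a0 b ~= 0" by blast
  let ?A = "A - {a0}"
  have "card B < card ?A" using insert.prems insert.hyps a0 by simp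
  from insert.IH[OF _ this, of "\<lambda>a b'. M a b' - M a b / M a0 b * M a0 b'"] insert.prems
  obtain \<mu> where \<mu>: "\<exists>a\<in>?A. \<mu> a ~= 0"
   "\<And>b'. b' \<in> B ==> (\<Sum>a\<in>?A. \<mu> a * (M a b' - M a b / M a0 b * M a0 b')) = 0"
   by blast
  \<comment> \<open>The value at the pivot is forced by equation \<open>b\<close>; the matrix was
    modified so that the other equations then hold as well.\<close>
  define m where "m = - (\<Sum>a\<in>?A. \<mu> a * M a b) / M a0 b"
  let ?\<mu> = "\<mu>(a0 := m)"
  have split: "(\<Sum>a\<in>A. ?\<mu> a * M a b') = m * M a0 b' + (\<Sum>a\<in>?A. \<mu> a * M a b')" for b'
   using a0 insert.prems by (subst sum.remove[of A a0]) (auto intro!: sum.cong)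
  have "(\<Sum>a\<in>A. ?\<mu> a * M a b') = 0" if "b' \<in> insert b B" for b'
  proof (cases "b' = b")
   case True
   then show ?thesis using a0 by (simp only: split) (simp add: m_def)
  next
   case False
   then have "0 = (\<Sum>a\<in>?A. \<mu> a * M a b' - \<mu> a * M a b * (M a0 b' / M a0 b))"
    using \<mu>(2)[of b'] that by (simp add: algebra_simps)
   also have "\<dots> = (\<Sum>a\<in>?A. \<mu> a * M a b') - (\<Sum>a\<in>?A. \<mu> a * M a b) * (M a0 b' / M a0 b)"
    by (simp only: sum_subtractf sum_distrib_right)
   finally show ?thesis by (simp only: split) (simp add: m_def)
  qed
  then show ?thesis using \<mu>(1) by (intro exI[of _ ?\<mu>]) auto
 qed
qed

section \<open>Spans of functions on a set and monomials of bounded degree\<close>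

definition fspan :: "'s set => ('s => 'a::field) set => ('s => 'a) set" where
 "fspan X G = {f. \<exists>l. \<forall>s\<in>X. f s = (\<Sum>g\<in>G. l g * g s)}"

lemma fspan_base: "finite G ==> g \<in> G ==> g \<in> fspan X G"
proof -
 assume "finite G" "g \<in> G"
 then have "\<forall>s\<in>X. g s = (\<Sum>g'\<in>G. (if g' = g then 1 else 0) * g' s)"
  by (simp add: if_distrib[of "\<lambda>x. x * _"] cong: if_cong)
 then show ?thesis unfolding fspan_def by (intro CollectI exI[of _ "\<lambda>g'. if g' = g then 1 else 0"])
qed

lemma fspan_zero: "(\<lambda>_. 0) \<in> fspan X G"
 unfolding fspan_def by (intro CollectI exI[of _ "\<lambda>_. 0"]) simp

lemma fspan_add: "f \<in> fspan X G ==> f' \<in> fspan X G ==> (\<lambda>s. f s + f' s) \<in> fspan X G"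
 unfolding fspan_def
proof clarify
 fix l l' assume "\<forall>s\<in>X. f s = (\<Sum>g\<in>G. l g * g s)" "\<forall>s\<in>X. f' s = (\<Sum>g\<in>G. l' g * g s)"
 then show "\<exists>l. \<forall>s\<in>X. f s + f' s = (\<Sum>g\<in>G. l g * g s)"
  by (intro exI[of _ "\<lambda>g. l g + l' g"]) (simp add: algebra_simps sum.distrib)
qed

lemma fspan_scale: "f \<in> fspan X G ==> (\<lambda>s. k * f s) \<in> fspan X G"
 unfolding fspan_def
proof clarify
 fix l assume "\<forall>s\<in>X. f s = (\<Sum>g\<in>G. l g * g s)"
 then show "\<exists>l. \<forall>s\<in>X. k * f s = (\<Sum>g\<in>G. l g * g s)"
  by (intro exI[of _ "\<lambda>g. k * l g"]) (simp add: sum_distrib_left mult_ac)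
qed

lemma fspan_sum: "(\<And>x. x \<in> S ==> f x \<in> fspan X G) ==> (\<lambda>s. \<Sum>x\<in>S. f x s) \<in> fspan X G"
 by (induction S rule: infinite_finite_induct) (auto intro: fspan_zero fspan_add)

text \<open>Only values on \<open>X\<close> count, so relations valid on \<open>X\<close> may be
  used to rewrite a function; this is what makes the spans small.\<close>

lemma fspan_cong: "f \<in> fspan X G ==> (\<And>s. s \<in> X ==> f s = f' s) ==> f' \<in> fspan X G"
 unfolding fspan_def by auto

lemma fspan_image:
 assumes f: "f \<in> fspan X G" and k: "\<And>g. g \<in> G ==> (\<lambda>s. k s * g s) \<in> fspan X H"
 shows "(\<lambda>s. k s * f s) \<in> fspan X H"
proof -
 obtain l where l: "\<forall>s\<in>X. f s = (\<Sum>g\<in>G. l g * g s)" using f unfolding fspan_def by blast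
 have "(\<lambda>s. \<Sum>g\<in>G. l g * (k s * g s)) \<in> fspan X H"
  using k by (intro fspan_sum fspan_scale) auto
 then show ?thesis by (rule fspan_cong) (simp add: l sum_distrib_left mult_ac)
qed

lemma fspan_mult:
 assumes "f \<in> fspan X G" "f' \<in> fspan X G'"
  and "\<And>g g'. g \<in> G ==> g' \<in> G' ==> (\<lambda>s. g s * g' s) \<in> fspan X H"
 shows "(\<lambda>s. f s * f' s) \<in> fspan X H"
proof (rule fspan_image[OF assms(2)])
 fix g' assume g': "g' \<in> G'"
 have "(\<lambda>s. g' s * f s) \<in> fspan X H"
  using assms(3) g' by (intro fspan_image[OF assms(1)]) (auto simp: mult.commute)
 then show "(\<lambda>s. f s * g' s) \<in> fspan X H" by (simp add: mult.commute)
qed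

lemma fspan_mono: "f \<in> fspan X G ==> G \<subseteq> H ==> finite H ==> f \<in> fspan X H"
 using fspan_image[of f X G "\<lambda>_. 1" H] fspan_base[of H _ X] by auto

text \<open>Degrees are bounded in each variable separately, which makes the exponents a product set
  and the count a power of \<open>D + 1\<close>.\<close>

definition monset :: "'v set => nat => (('v => 'a::field) => 'a) set" where
 "monset V D = (\<lambda>\<beta> s. \<Prod>v\<in>V. s v ^ \<beta> v) ` PiE V (\<lambda>_. {..D})"

lemma finite_monset: "finite V ==> finite (monset V D)"
 unfolding monset_def by (intro finite_imageI finite_PiE) auto

lemma card_monset: "finite V ==> card (monset V D) \<le> (D + 1) ^ card V"
 unfolding monset_def
 by (rule order_trans[OF card_image_le]) (auto intro: finite_PiE simp: card_PiE)

lemma monset_memI: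
 assumes "\<And>v. v \<in> V ==> \<beta> v \<le> D"
 shows "(\<lambda>s. \<Prod>v\<in>V. s v ^ \<beta> v) \<in> monset V D"
proof -
 have "(\<lambda>s. \<Prod>v\<in>V. s v ^ \<beta> v) = (\<lambda>s. \<Prod>v\<in>V. s v ^ (restrict \<beta> V) v)"
  by (intro ext prod.cong) auto
 then show ?thesis unfolding monset_def using assms by (intro image_eqI[of _ _ "restrict \<beta> V"]) auto
qed

lemma monset_mono: "D \<le> E ==> monset V D \<subseteq> monset V E"
 unfolding monset_def by (intro image_mono PiE_mono) auto

lemma fspan_monset_mono:
 "f \<in> fspan X (monset V D) ==> D \<le> E ==> finite V ==> f \<in> fspan X (monset V E)"
 by (rule fspan_mono[OF _ monset_mono finite_monset])

lemma monset_mult: "g \<in> monset V D ==> h \<in> monset V E ==> (\<lambda>s. g s * h s) \<in> monset V (D + E)"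
proof -
 assume "g \<in> monset V D" "h \<in> monset V E"
 then obtain \<beta> \<gamma> where "\<beta> \<in> PiE V (\<lambda>_. {..D})" "\<gamma> \<in> PiE V (\<lambda>_. {..E})"
  and gh: "g = (\<lambda>s. \<Prod>v\<in>V. s v ^ \<beta> v)" "h = (\<lambda>s. \<Prod>v\<in>V. s v ^ \<gamma> v)"
  unfolding monset_def by blast
 then have "(\<lambda>s. \<Prod>v\<in>V. s v ^ (\<beta> v + \<gamma> v)) \<in> monset V (D + E)"
  by (intro monset_memI) (auto intro!: add_mono)
 then show ?thesis unfolding gh by (simp add: power_add prod.distrib)
qed

lemma fspan_monset_mult:
 "finite V ==> f \<in> fspan X (monset V D) ==> f' \<in> fspan X (monset V E) ==>
   (\<lambda>s. f s * f' s) \<in> fspan X (monset V (D + E))"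
 by (erule fspan_mult, assumption) (auto intro!: fspan_base finite_monset monset_mult)

lemma polynomial_funs_degree:
 fixes f :: "('v => 'a::field) => 'a"
 assumes "finite V" "f \<in> polynomial_funs V"
 shows "\<exists>D. f \<in> fspan X (monset V D)"
 using assms(2)
proof (induction f rule: polynomial_funs.induct)
 case (const s)
 have "(\<lambda>s. \<Prod>v\<in>V. s v ^ 0) \<in> monset V 0" by (intro monset_memI) auto
 then have "(\<lambda>_. s * 1) \<in> fspan X (monset V 0)"
  by (intro fspan_scale fspan_base finite_monset assms) auto
 then show ?case by auto
next
 case (var i)
 have "(\<lambda>s::'v => 'a. \<Prod>v\<in>V. s v ^ (if v = i then 1 else 0)) \<in> monset V 1" by (intro monset_memI) auto
 moreover have "(\<lambda>s::'v => 'a. \<Prod>v\<in>V. s v ^ (if v = i then 1 else 0)) = (\<lambda>s. s i)"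
  using var assms(1) by (intro ext) (simp add: if_distrib[of "\<lambda>x. _ ^ x"] prod.delta cong: if_cong)
 ultimately have "(\<lambda>s::'v => 'a. s i) \<in> monset V 1" by simp
 then show ?case by (intro exI[of _ 1] fspan_base finite_monset assms(1))
next
 case (add P Q)
 then obtain D E where "P \<in> fspan X (monset V D)" "Q \<in> fspan X (monset V E)" by blast
 then have "P \<in> fspan X (monset V (max D E))" "Q \<in> fspan X (monset V (max D E))"
  by (auto intro: fspan_monset_mono[OF _ _ assms(1)])
 then show ?case by (blast intro: fspan_add)
next
 case (mult P Q)
 then show ?case using fspan_monset_mult[OF assms(1)] by blast
qed

lemma fspan_monset_power:
 assumes "finite V" "f \<in> fspan X (monset V D)"
 shows "(\<lambda>s. f s ^ n) \<in> fspan X (monset V (n * D))"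
proof (induction n)
 case 0
 have "(\<lambda>s. \<Prod>v\<in>V. s v ^ 0) \<in> monset V 0" by (intro monset_memI) auto
 then show ?case by (intro fspan_base finite_monset assms) auto
next
 case (Suc n)
 then show ?case using fspan_monset_mult[OF assms(1) assms(2) Suc.IH] by simp
qed

lemma fspan_monset_prod:
 assumes "finite V" "finite J" "\<And>j. j \<in> J ==> f j \<in> fspan X (monset V (D j))"
 shows "(\<lambda>s. \<Prod>j\<in>J. f j s) \<in> fspan X (monset V (\<Sum>j\<in>J. D j))"
 using assms(2,3)
proof (induction J rule: finite_induct)
 case empty
 have "(\<lambda>s. \<Prod>v\<in>V. s v ^ 0) \<in> monset V 0" by (intro monset_memI) auto
 then show ?case by (intro fspan_base finite_monset assms) auto
next
 case (insert j J)
 then show ?case using fspan_monset_mult[OF assms(1), of "f j" X "D j"] by simp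
qed

text \<open>On the set \<open>X\<close> the function \<open>s v\<close> is integral over the other coordinates once \<open>b d\<close> is
 inverted, so functions of degree at most \<open>N\<close> span a space of dimension \<open>O(N ^ (card V - 1))\<close>; this is
 less than the number of monomials of degree at most \<open>N\<close> in the \<open>c i\<close>.\<close>

lemma algebraic_dependence_integral:
 fixes c :: "'i => ('v => complex) => complex"
 assumes V: "finite V" "v \<in> V" and I: "finite I" "card I \<ge> card V"
  and b: "\<And>j. b j \<in> polynomial_funs (V - {v})"
  and int: "\<And>s. s \<in> X ==> b d s ~= 0 \<and> (\<Sum>j\<le>d. b j s * s v ^ j) = 0"
  and p: "\<And>i. i \<in> I ==> p i \<in> polynomial_funs V" and a: "a \<in> polynomial_funs V"
  and c: "\<And>s i. s \<in> X ==> i \<in> I ==> a s ~= 0 \<and> c i s * a s = p i s"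
 shows "\<exists>P\<in>polynomial_funs I. (\<exists>x. P x ~= 0) \<and> (\<forall>s\<in>X. P (\<lambda>i. c i s) = 0)"
proof (cases "X = {}")
 case True
 then show ?thesis by (intro bexI[of _ "\<lambda>_. 1"]) (auto intro: polynomial_funs.const)
next
 case False
 define W where "W = V - {v}"
 have W: "finite W" "v \<notin> W" "V = insert v W" using V by (auto simp: W_def)
 have "d ~= 0"
 proof
  assume "d = 0"
  moreover obtain s where "s \<in> X" using False by blast
  ultimately show False using int[of s] by simp
 qed
 have "\<exists>D. \<forall>j\<le>n. b j \<in> fspan X (monset W D)" for n
 proof (induction n)
  case 0
  then show ?case using polynomial_funs_degree[OF W(1) b[of 0, folded W_def], of X] by auto
 next
  case (Suc n)
  then obtain D where D: "\<forall>j\<le>n. b j \<in> fspan X (monset W D)" by blast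
  obtain E where E: "b (Suc n) \<in> fspan X (monset W E)"
   using polynomial_funs_degree[OF W(1) b[of "Suc n", folded W_def]] by blast
  show ?case
  proof (intro exI[of _ "max D E"] allI impI)
   fix j assume "j \<le> Suc n"
   then have "b j \<in> fspan X (monset W D) \<or> b j \<in> fspan X (monset W E)"
    using D E by (auto simp: le_Suc_eq)
   then show "b j \<in> fspan X (monset W (max D E))"
    using fspan_monset_mono[OF _ _ W(1), of "b j" X _ "max D E"] by (metis max.cobounded1 max.cobounded2)
  qed
 qed
 then obtain D1 where D1: "\<And>j. j \<le> d ==> b j \<in> fspan X (monset W D1)" by blast
 have "\<exists>D. \<forall>i\<in>J. p i \<in> fspan X (monset V D)" if "finite J" "J \<subseteq> I" for J
  using that
 proof (induction J rule: finite_induct)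
  case (insert j J)
  then obtain D where D: "\<forall>i\<in>J. p i \<in> fspan X (monset V D)" by blast
  obtain E where E: "p j \<in> fspan X (monset V E)"
   using polynomial_funs_degree[OF V(1) p[of j]] insert.prems by blast
  show ?case
  proof (intro exI[of _ "max D E"] ballI)
   fix i assume "i \<in> insert j J"
   then have "p i \<in> fspan X (monset V D) \<or> p i \<in> fspan X (monset V E)" using D E by auto
   then show "p i \<in> fspan X (monset V (max D E))"
    using fspan_monset_mono[OF _ _ V(1), of "p i" X _ "max D E"] by (metis max.cobounded1 max.cobounded2)
  qed
 qed simp
 from this[OF I(1)] obtain D2 where D2: "\<And>i. i \<in> I ==> p i \<in> fspan X (monset V D2)" by blast
 obtain D3 where D3: "a \<in> fspan X (monset V D3)" using polynomial_funs_degree[OF V(1) a] by blast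
 define D where "D = max D1 (max D2 D3)"
 have bD: "b j \<in> fspan X (monset W D)" if "j \<le> d" for j
  by (rule fspan_monset_mono[OF D1[OF that] _ W(1)]) (simp add: D_def)
 have pD: "p i \<in> fspan X (monset V D)" if "i \<in> I" for i
  by (rule fspan_monset_mono[OF D2[OF that] _ V(1)]) (simp add: D_def)
 have aD: "a \<in> fspan X (monset V D)"
  by (rule fspan_monset_mono[OF D3 _ V(1)]) (simp add: D_def)
 \<comment> \<open>The spanning set after reduction: powers of \<open>s v\<close> below
   \<open>d\<close> times monomials in the other coordinates. Its size grows with an exponent one
   less than for all monomials in \<open>V\<close>.\<close>
 define Q :: "nat => (('v => complex) => complex) set"
  where "Q E = (\<lambda>(g, \<gamma>). (\<lambda>s. g s * s v ^ \<gamma>)) ` (monset W E \<times> {..<d})" for E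
 have finQ: "finite (Q E)" for E unfolding Q_def by (intro finite_imageI finite_cartesian_product finite_monset W(1)) auto
 have cardQ: "card (Q E) \<le> (E + 1) ^ card W * d" for E
 proof -
  have "card (Q E) \<le> card ((monset W E :: (('v => complex) => complex) set) \<times> {..<d})"
   unfolding Q_def by (rule card_image_le) (simp add: finite_monset W(1))
  also have "\<dots> = card (monset W E :: (('v => complex) => complex) set) * d" by (simp add: card_cartesian_product)
  also have "\<dots> \<le> (E + 1) ^ card W * d" by (intro mult_right_mono card_monset W(1)) simp
  finally show ?thesis .
 qed
 have QI: "(\<lambda>s. f s * s v ^ \<gamma>) \<in> fspan X (Q E)" if "f \<in> fspan X (monset W E)" "\<gamma> < d" for f \<gamma> E
 proof -
  have "(\<lambda>s. s v ^ \<gamma> * f s) \<in> fspan X (Q E)"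
  proof (rule fspan_image[OF that(1)])
   fix g :: "('v => complex) => complex" assume "g \<in> monset W E"
   then have "(\<lambda>s. g s * s v ^ \<gamma>) \<in> Q E"
    unfolding Q_def using that(2) by (intro image_eqI[of _ _ "(g, \<gamma>)"]) auto
   then show "(\<lambda>s. s v ^ \<gamma> * g s) \<in> fspan X (Q E)"
    using fspan_base[OF finQ] by (simp add: mult.commute)
  qed
  then show ?thesis by (simp add: mult.commute)
 qed
 have Qmult: "(\<lambda>s. f s * f' s) \<in> fspan X (Q (E + E'))"
  if "f \<in> fspan X (Q E)" "f' \<in> fspan X (monset W E')" for f f' E E'
 proof (rule fspan_mult[OF that])
  fix g g' :: "('v => complex) => complex"
  assume "g \<in> Q E" and g': "g' \<in> monset W E'"
  then obtain h \<gamma> where h: "h \<in> monset W E" "\<gamma> < d" "g = (\<lambda>s. h s * s v ^ \<gamma>)" unfolding Q_def by auto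
  have "(\<lambda>s. (h s * g' s) * s v ^ \<gamma>) \<in> fspan X (Q (E + E'))"
   using h(2) by (intro QI fspan_base finite_monset W(1) monset_mult h g')
  then show "(\<lambda>s. g s * g' s) \<in> fspan X (Q (E + E'))" unfolding h by (simp add: mult_ac)
 qed
 \<comment> \<open>Multiplication by \<open>b d * s v\<close> preserves reduced form: a power
   \<open>s v ^ d\<close> is replaced by means of the relation, at the price of raising the degree
   in the other coordinates by \<open>D\<close>.\<close>
 have Qshift: "(\<lambda>s. f s * (b d s * s v)) \<in> fspan X (Q (E + D))" if "f \<in> fspan X (Q E)" for f E
 proof -
  have "(\<lambda>s. (b d s * s v) * f s) \<in> fspan X (Q (E + D))"
  proof (rule fspan_image[OF that])
   fix g :: "('v => complex) => complex"
   assume "g \<in> Q E"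
   then obtain h \<gamma> where h: "h \<in> monset W E" "\<gamma> < d" "g = (\<lambda>s. h s * s v ^ \<gamma>)" unfolding Q_def by auto
   have hb: "(\<lambda>s. h s * b j s) \<in> fspan X (monset W (E + D))" if "j \<le> d" for j
    by (intro fspan_monset_mult W(1) fspan_base finite_monset h(1) bD that)
   show "(\<lambda>s. b d s * s v * g s) \<in> fspan X (Q (E + D))"
   proof (cases "Suc \<gamma> < d")
    case True
    have "(\<lambda>s. (h s * b d s) * s v ^ Suc \<gamma>) \<in> fspan X (Q (E + D))"
     by (intro QI hb True) simp
    then show ?thesis unfolding h by (simp add: mult_ac)
   next
    case False
    then have d: "d = Suc \<gamma>" using h(2) by simp
    have "(\<lambda>s. \<Sum>j<d. - 1 * ((h s * b j s) * s v ^ j)) \<in> fspan X (Q (E + D))"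
     by (intro fspan_sum fspan_scale QI hb) auto
    then show ?thesis
    proof (rule fspan_cong)
     fix s assume "s \<in> X"
     then have "(\<Sum>j<d. b j s * s v ^ j) + b d s * s v ^ d = 0"
      using int[of s] by (simp add: lessThan_Suc_atMost[symmetric])
     then have "b d s * s v ^ d = - (\<Sum>j<d. b j s * s v ^ j)" by (simp add: eq_neg_iff_add_eq_0 add.commute)
     then have "h s * (b d s * s v ^ d) = (\<Sum>j<d. - 1 * ((h s * b j s) * s v ^ j))"
      by (simp add: sum_distrib_left sum_negf mult_ac)
     then show "(\<Sum>j<d. - 1 * ((h s * b j s) * s v ^ j)) = b d s * s v * g s"
      unfolding h d by (simp add: mult_ac)
    qed
   qed
  qed
  then show ?thesis by (simp add: mult.commute)
 qed
 \<comment> \<open>One factor \<open>b d\<close> is spent for each factor \<open>s v\<close>;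
   surplus factors \<open>b d\<close> are absorbed as polynomials of degree at most
   \<open>D\<close>.\<close>
 have Qpow: "\<forall>e\<le>M. (\<lambda>s. b d s ^ M * s v ^ e) \<in> fspan X (Q (M * D))" for M
 proof (induction M)
  case 0
  have "(\<lambda>s. \<Prod>v\<in>W. s v ^ 0) \<in> monset W 0" by (intro monset_memI) auto
  then have "(\<lambda>s::'v => complex. 1) \<in> fspan X (monset W 0)" by (intro fspan_base finite_monset W(1)) simp
  from QI[OF this, of 0] show ?case using \<open>d ~= 0\<close> by simp
 next
  case (Suc M)
  show ?case
  proof (intro allI impI)
   fix e assume "e \<le> Suc M"
   show "(\<lambda>s. b d s ^ Suc M * s v ^ e) \<in> fspan X (Q (Suc M * D))"
   proof (cases "e \<le> M")
    case True
    then show ?thesis using Qmult[OF Suc.IH[rule_format, OF True] bD[of d]]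
     by (simp add: mult.assoc mult.commute mult.left_commute add.commute)
   next
    case False
    then have "e = Suc M" using \<open>e \<le> Suc M\<close> by simp
    then show ?thesis using Qshift[OF Suc.IH[rule_format, of M]]
     by (simp add: mult_ac add.commute)
   qed
  qed
 qed
 have reduce: "(\<lambda>s. b d s ^ M * f s) \<in> fspan X (Q (M * D + M))" if f: "f \<in> fspan X (monset V M)" for f M
 proof (rule fspan_image[OF f])
  fix g :: "('v => complex) => complex" assume "g \<in> monset V M"
  then obtain \<beta> where \<beta>: "\<beta> \<in> PiE V (\<lambda>_. {..M})" and g: "g = (\<lambda>s. \<Prod>v\<in>V. s v ^ \<beta> v)"
   unfolding monset_def by blast
  have "(\<lambda>s. \<Prod>u\<in>W. s u ^ \<beta> u) \<in> monset W M" using \<beta> W(3) by (intro monset_memI) auto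
  then have "(\<lambda>s. (b d s ^ M * s v ^ \<beta> v) * (\<Prod>u\<in>W. s u ^ \<beta> u)) \<in> fspan X (Q (M * D + M))"
   using \<beta> V(2) by (intro Qmult Qpow[rule_format] fspan_base finite_monset W(1)) auto
  then show "(\<lambda>s. b d s ^ M * g s) \<in> fspan X (Q (M * D + M))"
   unfolding g W(3) using W by (simp add: mult_ac)
 qed
 define n where "n = card I"
 \<comment> \<open>\<open>M\<close> is the degree of a product of \<open>n\<close> factors, each
   completed to exponent \<open>N\<close>. \<open>K\<close> ensures
   \<open>M * D + M + 1 \<le> K * (N + 1)\<close>, and \<open>N\<close> absorbs
   \<open>K ^ card W * d\<close>, so that the reduced spanning set has at most
   \<open>N * (N + 1) ^ card W\<close> elements, fewer than the \<open>(N + 1) ^ card I\<close>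
   monomials.\<close>
 define K where "K = n * D * D + n * D + 1"
 define N where "N = K ^ card W * d"
 define M where "M = n * N * D"
 define A where "A = PiE I (\<lambda>_. {..N})"
 have finA: "finite A" unfolding A_def using I(1) by (intro finite_PiE) auto
 \<comment> \<open>Every power of \<open>p i\<close> is completed by the denominator
   \<open>a\<close> to total exponent \<open>N\<close>, so that all monomials in the
   \<open>c i\<close> share one denominator.\<close>
 have memA: "(\<lambda>s. b d s ^ M * (\<Prod>i\<in>I. p i s ^ \<alpha> i * a s ^ (N - \<alpha> i))) \<in> fspan X (Q (M * D + M))"
  if "\<alpha> \<in> A" for \<alpha>
 proof (rule reduce)
  have "(\<Sum>i\<in>I. \<alpha> i * D + (N - \<alpha> i) * D) = (\<Sum>i\<in>I. N * D)"
  proof (rule sum.cong[OF refl])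
   fix i assume "i \<in> I"
   then have "\<alpha> i + (N - \<alpha> i) = N" using that by (auto simp: A_def PiE_def Pi_def)
   then show "\<alpha> i * D + (N - \<alpha> i) * D = N * D" by (simp flip: add_mult_distrib)
  qed
  then have M: "(\<Sum>i\<in>I. \<alpha> i * D + (N - \<alpha> i) * D) = M" by (simp add: M_def n_def)
  have "(\<lambda>s. \<Prod>i\<in>I. p i s ^ \<alpha> i * a s ^ (N - \<alpha> i)) \<in> fspan X (monset V (\<Sum>i\<in>I. \<alpha> i * D + (N - \<alpha> i) * D))"
   by (intro fspan_monset_prod fspan_monset_mult fspan_monset_power V(1) I(1) pD aD)
  then show "(\<lambda>s. \<Prod>i\<in>I. p i s ^ \<alpha> i * a s ^ (N - \<alpha> i)) \<in> fspan X (monset V M)"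
   unfolding M .
 qed
 have "card (Q (M * D + M)) < card A"
 proof -
  have "M * D + M + 1 \<le> K * (N + 1)" by (simp add: M_def K_def algebra_simps)
  then have "(M * D + M + 1) ^ card W * d \<le> (K * (N + 1)) ^ card W * d"
   by (intro mult_right_mono power_mono) auto
  then have "card (Q (M * D + M)) \<le> (K * (N + 1)) ^ card W * d"
   by (rule order_trans[OF cardQ])
  also have "(K * (N + 1)) ^ card W * d = N * (N + 1) ^ card W"
   by (simp only: N_def power_mult_distrib mult_ac)
  also have "N * (N + 1) ^ card W < (N + 1) ^ Suc (card W)"
   by (simp only: power_Suc) (intro mult_strict_right_mono; simp)
  also have "Suc (card W) = card V" using W by simp
  also have "(N + 1) ^ card V \<le> (N + 1) ^ card I" using I(2) by (intro power_increasing) auto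
  also have "(N + 1) ^ card I = card A" unfolding A_def using I(1) by (simp add: card_PiE)
  finally show ?thesis .
 qed
 have "\<forall>\<alpha>\<in>A. \<exists>l. \<forall>s\<in>X. b d s ^ M * (\<Prod>i\<in>I. p i s ^ \<alpha> i * a s ^ (N - \<alpha> i)) = (\<Sum>g\<in>Q (M * D + M). l g * g s)"
  using memA unfolding fspan_def by blast
 from bchoice[OF this] obtain l where l: "\<And>\<alpha> s. \<alpha> \<in> A ==> s \<in> X ==>
   b d s ^ M * (\<Prod>i\<in>I. p i s ^ \<alpha> i * a s ^ (N - \<alpha> i)) = (\<Sum>g\<in>Q (M * D + M). l \<alpha> g * g s)"
  by blast
 obtain \<mu> where \<mu>: "\<exists>\<alpha>\<in>A. \<mu> \<alpha> ~= 0" "\<And>g. g \<in> Q (M * D + M) ==> (\<Sum>\<alpha>\<in>A. \<mu> \<alpha> * l \<alpha> g) = 0"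
  using underdetermined_system[OF finQ finA \<open>card (Q (M * D + M)) < card A\<close>, of l] by blast
 define P where "P x = (\<Sum>\<alpha>\<in>A. \<mu> \<alpha> * (\<Prod>i\<in>I. x i ^ \<alpha> i))" for x :: "'i => complex"
 have "P \<in> polynomial_funs I"
  unfolding P_def[abs_def] by (intro polynomial_funs_intros)
 moreover have "\<exists>x. P x ~= 0"
  using monomials_independent[OF I(1), where N = N and \<mu> = \<mu>] \<mu>(1) unfolding P_def A_def by blast
 moreover have "P (\<lambda>i. c i s) = 0" if s: "s \<in> X" for s
 proof -
  have eq: "p i s ^ k * a s ^ (N - k) = a s ^ N * c i s ^ k" if "i \<in> I" "k \<le> N" for i k
  proof -
   have "p i s = c i s * a s" using c[OF s that(1)] by simp
   then have "p i s ^ k * a s ^ (N - k) = c i s ^ k * (a s ^ k * a s ^ (N - k))"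
    by (simp add: power_mult_distrib)
   also have "a s ^ k * a s ^ (N - k) = a s ^ N" using that(2) by (simp flip: power_add)
   finally show ?thesis by simp
  qed
  define C where "C = (\<Prod>i\<in>I. a s ^ N)"
  have "b d s ^ M * C * P (\<lambda>i. c i s) =
    (\<Sum>\<alpha>\<in>A. \<mu> \<alpha> * (b d s ^ M * (\<Prod>i\<in>I. a s ^ N * c i s ^ \<alpha> i)))"
   unfolding P_def prod.distrib C_def[symmetric] sum_distrib_left
   by (intro sum.cong refl) (simp only: mult_ac)
  also have "\<dots> = (\<Sum>\<alpha>\<in>A. \<mu> \<alpha> * (b d s ^ M * (\<Prod>i\<in>I. p i s ^ \<alpha> i * a s ^ (N - \<alpha> i))))"
  proof (rule sum.cong[OF refl])
   fix \<alpha> assume \<alpha>: "\<alpha> \<in> A"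
   have "(\<Prod>i\<in>I. a s ^ N * c i s ^ \<alpha> i) = (\<Prod>i\<in>I. p i s ^ \<alpha> i * a s ^ (N - \<alpha> i))"
    using \<alpha> by (intro prod.cong refl eq[symmetric]) (auto simp: A_def)
   then show "\<mu> \<alpha> * (b d s ^ M * (\<Prod>i\<in>I. a s ^ N * c i s ^ \<alpha> i)) =
    \<mu> \<alpha> * (b d s ^ M * (\<Prod>i\<in>I. p i s ^ \<alpha> i * a s ^ (N - \<alpha> i)))" by simp
  qed
  also have "\<dots> = (\<Sum>\<alpha>\<in>A. \<mu> \<alpha> * (\<Sum>g\<in>Q (M * D + M). l \<alpha> g * g s))"
   using l s by (intro sum.cong) auto
  also have "\<dots> = (\<Sum>g\<in>Q (M * D + M). (\<Sum>\<alpha>\<in>A. \<mu> \<alpha> * l \<alpha> g) * g s)"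
   unfolding sum_distrib_left sum_distrib_right by (subst sum.swap) (simp add: mult_ac)
  also have "\<dots> = 0" using \<mu>(2) by simp
  finally have "b d s ^ M * C * P (\<lambda>i. c i s) = 0" .
  moreover have "b d s ~= 0" using int s by simp
  moreover have "C ~= 0" unfolding C_def using c[OF s] I(1) by (subst prod_zero_iff) auto
  ultimately show ?thesis by simp
 qed
 ultimately show ?thesis by blast
qed

section \<open>Images of hypersurfaces and of critical points\<close>

text \<open>Induction on the variables occurring in \<open>h\<close>. Where the leading coefficient
  in \<open>v\<close> vanishes, the induction hypothesis applies to that coefficient; elsewhere
  \<open>s v\<close> is integral over the other coordinates. The product of the two polynomials
  covers both regions.\<close>

lemma hypersurface_image_polynomial:
 fixes c :: "'i => ('v => complex) => complex"
 assumes V: "finite V" and I: "finite I" "card I \<ge> card V"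
  and p: "\<And>i. i \<in> I ==> p i \<in> polynomial_funs V" and a: "a \<in> polynomial_funs V"
  and c: "\<And>s i. s \<in> U ==> i \<in> I ==> a s ~= 0 \<and> c i s * a s = p i s"
  and S: "finite S" "S \<subseteq> V" and h: "h \<in> polynomial_funs S" "h s0 ~= 0"
 shows "\<exists>P\<in>polynomial_funs I. (\<exists>x. P x ~= 0) \<and> (\<forall>s\<in>U. h s = 0 --> P (\<lambda>i. c i s) = 0)"
 using S h
proof (induction S arbitrary: h s0 rule: finite_induct)
 case empty
 then have "h s = h s0" for s by (intro polynomial_funs_cong[of h "{}"]) auto
 then have "h s ~= 0" for s using empty by metis
 then show ?case by (intro bexI[of _ "\<lambda>_. 1"]) (auto intro: polynomial_funs.const)
next
 case (insert v S)
 obtain e b where b: "\<And>j. b j \<in> polynomial_funs S" "\<And>j. j > e ==> b j = (\<lambda>_. 0)"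
  "\<And>s. h s = (\<Sum>j\<le>e. b j s * s v ^ j)"
  using polynomial_funs_expand[OF insert.prems(2)] by blast
 let ?nz = "\<lambda>j. \<exists>s. b j s ~= 0"
 have nz: "\<exists>j\<le>e. ?nz j"
 proof (rule ccontr)
  assume "\<not> ?thesis"
  then have "h s0 = 0" unfolding b(3) by (intro sum.neutral) auto
  then show False using insert.prems by simp
 qed
 \<comment> \<open>Leading means nonzero as a polynomial; the coefficient may still vanish at some
   points of \<open>U\<close>.\<close>
 define d where "d = (GREATEST j. j \<le> e \<and> ?nz j)"
 have d: "d \<le> e" "?nz d"
  using GreatestI_ex_nat[of "\<lambda>j. j \<le> e \<and> ?nz j" e] nz by (auto simp: d_def)
 have top: "b j s = 0" if "j > d" for j s
 proof (cases "j \<le> e")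
  case True
  then show ?thesis using Greatest_le_nat[of "\<lambda>j. j \<le> e \<and> ?nz j" j e] that by (fastforce simp: d_def)
 qed (simp add: b(2))
 have hd: "h s = (\<Sum>j\<le>d. b j s * s v ^ j)" for s
  unfolding b(3) using d top by (intro sum.mono_neutral_right) auto
 obtain s1 where "b d s1 ~= 0" using d by blast
 from insert.IH[OF _ b(1) this] insert.prems obtain P1 where P1: "P1 \<in> polynomial_funs I" "\<exists>x. P1 x ~= 0"
  "\<And>s. s \<in> U ==> b d s = 0 ==> P1 (\<lambda>i. c i s) = 0" by auto
 have "\<exists>P\<in>polynomial_funs I. (\<exists>x. P x ~= 0) \<and>
   (\<forall>s\<in>{s\<in>U. b d s ~= 0 \<and> h s = 0}. P (\<lambda>i. c i s) = 0)"
 proof (rule algebraic_dependence_integral[where v = v and b = b and d = d and a = a and p = p])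
  show "b j \<in> polynomial_funs (V - {v})" for j
   using insert.hyps insert.prems by (intro polynomial_funs_mono[OF b(1)]) auto
 qed (use V I p a c insert.prems hd in auto)
 then obtain P2 where P2: "P2 \<in> polynomial_funs I" "\<exists>x. P2 x ~= 0"
  "\<And>s. s \<in> U ==> b d s ~= 0 ==> h s = 0 ==> P2 (\<lambda>i. c i s) = 0" by blast
 show ?case
 proof (intro bexI[of _ "\<lambda>x. P1 x * P2 x"] conjI ballI impI)
  show "\<exists>x. P1 x * P2 x ~= 0" using polynomial_funs_mult_nonzero P1(1,2) P2(1,2) by blast
  show "(\<lambda>x. P1 x * P2 x) \<in> polynomial_funs I" by (intro polynomial_funs.mult P1 P2)
  show "P1 (\<lambda>i. c i s) * P2 (\<lambda>i. c i s) = 0" if "s \<in> U" "h s = 0" for s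
   using P1(3)[OF that(1)] P2(3)[OF that(1) _ that(2)] by (cases "b d s = 0") auto
 qed
qed

section \<open>Rational functions without poles on a set\<close>

definition regular_funs :: "'v set => ('v => 'a::field) set => (('v => 'a) => 'a) set" where
 "regular_funs V U = {f. \<exists>p\<in>polynomial_funs V. \<exists>a\<in>polynomial_funs V. \<forall>s\<in>U. a s ~= 0 \<and> f s * a s = p s}"

lemma regular_funsE:
 assumes "f \<in> regular_funs V U"
 obtains p a where "p \<in> polynomial_funs V" "a \<in> polynomial_funs V"
  "\<And>s. s \<in> U ==> a s ~= 0" "\<And>s. s \<in> U ==> f s * a s = p s"
 using assms unfolding regular_funs_def by blast

lemma regular_funs_polynomial: "f \<in> polynomial_funs V ==> f \<in> regular_funs V U"
 unfolding regular_funs_def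
 by (intro CollectI bexI[of _ f] bexI[of _ "\<lambda>_. 1"] polynomial_funs.const) auto

lemma regular_funs_const: "(\<lambda>_. k) \<in> regular_funs V U"
 by (intro regular_funs_polynomial polynomial_funs.const)

lemma regular_funs_var: "v \<in> V ==> (\<lambda>s. s v) \<in> regular_funs V U"
 by (intro regular_funs_polynomial polynomial_funs.var)

lemma regular_funs_add:
 assumes "f \<in> regular_funs V U" "g \<in> regular_funs V U"
 shows "(\<lambda>s. f s + g s) \<in> regular_funs V U"
proof -
 from assms(1) obtain p a where f: "p \<in> polynomial_funs V" "a \<in> polynomial_funs V"
  "\<And>s. s \<in> U ==> a s ~= 0" "\<And>s. s \<in> U ==> f s * a s = p s" by (rule regular_funsE) blast
 from assms(2) obtain q b where g: "q \<in> polynomial_funs V" "b \<in> polynomial_funs V"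
  "\<And>s. s \<in> U ==> b s ~= 0" "\<And>s. s \<in> U ==> g s * b s = q s" by (rule regular_funsE) blast
 have "(f s + g s) * (a s * b s) = p s * b s + q s * a s" if "s \<in> U" for s
  unfolding f(4)[OF that, symmetric] g(4)[OF that, symmetric] by (simp add: algebra_simps)
 then show ?thesis unfolding regular_funs_def using f g
  by (intro CollectI bexI[of _ "\<lambda>s. p s * b s + q s * a s"] bexI[of _ "\<lambda>s. a s * b s"])
    (auto intro!: polynomial_funs_intros)
qed

lemma regular_funs_mult:
 assumes "f \<in> regular_funs V U" "g \<in> regular_funs V U"
 shows "(\<lambda>s. f s * g s) \<in> regular_funs V U"
proof -
 from assms(1) obtain p a where f: "p \<in> polynomial_funs V" "a \<in> polynomial_funs V"
  "\<And>s. s \<in> U ==> a s ~= 0" "\<And>s. s \<in> U ==> f s * a s = p s" by (rule regular_funsE) blast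
 from assms(2) obtain q b where g: "q \<in> polynomial_funs V" "b \<in> polynomial_funs V"
  "\<And>s. s \<in> U ==> b s ~= 0" "\<And>s. s \<in> U ==> g s * b s = q s" by (rule regular_funsE) blast
 have "(f s * g s) * (a s * b s) = p s * q s" if "s \<in> U" for s
  unfolding f(4)[OF that, symmetric] g(4)[OF that, symmetric] by (simp add: mult_ac)
 then show ?thesis unfolding regular_funs_def using f g
  by (intro CollectI bexI[of _ "\<lambda>s. p s * q s"] bexI[of _ "\<lambda>s. a s * b s"])
    (auto intro!: polynomial_funs_intros)
qed

lemma regular_funs_inverse:
 assumes "f \<in> regular_funs V U" "\<And>s. s \<in> U ==> f s ~= 0"
 shows "(\<lambda>s. inverse (f s)) \<in> regular_funs V U"
proof -
 from assms(1) obtain p a where f: "p \<in> polynomial_funs V" "a \<in> polynomial_funs V"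
  "\<And>s. s \<in> U ==> a s ~= 0" "\<And>s. s \<in> U ==> f s * a s = p s" by (rule regular_funsE) blast
 have "p s ~= 0 \<and> inverse (f s) * p s = a s" if "s \<in> U" for s
  using f(3,4)[OF that] assms(2)[OF that] by (auto simp: field_simps)
 then show ?thesis unfolding regular_funs_def using f(1,2) by blast
qed

lemma regular_funs_divide:
 assumes "f \<in> regular_funs V U" "g \<in> regular_funs V U" "\<And>s. s \<in> U ==> g s ~= 0"
 shows "(\<lambda>s. f s / g s) \<in> regular_funs V U"
 using regular_funs_mult[OF assms(1) regular_funs_inverse[OF assms(2,3)]] by (simp add: divide_inverse)

lemma regular_funs_uminus: "f \<in> regular_funs V U ==> (\<lambda>s. - f s) \<in> regular_funs V U"
 using regular_funs_mult[OF regular_funs_const[of "-1"]] by fastforce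

lemma regular_funs_sum:
 "(\<And>x. x \<in> S ==> f x \<in> regular_funs V U) ==> (\<lambda>s. \<Sum>x\<in>S. f x s) \<in> regular_funs V U"
 by (induction S rule: infinite_finite_induct) (auto intro: regular_funs_const regular_funs_add)

lemma regular_funs_prod:
 "(\<And>x. x \<in> S ==> f x \<in> regular_funs V U) ==> (\<lambda>s. \<Prod>x\<in>S. f x s) \<in> regular_funs V U"
 by (induction S rule: infinite_finite_induct) (auto intro: regular_funs_const regular_funs_mult)

lemma regular_funs_power: "f \<in> regular_funs V U ==> (\<lambda>s. f s ^ n) \<in> regular_funs V U"
 by (induction n) (auto intro: regular_funs_const regular_funs_mult)

lemma regular_funs_power_int:
 assumes "f \<in> regular_funs V U" "\<And>s. s \<in> U ==> f s ~= 0"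
 shows "(\<lambda>s. f s powi n) \<in> regular_funs V U"
 unfolding power_int_def using assms regular_funs_power[OF regular_funs_inverse[OF assms]]
 by (cases "n \<ge> 0") (auto intro: regular_funs_power)

lemma regular_funs_cong:
 "f \<in> regular_funs V U ==> (\<And>s. s \<in> U ==> f s = g s) ==> g \<in> regular_funs V U"
 unfolding regular_funs_def by auto

lemma regular_funs_compose:
 assumes "P \<in> polynomial_funs I" "\<And>i. i \<in> I ==> c i \<in> regular_funs V U"
 shows "(\<lambda>s. P (\<lambda>i. c i s)) \<in> regular_funs V U"
 using assms
 by (induction P rule: polynomial_funs.induct)
   (auto intro: regular_funs_const regular_funs_add regular_funs_mult)

text \<open>Denominators survive the substitution because the substituted point lies in
  \<open>U\<close>, where they have no zeros.\<close>

lemma regular_funs_reindex: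
 assumes "f \<in> regular_funs V U" "\<And>v. v \<in> V ==> g v \<in> regular_funs W T"
  "\<And>s. s \<in> T ==> (\<lambda>v. g v s) \<in> U"
 shows "(\<lambda>s. f (\<lambda>v. g v s)) \<in> regular_funs W T"
proof -
 from assms(1) obtain p a where f: "p \<in> polynomial_funs V" "a \<in> polynomial_funs V"
  "\<And>s. s \<in> U ==> a s ~= 0" "\<And>s. s \<in> U ==> f s * a s = p s" by (rule regular_funsE) blast
 have "(\<lambda>s. p (\<lambda>v. g v s) / a (\<lambda>v. g v s)) \<in> regular_funs W T"
  using f(3)[OF assms(3)]
  by (intro regular_funs_divide regular_funs_compose[OF f(1)] regular_funs_compose[OF f(2)])
    (auto intro: assms)
 then show ?thesis
 proof (rule regular_funs_cong)
  fix s assume "s \<in> T"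
  then show "p (\<lambda>v. g v s) / a (\<lambda>v. g v s) = f (\<lambda>v. g v s)"
   using f(3,4) assms(3) by (simp add: field_simps)
 qed
qed

lemma regular_funs_common_denominator:
 assumes "finite I" "\<And>i. i \<in> I ==> c i \<in> regular_funs V U"
 shows "\<exists>a\<in>polynomial_funs V. \<exists>p. (\<forall>i\<in>I. p i \<in> polynomial_funs V) \<and>
  (\<forall>s\<in>U. a s ~= 0) \<and> (\<forall>i\<in>I. \<forall>s\<in>U. c i s * a s = p i s)"
proof -
 have "\<forall>i\<in>I. \<exists>q. fst q \<in> polynomial_funs V \<and> snd q \<in> polynomial_funs V \<and>
   (\<forall>s\<in>U. snd q s ~= 0 \<and> c i s * snd q s = fst q s)"
  using assms(2) unfolding regular_funs_def by fastforce
 from bchoice[OF this] obtain q where q: "\<And>i. i \<in> I ==> fst (q i) \<in> polynomial_funs V"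
  "\<And>i. i \<in> I ==> snd (q i) \<in> polynomial_funs V"
  "\<And>i s. i \<in> I ==> s \<in> U ==> snd (q i) s ~= 0"
  "\<And>i s. i \<in> I ==> s \<in> U ==> c i s * snd (q i) s = fst (q i) s" by blast
 show ?thesis
 proof (intro bexI[of _ "\<lambda>s. \<Prod>i\<in>I. snd (q i) s"]
   exI[of _ "\<lambda>i s. fst (q i) s * (\<Prod>j\<in>I - {i}. snd (q j) s)"] conjI ballI)
  show "(\<lambda>s. fst (q i) s * (\<Prod>j\<in>I - {i}. snd (q j) s)) \<in> polynomial_funs V" if "i \<in> I" for i
   using that q by (intro polynomial_funs.mult polynomial_funs_prod) auto
  show "(\<Prod>i\<in>I. snd (q i) s) ~= 0" if "s \<in> U" for s using that q assms(1) by auto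
  show "c i s * (\<Prod>i\<in>I. snd (q i) s) = fst (q i) s * (\<Prod>j\<in>I - {i}. snd (q j) s)"
   if "i \<in> I" "s \<in> U" for i s
   using that q(4)[OF that] assms(1) by (subst prod.remove[of I i]) (auto simp flip: mult.assoc)
  show "(\<lambda>s. \<Prod>i\<in>I. snd (q i) s) \<in> polynomial_funs V" using q by (intro polynomial_funs_prod) auto
 qed
qed

lemma hypersurface_image:
 fixes c :: "'i => ('v => complex) => complex"
 assumes V: "finite V" and I: "finite I" "card I \<ge> card V"
  and c: "\<And>i. i \<in> I ==> c i \<in> regular_funs V U"
  and h: "h \<in> polynomial_funs V" "h s0 ~= 0"
 shows "\<exists>P\<in>polynomial_funs I. (\<exists>x. P x ~= 0) \<and> (\<forall>s\<in>U. h s = 0 --> P (\<lambda>i. c i s) = 0)"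
proof -
 have "\<exists>a\<in>polynomial_funs V. \<exists>p. (\<forall>i\<in>I. p i \<in> polynomial_funs V) \<and>
  (\<forall>s\<in>U. a s ~= 0) \<and> (\<forall>i\<in>I. \<forall>s\<in>U. c i s * a s = p i s)"
  by (rule regular_funs_common_denominator[OF I(1) c])
 then obtain a p where "a \<in> polynomial_funs V" "\<And>i. i \<in> I ==> p i \<in> polynomial_funs V"
  "\<And>s. s \<in> U ==> a s ~= 0" "\<And>i s. i \<in> I ==> s \<in> U ==> c i s * a s = p i s"
  by blast
 then show ?thesis using hypersurface_image_polynomial[OF V I, of p a U c V h s0] V h by blast
qed

text \<open>A dummy coordinate \<open>None\<close> reduces this to the hypersurface case: the
  functions are considered on the hyperplane where it is zero, and the strict inequality pays for
  the extra coordinate.\<close>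

lemma algebraic_dependence:
 fixes c :: "'i => ('v => complex) => complex"
 assumes V: "finite V" and I: "finite I" "card I > card V"
  and c: "\<And>i. i \<in> I ==> c i \<in> regular_funs V U"
 shows "\<exists>P\<in>polynomial_funs I. (\<exists>x. P x ~= 0) \<and> (\<forall>s\<in>U. P (\<lambda>i. c i s) = 0)"
proof -
 let ?W = "insert None (Some ` V)"
 let ?T = "{s. (\<lambda>v. s (Some v)) \<in> U}"
 have "\<exists>P\<in>polynomial_funs I. (\<exists>x. P x ~= 0) \<and>
   (\<forall>s\<in>?T. s None = 0 --> P (\<lambda>i. c i (\<lambda>v. s (Some v))) = 0)"
 proof (rule hypersurface_image[of ?W I _ ?T "\<lambda>s. s None" "\<lambda>_. 1"])
  show "card I \<ge> card ?W" using V I by (simp add: card_image)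
  show "(\<lambda>s. c i (\<lambda>v. s (Some v))) \<in> regular_funs ?W ?T" if "i \<in> I" for i
   by (rule regular_funs_reindex[OF c[OF that]]) (auto intro: regular_funs_var)
 qed (use V I in \<open>auto intro: polynomial_funs.var\<close>)
 then obtain P where P: "P \<in> polynomial_funs I" "\<exists>x. P x ~= 0"
  "\<And>s. s \<in> ?T ==> s None = 0 ==> P (\<lambda>i. c i (\<lambda>v. s (Some v))) = 0" by blast
 have "P (\<lambda>i. c i s) = 0" if "s \<in> U" for s
  using P(3)[of "\<lambda>w. case w of None => 0 | Some v => s v"] that by simp
 then show ?thesis using P by blast
qed

lemma polynomial_funs_deriv_zero:
 fixes P :: "('i => 'a::real_normed_field) => 'a"
 assumes "P \<in> polynomial_funs I" "\<And>i. i \<in> I ==> ((\<lambda>t. c i t) has_field_derivative 0) (at x)"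
 shows "((\<lambda>t. P (\<lambda>i. c i t)) has_field_derivative 0) (at x)"
 using assms
proof (induction P rule: polynomial_funs.induct)
 case (add P Q)
 then show ?case using DERIV_add[of "\<lambda>t. P (\<lambda>i. c i t)" 0 x UNIV "\<lambda>t. Q (\<lambda>i. c i t)" 0] by simp
next
 case (mult P Q)
 then show ?case using DERIV_mult[of "\<lambda>t. P (\<lambda>i. c i t)" 0 x UNIV "\<lambda>t. Q (\<lambda>i. c i t)" 0] by simp
qed (auto intro: derivative_eq_intros)

text \<open>Algebraic Sard theorem: if the \<open>c i\<close> are algebraically independent, then every coordinate \<open>s j\<close>
 satisfies an equation over them of minimal degree, and differentiating it along a vector annihilated by
 all \<open>d (c i)\<close> shows that \<open>s j\<close> is a multiple root.\<close>

lemma critical_image: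
 fixes c :: "'i => ('v => complex) => complex"
 assumes V: "finite V" and I: "finite I" "card I = card V"
  and c: "\<And>i. i \<in> I ==> c i \<in> regular_funs V U"
  and U: "\<And>s w. s \<in> U ==> \<forall>\<^sub>F t in nhds 0. (\<lambda>j. s j + t * w j) \<in> U"
 shows "\<exists>P\<in>polynomial_funs I. (\<exists>x. P x ~= 0) \<and>
  (\<forall>s\<in>U. \<forall>w. (\<exists>j\<in>V. w j ~= 0) \<and>
    (\<forall>i\<in>I. ((\<lambda>t. c i (\<lambda>j. s j + t * w j)) has_field_derivative 0) (at 0)) --> P (\<lambda>i. c i s) = 0)"
proof (cases "\<exists>P\<in>polynomial_funs I. (\<exists>x. P x ~= 0) \<and> (\<forall>s\<in>U. P (\<lambda>i. c i s) = 0)")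
 case True
 then show ?thesis by blast
next
 case indep: False
 have "\<exists>P\<in>polynomial_funs I. (\<exists>x. P x ~= 0) \<and>
  (\<forall>s\<in>U. \<forall>w. w j ~= 0 \<and>
    (\<forall>i\<in>I. ((\<lambda>t. c i (\<lambda>j. s j + t * w j)) has_field_derivative 0) (at 0)) --> P (\<lambda>i. c i s) = 0)"
  if j: "j \<in> V" for j
 proof -
  \<comment> \<open>A relation of degree \<open>d\<close> for the coordinate \<open>s j\<close> over
    the \<open>c i\<close>. Its leading coefficient is nonzero as a polynomial, not necessarily at
    each point of \<open>U\<close>.\<close>
  define rel where "rel d R \<longleftrightarrow> (\<forall>k. R k \<in> polynomial_funs I) \<and> (\<exists>x. R d x ~= 0) \<and>
    (\<forall>s\<in>U. (\<Sum>k\<le>d. R k (\<lambda>i. c i s) * s j ^ k) = 0)" for d and R :: "nat => ('i => complex) => complex"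
  let ?J = "insert None (Some ` I)"
  \<comment> \<open>Together with the coordinate \<open>s j\<close>, the \<open>c i\<close> are one
    function more than there are coordinates.\<close>
  have "\<exists>P\<in>polynomial_funs ?J. (\<exists>x. P x ~= 0) \<and>
    (\<forall>s\<in>U. P (\<lambda>i. (case i of None => (\<lambda>s. s j) | Some i => c i) s) = 0)"
   using V I j by (intro algebraic_dependence[OF V]) (auto simp: card_image intro: c regular_funs_var)
  then obtain P where P: "P \<in> polynomial_funs ?J" "\<exists>x. P x ~= 0"
   "\<And>s. s \<in> U ==> P (\<lambda>i. (case i of None => (\<lambda>s. s j) | Some i => c i) s) = 0" by blast
  obtain e b where b: "\<And>k. b k \<in> polynomial_funs (Some ` I)" "\<And>k. k > e ==> b k = (\<lambda>_. 0)"
   "\<And>s. P s = (\<Sum>k\<le>e. b k s * s None ^ k)"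
   using polynomial_funs_expand[OF P(1)] by blast
  define R where "R k x = b k (\<lambda>v. case v of None => 0 | Some i => x i)" for k x
  have R: "R k \<in> polynomial_funs I" for k
   unfolding R_def[abs_def]
   by (rule polynomial_funs_compose[OF b(1), of "\<lambda>v x. case v of None => 0 | Some i => x i"])
     (auto intro: polynomial_funs.var)
  have bR: "b k s = R k (\<lambda>i. s (Some i))" for k s
   unfolding R_def by (rule polynomial_funs_cong[OF b(1)]) auto
  have sumR: "(\<Sum>k\<le>e. R k (\<lambda>i. c i s) * s j ^ k) = 0" if "s \<in> U" for s
   using P(3)[OF that] by (simp add: b(3) bR)
  let ?nz = "\<lambda>k. \<exists>x. R k x ~= 0"
  have nz: "\<exists>k\<le>e. ?nz k"
  proof (rule ccontr)
   assume "\<not> ?thesis"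
   then have "P x = 0" for x unfolding b(3) bR by (intro sum.neutral) auto
   then show False using P(2) by simp
  qed
  define d' where "d' = (GREATEST k. k \<le> e \<and> ?nz k)"
  have d': "d' \<le> e" "?nz d'"
   using GreatestI_ex_nat[of "\<lambda>k. k \<le> e \<and> ?nz k" e] nz by (auto simp: d'_def)
  have top: "R k x = 0" if "k > d'" "k \<le> e" for k x
   using Greatest_le_nat[of "\<lambda>k. k \<le> e \<and> ?nz k" k e] that by (fastforce simp: d'_def)
  have "(\<Sum>k\<le>d'. R k (\<lambda>i. c i s) * s j ^ k) = (\<Sum>k\<le>e. R k (\<lambda>i. c i s) * s j ^ k)" for s
   using d' top by (intro sum.mono_neutral_left) auto
  then have "\<exists>d R. rel d R" using R d' sumR by (intro exI[of _ d'] exI[of _ R]) (auto simp: rel_def)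
  then have ex: "\<exists>d. \<exists>R. rel d R" .
  define d where "d = (LEAST d. \<exists>R. rel d R)"
  obtain R where R: "rel d R" using LeastI_ex[OF ex] by (auto simp: d_def)
  have min: "\<not> rel e R" if "e < d" for e R using not_less_Least that unfolding d_def by blast
  have "d ~= 0"
  proof
   assume "d = 0"
   then have "\<forall>s\<in>U. R 0 (\<lambda>i. c i s) = 0" using R by (simp add: rel_def)
   then show False using indep R \<open>d = 0\<close> unfolding rel_def by blast
  qed
  \<comment> \<open>The derivative of the minimal relation with respect to \<open>s j\<close>. Were
    it zero on \<open>U\<close>, it would be a relation of degree \<open>d - 1\<close>. Its zeros
    thus lie on a proper hypersurface, whose image is contained in the zeros of
    \<open>Q\<close>.\<close>
  define g where "g s = (\<Sum>k\<le>d - 1. of_nat (Suc k) * R (Suc k) (\<lambda>i. c i s) * s j ^ k)" for s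
  have "\<exists>s\<in>U. g s ~= 0"
  proof (rule ccontr)
   assume "\<not> ?thesis"
   moreover have "(\<exists>x. of_nat (Suc (d - 1)) * R (Suc (d - 1)) x ~= 0)"
    using R \<open>d ~= 0\<close> by (auto simp: rel_def simp del: of_nat_Suc)
   moreover have "(\<lambda>x. of_nat (Suc k) * R (Suc k) x) \<in> polynomial_funs I" for k
    using R by (intro polynomial_funs.mult polynomial_funs.const) (auto simp: rel_def)
   ultimately have "rel (d - 1) (\<lambda>k x. of_nat (Suc k) * R (Suc k) x)"
    unfolding rel_def g_def by blast
   then show False using min[of "d - 1"] \<open>d ~= 0\<close> by simp
  qed
  then obtain s1 where s1: "s1 \<in> U" "g s1 ~= 0" by blast
  have Rc: "(\<lambda>s. R k (\<lambda>i. c i s)) \<in> regular_funs V U" for k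
   using regular_funs_compose[where P = "R k" and c = c and I = I, OF _ c] R
   by (simp add: rel_def)
  have "g \<in> regular_funs V U"
   unfolding g_def[abs_def]
   by (intro regular_funs_sum regular_funs_mult regular_funs_const regular_funs_power
      regular_funs_var Rc j)
  then obtain p a where pa: "p \<in> polynomial_funs V" "a \<in> polynomial_funs V"
   "\<And>s. s \<in> U ==> a s ~= 0" "\<And>s. s \<in> U ==> g s * a s = p s" by (rule regular_funsE) blast
  have "p s1 ~= 0" using pa(3)[OF s1(1)] pa(4)[OF s1(1)] s1(2) by auto
  then have "\<exists>Q\<in>polynomial_funs I. (\<exists>x. Q x ~= 0) \<and> (\<forall>s\<in>U. p s = 0 --> Q (\<lambda>i. c i s) = 0)"
   using I by (intro hypersurface_image[where c = c and V = V] V c pa(1)) auto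
  then obtain Q where Q: "Q \<in> polynomial_funs I" "\<exists>x. Q x ~= 0"
   "\<And>s. s \<in> U ==> p s = 0 ==> Q (\<lambda>i. c i s) = 0" by blast
  have "Q (\<lambda>i. c i s) = 0"
   if s: "s \<in> U" and w: "w j ~= 0"
    and der: "\<And>i. i \<in> I ==> ((\<lambda>t. c i (\<lambda>j. s j + t * w j)) has_field_derivative 0) (at 0)" for s w
  proof -
   define r where "r t = (\<lambda>j. s j + t * w j)" for t
   have r0: "r 0 = s" by (simp add: r_def)
   \<comment> \<open>Along \<open>w\<close> the coefficients of the relation are stationary, so only
     the powers of \<open>s j\<close> contribute and the derivative is
     \<open>g s * w j\<close>.\<close>
   have "((\<lambda>t. \<Sum>k\<le>d. R k (\<lambda>i. c i (r t)) * (s j + t * w j) ^ k) has_field_derivative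
     (\<Sum>k\<le>d. R k (\<lambda>i. c i (r 0)) * (of_nat k * s j ^ (k - 1) * w j))) (at 0)"
   proof (rule DERIV_sum)
    fix k
    have A: "((\<lambda>t. R k (\<lambda>i. c i (r t))) has_field_derivative 0) (at 0)"
     using R der polynomial_funs_deriv_zero[where P = "R k" and c = "\<lambda>i t. c i (r t)" and I = I and x = 0]
     by (auto simp: rel_def r_def)
    have B: "((\<lambda>t. (s j + t * w j) ^ k) has_field_derivative (of_nat k * s j ^ (k - 1) * w j)) (at 0)"
     by (auto intro!: derivative_eq_intros)
    show "((\<lambda>t. R k (\<lambda>i. c i (r t)) * (s j + t * w j) ^ k) has_field_derivative
      R k (\<lambda>i. c i (r 0)) * (of_nat k * s j ^ (k - 1) * w j)) (at 0)"
     using DERIV_mult[OF A B] by (simp add: mult.commute)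
   qed
   moreover have ev: "\<forall>\<^sub>F t in nhds 0. (\<Sum>k\<le>d. R k (\<lambda>i. c i (r t)) * (s j + t * w j) ^ k) = 0"
    using U[OF s, of w]
   proof (rule eventually_mono)
    fix t assume "(\<lambda>j. s j + t * w j) \<in> U"
    then have "(\<Sum>k\<le>d. R k (\<lambda>i. c i (r t)) * r t j ^ k) = 0" using R unfolding rel_def r_def by blast
    then show "(\<Sum>k\<le>d. R k (\<lambda>i. c i (r t)) * (s j + t * w j) ^ k) = 0" by (simp add: r_def)
   qed
   ultimately have "((\<lambda>_. 0) has_field_derivative
     (\<Sum>k\<le>d. R k (\<lambda>i. c i (r 0)) * (of_nat k * s j ^ (k - 1) * w j))) (at 0)"
    by (simp only: DERIV_cong_ev[OF refl ev refl])
   then have "0 = (\<Sum>k\<le>d. R k (\<lambda>i. c i s) * (of_nat k * s j ^ (k - 1) * w j))"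
    unfolding r0 by (rule DERIV_unique[OF DERIV_const])
   also have "\<dots> = (\<Sum>k\<le>Suc (d - 1). R k (\<lambda>i. c i s) * (of_nat k * s j ^ (k - 1) * w j))"
    using \<open>d ~= 0\<close> by simp
   also have "\<dots> = (\<Sum>k\<le>d - 1. R (Suc k) (\<lambda>i. c i s) * (of_nat (Suc k) * s j ^ k * w j))"
    by (subst sum.atMost_Suc_shift) simp
   also have "\<dots> = g s * w j" unfolding g_def sum_distrib_right
    by (intro sum.cong refl) (simp only: mult_ac)
   finally have "g s = 0" using w by simp
   then have "p s = 0" using pa(4)[OF s] by simp
   then show ?thesis by (rule Q(3)[OF s])
  qed
  then show ?thesis using Q(1,2) by blast
 qed
 then have "\<forall>j\<in>V. \<exists>P. P \<in> polynomial_funs I \<and> (\<exists>x. P x ~= 0) \<and>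
  (\<forall>s\<in>U. \<forall>w. w j ~= 0 \<and>
    (\<forall>i\<in>I. ((\<lambda>t. c i (\<lambda>j. s j + t * w j)) has_field_derivative 0) (at 0)) --> P (\<lambda>i. c i s) = 0)"
  by blast
 from bchoice[OF this] obtain P where P: "\<And>j. j \<in> V ==> P j \<in> polynomial_funs I"
  "\<And>j. j \<in> V ==> \<exists>x. P j x ~= 0"
  "\<And>j s w. j \<in> V ==> s \<in> U ==> w j ~= 0 ==>
    (\<forall>i\<in>I. ((\<lambda>t. c i (\<lambda>j. s j + t * w j)) has_field_derivative 0) (at 0)) ==> P j (\<lambda>i. c i s) = 0"
  by blast
 show ?thesis
 proof (intro bexI[of _ "\<lambda>x. \<Prod>j\<in>V. P j x"] conjI ballI allI impI)
  show "\<exists>x. (\<Prod>j\<in>V. P j x) ~= 0" by (rule polynomial_funs_prod_nonzero[OF V P(1,2)])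
  show "(\<lambda>x. \<Prod>j\<in>V. P j x) \<in> polynomial_funs I" by (intro polynomial_funs_prod P)
  show "(\<Prod>j\<in>V. P j (\<lambda>i. c i s)) = 0" if "s \<in> U" "(\<exists>j\<in>V. w j ~= 0) \<and>
    (\<forall>i\<in>I. ((\<lambda>t. c i (\<lambda>j. s j + t * w j)) has_field_derivative 0) (at 0))" for s w
   using that P(3) V by (auto simp: prod_zero_iff)
 qed
qed

section \<open>Generic solutions of linear systems with parameters\<close>

lemma holds_generically_mono:
 "holds_generically I \<Phi> ==> (\<And>c. \<Phi> c ==> \<Psi> c) ==> holds_generically I \<Psi>"
 unfolding holds_generically_def by blast

lemma holds_generically_conj:
 fixes \<Phi> :: "('i => 'a::field_char_0) => bool"
 assumes "holds_generically I \<Phi>" "holds_generically I \<Psi>"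
 shows "holds_generically I (\<lambda>c. \<Phi> c \<and> \<Psi> c)"
proof -
 obtain P Q where P: "P \<in> polynomial_funs I" "\<exists>c. P c ~= 0" "\<And>c. P c ~= 0 ==> \<Phi> c"
  and Q: "Q \<in> polynomial_funs I" "\<exists>c. Q c ~= 0" "\<And>c. Q c ~= 0 ==> \<Psi> c"
  using assms unfolding holds_generically_def by blast
 have "\<exists>c. P c * Q c ~= 0" using polynomial_funs_mult_nonzero P(1,2) Q(1,2) by blast
 then show ?thesis unfolding holds_generically_def
  using P Q by (intro bexI[of _ "\<lambda>c. P c * Q c"] polynomial_funs.mult) auto
qed

lemma holds_generically_True: "(\<And>c. \<Phi> c) ==> holds_generically I \<Phi>"
 unfolding holds_generically_def
 by (intro bexI[of _ "\<lambda>_. 1"] polynomial_funs.const) auto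

lemma holds_generically_ball:
 fixes \<Phi> :: "'b => ('i => 'a::field_char_0) => bool"
 assumes "finite S" "\<And>x. x \<in> S ==> holds_generically I (\<Phi> x)"
 shows "holds_generically I (\<lambda>c. \<forall>x\<in>S. \<Phi> x c)"
 using assms
proof (induction S rule: finite_induct)
 case empty
 then show ?case by (intro holds_generically_True) simp
next
 case (insert x S)
 then have "holds_generically I (\<lambda>c. \<Phi> x c \<and> (\<forall>x\<in>S. \<Phi> x c))"
  by (intro holds_generically_conj) auto
 then show ?case by (rule holds_generically_mono) auto
qed

text \<open>Row rank equals column rank: a maximal independent set of columns with fewer than
  \<open>CARD('r)\<close> members would leave a nonzero \<open>y\<close> orthogonal to all of them,
  hence to all columns.\<close>

lemma independent_rows_minor:
 fixes \<psi> :: "'r::finite => 'i => 'a::field"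
 assumes "finite I" and indep: "\<And>y r. (\<And>i. i \<in> I ==> (\<Sum>r\<in>UNIV. y r * \<psi> r i) = 0) ==> y r = 0"
 shows "\<exists>\<kappa>. range \<kappa> \<subseteq> I \<and> det (\<chi> r r'. \<psi> r (\<kappa> r')) ~= 0"
proof -
 define col :: "'i => 'a^'r" where "col i = (\<chi> r. \<psi> r i)" for i
 obtain B where B: "B \<subseteq> col ` I" "vec.independent B" "col ` I \<subseteq> vec.span B"
  using vec.maximal_independent_subset by blast
 have finB: "finite B" using B(1) assms(1) finite_subset by blast
 have "CARD('r) \<le> card B"
 proof (rule ccontr)
  assume "\<not> ?thesis"
  then obtain y where y: "\<exists>r. y r ~= 0" "\<And>b. b \<in> B ==> (\<Sum>r\<in>UNIV. y r * b $ r) = 0"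
   using underdetermined_system[OF finB, of "UNIV :: 'r set" "\<lambda>r b. vec_nth b r"] by auto
  have "(\<Sum>r\<in>UNIV. y r * v $ r) = 0" if "v \<in> vec.span B" for v
   using that
  proof (induction rule: vec.span_induct_alt)
   case (step c b v)
   have "(\<Sum>r\<in>UNIV. y r * (c *s b + v) $ r) = c * (\<Sum>r\<in>UNIV. y r * b $ r) + (\<Sum>r\<in>UNIV. y r * v $ r)"
    by (simp add: sum_distrib_left sum.distrib[symmetric] algebra_simps)
   then show ?case using step y(2) by simp
  qed simp
  then have "(\<Sum>r\<in>UNIV. y r * \<psi> r i) = 0" if "i \<in> I" for i
   using that B(3) by (fastforce simp: col_def)
  then show False using indep y(1) by blast
 qed
 then obtain C where C: "C \<subseteq> B" "card C = CARD('r)" "finite C"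
  using obtain_subset_with_card_n by metis
 then obtain f :: "'r => 'a^'r" where f: "bij_betw f UNIV C"
  using finite_same_card_bij[of "UNIV :: 'r set" C] by auto
 have indC: "vec.independent C" using vec.independent_mono[OF B(2) C(1)] .
 have "\<exists>i. i \<in> I \<and> col i = f r" for r
 proof -
  have "f r \<in> C" using f by (auto simp: bij_betw_def)
  then have "f r \<in> col ` I" using C(1) B(1) by auto
  then show ?thesis by auto
 qed
 then have "\<forall>r. \<exists>i. i \<in> I \<and> col i = f r" by simp
 from choice[OF this] obtain \<kappa> where \<kappa>: "\<And>r. \<kappa> r \<in> I" "\<And>r. col (\<kappa> r) = f r" by auto
 let ?A = "(\<chi> r r'. \<psi> r (\<kappa> r')) :: 'a^'r^'r"
 have column: "column r ?A = f r" for r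
  using \<kappa>(2)[of r] by (simp add: column_def col_def)
 have "\<forall>c. (\<Sum>r\<in>UNIV. c r *s column r ?A) = 0 --> (\<forall>r. c r = 0)"
 proof (intro allI impI)
  fix c r assume c: "(\<Sum>r\<in>UNIV. c r *s column r ?A) = 0"
  have inj: "inj f" and ran: "range f = C" using f by (auto simp: bij_betw_def)
  have "(\<Sum>v\<in>C. c (inv f v) *s v) = (\<Sum>r\<in>UNIV. c r *s f r)"
   unfolding ran[symmetric] by (subst sum.reindex[OF inj]) (simp add: inj)
  then have zero: "(\<Sum>v\<in>C. c (inv f v) *s v) = 0" using c by (simp add: column)
  show "c r = 0"
  proof (rule ccontr)
   assume "c r ~= 0"
   then have "c (inv f (f r)) ~= 0" by (simp add: inj)
   moreover have "f r \<in> C" using ran by blast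
   ultimately have "\<exists>v\<in>C. c (inv f v) ~= 0" by (rule bexI)
   then have "vec.dependent C" unfolding vec.dependent_finite[OF C(3)]
    by (intro exI[of _ "\<lambda>v. c (inv f v)"] conjI zero)
   then show False using indC by contradiction
  qed
 qed
 then obtain D where "D ** ?A = mat 1" using matrix_left_invertible_independent_columns[of ?A] by auto
 then have "det D * det ?A = 1" by (metis det_I det_mul)
 then have "det ?A ~= 0" by auto
 then show ?thesis using \<kappa>(1) by blast
qed

lemma regular_funs_det:
 fixes f :: "'r::finite => 'r => ('v => 'a::field) => 'a"
 assumes "\<And>r r'. f r r' \<in> regular_funs V U"
 shows "(\<lambda>s. det (\<chi> r r'. f r r' s)) \<in> regular_funs V U"
proof -
 have "(\<lambda>s. \<Sum>p | p permutes UNIV. of_int (sign p) * (\<Prod>i\<in>UNIV. f i (p i) s)) \<in> regular_funs V U"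
  by (intro regular_funs_sum regular_funs_mult regular_funs_const regular_funs_prod assms)
 then show ?thesis by (simp add: det_def)
qed

lemma polynomial_funs_eventually_nonzero:
 fixes q :: "('v => complex) => complex"
 assumes "q \<in> polynomial_funs V" "q s ~= 0"
 shows "\<forall>\<^sub>F t in nhds 0. q (\<lambda>j. s j + t * w j) ~= 0"
proof -
 obtain p where p: "\<And>t. q (\<lambda>j. s j + t * w j) = poly p t"
  using polynomial_funs_line[OF assms(1), of s w] by blast
 have "poly p 0 ~= 0" using p[of 0] assms(2) by simp
 moreover have "open {t. poly p t ~= 0}"
  by (intro open_Collect_neq continuous_intros)
 ultimately show ?thesis unfolding p eventually_nhds by (intro exI[of _ "{t. poly p t ~= 0}"]) auto
qed

lemma regular_funs_line_differentiable:
 fixes f :: "('v => complex) => complex"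
 assumes f: "f \<in> regular_funs V U" and U: "s \<in> U" "\<forall>\<^sub>F t in nhds 0. (\<lambda>j. s j + t * w j) \<in> U"
 shows "\<exists>D. ((\<lambda>t. f (\<lambda>j. s j + t * w j)) has_field_derivative D) (at 0)"
proof -
 from f obtain p a where pa: "p \<in> polynomial_funs V" "a \<in> polynomial_funs V"
  "\<And>s. s \<in> U ==> a s ~= 0" "\<And>s. s \<in> U ==> f s * a s = p s" by (rule regular_funsE) blast
 obtain p' where p': "\<And>t. p (\<lambda>j. s j + t * w j) = poly p' t"
  using polynomial_funs_line[OF pa(1), of s w] by blast
 obtain a' where a': "\<And>t. a (\<lambda>j. s j + t * w j) = poly a' t"
  using polynomial_funs_line[OF pa(2), of s w] by blast
 have "poly a' 0 ~= 0" using a'[of 0] pa(3)[OF U(1)] by simp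
 then have "\<exists>D. ((\<lambda>t. poly p' t / poly a' t) has_field_derivative D) (at 0)"
  by (intro exI) (rule DERIV_divide[OF poly_DERIV poly_DERIV])
 moreover have "\<forall>\<^sub>F t in nhds 0. f (\<lambda>j. s j + t * w j) = poly p' t / poly a' t"
  using U(2)
 proof (rule eventually_mono)
  fix t assume "(\<lambda>j. s j + t * w j) \<in> U"
  from pa(3,4)[OF this] show "f (\<lambda>j. s j + t * w j) = poly p' t / poly a' t"
   unfolding p' a' by (simp add: field_simps)
 qed
 ultimately show ?thesis by (simp only: DERIV_cong_ev[OF refl _ refl])
qed

text \<open>Where the minor on the columns \<open>\<kappa>\<close> is nonzero, the coefficients at
  these columns are regular functions of the parameters (\<open>Inl\<close>) and of the remaining
  coefficients (\<open>Inr\<close>). The last clause says that every solution pair arises in this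
  way.\<close>

lemma linear_system_solution:
 fixes \<psi> :: "'r::finite => 'i => ('v => complex) => complex"
 assumes I: "finite I" and \<kappa>: "inj \<kappa>" "range \<kappa> \<subseteq> I"
  and \<psi>: "\<And>r i. i \<in> I ==> \<psi> r i \<in> regular_funs V U"
  and det: "\<And>s. s \<in> U ==> det (\<chi> r r'. \<psi> r (\<kappa> r') s) ~= 0"
 defines "W \<equiv> Inl ` V \<union> Inr ` (I - range \<kappa>)" and "T \<equiv> {\<sigma>. (\<lambda>v. \<sigma> (Inl v)) \<in> U}"
 shows "\<exists>c'. (\<forall>i\<in>I. c' i \<in> regular_funs W T) \<and>
  (\<forall>i\<in>I - range \<kappa>. c' i = (\<lambda>\<sigma>. \<sigma> (Inr i))) \<and>
  (\<forall>\<sigma>\<in>T. \<forall>r. (\<Sum>i\<in>I. \<psi> r i (\<lambda>v. \<sigma> (Inl v)) * c' i \<sigma>) = 0) \<and>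
  (\<forall>s\<in>U. \<forall>c. (\<forall>r. (\<Sum>i\<in>I. \<psi> r i s * c i) = 0) --> (\<forall>i\<in>I. c' i (case_sum s c) = c i))"
proof -
 \<comment> \<open>The free coefficients move to the right-hand side of the square system.\<close>
 define b where "b r \<sigma> = - (\<Sum>i\<in>I - range \<kappa>. \<psi> r i (\<lambda>v. \<sigma> (Inl v)) * \<sigma> (Inr i))" for r \<sigma>
 define x where "x \<sigma> r = det (\<chi> r1 r2. if r2 = r then b r1 \<sigma> else \<psi> r1 (\<kappa> r2) (\<lambda>v. \<sigma> (Inl v))) /
   det (\<chi> r r'. \<psi> r (\<kappa> r') (\<lambda>v. \<sigma> (Inl v)))" for \<sigma> r
 define c' where "c' i = (if i \<in> range \<kappa> then (\<lambda>\<sigma>. x \<sigma> (inv \<kappa> i)) else (\<lambda>\<sigma>. \<sigma> (Inr i)))" for i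
 have split: "(\<Sum>i\<in>I. \<psi> r i s * c i) = (\<Sum>r'\<in>UNIV. \<psi> r (\<kappa> r') s * c (\<kappa> r')) + (\<Sum>i\<in>I - range \<kappa>. \<psi> r i s * c i)"
  for r s c
 proof -
  have "(\<Sum>i\<in>I. \<psi> r i s * c i) = (\<Sum>i\<in>range \<kappa>. \<psi> r i s * c i) + (\<Sum>i\<in>I - range \<kappa>. \<psi> r i s * c i)"
   by (metis I \<kappa>(2) add.commute sum.subset_diff)
  then show ?thesis by (simp add: sum.reindex[OF \<kappa>(1)])
 qed
 have cramer': "(\<chi> r r'. \<psi> r (\<kappa> r') (\<lambda>v. \<sigma> (Inl v))) *v y = (\<chi> r. b r \<sigma>) \<longleftrightarrow> y = (\<chi> r. x \<sigma> r)"
  if "\<sigma> \<in> T" for \<sigma> y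
  using cramer[of "\<chi> r r'. \<psi> r (\<kappa> r') (\<lambda>v. \<sigma> (Inl v))" y "\<chi> r. b r \<sigma>"] det that
  by (simp add: T_def x_def cong: if_cong)
 have "\<psi> r i \<in> regular_funs V U ==> (\<lambda>\<sigma>. \<psi> r i (\<lambda>v. \<sigma> (Inl v))) \<in> regular_funs W T" for r i
  by (erule regular_funs_reindex) (auto simp: W_def T_def intro: regular_funs_var)
 then have \<psi>': "i \<in> I ==> (\<lambda>\<sigma>. \<psi> r i (\<lambda>v. \<sigma> (Inl v))) \<in> regular_funs W T" for r i
  using \<psi> by blast
 have breg: "b r \<in> regular_funs W T" for r
  unfolding b_def[abs_def]
  by (intro regular_funs_uminus regular_funs_sum regular_funs_mult \<psi>' regular_funs_var) (auto simp: W_def)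
 have \<kappa>I: "\<kappa> r \<in> I" for r using \<kappa>(2) by blast
 have "(\<lambda>\<sigma>. x \<sigma> r) \<in> regular_funs W T" for r
  unfolding x_def
 proof (intro regular_funs_divide regular_funs_det)
  show "(\<lambda>\<sigma>. if r2 = r then b r1 \<sigma> else \<psi> r1 (\<kappa> r2) (\<lambda>v. \<sigma> (Inl v))) \<in> regular_funs W T" for r1 r2
   using breg \<psi>'[OF \<kappa>I] by (cases "r2 = r") auto
 qed (use det \<psi>'[OF \<kappa>I] in \<open>auto simp: T_def\<close>)
 then have 1: "c' i \<in> regular_funs W T" if "i \<in> I" for i
  using that by (auto simp: c'_def W_def intro: regular_funs_var)
 have 2: "c' i = (\<lambda>\<sigma>. \<sigma> (Inr i))" if "i \<in> I - range \<kappa>" for i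
  using that by (simp add: c'_def)
 have 3: "(\<Sum>i\<in>I. \<psi> r i (\<lambda>v. \<sigma> (Inl v)) * c' i \<sigma>) = 0" if "\<sigma> \<in> T" for \<sigma> r
 proof -
  have "((\<chi> r r'. \<psi> r (\<kappa> r') (\<lambda>v. \<sigma> (Inl v))) *v (\<chi> r. x \<sigma> r)) $ r = b r \<sigma>"
   using cramer'[OF that, of "\<chi> r. x \<sigma> r"] by simp
  then have "(\<Sum>r'\<in>UNIV. \<psi> r (\<kappa> r') (\<lambda>v. \<sigma> (Inl v)) * x \<sigma> r') = b r \<sigma>"
   by (simp add: matrix_vector_mult_def)
  then show ?thesis
   unfolding split by (simp add: c'_def \<kappa>(1) b_def)
 qed
 have 4: "c' i (case_sum s c) = c i"
  if s: "s \<in> U" and c: "\<And>r. (\<Sum>i\<in>I. \<psi> r i s * c i) = 0" and i: "i \<in> I" for s c i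
 proof (cases "i \<in> range \<kappa>")
  case True
  have T: "case_sum s c \<in> T" using s by (simp add: T_def)
  have "(\<chi> r r'. \<psi> r (\<kappa> r') s) *v (\<chi> r. c (\<kappa> r)) = (\<chi> r. b r (case_sum s c))"
   using c unfolding split
   by (simp add: matrix_vector_mult_def vec_eq_iff b_def eq_neg_iff_add_eq_0)
  then have "(\<chi> r. c (\<kappa> r)) = (\<chi> r. x (case_sum s c) r)"
   using cramer'[OF T, of "\<chi> r. c (\<kappa> r)"] by simp
  then have "c (\<kappa> r) = x (case_sum s c) r" for r by (simp add: vec_eq_iff)
  then show ?thesis using True by (auto simp: c'_def \<kappa>(1))
 qed (simp add: c'_def)
 show ?thesis
 proof (intro exI[of _ c'] conjI ballI allI impI)
  show "c' i \<in> regular_funs W T" if "i \<in> I" for i by (rule 1[OF that])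
  show "c' i = (\<lambda>\<sigma>. \<sigma> (Inr i))" if "i \<in> I - range \<kappa>" for i by (rule 2[OF that])
  show "(\<Sum>i\<in>I. \<psi> r i (\<lambda>v. \<sigma> (Inl v)) * c' i \<sigma>) = 0" if "\<sigma> \<in> T" for \<sigma> r by (rule 3[OF that])
  show "c' i (case_sum s c) = c i"
   if "s \<in> U" "\<forall>r. (\<Sum>i\<in>I. \<psi> r i s * c i) = 0" "i \<in> I" for s c i
   by (rule 4[OF that(1) that(2)[rule_format] that(3)])
 qed
qed

text \<open>With as many parameters as independent equations, the solution pairs are parametrised by
  exactly \<open>card I\<close> quantities; the equation \<open>h s = 0\<close> cuts out a
  hypersurface among them, so the coefficients that occur satisfy a polynomial relation.\<close>

lemma generic_no_solution:
 fixes \<psi> :: "'r::finite => 'i => ('v => complex) => complex"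
 assumes I: "finite I" and V: "finite V" "card V = CARD('r)" and q: "q \<in> polynomial_funs V"
  and \<psi>: "\<And>r i. i \<in> I ==> \<psi> r i \<in> regular_funs V {s. q s ~= 0}"
  and h: "h \<in> polynomial_funs V" "h s0 ~= 0"
 shows "holds_generically I (\<lambda>c. \<not> (\<exists>s. q s ~= 0 \<and> h s = 0 \<and>
  (\<forall>y. (\<forall>i\<in>I. (\<Sum>r\<in>UNIV. y r * \<psi> r i s) = 0) --> (\<forall>r. y r = 0)) \<and>
  (\<forall>r. (\<Sum>i\<in>I. \<psi> r i s * c i) = 0)))"
proof -
 let ?D = "\<lambda>\<kappa> s. det (\<chi> r r'. \<psi> r (\<kappa> r') s)"
 \<comment> \<open>One minor at a time: there are finitely many choices of columns, and one of them
   is nonzero at any point with independent rows.\<close>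
 have *: "holds_generically I (\<lambda>c. \<not> (\<exists>s. q s ~= 0 \<and> h s = 0 \<and> ?D \<kappa> s ~= 0 \<and>
  (\<forall>r. (\<Sum>i\<in>I. \<psi> r i s * c i) = 0)))" if \<kappa>: "range \<kappa> \<subseteq> I" for \<kappa>
 proof (cases "inj \<kappa>")
  case False
  then obtain a b where ab: "a ~= b" "\<kappa> a = \<kappa> b" by (auto simp: inj_def)
  have "?D \<kappa> s = 0" for s
   by (rule det_identical_columns[OF ab(1)]) (simp add: column_def ab(2))
  then show ?thesis by (intro holds_generically_True) auto
 next
  case True
  define U where "U = {s. q s ~= 0 \<and> ?D \<kappa> s ~= 0}"
  have \<psi>': "i \<in> I ==> \<psi> r i \<in> regular_funs V U" for r i
   using \<psi>[of i r] unfolding regular_funs_def U_def by blast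
  have det: "?D \<kappa> s ~= 0" if "s \<in> U" for s using that by (simp add: U_def)
  obtain c' where c': "\<And>i. i \<in> I ==> c' i \<in> regular_funs (Inl ` V \<union> Inr ` (I - range \<kappa>)) {\<sigma>. (\<lambda>v. \<sigma> (Inl v)) \<in> U}"
   "\<And>s c i. s \<in> U ==> (\<forall>r. (\<Sum>i\<in>I. \<psi> r i s * c i) = 0) ==> i \<in> I ==> c' i (case_sum s c) = c i"
   using linear_system_solution[where \<psi> = \<psi> and V = V and U = U, OF I True \<kappa> \<psi>' det] by blast
  let ?W = "Inl ` V \<union> Inr ` (I - range \<kappa>)"
  \<comment> \<open>The minor removes \<open>CARD('r)\<close> coefficients and the parameters put
    the same number back.\<close>
  have cardW: "card ?W = card I"
  proof -
   have "card ?W = card V + card (I - range \<kappa>)"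
    using I V by (subst card_Un_disjoint) (auto simp: card_image)
   also have "card (I - range \<kappa>) = card I - card (range \<kappa>)" using \<kappa> I by (intro card_Diff_subset) (auto intro: finite_subset)
   also have "card (range \<kappa>) = card V" using True V by (simp add: card_image)
   finally show ?thesis using card_mono[OF I \<kappa>] True V by (simp add: card_image)
  qed
  have "\<exists>P\<in>polynomial_funs I. (\<exists>x. P x ~= 0) \<and> (\<forall>\<sigma>\<in>{\<sigma>. (\<lambda>v. \<sigma> (Inl v)) \<in> U}.
    h (\<lambda>v. \<sigma> (Inl v)) = 0 --> P (\<lambda>i. c' i \<sigma>) = 0)"
  proof (rule hypersurface_image[where V = ?W])
   show "(\<lambda>\<sigma>. h (\<lambda>v. \<sigma> (Inl v))) \<in> polynomial_funs ?W"
    using polynomial_funs_compose[where P = h and I = V and J = ?W and g = "\<lambda>v \<sigma>. \<sigma> (Inl v)"] h(1)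
    by (auto intro: polynomial_funs.var)
   show "h (\<lambda>v. case_sum s0 undefined (Inl v)) ~= 0" using h(2) by simp
  qed (use I V c' cardW in auto)
  then obtain P where P: "P \<in> polynomial_funs I" "\<exists>x. P x ~= 0"
   "\<And>\<sigma>. (\<lambda>v. \<sigma> (Inl v)) \<in> U ==> h (\<lambda>v. \<sigma> (Inl v)) = 0 ==> P (\<lambda>i. c' i \<sigma>) = 0" by blast
  have "P c = 0" if "s \<in> U" "h s = 0" "\<forall>r. (\<Sum>i\<in>I. \<psi> r i s * c i) = 0" for c s
  proof -
   have "P c = P (\<lambda>i. c' i (case_sum s c))"
    using c'(2)[OF that(1,3)] by (intro polynomial_funs_cong[OF P(1)]) simp
   also have "\<dots> = 0" using that by (intro P(3)) auto
   finally show ?thesis .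
  qed
  then show ?thesis unfolding holds_generically_def using P(1,2) by (intro bexI[of _ P]) (auto simp: U_def)
 qed
 have fin: "finite {\<kappa>::'r => 'i. range \<kappa> \<subseteq> I}"
  using finite_PiE[of "UNIV :: 'r set" "\<lambda>_. I"] I by (auto simp: PiE_def Pi_def image_subset_iff)
 have "holds_generically I (\<lambda>c. \<forall>\<kappa>\<in>{\<kappa>::'r => 'i. range \<kappa> \<subseteq> I}. \<not> (\<exists>s. q s ~= 0 \<and> h s = 0 \<and> ?D \<kappa> s ~= 0 \<and>
  (\<forall>r. (\<Sum>i\<in>I. \<psi> r i s * c i) = 0)))"
  by (intro holds_generically_ball[OF fin] *) simp
 then show ?thesis
 proof (rule holds_generically_mono, intro notI, elim exE conjE)
  fix c s assume c: "\<forall>\<kappa>\<in>{\<kappa>::'r => 'i. range \<kappa> \<subseteq> I}. \<not> (\<exists>s. q s ~= 0 \<and> h s = 0 \<and> ?D \<kappa> s ~= 0 \<and>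
    (\<forall>r. (\<Sum>i\<in>I. \<psi> r i s * c i) = 0))"
   and s: "q s ~= 0" "h s = 0" "\<forall>r. (\<Sum>i\<in>I. \<psi> r i s * c i) = 0"
   "\<forall>y. (\<forall>i\<in>I. (\<Sum>r\<in>UNIV. y r * \<psi> r i s) = 0) --> (\<forall>r. y r = 0)"
  obtain \<kappa> :: "'r => 'i" where "range \<kappa> \<subseteq> I" "?D \<kappa> s ~= 0"
   using independent_rows_minor[OF I, of "\<lambda>r i. \<psi> r i s"] s(4) by blast
  then show False using c s by blast
 qed
qed

text \<open>A direction \<open>w\<close> in which the equations, with \<open>c\<close> held fixed,
  are stationary is a direction in which the parametrisation of the coefficients is stationary. Such
  points are critical, and their image lies in a hypersurface.\<close>

lemma generic_regular_solution:
 fixes \<psi> :: "'r::finite => 'i => ('v => complex) => complex"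
 assumes I: "finite I" and V: "finite V" "card V = CARD('r)" and q: "q \<in> polynomial_funs V"
  and \<psi>: "\<And>r i. i \<in> I ==> \<psi> r i \<in> regular_funs V {s. q s ~= 0}"
 shows "holds_generically I (\<lambda>c. \<not> (\<exists>s w. q s ~= 0 \<and> (\<exists>v\<in>V. w v ~= 0) \<and>
  (\<forall>y. (\<forall>i\<in>I. (\<Sum>r\<in>UNIV. y r * \<psi> r i s) = 0) --> (\<forall>r. y r = 0)) \<and>
  (\<forall>r. (\<Sum>i\<in>I. \<psi> r i s * c i) = 0) \<and>
  (\<forall>r. ((\<lambda>t. \<Sum>i\<in>I. \<psi> r i (\<lambda>v. s v + t * w v) * c i) has_field_derivative 0) (at 0))))"
proof -
 let ?D = "\<lambda>\<kappa> s. det (\<chi> r r'. \<psi> r (\<kappa> r') s)"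
 let ?bad = "\<lambda>c s w. q s ~= 0 \<and> (\<exists>v\<in>V. w v ~= 0) \<and> (\<forall>r. (\<Sum>i\<in>I. \<psi> r i s * c i) = 0) \<and>
  (\<forall>r. ((\<lambda>t. \<Sum>i\<in>I. \<psi> r i (\<lambda>v. s v + t * w v) * c i) has_field_derivative 0) (at 0))"
 have *: "holds_generically I (\<lambda>c. \<not> (\<exists>s w. ?bad c s w \<and> ?D \<kappa> s ~= 0))" if \<kappa>: "range \<kappa> \<subseteq> I" for \<kappa>
 proof (cases "inj \<kappa>")
  case False
  then obtain a b where ab: "a ~= b" "\<kappa> a = \<kappa> b" by (auto simp: inj_def)
  have "?D \<kappa> s = 0" for s
   by (rule det_identical_columns[OF ab(1)]) (simp add: column_def ab(2))
  then show ?thesis by (intro holds_generically_True) auto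
 next
  case True
  have \<kappa>I: "\<kappa> r \<in> I" for r using \<kappa> by blast
  \<comment> \<open>The numerator \<open>p\<close> stands in for the minor, so that \<open>U\<close>
    is given by nonvanishing polynomials and contains short segments of every line through its
    points.\<close>
  have "?D \<kappa> \<in> regular_funs V {s. q s ~= 0}" by (intro regular_funs_det \<psi> \<kappa>I)
  then obtain p a where pa: "p \<in> polynomial_funs V"
   "\<And>s. q s ~= 0 ==> a s ~= 0" "\<And>s. q s ~= 0 ==> ?D \<kappa> s * a s = p s"
   by (rule regular_funsE) blast
  have nz: "?D \<kappa> s ~= 0 \<longleftrightarrow> p s ~= 0" if "q s ~= 0" for s
   using pa(2,3)[OF that] by (metis mult_eq_0_iff)
  define U where "U = {s. q s ~= 0 \<and> p s ~= 0}"
  have line: "\<forall>\<^sub>F t in nhds 0. (\<lambda>j. s j + t * w j) \<in> U" if "s \<in> U" for s w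
   using that polynomial_funs_eventually_nonzero[OF q, of s w]
    polynomial_funs_eventually_nonzero[OF pa(1), of s w] by (auto simp: U_def eventually_conj_iff)
  have \<psi>': "i \<in> I ==> \<psi> r i \<in> regular_funs V U" for r i
   using \<psi>[of i r] unfolding regular_funs_def U_def by blast
  let ?W = "Inl ` V \<union> Inr ` (I - range \<kappa>)"
  let ?T = "{\<sigma>. (\<lambda>v. \<sigma> (Inl v)) \<in> U}"
  have det: "?D \<kappa> s ~= 0" if "s \<in> U" for s using that nz by (simp add: U_def)
  obtain c' where c': "\<And>i. i \<in> I ==> c' i \<in> regular_funs ?W ?T"
   "\<And>i. i \<in> I - range \<kappa> ==> c' i = (\<lambda>\<sigma>. \<sigma> (Inr i))"
   "\<And>\<sigma> r. \<sigma> \<in> ?T ==> (\<Sum>i\<in>I. \<psi> r i (\<lambda>v. \<sigma> (Inl v)) * c' i \<sigma>) = 0"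
   "\<And>s c i. s \<in> U ==> (\<forall>r. (\<Sum>i\<in>I. \<psi> r i s * c i) = 0) ==> i \<in> I ==> c' i (case_sum s c) = c i"
   using linear_system_solution[where \<psi> = \<psi> and V = V and U = U, OF I True \<kappa> \<psi>' det] by blast
  have cardW: "card I = card ?W"
  proof -
   have "card ?W = card V + card (I - range \<kappa>)"
    using I V by (subst card_Un_disjoint) (auto simp: card_image)
   also have "card (I - range \<kappa>) = card I - card (range \<kappa>)" using \<kappa> I by (intro card_Diff_subset) (auto intro: finite_subset)
   also have "card (range \<kappa>) = card V" using True V by (simp add: card_image)
   finally show ?thesis using card_mono[OF I \<kappa>] True V by (simp add: card_image)
  qed
  have lineT: "\<forall>\<^sub>F t in nhds 0. (\<lambda>j. \<sigma> j + t * \<omega> j) \<in> ?T" if "\<sigma> \<in> ?T" for \<sigma> \<omega>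
   using line[of "\<lambda>v. \<sigma> (Inl v)" "\<lambda>v. \<omega> (Inl v)"] that by simp
  have "\<exists>P\<in>polynomial_funs I. (\<exists>x. P x ~= 0) \<and> (\<forall>\<sigma>\<in>?T. \<forall>\<omega>. (\<exists>j\<in>?W. \<omega> j ~= 0) \<and>
    (\<forall>i\<in>I. ((\<lambda>t. c' i (\<lambda>j. \<sigma> j + t * \<omega> j)) has_field_derivative 0) (at 0)) --> P (\<lambda>i. c' i \<sigma>) = 0)"
   using I V by (intro critical_image[where U = ?T and V = ?W and I = I and c = c'] cardW lineT c'(1)) auto
  then obtain P where P: "P \<in> polynomial_funs I" "\<exists>x. P x ~= 0"
   and P3: "\<forall>\<sigma>\<in>?T. \<forall>\<omega>. (\<exists>j\<in>?W. \<omega> j ~= 0) \<and>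
    (\<forall>i\<in>I. ((\<lambda>t. c' i (\<lambda>j. \<sigma> j + t * \<omega> j)) has_field_derivative 0) (at 0)) --> P (\<lambda>i. c' i \<sigma>) = 0"
   by (elim bexE conjE) (rule that)
  have "P c = 0" if bad: "?bad c s w" and D: "?D \<kappa> s ~= 0" for c s w
  proof -
   have sU: "s \<in> U" using bad D nz by (simp add: U_def)
   define \<sigma> where "\<sigma> = case_sum s c"
   \<comment> \<open>The parameters move along \<open>w\<close> while the free coefficients stay
     fixed.\<close>
   define \<omega> where "\<omega> = case_sum w (\<lambda>_::'i. 0)"
   have \<sigma>T: "\<sigma> \<in> ?T" using sU by (simp add: \<sigma>_def)
   have c\<sigma>: "c' i \<sigma> = c i" if "i \<in> I" for i
    using c'(4)[OF sU _ that] bad unfolding \<sigma>_def by blast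
   have "\<forall>i\<in>I. \<exists>D. ((\<lambda>t. c' i (\<lambda>j. \<sigma> j + t * \<omega> j)) has_field_derivative D) (at 0)"
    using regular_funs_line_differentiable[OF c'(1) \<sigma>T lineT[OF \<sigma>T]] by blast
   from bchoice[OF this] obtain D' where D': "\<And>i. i \<in> I ==>
     ((\<lambda>t. c' i (\<lambda>j. \<sigma> j + t * \<omega> j)) has_field_derivative D' i) (at 0)" by blast
   have out: "D' i = 0" if "i \<in> I - range \<kappa>" for i
   proof -
    have "((\<lambda>t. \<sigma> (Inr i)) has_field_derivative D' i) (at 0)"
     using D'[of i] that by (simp add: c'(2)[OF that] \<omega>_def)
    then show ?thesis using DERIV_unique DERIV_const by blast
   qed
   \<comment> \<open>Differentiating the identity satisfied by \<open>c'\<close> gives the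
     derivative of the rows applied to \<open>c\<close>, which is zero by assumption, plus the rows
     applied to \<open>D'\<close>. As \<open>D'\<close> vanishes off the columns
     \<open>\<kappa>\<close>, the nonzero minor then forces \<open>D' = 0\<close>.\<close>
   have sys: "(\<Sum>i\<in>I. \<psi> r i s * D' i) = 0" for r
   proof -
    have "\<forall>i\<in>I. \<exists>E. ((\<lambda>t. \<psi> r i (\<lambda>j. s j + t * w j)) has_field_derivative E) (at 0)"
     using regular_funs_line_differentiable[OF \<psi>' sU line[OF sU]] by blast
    from bchoice[OF this] obtain E where E: "\<And>i. i \<in> I ==>
      ((\<lambda>t. \<psi> r i (\<lambda>j. s j + t * w j)) has_field_derivative E i) (at 0)" by blast
    have "((\<lambda>t. \<Sum>i\<in>I. \<psi> r i (\<lambda>v. s v + t * w v) * c i) has_field_derivative (\<Sum>i\<in>I. E i * c i)) (at 0)"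
     by (intro DERIV_sum DERIV_cmult_right E)
    moreover have "((\<lambda>t. \<Sum>i\<in>I. \<psi> r i (\<lambda>v. s v + t * w v) * c i) has_field_derivative 0) (at 0)"
     using bad by blast
    ultimately have Ec: "(\<Sum>i\<in>I. E i * c i) = 0" by (rule DERIV_unique)
    have "((\<lambda>t. \<Sum>i\<in>I. \<psi> r i (\<lambda>v. s v + t * w v) * c' i (\<lambda>j. \<sigma> j + t * \<omega> j)) has_field_derivative
      (\<Sum>i\<in>I. E i * c i + D' i * \<psi> r i s)) (at 0)"
    proof (rule DERIV_sum)
     fix i assume i: "i \<in> I"
     show "((\<lambda>t. \<psi> r i (\<lambda>v. s v + t * w v) * c' i (\<lambda>j. \<sigma> j + t * \<omega> j)) has_field_derivative
      E i * c i + D' i * \<psi> r i s) (at 0)"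
      using DERIV_mult[OF E[OF i] D'[OF i]] c\<sigma>[OF i] by simp
    qed
    moreover have ev: "\<forall>\<^sub>F t in nhds 0. (\<Sum>i\<in>I. \<psi> r i (\<lambda>v. s v + t * w v) * c' i (\<lambda>j. \<sigma> j + t * \<omega> j)) = 0"
     using lineT[OF \<sigma>T, of \<omega>]
    proof (rule eventually_mono)
     fix t assume "(\<lambda>j. \<sigma> j + t * \<omega> j) \<in> ?T"
     from c'(3)[OF this, of r] show "(\<Sum>i\<in>I. \<psi> r i (\<lambda>v. s v + t * w v) * c' i (\<lambda>j. \<sigma> j + t * \<omega> j)) = 0"
      by (simp add: \<sigma>_def \<omega>_def)
    qed
    ultimately have "((\<lambda>_. 0) has_field_derivative (\<Sum>i\<in>I. E i * c i + D' i * \<psi> r i s)) (at 0)"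
     by (simp only: DERIV_cong_ev[OF refl ev refl])
    then have "(\<Sum>i\<in>I. E i * c i + D' i * \<psi> r i s) = 0" using DERIV_unique DERIV_const by blast
    then show ?thesis using Ec by (simp add: sum.distrib mult.commute)
   qed
   have "D' i = 0" if "i \<in> I" for i
   proof (cases "i \<in> range \<kappa>")
    case True
    have "(\<Sum>r'\<in>UNIV. \<psi> r (\<kappa> r') s * D' (\<kappa> r')) = 0" for r
    proof -
     have "(\<Sum>i\<in>I. \<psi> r i s * D' i) = (\<Sum>i\<in>range \<kappa>. \<psi> r i s * D' i)"
      using \<kappa> I out by (intro sum.mono_neutral_right) auto
     then show ?thesis using sys[of r] by (simp add: sum.reindex[OF \<open>inj \<kappa>\<close>])
    qed
    then have "(\<chi> r r'. \<psi> r (\<kappa> r') s) *v (\<chi> r. D' (\<kappa> r)) = 0"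
     by (simp add: matrix_vector_mult_def vec_eq_iff)
    then have "(\<chi> r. D' (\<kappa> r)) = 0"
     using D det_nz_iff_inj matrix_left_invertible_ker invertible_det_nz invertible_left_inverse by blast
    then show ?thesis using True by (auto simp: vec_eq_iff)
   qed (use out that in blast)
   then have "\<forall>i\<in>I. ((\<lambda>t. c' i (\<lambda>j. \<sigma> j + t * \<omega> j)) has_field_derivative 0) (at 0)" using D' by metis
   moreover have "\<exists>j\<in>?W. \<omega> j ~= 0"
   proof -
    obtain v where "v \<in> V" "w v ~= 0" using bad by blast
    then show ?thesis by (intro bexI[of _ "Inl v"]) (auto simp: \<omega>_def)
   qed
   ultimately have "P (\<lambda>i. c' i \<sigma>) = 0" by (intro P3[rule_format, OF \<sigma>T] conjI)
   then show ?thesis using polynomial_funs_cong[OF P(1), of "\<lambda>i. c' i \<sigma>" c] c\<sigma> by simp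
  qed
  then show ?thesis unfolding holds_generically_def using P(1,2) by (intro bexI[of _ P]) blast+
 qed
 have fin: "finite {\<kappa>::'r => 'i. range \<kappa> \<subseteq> I}"
  using finite_PiE[of "UNIV :: 'r set" "\<lambda>_. I"] I by (auto simp: PiE_def Pi_def image_subset_iff)
 have "holds_generically I (\<lambda>c. \<forall>\<kappa>\<in>{\<kappa>::'r => 'i. range \<kappa> \<subseteq> I}. \<not> (\<exists>s w. ?bad c s w \<and> ?D \<kappa> s ~= 0))"
  by (intro holds_generically_ball[OF fin] *) simp
 then show ?thesis
 proof (rule holds_generically_mono, intro notI, elim exE)
  fix c s w assume c: "\<forall>\<kappa>\<in>{\<kappa>::'r => 'i. range \<kappa> \<subseteq> I}. \<not> (\<exists>s w. ?bad c s w \<and> ?D \<kappa> s ~= 0)"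
   and s: "q s ~= 0 \<and> (\<exists>v\<in>V. w v ~= 0) \<and>
    (\<forall>y. (\<forall>i\<in>I. (\<Sum>r\<in>UNIV. y r * \<psi> r i s) = 0) --> (\<forall>r. y r = 0)) \<and>
    (\<forall>r. (\<Sum>i\<in>I. \<psi> r i s * c i) = 0) \<and>
    (\<forall>r. ((\<lambda>t. \<Sum>i\<in>I. \<psi> r i (\<lambda>v. s v + t * w v) * c i) has_field_derivative 0) (at 0))"
  obtain \<kappa> :: "'r => 'i" where "range \<kappa> \<subseteq> I" "?D \<kappa> s ~= 0"
   using independent_rows_minor[OF I, of "\<lambda>r i. \<psi> r i s"] s by blast
  then show False using c s by blast
 qed
qed

declare One_nat_def [simp del]

section \<open>Generic pairs of Laurent polynomials\<close>

abbreviation (input) coefl :: "('a + 'b => 'c) => 'a => 'c" where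
 "coefl c == \<lambda>e. c (Inl e)"

abbreviation (input) coefr :: "('a + 'b => 'c) => 'b => 'c" where
 "coefr c == \<lambda>e. c (Inr e)"

text \<open>Over a fixed point of the plane this is the coefficient of \<open>z powi k\<close>; it
  is linear in \<open>c\<close>, as the row systems require.\<close>

definition coef :: "exponent set => (exponent => 'a::field) => int => 'a => 'a => 'a" where
 "coef A c k x y = (\<Sum>(i, j, l)\<in>{e \<in> A. snd (snd e) = k}. c (i, j, l) * x powi i * y powi j)"

lemma finite_last_coords: "finite A ==> finite (last_coords A)"
 by (simp add: last_coords_def)

lemma last_coords_snd: "last_coords A = (\<lambda>e. snd (snd e)) ` A"
 unfolding last_coords_def by (intro image_cong) auto

lemma sum_by_last_coord:
 assumes "finite A"
 shows "(\<Sum>k\<in>last_coords A. f k * coef A c k x y) = (\<Sum>(i, j, k)\<in>A. f k * x powi i * y powi j * c (i, j, k))"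
proof -
 have "(\<Sum>(i, j, k)\<in>A. f k * x powi i * y powi j * c (i, j, k)) =
   (\<Sum>k\<in>last_coords A. \<Sum>e\<in>{e \<in> A. snd (snd e) = k}. (case e of (i, j, k) => f k * x powi i * y powi j * c (i, j, k)))"
  by (rule sum.group[symmetric]) (auto simp: assms finite_last_coords last_coords_snd)
 also have "\<dots> = (\<Sum>k\<in>last_coords A. f k * coef A c k x y)"
  unfolding coef_def sum_distrib_left by (intro sum.cong refl) (auto simp: mult_ac)
 finally show ?thesis by simp
qed

lemma laurent_coef:
 assumes "finite A"
 shows "laurent A c (x, y, z) = (\<Sum>k\<in>last_coords A. coef A c k x y * z powi k)"
 using sum_by_last_coord[OF assms, of "\<lambda>k. z powi k" c x y]
 by (simp add: laurent_def mult_ac)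

text \<open>The derivative in the direction
  \<open>(x * \<alpha>, y * \<beta>, z * \<gamma>)\<close>, that is, along the torus action.
  Monomials are eigenvectors, so no exponent is lowered.\<close>

definition logder :: "exponent set => (exponent => 'a::field) => 'a \<times> 'a \<times> 'a => 'a \<times> 'a \<times> 'a => 'a" where
 "logder A c = (\<lambda>(x, y, z) (\<alpha>, \<beta>, \<gamma>). \<Sum>(i, j, k)\<in>A. c (i, j, k) * x powi i * y powi j * z powi k *
   (of_int i * \<alpha> + of_int j * \<beta> + of_int k * \<gamma>))"

lemma has_field_derivative_powi_log:
 fixes x :: "'a::real_normed_field"
 assumes "x ~= 0"
 shows "((\<lambda>t. (x + t * (x * \<alpha>)) powi i) has_field_derivative x powi i * (of_int i * \<alpha>)) (at 0)"
proof -
 have "((\<lambda>t. x + t * (x * \<alpha>)) has_field_derivative x * \<alpha>) (at 0)"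
  by (auto intro!: derivative_eq_intros)
 from DERIV_power_int[OF this, of i] assms
 have "((\<lambda>t. (x + t * (x * \<alpha>)) powi i) has_field_derivative of_int i * x powi (i - 1) * (x * \<alpha>)) (at 0)"
  by simp
 moreover have "of_int i * x powi (i - 1) * (x * \<alpha>) = x powi i * (of_int i * \<alpha>)"
  using power_int_add_1[of x "i - 1"] assms by (simp add: mult_ac)
 ultimately show ?thesis by metis
qed

lemma laurent_line_deriv:
 fixes x :: "'a::real_normed_field"
 assumes "x ~= 0" "y ~= 0" "z ~= 0"
 shows "((\<lambda>t. laurent A c (x + t * (x * \<alpha>), y + t * (y * \<beta>), z + t * (z * \<gamma>))) has_field_derivative
   logder A c (x, y, z) (\<alpha>, \<beta>, \<gamma>)) (at 0)"
 unfolding laurent_def logder_def prod.case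
proof (rule DERIV_sum, clarify)
 fix i j k
 let ?X = "\<lambda>t. (x + t * (x * \<alpha>)) powi i" and ?Y = "\<lambda>t. (y + t * (y * \<beta>)) powi j"
  and ?Z = "\<lambda>t. (z + t * (z * \<gamma>)) powi k"
 have "((\<lambda>t. c (i, j, k) * (?X t * ?Y t * ?Z t)) has_field_derivative
   c (i, j, k) * ((x powi i * (of_int i * \<alpha>) * ?Y 0 + y powi j * (of_int j * \<beta>) * ?X 0) * ?Z 0 +
    z powi k * (of_int k * \<gamma>) * (?X 0 * ?Y 0))) (at 0)"
  by (intro DERIV_cmult DERIV_mult has_field_derivative_powi_log assms)
 moreover have "(\<lambda>t. c (i, j, k) * (?X t * ?Y t * ?Z t)) = (\<lambda>t. c (i, j, k) * ?X t * ?Y t * ?Z t)"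
  by (simp add: mult.assoc)
 moreover have "c (i, j, k) * ((x powi i * (of_int i * \<alpha>) * ?Y 0 + y powi j * (of_int j * \<beta>) * ?X 0) * ?Z 0 +
    z powi k * (of_int k * \<gamma>) * (?X 0 * ?Y 0)) =
   c (i, j, k) * x powi i * y powi j * z powi k * (of_int i * \<alpha> + of_int j * \<beta> + of_int k * \<gamma>)"
  by (simp add: algebra_simps)
 ultimately show "((\<lambda>t. c (i, j, k) * ?X t * ?Y t * ?Z t) has_field_derivative
   c (i, j, k) * x powi i * y powi j * z powi k * (of_int i * \<alpha> + of_int j * \<beta> + of_int k * \<gamma>)) (at 0)"
  by (simp only:)
qed

section \<open>Equations whose weights depend on the last exponent only\<close>

definition indep_rows :: "('r::finite => int => 'a::field) => int set => bool" where
 "indep_rows R B \<longleftrightarrow> (\<forall>y. (\<forall>k\<in>B. (\<Sum>r\<in>UNIV. y r * R r k) = 0) --> (\<forall>r. y r = 0))"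

context
 fixes A1 A2 :: "exponent set" and q :: "(nat => complex) => complex"
  and R1 :: "'r::finite => (nat => complex) => int => complex"
  and R2 :: "'s::finite => (nat => complex) => int => complex" and V :: "nat set"
 assumes A: "finite A1" "finite A2" and V: "finite V" "card V = CARD('r) + CARD('s)" "0 \<in> V" "1 \<in> V"
  and q: "q \<in> polynomial_funs V" "\<And>s. q s ~= 0 ==> s 0 ~= 0 \<and> s 1 ~= 0"
  and R1: "\<And>r k. (\<lambda>s. R1 r s k) \<in> regular_funs V {s. q s ~= 0}"
  and R2: "\<And>r k. (\<lambda>s. R2 r s k) \<in> regular_funs V {s. q s ~= 0}"
begin

definition system_row :: "'r + 's => exponent + exponent => (nat => complex) => complex" where
 "system_row u e = (case (u, e) of
   (Inl r, Inl (i, j, k)) => (\<lambda>s. R1 r s k * s 0 powi i * s 1 powi j)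
  | (Inr r, Inr (i, j, k)) => (\<lambda>s. R2 r s k * s 0 powi i * s 1 powi j)
  | _ => (\<lambda>s. 0))"

lemma system_row_regular: "system_row u e \<in> regular_funs V {s. q s ~= 0}"
proof -
 have p: "(\<lambda>s. s 0 powi i) \<in> regular_funs V {s. q s ~= 0}" "(\<lambda>s. s 1 powi i) \<in> regular_funs V {s. q s ~= 0}" for i
  using V q(2) by (auto intro!: regular_funs_power_int regular_funs_var)
 show ?thesis unfolding system_row_def
  by (auto split: sum.split prod.split intro!: regular_funs_mult p R1 R2 regular_funs_const)
qed

lemma system_row_sum:
 "(\<Sum>e\<in>A1 <+> A2. system_row (Inl r) e s * c e) =
   (\<Sum>k\<in>last_coords A1. R1 r s k * coef A1 (coefl c) k (s 0) (s 1))"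
 "(\<Sum>e\<in>A1 <+> A2. system_row (Inr r') e s * c e) =
   (\<Sum>k\<in>last_coords A2. R2 r' s k * coef A2 (coefr c) k (s 0) (s 1))"
 using A by (simp_all add: sum.Plus sum_by_last_coord system_row_def case_prod_unfold)

text \<open>Each entry is \<open>R1 r s k\<close> or \<open>R2 r s k\<close> times the unit
  \<open>s 0 powi i * s 1 powi j\<close>, and the two polynomials use disjoint coefficients.
  Independence can therefore be tested on last exponents, separately for each polynomial.\<close>

lemma system_row_indep:
 assumes "q s ~= 0" "indep_rows (\<lambda>r. R1 r s) (last_coords A1)" "indep_rows (\<lambda>r. R2 r s) (last_coords A2)"
  and y: "\<forall>e\<in>A1 <+> A2. (\<Sum>u\<in>UNIV. y u * system_row u e s) = 0"
 shows "y u = 0"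
proof -
 have s: "s 0 ~= 0" "s 1 ~= 0" using q(2)[OF assms(1)] by auto
 have split: "(\<Sum>u\<in>UNIV. f u) = (\<Sum>r\<in>UNIV. f (Inl r)) + (\<Sum>r\<in>UNIV. f (Inr r))" for f :: "'r + 's => complex"
  unfolding UNIV_Plus_UNIV[symmetric] by (subst sum.Plus) auto
 have "(\<Sum>r\<in>UNIV. y (Inl r) * R1 r s k) = 0" if k: "k \<in> last_coords A1" for k
 proof -
  obtain i j where ij: "(i, j, k) \<in> A1" using k by (auto simp: last_coords_def)
  then have "(\<Sum>u\<in>UNIV. y u * system_row u (Inl (i, j, k)) s) = 0" using y by blast
  then have "0 = (\<Sum>r\<in>UNIV. y (Inl r) * (R1 r s k * s 0 powi i * s 1 powi j))"
   unfolding split by (simp add: system_row_def)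
  also have "\<dots> = (\<Sum>r\<in>UNIV. y (Inl r) * R1 r s k) * (s 0 powi i * s 1 powi j)"
   unfolding sum_distrib_right by (intro sum.cong refl) (simp only: mult_ac)
  finally show ?thesis using s by simp
 qed
 then have 1: "y (Inl r) = 0" for r
  using assms(2)[unfolded indep_rows_def, rule_format, of "\<lambda>r. y (Inl r)"] by blast
 have "(\<Sum>r\<in>UNIV. y (Inr r) * R2 r s k) = 0" if k: "k \<in> last_coords A2" for k
 proof -
  obtain i j where ij: "(i, j, k) \<in> A2" using k by (auto simp: last_coords_def)
  then have "(\<Sum>u\<in>UNIV. y u * system_row u (Inr (i, j, k)) s) = 0" using y by blast
  then have "0 = (\<Sum>r\<in>UNIV. y (Inr r) * (R2 r s k * s 0 powi i * s 1 powi j))"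
   unfolding split by (simp add: system_row_def)
  also have "\<dots> = (\<Sum>r\<in>UNIV. y (Inr r) * R2 r s k) * (s 0 powi i * s 1 powi j)"
   unfolding sum_distrib_right by (intro sum.cong refl) (simp only: mult_ac)
  finally show ?thesis using s by simp
 qed
 then have 2: "y (Inr r) = 0" for r
  using assms(3)[unfolded indep_rows_def, rule_format, of "\<lambda>r. y (Inr r)"] by blast
 show ?thesis using 1 2 by (cases u) auto
qed

lemma generic_rows_no_solution:
 assumes h: "h \<in> polynomial_funs V" "h s0 ~= 0"
 shows "holds_generically (A1 <+> A2) (\<lambda>c. \<forall>s. q s ~= 0 --> h s = 0 -->
  indep_rows (\<lambda>r. R1 r s) (last_coords A1) --> indep_rows (\<lambda>r. R2 r s) (last_coords A2) -->
  (\<forall>r. (\<Sum>k\<in>last_coords A1. R1 r s k * coef A1 (coefl c) k (s 0) (s 1)) = 0) -->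
  (\<forall>r. (\<Sum>k\<in>last_coords A2. R2 r s k * coef A2 (coefr c) k (s 0) (s 1)) = 0) --> False)"
proof -
 have "holds_generically (A1 <+> A2) (\<lambda>c. \<not> (\<exists>s. q s ~= 0 \<and> h s = 0 \<and>
  (\<forall>y. (\<forall>i\<in>A1 <+> A2. (\<Sum>r\<in>UNIV. y r * system_row r i s) = 0) --> (\<forall>r. y r = 0)) \<and>
  (\<forall>r. (\<Sum>i\<in>A1 <+> A2. system_row r i s * c i) = 0)))"
  by (rule generic_no_solution[OF _ V(1) _ q(1) system_row_regular h]) (use A V in auto)
 then show ?thesis
 proof (rule holds_generically_mono, intro allI impI)
  fix c s
  assume no: "\<not> (\<exists>s. q s ~= 0 \<and> h s = 0 \<and>
   (\<forall>y. (\<forall>i\<in>A1 <+> A2. (\<Sum>r\<in>UNIV. y r * system_row r i s) = 0) --> (\<forall>r. y r = 0)) \<and>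
   (\<forall>r. (\<Sum>i\<in>A1 <+> A2. system_row r i s * c i) = 0))"
   and s: "q s ~= 0" "h s = 0" "indep_rows (\<lambda>r. R1 r s) (last_coords A1)" "indep_rows (\<lambda>r. R2 r s) (last_coords A2)"
   and z: "\<forall>r. (\<Sum>k\<in>last_coords A1. R1 r s k * coef A1 (coefl c) k (s 0) (s 1)) = 0"
    "\<forall>r. (\<Sum>k\<in>last_coords A2. R2 r s k * coef A2 (coefr c) k (s 0) (s 1)) = 0"
  have "(\<Sum>i\<in>A1 <+> A2. system_row r i s * c i) = 0" for r
   by (cases r) (simp_all add: system_row_sum z)
  moreover have "(\<forall>y. (\<forall>i\<in>A1 <+> A2. (\<Sum>r\<in>UNIV. y r * system_row r i s) = 0) --> (\<forall>r. y r = 0))"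
   using system_row_indep[OF s(1,3,4)] by simp
  ultimately show False using no s(1,2) by blast
 qed
qed

lemma generic_rows_regular:
 "holds_generically (A1 <+> A2) (\<lambda>c. \<forall>s w. q s ~= 0 --> (\<exists>v\<in>V. w v ~= 0) -->
  indep_rows (\<lambda>r. R1 r s) (last_coords A1) --> indep_rows (\<lambda>r. R2 r s) (last_coords A2) -->
  (\<forall>r. (\<Sum>k\<in>last_coords A1. R1 r s k * coef A1 (coefl c) k (s 0) (s 1)) = 0) -->
  (\<forall>r. (\<Sum>k\<in>last_coords A2. R2 r s k * coef A2 (coefr c) k (s 0) (s 1)) = 0) -->
  (\<forall>r. ((\<lambda>t. \<Sum>k\<in>last_coords A1. R1 r (\<lambda>v. s v + t * w v) k *
    coef A1 (coefl c) k (s 0 + t * w 0) (s 1 + t * w 1)) has_field_derivative 0) (at 0)) -->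
  (\<forall>r. ((\<lambda>t. \<Sum>k\<in>last_coords A2. R2 r (\<lambda>v. s v + t * w v) k *
    coef A2 (coefr c) k (s 0 + t * w 0) (s 1 + t * w 1)) has_field_derivative 0) (at 0)) --> False)"
proof -
 have "holds_generically (A1 <+> A2) (\<lambda>c. \<not> (\<exists>s w. q s ~= 0 \<and> (\<exists>v\<in>V. w v ~= 0) \<and>
  (\<forall>y. (\<forall>i\<in>A1 <+> A2. (\<Sum>r\<in>UNIV. y r * system_row r i s) = 0) --> (\<forall>r. y r = 0)) \<and>
  (\<forall>r. (\<Sum>i\<in>A1 <+> A2. system_row r i s * c i) = 0) \<and>
  (\<forall>r. ((\<lambda>t. \<Sum>i\<in>A1 <+> A2. system_row r i (\<lambda>v. s v + t * w v) * c i) has_field_derivative 0) (at 0))))"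
  by (rule generic_regular_solution[OF _ V(1) _ q(1) system_row_regular]) (use A V in auto)
 then show ?thesis
 proof (rule holds_generically_mono, intro allI impI)
  fix c s w
  assume no: "\<not> (\<exists>s w. q s ~= 0 \<and> (\<exists>v\<in>V. w v ~= 0) \<and>
   (\<forall>y. (\<forall>i\<in>A1 <+> A2. (\<Sum>r\<in>UNIV. y r * system_row r i s) = 0) --> (\<forall>r. y r = 0)) \<and>
   (\<forall>r. (\<Sum>i\<in>A1 <+> A2. system_row r i s * c i) = 0) \<and>
   (\<forall>r. ((\<lambda>t. \<Sum>i\<in>A1 <+> A2. system_row r i (\<lambda>v. s v + t * w v) * c i) has_field_derivative 0) (at 0)))"
   and s: "q s ~= 0" "\<exists>v\<in>V. w v ~= 0"
    "indep_rows (\<lambda>r. R1 r s) (last_coords A1)" "indep_rows (\<lambda>r. R2 r s) (last_coords A2)"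
   and z: "\<forall>r. (\<Sum>k\<in>last_coords A1. R1 r s k * coef A1 (coefl c) k (s 0) (s 1)) = 0"
    "\<forall>r. (\<Sum>k\<in>last_coords A2. R2 r s k * coef A2 (coefr c) k (s 0) (s 1)) = 0"
   and d: "\<forall>r. ((\<lambda>t. \<Sum>k\<in>last_coords A1. R1 r (\<lambda>v. s v + t * w v) k *
     coef A1 (coefl c) k (s 0 + t * w 0) (s 1 + t * w 1)) has_field_derivative 0) (at 0)"
    "\<forall>r. ((\<lambda>t. \<Sum>k\<in>last_coords A2. R2 r (\<lambda>v. s v + t * w v) k *
     coef A2 (coefr c) k (s 0 + t * w 0) (s 1 + t * w 1)) has_field_derivative 0) (at 0)"
  have "(\<Sum>i\<in>A1 <+> A2. system_row r i s * c i) = 0" for r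
   by (cases r) (simp_all add: system_row_sum z)
  moreover have "(\<forall>y. (\<forall>i\<in>A1 <+> A2. (\<Sum>r\<in>UNIV. y r * system_row r i s) = 0) --> (\<forall>r. y r = 0))"
   using system_row_indep[OF s(1,3,4)] by simp
  moreover have "((\<lambda>t. \<Sum>i\<in>A1 <+> A2. system_row r i (\<lambda>v. s v + t * w v) * c i) has_field_derivative 0) (at 0)" for r
   by (cases r) (simp_all add: system_row_sum d)
  ultimately show False using no s(1,2) by blast
 qed
qed

end

lemma indep_rows_1:
 fixes f :: "int => 'a::field"
 assumes "k \<in> B" "f k ~= 0"
 shows "indep_rows (\<lambda>(r::1) k. f k) B"
 unfolding indep_rows_def using assms by auto

lemma indep_rows_2:
 fixes f g :: "int => 'a::field"
 assumes "\<And>a b. (\<And>k. k \<in> B ==> a * f k + b * g k = 0) ==> a = 0 \<and> b = 0"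
 shows "indep_rows (\<lambda>(r::2) k. if r = 1 then f k else g k) B"
 unfolding indep_rows_def
proof (intro allI impI)
 fix y :: "2 => 'a" and r
 assume "\<forall>k\<in>B. (\<Sum>r\<in>UNIV. y r * (if r = 1 then f k else g k)) = 0"
 then have "y 1 = 0 \<and> y 2 = 0" by (intro assms) (auto simp: sum_2)
 then have "\<forall>r. y r = 0" by (simp add: forall_2)
 then show "y r = 0" by simp
qed

lemma indep_rows_3:
 fixes f g h :: "int => 'a::field"
 assumes "\<And>a b d. (\<And>k. k \<in> B ==> a * f k + b * g k + d * h k = 0) ==> a = 0 \<and> b = 0 \<and> d = 0"
 shows "indep_rows (\<lambda>(r::3) k. if r = 1 then f k else if r = 2 then g k else h k) B"
 unfolding indep_rows_def
proof (intro allI impI)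
 fix y :: "3 => 'a" and r
 assume "\<forall>k\<in>B. (\<Sum>r\<in>UNIV. y r * (if r = 1 then f k else if r = 2 then g k else h k)) = 0"
 then have "y 1 = 0 \<and> y 2 = 0 \<and> y 3 = 0" by (intro assms) (auto simp: sum_3)
 then have "\<forall>r. y r = 0" by (simp add: forall_3)
 then show "y r = 0" by simp
qed

lemma regular_funs_if:
 "(b ==> f \<in> regular_funs V U) ==> (\<not> b ==> g \<in> regular_funs V U) ==>
   (\<lambda>s. if b then f s else g s) \<in> regular_funs V U"
 by (cases b) auto

lemma regular_funs_coordinate_power:
 "v < n ==> (\<lambda>s. s v powi k) \<in> regular_funs {..<n} {s. (\<Prod>v<n. s v) ~= (0 :: 'a::field)}"
 for n :: nat
 by (intro regular_funs_power_int regular_funs_var) (auto simp: prod_zero_iff)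

lemma regular_funs_coordinate_power_scaled:
 "v < n ==> (\<lambda>s. (\<tau> * s v) powi k) \<in> regular_funs {..<n} {s. (\<Prod>v<n. s v) ~= (0 :: 'a::field)}"
 for n :: nat
 unfolding power_int_mult_distrib
 by (intro regular_funs_mult regular_funs_const regular_funs_coordinate_power)

lemmas regular_funs_row_intros =
 regular_funs_if regular_funs_coordinate_power regular_funs_coordinate_power_scaled regular_funs_const

text \<open>The coordinates \<open>s 0\<close> and \<open>s 1\<close> are the point of the plane and
  the others are roots, all nonzero. There must be exactly as many coordinates as rows; the excess
  condition enters through \<open>h\<close>.\<close>

lemma rows_no_solution:
 fixes R1 :: "'r::finite => (nat => complex) => int => complex"
  and R2 :: "'s::finite => (nat => complex) => int => complex"
 assumes A: "finite A1" "finite A2" and n: "n = CARD('r) + CARD('s)"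
  and R1: "\<And>r k. (\<lambda>s. R1 r s k) \<in> regular_funs {..<n} {s. (\<Prod>v<n. s v) ~= 0}"
  and R2: "\<And>r k. (\<lambda>s. R2 r s k) \<in> regular_funs {..<n} {s. (\<Prod>v<n. s v) ~= 0}"
  and h: "h \<in> polynomial_funs {..<n}" "h s0 ~= 0"
 shows "holds_generically (A1 <+> A2) (\<lambda>c. \<forall>s. (\<forall>v<n. s v ~= 0) --> h s = 0 -->
  indep_rows (\<lambda>r. R1 r s) (last_coords A1) --> indep_rows (\<lambda>r. R2 r s) (last_coords A2) -->
  (\<forall>r. (\<Sum>k\<in>last_coords A1. R1 r s k * coef A1 (coefl c) k (s 0) (s 1)) = 0) -->
  (\<forall>r. (\<Sum>k\<in>last_coords A2. R2 r s k * coef A2 (coefr c) k (s 0) (s 1)) = 0) --> False)"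
proof -
 have pos: "0 < CARD('r)" "0 < CARD('s)" by (simp_all add: zero_less_card_finite)
 have "(\<Prod>v<n. s v) ~= 0 \<longleftrightarrow> (\<forall>v<n. s v ~= 0)" for s :: "nat => complex" by auto
 moreover have "(\<lambda>s. \<Prod>v<n. s v) \<in> polynomial_funs {..<n}"
  by (intro polynomial_funs_prod polynomial_funs.var)
 ultimately show ?thesis
  using generic_rows_no_solution[OF A, of "{..<n}" "\<lambda>s. \<Prod>v<n. s v" R1 R2 h s0] n pos R1 R2 h by auto
qed

lemma rows_regular:
 fixes R1 :: "'r::finite => (nat => complex) => int => complex"
  and R2 :: "'s::finite => (nat => complex) => int => complex"
 assumes A: "finite A1" "finite A2" and n: "n = CARD('r) + CARD('s)"
  and R1: "\<And>r k. (\<lambda>s. R1 r s k) \<in> regular_funs {..<n} {s. (\<Prod>v<n. s v) ~= 0}"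
  and R2: "\<And>r k. (\<lambda>s. R2 r s k) \<in> regular_funs {..<n} {s. (\<Prod>v<n. s v) ~= 0}"
 shows "holds_generically (A1 <+> A2) (\<lambda>c. \<forall>s w. (\<forall>v<n. s v ~= 0) --> (\<exists>v<n. w v ~= 0) -->
  indep_rows (\<lambda>r. R1 r s) (last_coords A1) --> indep_rows (\<lambda>r. R2 r s) (last_coords A2) -->
  (\<forall>r. (\<Sum>k\<in>last_coords A1. R1 r s k * coef A1 (coefl c) k (s 0) (s 1)) = 0) -->
  (\<forall>r. (\<Sum>k\<in>last_coords A2. R2 r s k * coef A2 (coefr c) k (s 0) (s 1)) = 0) -->
  (\<forall>r. ((\<lambda>t. \<Sum>k\<in>last_coords A1. R1 r (\<lambda>v. s v + t * w v) k *
    coef A1 (coefl c) k (s 0 + t * w 0) (s 1 + t * w 1)) has_field_derivative 0) (at 0)) -->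
  (\<forall>r. ((\<lambda>t. \<Sum>k\<in>last_coords A2. R2 r (\<lambda>v. s v + t * w v) k *
    coef A2 (coefr c) k (s 0 + t * w 0) (s 1 + t * w 1)) has_field_derivative 0) (at 0)) --> False)"
proof -
 have pos: "0 < CARD('r)" "0 < CARD('s)" by (simp_all add: zero_less_card_finite)
 have eq: "(\<Prod>v<n. s v) ~= 0 \<longleftrightarrow> (\<forall>v<n. s v ~= 0)" for s :: "nat => complex" by auto
 have "(\<lambda>s. \<Prod>v<n. s v) \<in> polynomial_funs {..<n}"
  by (intro polynomial_funs_prod polynomial_funs.var)
 then show ?thesis
  using generic_rows_regular[where q = "\<lambda>s. \<Prod>v<n. s v" and V = "{..<n}" and ?R1.0 = R1 and ?R2.0 = R2, OF A _ _ _ _ _ _ R1 R2]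
   n pos unfolding eq by (auto simp: Bex_def)
qed

lemma sum_eval_row:
 "finite A ==> (\<Sum>k\<in>last_coords A. z powi k * coef A c k x y) = laurent A c (x, y, z)"
 by (simp add: laurent_coef mult.commute)

lemma sum_deriv_row:
 "finite A ==> (\<Sum>k\<in>last_coords A. (of_int k * z powi k) * coef A c k x y) = logder A c (x, y, z) (0, 0, 1)"
 by (subst sum_by_last_coord) (simp_all add: logder_def mult_ac)

lemma sum_unit_row:
 "finite A ==> k \<in> last_coords A ==>
   (\<Sum>l\<in>last_coords A. (if l = k then 1 else 0) * coef A c l x y) = coef A c k x y"
 by (simp add: if_distrib[of "\<lambda>x. x * _"] finite_last_coords cong: if_cong)

lemma sum_coordinate_derivs:
 fixes s :: "nat => complex"
 assumes "finite A" "s 0 ~= 0" "s 1 ~= 0" "\<tau> * s v ~= 0" "w 0 = s 0 * \<alpha>" "w 1 = s 1 * \<beta>" "w v = s v * \<gamma>"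
 shows "((\<lambda>t. \<Sum>k\<in>last_coords A. (\<tau> * (s v + t * w v)) powi k * coef A c k (s 0 + t * w 0) (s 1 + t * w 1))
   has_field_derivative logder A c (s 0, s 1, \<tau> * s v) (\<alpha>, \<beta>, \<gamma>)) (at 0)"
 using laurent_line_deriv[OF assms(2-4), of A c \<alpha> \<beta> \<gamma>]
 by (simp add: sum_eval_row[OF assms(1)] assms(5-7) algebra_simps)

definition indep2 :: "(int => 'a::field) => (int => 'a) => int set => bool" where
 "indep2 f g B \<longleftrightarrow> (\<forall>a b. (\<forall>k\<in>B. a * f k + b * g k = 0) --> a = 0 \<and> b = 0)"

lemma indep2_rows: "indep2 f g B ==> indep_rows (\<lambda>(r::2) k. if r = 1 then f k else g k) B"
 unfolding indep2_def by (rule indep_rows_2) blast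

text \<open>For nonzero \<open>z\<close> and \<tau> this holds exactly when the evaluation rows at
  \<open>z\<close> and \<open>\<tau> * z\<close> are proportional on \<open>B\<close>. If
  \<open>B\<close> has two elements, it makes a nonzero \<tau> a root of unity whose order divides
  all differences in \<open>B\<close>.\<close>

definition ratio_const :: "'a::field => int set => bool" where
 "ratio_const \<tau> B \<longleftrightarrow> (\<exists>\<kappa>. \<forall>k\<in>B. \<tau> powi k = \<kappa>)"

lemma eval_rows_indep:
 fixes z :: "'a::field"
 assumes "z ~= 0" "\<not> ratio_const \<tau> B"
 shows "indep2 (\<lambda>k. z powi k) (\<lambda>k. (\<tau> * z) powi k) B"
 unfolding indep2_def
proof (intro allI impI)
 fix a b assume ab: "\<forall>k\<in>B. a * z powi k + b * (\<tau> * z) powi k = 0"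
 have *: "a + b * \<tau> powi k = 0" if "k \<in> B" for k
 proof -
  have "z powi k * (a + b * \<tau> powi k) = 0"
   using ab[rule_format, OF that] by (simp add: power_int_mult_distrib algebra_simps)
  then show ?thesis using assms(1) by simp
 qed
 have "b = 0"
 proof (rule ccontr)
  assume "b ~= 0"
  then have "\<tau> powi k = - a / b" if "k \<in> B" for k
   using *[OF that] \<open>b ~= 0\<close> by (simp add: field_simps add_eq_0_iff)
  then show False using assms(2) by (auto simp: ratio_const_def)
 qed
 moreover obtain k where "k \<in> B" using assms(2) by (force simp: ratio_const_def)
 ultimately show "a = 0 \<and> b = 0" using * by auto
qed

lemma two_elements:
 assumes "card B \<ge> 2"
 obtains k l :: "'a::linorder" where "k \<in> B" "l \<in> B" "k < l"
proof -
 from assms obtain C where C: "C \<subseteq> B" "card C = 2" by (meson obtain_subset_with_card_n)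
 then obtain k l where "C = {k, l}" "k ~= l" by (auto simp: card_2_iff)
 then show ?thesis using C(1) that by (cases "k < l") (auto simp: not_less_iff_gr_or_eq)
qed

text \<open>After cancelling \<open>z powi k\<close>, a relation says that the affine function
  \<open>a + b * k\<close> has two different zeros.\<close>

lemma deriv_rows_indep:
 fixes z :: "'a::field_char_0"
 assumes "z ~= 0" "card B \<ge> 2"
 shows "indep2 (\<lambda>k. z powi k) (\<lambda>k. of_int k * z powi k) B"
 unfolding indep2_def
proof (intro allI impI)
 fix a b assume ab: "\<forall>k\<in>B. a * z powi k + b * (of_int k * z powi k) = 0"
 have *: "a + b * of_int k = 0" if "k \<in> B" for k
 proof -
  have "z powi k * (a + b * of_int k) = 0" using ab[rule_format, OF that] by (simp add: algebra_simps)
  then show ?thesis using assms(1) by simp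
 qed
 obtain k l where kl: "k \<in> B" "l \<in> B" "k < l" using two_elements[OF assms(2)] .
 have "b * of_int k = b * of_int l" using *[OF kl(1)] *[OF kl(2)] by (metis add_left_cancel)
 then have "b = 0" using kl(3) by simp
 then show "a = 0 \<and> b = 0" using *[OF kl(1)] by simp
qed

lemma unit_rows_indep:
 fixes f :: "int => 'a::field"
 assumes "k \<in> B" "l \<in> B" "l ~= k" "f l ~= 0"
 shows "indep2 (\<lambda>m. if m = k then 1 else 0) f B"
 unfolding indep2_def
proof (intro allI impI)
 fix a b assume ab: "\<forall>m\<in>B. a * (if m = k then 1 else 0) + b * f m = 0"
 from bspec[OF this assms(2)] assms(3,4) have "b = 0" by simp
 with bspec[OF ab assms(1)] show "a = 0 \<and> b = 0" by simp
qed

lemma unit_eval_rows_indep: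
 fixes z :: "'a::field"
 assumes "z ~= 0" "card B \<ge> 2" "k \<in> B"
 shows "indep2 (\<lambda>m. if m = k then 1 else 0) (\<lambda>m. z powi m) B"
proof -
 obtain m n where mn: "m \<in> B" "n \<in> B" "m < n" using two_elements[OF assms(2)] .
 obtain l where "l \<in> B" "l ~= k" using mn by (cases "m = k") auto
 then show ?thesis using assms by (intro unit_rows_indep) auto
qed

text \<open>Coordinates beyond the third are 1: nonzero, and equal to the value at which a dummy
  coordinate is pinned.\<close>

definition point3 :: "'a::one => 'a => 'a => nat => 'a" where
 "point3 x y z v = (if v = 0 then x else if v = 1 then y else if v = 2 then z else 1)"

lemma point3_simps: "point3 x y z 0 = x" "point3 x y z 1 = y" "point3 x y z 2 = z" "point3 x y z 3 = 1"
 by (simp_all add: point3_def)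

lemma point3_nonzero: "x ~= 0 ==> y ~= 0 ==> z ~= 0 ==> point3 x y z v ~= (0::'a::field)"
 by (simp add: point3_def)

section \<open>Four equations in three unknowns\<close>

context
 fixes A1 A2 :: "exponent set"
 assumes A: "finite A1" "finite A2"
begin

text \<open>The unknowns are \<open>s 0\<close>, \<open>s 1\<close>, \<open>s 2\<close>. The fourth
  coordinate is a dummy, pinned by \<open>s 3 = 1\<close>; pinning it is the extra equation that
  makes the system overdetermined.\<close>

lemma rows_2_2_no_solution:
 assumes f: "\<And>k. (\<lambda>s. f1 s k) \<in> regular_funs {..<4} {s. (\<Prod>v<4. s v) ~= 0}"
  "\<And>k. (\<lambda>s. g1 s k) \<in> regular_funs {..<4} {s. (\<Prod>v<4. s v) ~= 0}"
  "\<And>k. (\<lambda>s. f2 s k) \<in> regular_funs {..<4} {s. (\<Prod>v<4. s v) ~= 0}"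
  "\<And>k. (\<lambda>s. g2 s k) \<in> regular_funs {..<4} {s. (\<Prod>v<4. s v) ~= 0}"
 shows "holds_generically (A1 <+> A2) (\<lambda>c :: _ => complex. \<forall>s :: nat => complex. (\<forall>v. s v ~= 0) --> s 3 = 1 -->
  indep2 (f1 s) (g1 s) (last_coords A1) -->
  indep2 (f2 s) (g2 s) (last_coords A2) -->
  (\<Sum>k\<in>last_coords A1. f1 s k * coef A1 (coefl c) k (s 0) (s 1)) = 0 -->
  (\<Sum>k\<in>last_coords A1. g1 s k * coef A1 (coefl c) k (s 0) (s 1)) = 0 -->
  (\<Sum>k\<in>last_coords A2. f2 s k * coef A2 (coefr c) k (s 0) (s 1)) = 0 -->
  (\<Sum>k\<in>last_coords A2. g2 s k * coef A2 (coefr c) k (s 0) (s 1)) = 0 --> False)"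
proof -
 let ?R1 = "\<lambda>(r::2) s k. if r = 1 then f1 s k else g1 s k"
 let ?R2 = "\<lambda>(r::2) s k. if r = 1 then f2 s k else g2 s k"
 have h: "(\<lambda>s. s 3 - 1 :: complex) \<in> polynomial_funs {..<4::nat}" by (intro polynomial_funs_intros) simp
 have reg: "(\<lambda>s. ?R1 r s k) \<in> regular_funs {..<4} {s. (\<Prod>v<4. s v) ~= 0}"
  "(\<lambda>s. ?R2 r s k) \<in> regular_funs {..<4} {s. (\<Prod>v<4. s v) ~= 0}" for r k
  by (intro regular_funs_if f)+
 have "holds_generically (A1 <+> A2) (\<lambda>c :: _ => complex. \<forall>s :: nat => complex. (\<forall>v<4. s v ~= 0) --> s 3 - 1 = 0 -->
  indep_rows (\<lambda>r. ?R1 r s) (last_coords A1) --> indep_rows (\<lambda>r. ?R2 r s) (last_coords A2) -->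
  (\<forall>r. (\<Sum>k\<in>last_coords A1. ?R1 r s k * coef A1 (coefl c) k (s 0) (s 1)) = 0) -->
  (\<forall>r. (\<Sum>k\<in>last_coords A2. ?R2 r s k * coef A2 (coefr c) k (s 0) (s 1)) = 0) --> False)"
  by (rule rows_no_solution[where h = "\<lambda>s. s 3 - 1" and ?s0.0 = "\<lambda>_. 0", OF A _ reg h]) auto
 then show ?thesis
 proof (rule holds_generically_mono, goal_cases main)
  case (main c)
  show ?case
  proof (intro allI impI, goal_cases)
   case (1 s)
   have R: "\<forall>r. (\<Sum>k\<in>last_coords A1. ?R1 r s k * coef A1 (coefl c) k (s 0) (s 1)) = 0"
    "\<forall>r. (\<Sum>k\<in>last_coords A2. ?R2 r s k * coef A2 (coefr c) k (s 0) (s 1)) = 0"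
    using 1(5-8) by (simp_all add: forall_2)
   show False
    by (rule main[rule_format, of s]) (use 1(1,2) R indep2_rows[OF 1(3)] indep2_rows[OF 1(4)] in simp_all)
  qed
 qed
qed

text \<open>Two values and two derivatives in \<open>z\<close> are four equations for
  \<open>x\<close>, \<open>y\<close>, \<open>z\<close>. Hence at a common root at least one of the
  polynomials has a simple root in \<open>z\<close>, and the implicit function theorem applies to
  that one.\<close>

lemma generic_no_double_root:
 assumes B: "card (last_coords A1) \<ge> 2" "card (last_coords A2) \<ge> 2"
 shows "holds_generically (A1 <+> A2) (\<lambda>c :: _ => complex. \<forall>x y z. x ~= 0 --> y ~= 0 --> z ~= 0 -->
   laurent A1 (coefl c) (x, y, z) = 0 --> logder A1 (coefl c) (x, y, z) (0, 0, 1) = 0 -->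
   laurent A2 (coefr c) (x, y, z) = 0 --> logder A2 (coefr c) (x, y, z) (0, 0, 1) = 0 --> False)"
proof (rule holds_generically_mono[OF rows_2_2_no_solution[of
    "\<lambda>s k. s 2 powi k" "\<lambda>s k. of_int k * s 2 powi k" "\<lambda>s k. s 2 powi k" "\<lambda>s k. of_int k * s 2 powi k"]],
   goal_cases _ _ _ _ main)
  case (main c)
  show ?case
  proof (intro allI impI)
   fix x y z :: complex assume nz: "x ~= 0" "y ~= 0" "z ~= 0" and
    zero: "laurent A1 (coefl c) (x, y, z) = 0" "logder A1 (coefl c) (x, y, z) (0, 0, 1) = 0"
    "laurent A2 (coefr c) (x, y, z) = 0" "logder A2 (coefr c) (x, y, z) (0, 0, 1) = 0"
   show False
   proof (rule main[rule_format, of "point3 x y z", unfolded point3_simps, OF point3_nonzero[OF nz] refl])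
   qed (simp_all only: deriv_rows_indep[OF nz(3) B(1)] deriv_rows_indep[OF nz(3) B(2)]
      sum_eval_row[OF A(1)] sum_eval_row[OF A(2)] sum_deriv_row[OF A(1)] sum_deriv_row[OF A(2)] zero)
  qed
 qed (intro regular_funs_row_intros regular_funs_mult; simp)+

text \<open>Meant for a ratio \<tau> that is constant on the first exponent set, where the first
  polynomial gives only one value equation for both roots; its \<open>z\<close>-derivative replaces
  the missing fourth equation.\<close>

lemma generic_no_double_root_pair:
 assumes B: "card (last_coords A1) \<ge> 2" and \<tau>: "\<tau> ~= 0" "\<not> ratio_const \<tau> (last_coords A2)"
 shows "holds_generically (A1 <+> A2) (\<lambda>c :: _ => complex. \<forall>x y z. x ~= 0 --> y ~= 0 --> z ~= 0 -->
   laurent A1 (coefl c) (x, y, z) = 0 --> logder A1 (coefl c) (x, y, z) (0, 0, 1) = 0 -->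
   laurent A2 (coefr c) (x, y, z) = 0 --> laurent A2 (coefr c) (x, y, \<tau> * z) = 0 --> False)"
proof (rule holds_generically_mono[OF rows_2_2_no_solution[of
    "\<lambda>s k. s 2 powi k" "\<lambda>s k. of_int k * s 2 powi k" "\<lambda>s k. s 2 powi k" "\<lambda>s k. (\<tau> * s 2) powi k"]],
   goal_cases _ _ _ _ main)
  case (main c)
  show ?case
  proof (intro allI impI)
   fix x y z :: complex assume nz: "x ~= 0" "y ~= 0" "z ~= 0" and
    zero: "laurent A1 (coefl c) (x, y, z) = 0" "logder A1 (coefl c) (x, y, z) (0, 0, 1) = 0"
    "laurent A2 (coefr c) (x, y, z) = 0" "laurent A2 (coefr c) (x, y, \<tau> * z) = 0"
   show False
   proof (rule main[rule_format, of "point3 x y z", unfolded point3_simps, OF point3_nonzero[OF nz] refl])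
   qed (simp_all only: deriv_rows_indep[OF nz(3) B] eval_rows_indep[OF nz(3) \<tau>(2)]
      sum_eval_row[OF A(1)] sum_eval_row[OF A(2)] sum_deriv_row[OF A(1)] sum_deriv_row[OF A(2)] zero)
  qed
 qed (intro regular_funs_row_intros regular_funs_mult; simp)+

text \<open>A prescribed ratio removes one unknown from the pair of roots, so four equations remain
  for three unknowns. This is applied to a finite set of ratios.\<close>

lemma generic_no_two_pairs:
 assumes \<tau>: "\<tau> ~= 0" "\<not> ratio_const \<tau> (last_coords A1)" "\<not> ratio_const \<tau> (last_coords A2)"
 shows "holds_generically (A1 <+> A2) (\<lambda>c :: _ => complex. \<forall>x y z. x ~= 0 --> y ~= 0 --> z ~= 0 -->
   laurent A1 (coefl c) (x, y, z) = 0 --> laurent A1 (coefl c) (x, y, \<tau> * z) = 0 -->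
   laurent A2 (coefr c) (x, y, z) = 0 --> laurent A2 (coefr c) (x, y, \<tau> * z) = 0 --> False)"
proof (rule holds_generically_mono[OF rows_2_2_no_solution[of
    "\<lambda>s k. s 2 powi k" "\<lambda>s k. (\<tau> * s 2) powi k" "\<lambda>s k. s 2 powi k" "\<lambda>s k. (\<tau> * s 2) powi k"]],
   goal_cases _ _ _ _ main)
  case (main c)
  show ?case
  proof (intro allI impI)
   fix x y z :: complex assume nz: "x ~= 0" "y ~= 0" "z ~= 0" and
    zero: "laurent A1 (coefl c) (x, y, z) = 0" "laurent A1 (coefl c) (x, y, \<tau> * z) = 0"
    "laurent A2 (coefr c) (x, y, z) = 0" "laurent A2 (coefr c) (x, y, \<tau> * z) = 0"
   show False
   proof (rule main[rule_format, of "point3 x y z", unfolded point3_simps, OF point3_nonzero[OF nz] refl])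
   qed (simp_all only: eval_rows_indep[OF nz(3) \<tau>(2)] eval_rows_indep[OF nz(3) \<tau>(3)]
      sum_eval_row[OF A(1)] sum_eval_row[OF A(2)] sum_deriv_row[OF A(1)] sum_deriv_row[OF A(2)] zero)
  qed
 qed (intro regular_funs_row_intros regular_funs_mult; simp)+

text \<open>For extreme exponents this says that a root escaping to zero or infinity is not
  accompanied by a finite root.\<close>

lemma generic_no_root_at_end:
 assumes B: "card (last_coords A1) \<ge> 2" "card (last_coords A2) \<ge> 2"
  and kl: "k \<in> last_coords A1" "l \<in> last_coords A2"
 shows "holds_generically (A1 <+> A2) (\<lambda>c :: _ => complex. \<forall>x y z. x ~= 0 --> y ~= 0 --> z ~= 0 -->
   coef A1 (coefl c) k x y = 0 --> laurent A1 (coefl c) (x, y, z) = 0 -->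
   coef A2 (coefr c) l x y = 0 --> laurent A2 (coefr c) (x, y, z) = 0 --> False)"
proof (rule holds_generically_mono[OF rows_2_2_no_solution[of
    "\<lambda>s m. if m = k then 1 else 0" "\<lambda>s m. s 2 powi m" "\<lambda>s m. if m = l then 1 else 0" "\<lambda>s m. s 2 powi m"]],
   goal_cases _ _ _ _ main)
  case (main c)
  show ?case
  proof (intro allI impI)
   fix x y z :: complex assume nz: "x ~= 0" "y ~= 0" "z ~= 0" and
    zero: "coef A1 (coefl c) k x y = 0" "laurent A1 (coefl c) (x, y, z) = 0"
    "coef A2 (coefr c) l x y = 0" "laurent A2 (coefr c) (x, y, z) = 0"
   show False
   proof (rule main[rule_format, of "point3 x y z", unfolded point3_simps, OF point3_nonzero[OF nz] refl])
   qed (simp_all only: unit_eval_rows_indep[OF nz(3) B(1) kl(1)] unit_eval_rows_indep[OF nz(3) B(2) kl(2)]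
      sum_unit_row[OF A(1) kl(1)] sum_unit_row[OF A(2) kl(2)] sum_eval_row[OF A(1)] sum_eval_row[OF A(2)] sum_deriv_row[OF A(1)] sum_deriv_row[OF A(2)] zero)
  qed
 qed (intro regular_funs_row_intros regular_funs_mult; simp)+

end

text \<open>Padding by 1 again keeps all coordinates nonzero and pins the dummy coordinate.\<close>

definition point_of :: "'a::one list => nat => 'a" where
 "point_of xs v = (if v < length xs then xs ! v else 1)"

lemma point_of_simps:
 "point_of (x # xs) 0 = x" "point_of (x # y # xs) 1 = y" "point_of (x # y # z # xs) 2 = z"
 "point_of (x # y # z # z' # xs) 3 = z'" "point_of (x # y # z # z' # z'' # xs) 4 = z''"
 "point_of [x, y] 2 = 1" "point_of [x, y, z] 3 = 1" "point_of [x, y, z, z'] 4 = 1"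
 "point_of [x, y, z, z', z''] 5 = 1"
 by (simp_all add: point_of_def One_nat_def)

lemma point_of_nonzero: "0 \<notin> set xs ==> point_of xs v ~= (0::'a::field)"
 using nth_mem[of v xs] by (cases "v < length xs") (auto simp: point_of_def simp del: nth_mem)

definition indep3 :: "(int => 'a::field) => (int => 'a) => (int => 'a) => int set => bool" where
 "indep3 f g h B \<longleftrightarrow> (\<forall>a b d. (\<forall>k\<in>B. a * f k + b * g k + d * h k = 0) --> a = 0 \<and> b = 0 \<and> d = 0)"

lemma indep3_rows:
 "indep3 f g h B ==> indep_rows (\<lambda>(r::3) k. if r = 1 then f k else if r = 2 then g k else h k) B"
 unfolding indep3_def by (rule indep_rows_3) blast

text \<open>The determinant with rows \<open>1, 1, 1\<close>, the \<open>p\<close> and the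
  \<open>q\<close>, multiplied by an entry of a kernel vector, is a combination of the three
  equations whose factors come from the adjugate; some entry can then be cancelled.\<close>

lemma det3_kernel:
 fixes U V W :: "'a::field"
 assumes "U + V + W = 0" "U * p1 + V * p2 + W * p3 = 0" "U * q1 + V * q2 + W * q3 = 0"
  and "U ~= 0 \<or> V ~= 0 \<or> W ~= 0"
 shows "(p2 * q3 - p3 * q2) - (p1 * q3 - p3 * q1) + (p1 * q2 - p2 * q1) = 0" (is "?D = 0")
proof -
 have "U * ?D = (U + V + W) * (p2 * q3 - p3 * q2) - (U * p1 + V * p2 + W * p3) * (q3 - q2)
   + (U * q1 + V * q2 + W * q3) * (p3 - p2)" by (simp add: algebra_simps)
 moreover have "V * ?D = (U + V + W) * (p3 * q1 - p1 * q3) - (U * p1 + V * p2 + W * p3) * (q1 - q3)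
   + (U * q1 + V * q2 + W * q3) * (p1 - p3)" by (simp add: algebra_simps)
 moreover have "W * ?D = (U + V + W) * (p1 * q2 - p2 * q1) - (U * p1 + V * p2 + W * p3) * (q2 - q1)
   + (U * q1 + V * q2 + W * q3) * (p2 - p1)" by (simp add: algebra_simps)
 ultimately have "U * ?D = 0" "V * ?D = 0" "W * ?D = 0" unfolding assms(1-3) by simp_all
 then show ?thesis using assms(4) by auto
qed

text \<open>A dependence of the three rows kills their minor at the exponents \<open>k\<close>,
  \<open>l\<close>, \<open>m\<close>. Absorbing \<open>z powi k\<close> into the coefficients leaves
  the exponents 0, \<open>a\<close>, \<open>b\<close>, hence a polynomial in the roots.\<close>

lemma vandermonde_minor_zero:
 fixes z1 z2 z3 :: "'a::field"
 assumes "\<not> indep3 (\<lambda>k. z1 powi k) (\<lambda>k. z2 powi k) (\<lambda>k. z3 powi k) B"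
  and "z1 ~= 0" "z2 ~= 0" "z3 ~= 0" and klm: "k \<in> B" "l \<in> B" "m \<in> B" "l = k + int a" "m = k + int b"
 shows "(z2 ^ a * z3 ^ b - z3 ^ a * z2 ^ b) - (z1 ^ a * z3 ^ b - z3 ^ a * z1 ^ b) + (z1 ^ a * z2 ^ b - z2 ^ a * z1 ^ b) = 0"
proof -
 obtain u v w where uvw: "\<And>k. k \<in> B ==> u * z1 powi k + v * z2 powi k + w * z3 powi k = 0"
  "u ~= 0 \<or> v ~= 0 \<or> w ~= 0" using assms(1) unfolding indep3_def by blast
 define U where "U = u * z1 powi k"
 define V where "V = v * z2 powi k"
 define W where "W = w * z3 powi k"
 have e: "U + V + W = 0" "U * z1 ^ a + V * z2 ^ a + W * z3 ^ a = 0" "U * z1 ^ b + V * z2 ^ b + W * z3 ^ b = 0"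
  using uvw(1)[OF klm(1)] uvw(1)[OF klm(2)] uvw(1)[OF klm(3)] assms(2-4)
  by (simp_all add: U_def V_def W_def klm(4,5) power_int_add mult.assoc)
 have "U ~= 0 \<or> V ~= 0 \<or> W ~= 0" using uvw(2) assms(2-4) by (auto simp: U_def V_def W_def)
 with e show ?thesis by (rule det3_kernel)
qed

section \<open>Pairs of roots, vanishing coefficients and triples of roots\<close>

context
 fixes A1 A2 :: "exponent set"
 assumes A: "finite A1" "finite A2"
begin

text \<open>Three equations for the two unknowns \<open>x\<close> and \<open>y\<close>; the third
  coordinate is again a pinned dummy.\<close>

lemma generic_no_three_ends:
 assumes k: "k \<in> last_coords A1" "l \<in> last_coords A1" "k ~= l" "m \<in> last_coords A2"
 shows "holds_generically (A1 <+> A2) (\<lambda>c :: _ => complex. \<forall>x y. x ~= 0 --> y ~= 0 -->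
   coef A1 (coefl c) k x y = 0 --> coef A1 (coefl c) l x y = 0 -->
   coef A2 (coefr c) m x y = 0 --> False)"
proof -
 let ?R1 = "\<lambda>(r::2) (s :: nat => complex) n. if r = 1 then (if n = k then 1 else 0) else (if n = l then 1 else 0)"
 let ?R2 = "\<lambda>(r::1) (s :: nat => complex) n. if n = m then 1 else 0"
 have h: "(\<lambda>s. s 2 - 1 :: complex) \<in> polynomial_funs {..<3::nat}" by (intro polynomial_funs_intros) simp
 have reg: "(\<lambda>s. ?R1 r s n) \<in> regular_funs {..<3} {s. (\<Prod>v<3. s v) ~= 0}"
  "(\<lambda>s. ?R2 r' s n) \<in> regular_funs {..<3} {s. (\<Prod>v<3. s v) ~= 0}" for r r' n
  by (intro regular_funs_row_intros)+
 have "indep2 (\<lambda>n. if n = k then 1 else 0 :: complex) (\<lambda>n. if n = l then 1 else 0) (last_coords A1)"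
  using k by (intro unit_rows_indep[of k _ l]) auto
 note i1 = indep2_rows[OF this]
 have i2: "indep_rows (\<lambda>(r::1) n. if n = m then 1 else 0 :: complex) (last_coords A2)"
  by (rule indep_rows_1[OF k(4)]) simp
 have card: "3 = CARD(2) + CARD(1)" by simp
 have h0: "(\<lambda>_. 0) 2 - 1 ~= (0::complex)" by simp
 show ?thesis
 proof (rule holds_generically_mono[OF rows_no_solution[where ?R1.0 = ?R1 and ?R2.0 = ?R2 and h = "\<lambda>s. s 2 - 1",
    OF A card reg h h0]], goal_cases main)
  case (main c)
  show ?case
  proof (intro allI impI)
   fix x y :: complex assume nz: "x ~= 0" "y ~= 0" and zero: "coef A1 (coefl c) k x y = 0"
    "coef A1 (coefl c) l x y = 0" "coef A2 (coefr c) m x y = 0"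
   have R: "(\<Sum>n\<in>last_coords A1. ?R1 r (point_of [x, y]) n * coef A1 (coefl c) n x y) = 0"
    "(\<Sum>n\<in>last_coords A2. ?R2 r' (point_of [x, y]) n * coef A2 (coefr c) n x y) = 0" for r r'
    by (cases "r = 1"; simp_all only: refl if_True if_False sum_unit_row[OF A(1) k(1)] sum_unit_row[OF A(1) k(2)]
       sum_unit_row[OF A(2) k(4)] zero)+
   show False
   proof (rule main[rule_format, of "point_of [x, y]", unfolded point_of_simps])
    show "point_of [x, y] v ~= 0" for v by (rule point_of_nonzero) (use nz in auto)
   qed (simp_all only: R i1 i2 diff_self)
  qed
 qed
qed

text \<open>Four equations for \<open>x\<close>, \<open>y\<close>, \<open>z\<close>,
  \<open>z'\<close>. A tangent direction common to the two branches, lifted by \<gamma> at one root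
  and by \<gamma>' at the other, would be a nonzero kernel vector of the differentiated
  system.\<close>

lemma generic_pair_regular:
 "holds_generically (A1 <+> A2) (\<lambda>c :: _ => complex. \<forall>x y z z' \<alpha> \<beta> \<gamma> \<gamma>'.
   x ~= 0 --> y ~= 0 --> z ~= 0 --> z' ~= 0 --> \<alpha> ~= 0 \<or> \<beta> ~= 0 -->
   indep2 (\<lambda>k. z powi k) (\<lambda>k. z' powi k) (last_coords A1) -->
   indep2 (\<lambda>k. z powi k) (\<lambda>k. z' powi k) (last_coords A2) -->
   laurent A1 (coefl c) (x, y, z) = 0 --> laurent A1 (coefl c) (x, y, z') = 0 -->
   laurent A2 (coefr c) (x, y, z) = 0 --> laurent A2 (coefr c) (x, y, z') = 0 -->
   logder A1 (coefl c) (x, y, z) (\<alpha>, \<beta>, \<gamma>) = 0 --> logder A1 (coefl c) (x, y, z') (\<alpha>, \<beta>, \<gamma>') = 0 -->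
   logder A2 (coefr c) (x, y, z) (\<alpha>, \<beta>, \<gamma>) = 0 --> logder A2 (coefr c) (x, y, z') (\<alpha>, \<beta>, \<gamma>') = 0 --> False)"
proof -
 let ?R = "\<lambda>(r::2) (s :: nat => complex) k. if r = 1 then (1 * s 2) powi k else (1 * s 3) powi k"
 have reg: "(\<lambda>s. ?R r s n) \<in> regular_funs {..<4} {s. (\<Prod>v<4. s v) ~= 0}" for r n
  by (intro regular_funs_if regular_funs_coordinate_power_scaled) simp_all
 have card: "4 = CARD(2) + CARD(2)" by simp
 show ?thesis
 proof (rule holds_generically_mono[OF rows_regular[where ?R1.0 = ?R and ?R2.0 = ?R, OF A card reg reg]], goal_cases main)
  case (main c)
  show ?case
  proof (intro allI impI)
   fix x y z z' \<alpha> \<beta> \<gamma> \<gamma>' :: complex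
   assume nz: "x ~= 0" "y ~= 0" "z ~= 0" "z' ~= 0" "\<alpha> ~= 0 \<or> \<beta> ~= 0" and
    ind: "indep2 (\<lambda>k. z powi k) (\<lambda>k. z' powi k) (last_coords A1)"
     "indep2 (\<lambda>k. z powi k) (\<lambda>k. z' powi k) (last_coords A2)" and
    zero: "laurent A1 (coefl c) (x, y, z) = 0" "laurent A1 (coefl c) (x, y, z') = 0"
     "laurent A2 (coefr c) (x, y, z) = 0" "laurent A2 (coefr c) (x, y, z') = 0" and
    der: "logder A1 (coefl c) (x, y, z) (\<alpha>, \<beta>, \<gamma>) = 0" "logder A1 (coefl c) (x, y, z') (\<alpha>, \<beta>, \<gamma>') = 0"
     "logder A2 (coefr c) (x, y, z) (\<alpha>, \<beta>, \<gamma>) = 0" "logder A2 (coefr c) (x, y, z') (\<alpha>, \<beta>, \<gamma>') = 0"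
   define s where "s = point_of [x, y, z, z']"
   define w where "w = point_of [x * \<alpha>, y * \<beta>, z * \<gamma>, z' * \<gamma>']"
   have s: "s 0 = x" "s 1 = y" "s 2 = z" "s 3 = z'" "\<And>v. s v ~= 0"
    using nz by (auto simp: s_def point_of_simps point_of_nonzero)
   have w: "w 0 = s 0 * \<alpha>" "w 1 = s 1 * \<beta>" "w 2 = s 2 * \<gamma>" "w 3 = s 3 * \<gamma>'"
    by (auto simp: s w_def point_of_simps)
   have one: "1 * s v ~= 0" for v using s(5) by simp
   show False
   proof (rule main[rule_format, of s w])
    show "\<exists>v<4. w v ~= 0"
    proof (cases "\<alpha> = 0")
     case True
     then show ?thesis using nz w(2) s by (intro exI[of _ 1]) auto
    next
     case False
     then show ?thesis using nz w(1) s by (intro exI[of _ 0]) auto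
    qed
    show "indep_rows (\<lambda>r. ?R r s) (last_coords A1)" "indep_rows (\<lambda>r. ?R r s) (last_coords A2)"
     unfolding s(1-4) mult_1_left by (rule indep2_rows[OF ind(1)], rule indep2_rows[OF ind(2)])
    show "(\<Sum>k\<in>last_coords A1. ?R r s k * coef A1 (coefl c) k (s 0) (s 1)) = 0" for r
     by (cases "r = 1") (simp_all only: refl if_True if_False mult_1_left sum_eval_row[OF A(1)] s zero)
    show "(\<Sum>k\<in>last_coords A2. ?R r s k * coef A2 (coefr c) k (s 0) (s 1)) = 0" for r
     by (cases "r = 1") (simp_all only: refl if_True if_False mult_1_left sum_eval_row[OF A(2)] s zero)
    show "((\<lambda>t. \<Sum>k\<in>last_coords A1. ?R r (\<lambda>v. s v + t * w v) k *
      coef A1 (coefl c) k (s 0 + t * w 0) (s 1 + t * w 1)) has_field_derivative 0) (at 0)" for r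
     using sum_coordinate_derivs[where \<tau> = 1 and s = s and w = w and c = "\<lambda>e. c (Inl e)", OF A(1) s(5) s(5) one w(1,2,3)]
      sum_coordinate_derivs[where \<tau> = 1 and s = s and w = w and c = "\<lambda>e. c (Inl e)", OF A(1) s(5) s(5) one w(1,2,4)]
     by (cases "r = 1") (simp_all only: refl if_True if_False mult_1_left s(1-4) der)
    show "((\<lambda>t. \<Sum>k\<in>last_coords A2. ?R r (\<lambda>v. s v + t * w v) k *
      coef A2 (coefr c) k (s 0 + t * w 0) (s 1 + t * w 1)) has_field_derivative 0) (at 0)" for r
     using sum_coordinate_derivs[where \<tau> = 1 and s = s and w = w and c = "\<lambda>e. c (Inr e)", OF A(2) s(5) s(5) one w(1,2,3)]
      sum_coordinate_derivs[where \<tau> = 1 and s = s and w = w and c = "\<lambda>e. c (Inr e)", OF A(2) s(5) s(5) one w(1,2,4)]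
     by (cases "r = 1") (simp_all only: refl if_True if_False mult_1_left s(1-4) der)
   qed (use s in auto)
  qed
 qed
qed

text \<open>For a ratio constant on the first exponent set the two equations of the first polynomial
  coincide up to a factor. Three equations for \<open>x\<close>, \<open>y\<close>, \<open>z\<close>
  remain, and a kernel vector has the single vertical component \<gamma>.\<close>

lemma generic_scaled_pair_regular:
 assumes ne: "last_coords A1 ~= {}" and \<tau>: "\<tau> ~= 0" "\<not> ratio_const \<tau> (last_coords A2)"
 shows "holds_generically (A1 <+> A2) (\<lambda>c :: _ => complex. \<forall>x y z \<alpha> \<beta> \<gamma>.
   x ~= 0 --> y ~= 0 --> z ~= 0 --> \<alpha> ~= 0 \<or> \<beta> ~= 0 -->
   laurent A1 (coefl c) (x, y, z) = 0 -->
   laurent A2 (coefr c) (x, y, z) = 0 --> laurent A2 (coefr c) (x, y, \<tau> * z) = 0 -->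
   logder A1 (coefl c) (x, y, z) (\<alpha>, \<beta>, \<gamma>) = 0 -->
   logder A2 (coefr c) (x, y, z) (\<alpha>, \<beta>, \<gamma>) = 0 --> logder A2 (coefr c) (x, y, \<tau> * z) (\<alpha>, \<beta>, \<gamma>) = 0 --> False)"
proof -
 let ?R1 = "\<lambda>(r::1) (s :: nat => complex) k. (1 * s 2) powi k"
 let ?R2 = "\<lambda>(r::2) (s :: nat => complex) k. if r = 1 then (1 * s 2) powi k else (\<tau> * s 2) powi k"
 have reg: "(\<lambda>s. ?R1 r s n) \<in> regular_funs {..<3} {s. (\<Prod>v<3. s v) ~= 0}"
  "(\<lambda>s. ?R2 r' s n) \<in> regular_funs {..<3} {s. (\<Prod>v<3. s v) ~= 0}" for r r' n
  by (intro regular_funs_if regular_funs_coordinate_power_scaled; simp)+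
 have card: "3 = CARD(1) + CARD(2)" by simp
 show ?thesis
 proof (rule holds_generically_mono[OF rows_regular[where ?R1.0 = ?R1 and ?R2.0 = ?R2, OF A card reg]], goal_cases main)
  case (main c)
  show ?case
  proof (intro allI impI)
   fix x y z \<alpha> \<beta> \<gamma> :: complex
   assume nz: "x ~= 0" "y ~= 0" "z ~= 0" "\<alpha> ~= 0 \<or> \<beta> ~= 0" and
    zero: "laurent A1 (coefl c) (x, y, z) = 0"
     "laurent A2 (coefr c) (x, y, z) = 0" "laurent A2 (coefr c) (x, y, \<tau> * z) = 0" and
    der: "logder A1 (coefl c) (x, y, z) (\<alpha>, \<beta>, \<gamma>) = 0"
     "logder A2 (coefr c) (x, y, z) (\<alpha>, \<beta>, \<gamma>) = 0" "logder A2 (coefr c) (x, y, \<tau> * z) (\<alpha>, \<beta>, \<gamma>) = 0"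
   define s where "s = point_of [x, y, z]"
   define w where "w = point_of [x * \<alpha>, y * \<beta>, z * \<gamma>]"
   have s: "s 0 = x" "s 1 = y" "s 2 = z" "\<And>v. s v ~= 0"
    using nz by (auto simp: s_def point_of_simps point_of_nonzero)
   have w: "w 0 = s 0 * \<alpha>" "w 1 = s 1 * \<beta>" "w 2 = s 2 * \<gamma>"
    by (auto simp: s w_def point_of_simps)
   have one: "1 * s v ~= 0" "\<tau> * s v ~= 0" for v using s(4) \<tau>(1) by auto
   obtain k where k: "k \<in> last_coords A1" using ne by blast
   show False
   proof (rule main[rule_format, of s w])
    show "\<exists>v<3. w v ~= 0"
    proof (cases "\<alpha> = 0")
     case True
     then show ?thesis using nz w(2) s by (intro exI[of _ 1]) auto
    next
     case False
     then show ?thesis using nz w(1) s by (intro exI[of _ 0]) auto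
    qed
    show "indep_rows (\<lambda>r. ?R1 r s) (last_coords A1)"
     by (rule indep_rows_1[OF k]) (use s(3) nz(3) in simp)
    show "indep_rows (\<lambda>r. ?R2 r s) (last_coords A2)"
     unfolding s(1-3) mult_1_left by (rule indep2_rows[OF eval_rows_indep[OF nz(3) \<tau>(2)]])
    show "(\<Sum>k\<in>last_coords A1. ?R1 r s k * coef A1 (coefl c) k (s 0) (s 1)) = 0" for r
     by (simp only: mult_1_left sum_eval_row[OF A(1)] s zero)
    show "(\<Sum>k\<in>last_coords A2. ?R2 r s k * coef A2 (coefr c) k (s 0) (s 1)) = 0" for r
     by (cases "r = 1") (simp_all only: refl if_True if_False mult_1_left sum_eval_row[OF A(2)] s zero)
    show "((\<lambda>t. \<Sum>k\<in>last_coords A1. ?R1 r (\<lambda>v. s v + t * w v) k *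
      coef A1 (coefl c) k (s 0 + t * w 0) (s 1 + t * w 1)) has_field_derivative 0) (at 0)" for r
     using sum_coordinate_derivs[where s = s and w = w and c = "\<lambda>e. c (Inl e)", OF A(1) s(4) s(4) one(1) w]
     by (simp only: mult_1_left s(1-3) der)
    show "((\<lambda>t. \<Sum>k\<in>last_coords A2. ?R2 r (\<lambda>v. s v + t * w v) k *
      coef A2 (coefr c) k (s 0 + t * w 0) (s 1 + t * w 1)) has_field_derivative 0) (at 0)" for r
     using sum_coordinate_derivs[where s = s and w = w and c = "\<lambda>e. c (Inr e)", OF A(2) s(4) s(4) one(1) w]
      sum_coordinate_derivs[where s = s and w = w and c = "\<lambda>e. c (Inr e)", OF A(2) s(4) s(4) one(2) w]
     by (cases "r = 1") (simp_all only: refl if_True if_False mult_1_left s(1-3) der)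
   qed (use s in auto)
  qed
 qed
qed

text \<open>Evaluation at \<open>z = 1\<close> makes the derivative formula for Laurent polynomials
  available for a single coefficient.\<close>

lemma coef_laurent: "coef A c k x y = laurent {e \<in> A. snd (snd e) = k} c (x, y, 1)"
 unfolding coef_def laurent_def prod.case by (intro sum.cong refl) (auto split: prod.split)

text \<open>Two equations for \<open>x\<close> and \<open>y\<close>: the two coefficient curves meet
  transversally. For extreme coefficients this gives smoothness of the branch at the end.\<close>

lemma generic_ends_regular:
 assumes kl: "k \<in> last_coords A1" "l \<in> last_coords A2"
 shows "holds_generically (A1 <+> A2) (\<lambda>c :: _ => complex. \<forall>x y \<alpha> \<beta>.
   x ~= 0 --> y ~= 0 --> \<alpha> ~= 0 \<or> \<beta> ~= 0 -->
   coef A1 (coefl c) k x y = 0 --> coef A2 (coefr c) l x y = 0 -->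
   logder {e \<in> A1. snd (snd e) = k} (coefl c) (x, y, 1) (\<alpha>, \<beta>, 0) = 0 -->
   logder {e \<in> A2. snd (snd e) = l} (coefr c) (x, y, 1) (\<alpha>, \<beta>, 0) = 0 --> False)"
proof -
 let ?R1 = "\<lambda>(r::1) (s :: nat => complex) m. if m = k then 1 else 0"
 let ?R2 = "\<lambda>(r::1) (s :: nat => complex) m. if m = l then 1 else 0"
 have reg: "(\<lambda>s. ?R1 r s n) \<in> regular_funs {..<2} {s. (\<Prod>v<2. s v) ~= 0}"
  "(\<lambda>s. ?R2 r s n) \<in> regular_funs {..<2} {s. (\<Prod>v<2. s v) ~= 0}" for r n
  by (intro regular_funs_row_intros)+
 have card: "2 = CARD(1) + CARD(1)" by simp
 show ?thesis
 proof (rule holds_generically_mono[OF rows_regular[where ?R1.0 = ?R1 and ?R2.0 = ?R2, OF A card reg]], goal_cases main)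
  case (main c)
  show ?case
  proof (intro allI impI)
   fix x y \<alpha> \<beta> :: complex
   assume nz: "x ~= 0" "y ~= 0" "\<alpha> ~= 0 \<or> \<beta> ~= 0" and
    zero: "coef A1 (coefl c) k x y = 0" "coef A2 (coefr c) l x y = 0" and
    der: "logder {e \<in> A1. snd (snd e) = k} (coefl c) (x, y, 1) (\<alpha>, \<beta>, 0) = 0"
     "logder {e \<in> A2. snd (snd e) = l} (coefr c) (x, y, 1) (\<alpha>, \<beta>, 0) = 0"
   define s where "s = point_of [x, y]"
   define w where "w = point_of [x * \<alpha>, y * \<beta>]"
   have s: "s 0 = x" "s 1 = y" "\<And>v. s v ~= 0"
    using nz by (auto simp: s_def point_of_simps point_of_nonzero)
   have w: "w 0 = x * \<alpha>" "w 1 = y * \<beta>" by (auto simp: w_def point_of_simps)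
   show False
   proof (rule main[rule_format, of s w])
    show "\<exists>v<2. w v ~= 0"
    proof (cases "\<alpha> = 0")
     case True
     then show ?thesis using nz w(2) by (intro exI[of _ 1]) auto
    next
     case False
     then show ?thesis using nz w(1) by (intro exI[of _ 0]) auto
    qed
    show "indep_rows (\<lambda>r. ?R1 r s) (last_coords A1)" by (rule indep_rows_1[OF kl(1)]) simp
    show "indep_rows (\<lambda>r. ?R2 r s) (last_coords A2)" by (rule indep_rows_1[OF kl(2)]) simp
    show "(\<Sum>m\<in>last_coords A1. ?R1 r s m * coef A1 (coefl c) m (s 0) (s 1)) = 0" for r
     by (simp only: sum_unit_row[OF A(1) kl(1)] s zero)
    show "(\<Sum>m\<in>last_coords A2. ?R2 r s m * coef A2 (coefr c) m (s 0) (s 1)) = 0" for r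
     by (simp only: sum_unit_row[OF A(2) kl(2)] s zero)
    show "((\<lambda>t. \<Sum>m\<in>last_coords A1. ?R1 r (\<lambda>v. s v + t * w v) m *
      coef A1 (coefl c) m (s 0 + t * w 0) (s 1 + t * w 1)) has_field_derivative 0) (at 0)" for r
     using laurent_line_deriv[OF nz(1,2) one_neq_zero, of "{e \<in> A1. snd (snd e) = k}" "\<lambda>e. c (Inl e)" \<alpha> \<beta> 0]
     unfolding sum_unit_row[OF A(1) kl(1)] by (simp add: coef_laurent s w der)
    show "((\<lambda>t. \<Sum>m\<in>last_coords A2. ?R2 r (\<lambda>v. s v + t * w v) m *
      coef A2 (coefr c) m (s 0 + t * w 0) (s 1 + t * w 1)) has_field_derivative 0) (at 0)" for r
     using laurent_line_deriv[OF nz(1,2) one_neq_zero, of "{e \<in> A2. snd (snd e) = l}" "\<lambda>e. c (Inr e)" \<alpha> \<beta> 0]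
     unfolding sum_unit_row[OF A(2) kl(2)] by (simp add: coef_laurent s w der)
   qed (use s in auto)
  qed
 qed
qed

text \<open>One equation from the first polynomial and three from the second, for the three unknowns
  \<open>x\<close>, \<open>y\<close>, \<open>z\<close>. Scaling by \<open>z\<close> carries the
  independence at 1, \<tau>, \<tau>' over to the actual roots.\<close>

lemma generic_no_scaled_triple:
 assumes ne: "last_coords A1 ~= {}" and
  \<tau>: "indep3 (\<lambda>k. 1) (\<lambda>k. \<tau> powi k) (\<lambda>k. \<tau>' powi k) (last_coords A2)"
 shows "holds_generically (A1 <+> A2) (\<lambda>c :: _ => complex. \<forall>x y z. x ~= 0 --> y ~= 0 --> z ~= 0 -->
   laurent A1 (coefl c) (x, y, z) = 0 --> laurent A2 (coefr c) (x, y, z) = 0 -->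
   laurent A2 (coefr c) (x, y, \<tau> * z) = 0 --> laurent A2 (coefr c) (x, y, \<tau>' * z) = 0 --> False)"
proof -
 let ?R1 = "\<lambda>(r::1) (s :: nat => complex) k. s 2 powi k"
 let ?R2 = "\<lambda>(r::3) (s :: nat => complex) k. if r = 1 then s 2 powi k else if r = 2 then (\<tau> * s 2) powi k else (\<tau>' * s 2) powi k"
 have h: "(\<lambda>s. s 3 - 1 :: complex) \<in> polynomial_funs {..<4::nat}" by (intro polynomial_funs_intros) simp
 have reg: "(\<lambda>s. ?R1 r s n) \<in> regular_funs {..<4} {s. (\<Prod>v<4. s v) ~= 0}"
  "(\<lambda>s. ?R2 r' s n) \<in> regular_funs {..<4} {s. (\<Prod>v<4. s v) ~= 0}" for r r' n
  by (intro regular_funs_row_intros; simp)+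
 have card: "4 = CARD(1) + CARD(3)" by simp
 have h0: "(\<lambda>_. 0) 3 - 1 ~= (0::complex)" by simp
 show ?thesis
 proof (rule holds_generically_mono[OF rows_no_solution[where ?R1.0 = ?R1 and ?R2.0 = ?R2 and h = "\<lambda>s. s 3 - 1", OF A card reg h h0]], goal_cases main)
  case (main c)
  show ?case
  proof (intro allI impI)
   fix x y z :: complex
   assume nz: "x ~= 0" "y ~= 0" "z ~= 0" and
    zero: "laurent A1 (coefl c) (x, y, z) = 0" "laurent A2 (coefr c) (x, y, z) = 0"
     "laurent A2 (coefr c) (x, y, \<tau> * z) = 0" "laurent A2 (coefr c) (x, y, \<tau>' * z) = 0"
   define s where "s = point_of [x, y, z]"
   have s: "s 0 = x" "s 1 = y" "s 2 = z" "s 3 = 1" "\<And>v. s v ~= 0"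
    using nz by (auto simp: s_def point_of_simps point_of_nonzero)
   obtain k where k: "k \<in> last_coords A1" using ne by blast
   have ind: "indep3 (\<lambda>k. z powi k) (\<lambda>k. (\<tau> * z) powi k) (\<lambda>k. (\<tau>' * z) powi k) (last_coords A2)"
    unfolding indep3_def
   proof (intro allI impI)
    fix a b d assume *: "\<forall>k\<in>last_coords A2. a * z powi k + b * (\<tau> * z) powi k + d * (\<tau>' * z) powi k = 0"
    have "a * 1 + b * \<tau> powi k + d * \<tau>' powi k = 0" if "k \<in> last_coords A2" for k
    proof -
     have "z powi k * (a * 1 + b * \<tau> powi k + d * \<tau>' powi k) = 0"
      using bspec[OF * that] by (simp add: power_int_mult_distrib algebra_simps)
     then show ?thesis using nz(3) by simp
    qed
    then show "a = 0 \<and> b = 0 \<and> d = 0" using \<tau> unfolding indep3_def by blast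
   qed
   show False
   proof (rule main[rule_format, of s])
    show "indep_rows (\<lambda>r. ?R1 r s) (last_coords A1)"
     by (rule indep_rows_1[OF k]) (use s(3) nz(3) in simp)
    show "indep_rows (\<lambda>r. ?R2 r s) (last_coords A2)" unfolding s(1-3) by (rule indep3_rows[OF ind])
    show "(\<Sum>k\<in>last_coords A1. ?R1 r s k * coef A1 (coefl c) k (s 0) (s 1)) = 0" for r
     by (simp only: sum_eval_row[OF A(1)] s zero)
    show "(\<Sum>k\<in>last_coords A2. ?R2 r s k * coef A2 (coefr c) k (s 0) (s 1)) = 0" for r
     by (cases "r = 1"; cases "r = 2") (simp_all only: refl if_True if_False sum_eval_row[OF A(2)] s zero)
   qed (use s in auto)
  qed
 qed
qed

text \<open>Six equations for the five unknowns \<open>x\<close>, \<open>y\<close>,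
  \<open>z\<close>, \<open>z'\<close>, \<open>z''\<close>; the sixth coordinate is pinned.\<close>

lemma generic_no_independent_triple:
 "holds_generically (A1 <+> A2) (\<lambda>c :: _ => complex. \<forall>x y z z' z''. x ~= 0 --> y ~= 0 --> z ~= 0 --> z' ~= 0 --> z'' ~= 0 -->
   indep3 (\<lambda>k. z powi k) (\<lambda>k. z' powi k) (\<lambda>k. z'' powi k) (last_coords A1) -->
   indep3 (\<lambda>k. z powi k) (\<lambda>k. z' powi k) (\<lambda>k. z'' powi k) (last_coords A2) -->
   (\<forall>\<zeta>\<in>{z, z', z''}. laurent A1 (coefl c) (x, y, \<zeta>) = 0 \<and> laurent A2 (coefr c) (x, y, \<zeta>) = 0) --> False)"
proof -
 let ?R = "\<lambda>(r::3) (s :: nat => complex) k. if r = 1 then s 2 powi k else if r = 2 then s 3 powi k else s 4 powi k"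
 have h: "(\<lambda>s. s 5 - 1 :: complex) \<in> polynomial_funs {..<6::nat}" by (intro polynomial_funs_intros) simp
 have reg: "(\<lambda>s. ?R r s n) \<in> regular_funs {..<6} {s. (\<Prod>v<6. s v) ~= 0}" for r n
  by (intro regular_funs_row_intros; simp)
 have card: "6 = CARD(3) + CARD(3)" by simp
 have h0: "(\<lambda>_. 0) 5 - 1 ~= (0::complex)" by simp
 show ?thesis
 proof (rule holds_generically_mono[OF rows_no_solution[where ?R1.0 = ?R and ?R2.0 = ?R and h = "\<lambda>s. s 5 - 1", OF A card reg reg h h0]], goal_cases main)
  case (main c)
  show ?case
  proof (intro allI impI)
   fix x y z z' z'' :: complex
   assume nz: "x ~= 0" "y ~= 0" "z ~= 0" "z' ~= 0" "z'' ~= 0" and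
    ind: "indep3 (\<lambda>k. z powi k) (\<lambda>k. z' powi k) (\<lambda>k. z'' powi k) (last_coords A1)"
     "indep3 (\<lambda>k. z powi k) (\<lambda>k. z' powi k) (\<lambda>k. z'' powi k) (last_coords A2)" and
    zero: "\<forall>\<zeta>\<in>{z, z', z''}. laurent A1 (coefl c) (x, y, \<zeta>) = 0 \<and> laurent A2 (coefr c) (x, y, \<zeta>) = 0"
   define s where "s = point_of [x, y, z, z', z'']"
   have s: "s 0 = x" "s 1 = y" "s 2 = z" "s 3 = z'" "s 4 = z''" "s 5 = 1" "\<And>v. s v ~= 0"
    using nz by (auto simp: s_def point_of_simps point_of_nonzero)
   show False
   proof (rule main[rule_format, of s])
    show "indep_rows (\<lambda>r. ?R r s) (last_coords A1)" unfolding s(1-5) by (rule indep3_rows[OF ind(1)])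
    show "indep_rows (\<lambda>r. ?R r s) (last_coords A2)" unfolding s(1-5) by (rule indep3_rows[OF ind(2)])
    show "(\<Sum>k\<in>last_coords A1. ?R r s k * coef A1 (coefl c) k (s 0) (s 1)) = 0" for r
     using zero by (cases "r = 1"; cases "r = 2") (simp_all add: sum_eval_row[OF A(1)] s)
    show "(\<Sum>k\<in>last_coords A2. ?R r s k * coef A2 (coefr c) k (s 0) (s 1)) = 0" for r
     using zero by (cases "r = 1"; cases "r = 2") (simp_all add: sum_eval_row[OF A(2)] s)
   qed (use s in auto)
  qed
 qed
qed

text \<open>The first polynomial contributes two equations, for \<open>z\<close> and
  \<open>z'\<close>, and the second three, as many as there are unknowns. The excess condition
  \<open>h\<close> is the vanishing minor of the dependent rows.\<close>

lemma generic_no_semidependent_triple: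
 assumes klm: "k \<in> last_coords A1" "l \<in> last_coords A1" "m \<in> last_coords A1" "k < l" "l < m"
 shows "holds_generically (A1 <+> A2) (\<lambda>c :: _ => complex. \<forall>x y z z' z''. x ~= 0 --> y ~= 0 --> z ~= 0 --> z' ~= 0 --> z'' ~= 0 -->
   \<not> indep3 (\<lambda>k. z powi k) (\<lambda>k. z' powi k) (\<lambda>k. z'' powi k) (last_coords A1) -->
   indep2 (\<lambda>k. z powi k) (\<lambda>k. z' powi k) (last_coords A1) -->
   indep3 (\<lambda>k. z powi k) (\<lambda>k. z' powi k) (\<lambda>k. z'' powi k) (last_coords A2) -->
   (\<forall>\<zeta>\<in>{z, z', z''}. laurent A1 (coefl c) (x, y, \<zeta>) = 0 \<and> laurent A2 (coefr c) (x, y, \<zeta>) = 0) --> False)"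
proof -
 define a where "a = nat (l - k)"
 define b where "b = nat (m - k)"
 have ab: "0 < a" "a < b" "l = k + int a" "m = k + int b" using klm(4,5) by (auto simp: a_def b_def)
 let ?h = "\<lambda>s :: nat => complex. (s 3 ^ a * s 4 ^ b - s 4 ^ a * s 3 ^ b) - (s 2 ^ a * s 4 ^ b - s 4 ^ a * s 2 ^ b) +
   (s 2 ^ a * s 3 ^ b - s 3 ^ a * s 2 ^ b)"
 let ?R1 = "\<lambda>(r::2) (s :: nat => complex) k. if r = 1 then s 2 powi k else s 3 powi k"
 let ?R2 = "\<lambda>(r::3) (s :: nat => complex) k. if r = 1 then s 2 powi k else if r = 2 then s 3 powi k else s 4 powi k"
 have h: "?h \<in> polynomial_funs {..<5::nat}" by (intro polynomial_funs_intros) simp_all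
 have "of_nat (2 ^ a) ~= (of_nat (2 ^ b) :: complex)" using ab(2) unfolding of_nat_eq_iff by simp
 then have "(2::complex) ^ a ~= 2 ^ b" by simp
 \<comment> \<open>At the roots 0, 1, 2 the minor equals 2^b - 2^a. A zero root is legitimate here,
   since the point only shows that the polynomial is nonzero.\<close>
 then have h0: "?h (point_of [1, 1, 0, 1, 2]) ~= 0" using ab(1,2) by (simp add: point_of_simps power_0_left)
 have reg: "(\<lambda>s. ?R1 r s n) \<in> regular_funs {..<5} {s. (\<Prod>v<5. s v) ~= 0}"
  "(\<lambda>s. ?R2 r' s n) \<in> regular_funs {..<5} {s. (\<Prod>v<5. s v) ~= 0}" for r r' n
  by (intro regular_funs_row_intros; simp)+
 have card: "5 = CARD(2) + CARD(3)" by simp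
 show ?thesis
 proof (rule holds_generically_mono[OF rows_no_solution[where ?R1.0 = ?R1 and ?R2.0 = ?R2 and h = ?h, OF A card reg h h0]], goal_cases main)
  case (main c)
  show ?case
  proof (intro allI impI)
   fix x y z z' z'' :: complex
   assume nz: "x ~= 0" "y ~= 0" "z ~= 0" "z' ~= 0" "z'' ~= 0" and
    ind: "\<not> indep3 (\<lambda>k. z powi k) (\<lambda>k. z' powi k) (\<lambda>k. z'' powi k) (last_coords A1)"
     "indep2 (\<lambda>k. z powi k) (\<lambda>k. z' powi k) (last_coords A1)"
     "indep3 (\<lambda>k. z powi k) (\<lambda>k. z' powi k) (\<lambda>k. z'' powi k) (last_coords A2)" and
    zero: "\<forall>\<zeta>\<in>{z, z', z''}. laurent A1 (coefl c) (x, y, \<zeta>) = 0 \<and> laurent A2 (coefr c) (x, y, \<zeta>) = 0"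
   define s where "s = point_of [x, y, z, z', z'']"
   have s: "s 0 = x" "s 1 = y" "s 2 = z" "s 3 = z'" "s 4 = z''" "\<And>v. s v ~= 0"
    using nz by (auto simp: s_def point_of_simps point_of_nonzero)
   show False
   proof (rule main[rule_format, of s])
    show "?h s = 0" unfolding s
     by (rule vandermonde_minor_zero[OF ind(1) nz(3-5) klm(1-3) ab(3,4)])
    show "indep_rows (\<lambda>r. ?R1 r s) (last_coords A1)" unfolding s(1-5) by (rule indep2_rows[OF ind(2)])
    show "indep_rows (\<lambda>r. ?R2 r s) (last_coords A2)" unfolding s(1-5) by (rule indep3_rows[OF ind(3)])
    show "(\<Sum>k\<in>last_coords A1. ?R1 r s k * coef A1 (coefl c) k (s 0) (s 1)) = 0" for r
     using zero by (cases "r = 1") (simp_all add: sum_eval_row[OF A(1)] s)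
    show "(\<Sum>k\<in>last_coords A2. ?R2 r s k * coef A2 (coefr c) k (s 0) (s 1)) = 0" for r
     using zero by (cases "r = 1"; cases "r = 2") (simp_all add: sum_eval_row[OF A(2)] s)
   qed (use s in auto)
  qed
 qed
qed

end

declare One_nat_def [simp]

section \<open>Lattice conditions\<close>

text \<open>The exponents \<open>m\<close> with \<open>\<tau> powi m = 1\<close> and
  \<open>\<tau>' powi m = 1\<close> form a subgroup of the integers; the least positive one
  generates it.\<close>

lemma common_order:
 fixes \<tau> \<tau>' :: complex
 assumes "n > 0" "\<tau> ^ n = 1" "\<tau>' ^ n = 1"
 shows "\<exists>d>0. \<tau> ^ d = 1 \<and> \<tau>' ^ d = 1 \<and> (\<forall>m. \<tau> powi m = 1 --> \<tau>' powi m = 1 --> int d dvd m)"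
proof -
 define P where "P d \<longleftrightarrow> d > 0 \<and> \<tau> ^ d = 1 \<and> \<tau>' ^ d = 1" for d
 define d where "d = (LEAST d. P d)"
 have "P n" using assms by (simp add: P_def)
 then have d: "P d" unfolding d_def by (rule LeastI)
 have nz: "\<tau> ~= 0" "\<tau>' ~= 0" using assms by (auto simp: power_0_left)
 have "int d dvd m" if m: "\<tau> powi m = 1" "\<tau>' powi m = 1" for m
 proof (rule ccontr)
  assume "\<not> int d dvd m"
  define r where "r = nat (m mod int d)"
  have r: "int r = m mod int d" using d by (simp add: r_def P_def)
  have "r > 0" using \<open>\<not> int d dvd m\<close> r by (metis dvd_eq_mod_eq_0 gr0I of_nat_0)
  have "m mod int d < int d" using d by (simp add: P_def)
  then have "r < d" using r by simp
  have *: "z ^ r = 1" if "z ^ d = 1" "z powi m = 1" "z ~= 0" for z :: complex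
  proof -
   have "z powi m = z powi (int d * (m div int d) + int r)" using r by simp
   also have "\<dots> = (z powi int d) powi (m div int d) * z ^ r"
    using that(3) by (simp add: power_int_add power_int_mult)
   also have "\<dots> = z ^ r" using that(1) by simp
   finally show ?thesis using that(2) by simp
  qed
  have "P r" using *[of \<tau>] *[of \<tau>'] d m nz \<open>r > 0\<close> by (auto simp: P_def)
  then show False using \<open>r < d\<close> not_less_Least unfolding d_def by blast
 qed
 then show ?thesis using d unfolding P_def by blast
qed

lemma shiftableI: "(\<And>k l. k \<in> B ==> l \<in> B ==> d dvd k - l) ==> shiftable d B"
 unfolding shiftable_def
proof (cases "B = {}")
 case False
 assume *: "\<And>k l. k \<in> B ==> l \<in> B ==> d dvd k - l"
 obtain l where "l \<in> B" using False by blast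
 then show "\<exists>s. \<forall>b\<in>B. d dvd b + s" using *[of _ l] by (intro exI[of _ "- l"]) simp
qed simp

lemma ratio_const_power:
 fixes \<tau> :: complex
 assumes "ratio_const \<tau> B" "\<tau> ~= 0" "k \<in> B" "l \<in> B"
 shows "\<tau> powi (k - l) = 1"
 using assms by (auto simp: ratio_const_def power_int_diff)

lemma common_root_order:
 fixes \<tau> \<tau>' :: complex
 assumes "card B \<ge> 2" "ratio_const \<tau> B" "ratio_const \<tau>' B" "\<tau> ~= 0" "\<tau>' ~= 0"
 obtains n where "n > 0" "\<tau> ^ n = 1" "\<tau>' ^ n = 1"
proof -
 obtain k l where kl: "k \<in> B" "l \<in> B" "k < l" using two_elements[OF assms(1)] .
 define n where "n = nat (l - k)"
 have n: "int n = l - k" "n > 0" using kl by (auto simp: n_def)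
 have "z ^ n = 1" if "ratio_const z B" "z ~= 0" for z :: complex
  using ratio_const_power[OF that kl(2,1)] n(1) by (metis power_int_of_nat)
 then show ?thesis using that n assms by blast
qed

text \<open>The order of \<tau> is at least 2 and divides all differences within each set, so it is
  a \<open>k\<close> as in condition (1).\<close>

lemma ratio_const_common_sublattice:
 fixes \<tau> :: complex
 assumes "card B1 \<ge> 2" "\<tau> ~= 0" "\<tau> ~= 1" "ratio_const \<tau> B1" "ratio_const \<tau> B2"
 shows "common_sublattice B1 B2"
proof -
 obtain n where n: "n > 0" "\<tau> ^ n = 1" using common_root_order[OF assms(1,4,4,2,2)] by blast
 obtain d where d: "d > 0" "\<tau> ^ d = 1" "\<tau> ^ d = 1"
  "\<And>m. \<tau> powi m = 1 ==> \<tau> powi m = 1 ==> int d dvd m"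
  using common_order[OF n n(2)] by auto
 have "d ~= 1" using d(2) assms(3) by auto
 moreover have "shiftable (int d) B1" "shiftable (int d) B2"
  by (intro shiftableI d(4) ratio_const_power[OF assms(4,2)] ratio_const_power[OF assms(5,2)]; assumption)+
 ultimately show ?thesis unfolding common_sublattice_def using d(1) by (intro exI[of _ "int d"]) auto
qed

lemma ratio_const_divide:
 fixes \<tau> \<tau>' :: complex
 shows "ratio_const \<tau> B ==> ratio_const \<tau>' B ==> ratio_const (\<tau>' / \<tau>) B"
 unfolding ratio_const_def power_int_divide_distrib by metis

text \<open>A relation \<open>u + v \<tau>^k + w \<tau>'^k = 0\<close> between unit complex numbers is a triangle with given side
 lengths, hence determines \<open>(\<tau>^k, \<tau>'^k)\<close> up to a reflection.\<close>

lemma dependent_triple_split: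
 fixes \<tau> \<tau>' :: complex
 assumes B: "card B1 \<ge> 2" "B2 ~= {}" and \<tau>: "\<tau> ~= 0" "\<tau>' ~= 0" "\<tau> ~= 1" "\<tau>' ~= 1" "\<tau> ~= \<tau>'"
  and const: "ratio_const \<tau> B1" "ratio_const \<tau>' B1"
  and rel: "\<And>k. k \<in> B2 ==> u + v * \<tau> powi k + w * \<tau>' powi k = 0" "u ~= 0 \<or> v ~= 0 \<or> w ~= 0"
 shows "common_sublattice B1 B2 \<or> split_sublattice B2 B1"
proof (cases "common_sublattice B1 B2")
 case False
 have no: "\<not> ratio_const z B2" if "z \<in> {\<tau>, \<tau>', \<tau>' / \<tau>}" for z
  using that ratio_const_common_sublattice[OF B(1), of z B2] False \<tau> const ratio_const_divide[OF const] by auto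
 \<comment> \<open>A vanishing coefficient would leave a two-term relation, making one of \<tau>,
   \<tau>', \<tau>'/\<tau> constant on \<open>B2\<close> as well as on \<open>B1\<close>, which
   \<open>no\<close> forbids.\<close>
 have nz: "u ~= 0" "v ~= 0" "w ~= 0"
 proof -
  obtain k0 where k0: "k0 \<in> B2" using B(2) by blast
  show "w ~= 0"
  proof
   assume w: "w = 0"
   then have "v ~= 0" using rel(1)[OF k0] rel(2) by auto
   then have "\<tau> powi k = - u / v" if "k \<in> B2" for k
    using rel(1)[OF that] w by (simp add: field_simps add_eq_0_iff)
   then show False using no[of \<tau>] by (auto simp: ratio_const_def)
  qed
  show "v ~= 0"
  proof
   assume w: "v = 0"
   then have "w ~= 0" using rel(1)[OF k0] rel(2) by auto
   then have "\<tau>' powi k = - u / w" if "k \<in> B2" for k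
    using rel(1)[OF that] w by (simp add: field_simps add_eq_0_iff)
   then show False using no[of \<tau>'] by (auto simp: ratio_const_def)
  qed
  show "u ~= 0"
  proof
   assume u: "u = 0"
   then have "(\<tau>' / \<tau>) powi k = - v / w" if "k \<in> B2" for k
    using rel(1)[OF that] \<open>w ~= 0\<close> \<tau>(1) by (simp add: field_simps add_eq_0_iff power_int_divide_distrib)
   then show False using no[of "\<tau>' / \<tau>"] by (auto simp: ratio_const_def)
  qed
 qed
 obtain n where n: "n > 0" "\<tau> ^ n = 1" "\<tau>' ^ n = 1" using common_root_order[OF B(1) const \<tau>(1,2)] by blast
 obtain d where d: "d > 0" "\<tau> ^ d = 1" "\<tau>' ^ d = 1"
  "\<And>m. \<tau> powi m = 1 ==> \<tau>' powi m = 1 ==> int d dvd m"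
  using common_order[OF n] by auto
 have "d ~= 1" using d(2) \<tau>(3) by auto
 \<comment> \<open>A joint order two would make both ratios -1, although they differ. This is where
   the bound 3 in condition (2) comes from.\<close>
 moreover have "d ~= 2"
 proof
  assume "d = 2"
  then have "\<tau> = -1" "\<tau>' = -1" using d(2,3) \<tau>(3,4) by (auto simp: power2_eq_1_iff)
  then show False using \<tau>(5) by simp
 qed
 ultimately have d3: "int d \<ge> 3" using d(1) by simp
 have norm: "norm (z powi k) = 1" if "z ^ n = 1" for z :: complex and k
 proof -
  have "norm z = 1" using power_eq_1_iff[OF that] n(1) by simp
  then show ?thesis by (simp add: norm_power_int)
 qed
 define p where "p = cnj u * v"
 have p: "p ~= 0" using nz by (simp add: p_def)
 define X where "X k = \<tau> powi k" for k
 have nX: "norm (X k) = 1" for k unfolding X_def by (rule norm[OF n(2)])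
 \<comment> \<open>Law of cosines: since \<open>X k\<close> and \<open>\<tau>' powi k\<close> have
   norm one, |u + v X| = |w| fixes the real part of \<open>p * X k\<close>.\<close>
 define \<rho> where "\<rho> = ((norm w)\<^sup>2 - (norm u)\<^sup>2 - (norm v)\<^sup>2) / 2"
 have re: "Re (p * X k) = \<rho>" if "k \<in> B2" for k
 proof -
  have "u + v * X k = - (w * \<tau>' powi k)" using rel(1)[OF that] by (simp add: X_def eq_neg_iff_add_eq_0)
  then have "norm (u + v * X k) = norm w" using norm[OF n(3), of k] by (simp add: norm_mult)
  then have "(norm (u + v * X k))\<^sup>2 = (norm w)\<^sup>2" by simp
  moreover have "(norm (u + v * X k))\<^sup>2 = (norm u)\<^sup>2 + (norm (v * X k))\<^sup>2 + 2 * Re (p * X k)"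
   unfolding cmod_power2 by (simp add: p_def algebra_simps power2_eq_square)
  moreover have "norm (v * X k) = norm v" using nX[of k] by (simp add: norm_mult)
  ultimately show ?thesis by (simp add: \<rho>_def)
 qed
 obtain k1 where k1: "k1 \<in> B2" using B(2) by blast
 \<comment> \<open>The mirror image: the same real part of \<open>p * X\<close> and the opposite
   imaginary part. Hence \<open>X\<close> takes at most two values on \<open>B2\<close>, and these
   define the splitting.\<close>
 define X' where "X' = cnj (p * X k1) / p"
 have two: "X k = X k1 \<or> X k = X'" if "k \<in> B2" for k
 proof -
  have "(norm (p * X k))\<^sup>2 = (norm (p * X k1))\<^sup>2" using nX by (simp add: norm_mult)
  then have "(Im (p * X k))\<^sup>2 = (Im (p * X k1))\<^sup>2"
   unfolding cmod_power2 using re[OF that] re[OF k1] by simp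
  then have "Im (p * X k) = Im (p * X k1) \<or> Im (p * X k) = - Im (p * X k1)" by (simp add: power2_eq_iff)
  then have "p * X k = p * X k1 \<or> p * X k = cnj (p * X k1)"
   using re[OF that] re[OF k1] by (auto simp: complex_eq_iff)
  then show ?thesis using p by (auto simp: X'_def field_simps)
 qed
 define B' where "B' = {k \<in> B2. X k = X k1}"
 \<comment> \<open>Equal values of \<open>X\<close> also give equal powers of \<tau>' through the
   relation, because \<open>w\<close> is nonzero; the difference is then divisible by the joint
   order.\<close>
 have dvd: "int d dvd k - l" if "k \<in> B2" "l \<in> B2" "X k = X l" for k l
 proof (rule d(4))
  show "\<tau> powi (k - l) = 1" using that(3) \<tau>(1) by (simp add: X_def power_int_diff)
  have "w * \<tau>' powi k = w * \<tau>' powi l"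
   using rel(1)[OF that(1)] rel(1)[OF that(2)] that(3) unfolding X_def by (metis add_left_cancel)
  then show "\<tau>' powi (k - l) = 1" using nz \<tau>(2) by (simp add: power_int_diff)
 qed
 have "B2 - B' ~= {}"
 proof
  assume "B2 - B' = {}"
  then have "ratio_const \<tau> B2" by (auto simp: ratio_const_def B'_def X_def)
  then show False using no[of \<tau>] by simp
 qed
 moreover have "shiftable (int d) B'" by (intro shiftableI dvd) (auto simp: B'_def)
 moreover have "shiftable (int d) (B2 - B')"
 proof (intro shiftableI dvd)
  fix k l assume "k \<in> B2 - B'" "l \<in> B2 - B'"
  then show "X k = X l" using two[of k] two[of l] by (auto simp: B'_def)
 qed auto
 moreover have "shiftable (int d) B1"
  by (intro shiftableI d(4) ratio_const_power[OF const(1) \<tau>(1)] ratio_const_power[OF const(2) \<tau>(2)])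
 moreover have "B' ~= {}" using k1 by (auto simp: B'_def)
 moreover have "B2 = B' \<union> (B2 - B')" "B' \<inter> (B2 - B') = {}" by (auto simp: B'_def)
 ultimately have "split_sublattice B2 B1" unfolding split_sublattice_def using d3 by blast
 then show ?thesis by simp
qed simp

section \<open>Bivariate polynomials\<close>

definition eval2 :: "complex poly poly => complex => complex => complex" where
 "eval2 P s t = poly (map_poly (\<lambda>p. poly p s) P) t"

lemma eval2_alt: "eval2 P s t = poly (poly P [:t:]) s"
 unfolding eval2_def by (induction P) (auto simp: map_poly_pCons)

lemma eval2_mult: "eval2 (P * Q) s t = eval2 P s t * eval2 Q s t"
 and eval2_add: "eval2 (P + Q) s t = eval2 P s t + eval2 Q s t"
 and eval2_diff: "eval2 (P - Q) s t = eval2 P s t - eval2 Q s t"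
 and eval2_power: "eval2 (P ^ n) s t = eval2 P s t ^ n"
 and eval2_smult: "eval2 (smult a P) s t = poly a s * eval2 P s t"
 and eval2_zero: "eval2 0 s t = 0"
 and eval2_one: "eval2 1 s t = 1"
 and eval2_fst: "eval2 [:[:0, 1:]:] s t = s"
 and eval2_snd: "eval2 [:0, 1:] s t = t"
 by (simp_all add: eval2_alt)

text \<open>A projection of a constructible set to a line. For fixed \<open>s\<close>, all roots of
  \<open>P\<close> are roots of \<open>H\<close> if and only if \<open>P\<close> divides
  \<open>H ^ degree P\<close>, by the univariate Nullstellensatz. Pseudo-division by
  \<open>P\<close> turns this, outside finitely many \<open>s\<close>, into the vanishing of the
  specialised remainder \<open>R\<close>, which holds always or finitely often.\<close>

lemma finite_or_cofinite_single:
 fixes P H :: "complex poly poly"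
 defines "S \<equiv> {s. \<exists>t. eval2 P s t = 0 \<and> eval2 H s t ~= 0}"
 shows "finite S \<or> finite (- S)"
proof (cases "P = 0")
 case True
 show ?thesis
 proof (cases "H = 0")
  case False
  have "- S \<subseteq> {s. poly (lead_coeff H) s = 0}"
  proof
   fix s assume "s \<in> - S"
   then have "\<forall>t. poly (map_poly (\<lambda>p. poly p s) H) t = 0"
    by (simp add: S_def True eval2_zero) (simp add: eval2_def)
   then have "map_poly (\<lambda>p. poly p s) H = 0" using poly_all_0_iff_0 by blast
   then have "poly (coeff H (degree H)) s = 0" by (metis coeff_0 coeff_map_poly poly_0)
   then show "s \<in> {s. poly (lead_coeff H) s = 0}" by simp
  qed
  moreover have "finite {s. poly (lead_coeff H) s = 0}" using False by (intro poly_roots_finite) simp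
  ultimately show ?thesis using finite_subset by blast
 qed (simp add: S_def eval2_zero)
next
 case False
 define R where "R = pseudo_mod (H ^ degree P) P"
 obtain a Q where aQ: "a ~= 0" "smult a (H ^ degree P) = P * Q + R" and R: "R = 0 \<or> degree R < degree P"
  using pseudo_mod[OF False, of "H ^ degree P"] unfolding R_def by blast
 define F where "F = {s. poly a s = 0} \<union> {s. poly (lead_coeff P) s = 0}"
 have finF: "finite F" unfolding F_def using aQ(1) False by (auto intro: poly_roots_finite)
 have *: "s \<in> - S \<longleftrightarrow> map_poly (\<lambda>p. poly p s) R = 0" if s: "s \<notin> F" for s
 proof -
  let ?e = "map_poly (\<lambda>p. poly p s)"
  have lead: "poly (lead_coeff P) s ~= 0" "poly a s ~= 0" using s by (auto simp: F_def)
  have degP: "degree (?e P) = degree P"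
   by (rule map_poly_degree_eq) (use lead in auto)
  have eP: "?e P ~= 0" using lead(1) by (metis coeff_0 coeff_map_poly poly_0)
  have "s \<in> - S \<longleftrightarrow> (\<forall>t. poly (?e P) t = 0 --> poly (?e H) t = 0)"
   by (auto simp: S_def eval2_def)
  also have "\<dots> \<longleftrightarrow> ?e P dvd (?e H) ^ degree P"
   using nullstellensatz_univariate[of "?e P" "?e H"] eP by (simp add: degP)
  also have "\<dots> \<longleftrightarrow> ?e P dvd smult (poly a s) ((?e H) ^ degree P)"
   using lead(2) by (simp add: dvd_smult_iff)
  also have "smult (poly a s) ((?e H) ^ degree P) = ?e P * ?e Q + ?e R"
  proof -
   have "poly (smult (poly a s) (?e H ^ degree P)) t = poly (?e P * ?e Q + ?e R) t" for t
    using arg_cong[OF aQ(2), of "\<lambda>P. eval2 P s t"]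
    by (simp add: eval2_smult eval2_power eval2_add eval2_mult) (simp add: eval2_def)
   then show ?thesis by (intro poly_eq_poly_eq_iff[THEN iffD1] ext)
  qed
  also have "?e P dvd ?e P * ?e Q + ?e R \<longleftrightarrow> ?e P dvd ?e R" by (simp add: dvd_add_right_iff)
  also have "\<dots> \<longleftrightarrow> ?e R = 0"
  proof
   assume dvd: "?e P dvd ?e R"
   show "?e R = 0"
   proof (rule ccontr)
    assume "?e R ~= 0"
    then have "degree P \<le> degree (?e R)" using dvd_imp_degree_le[OF dvd] degP by simp
    also have "\<dots> \<le> degree R" by (rule map_poly_degree_leq)
    finally show False using R \<open>?e R ~= 0\<close> by auto
   qed
  qed simp
  finally show ?thesis .
 qed
 show ?thesis
 proof (cases "R = 0")
  case True
  then have "S \<subseteq> F" using * by auto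
  then show ?thesis using finF finite_subset by blast
 next
  case nz: False
  have "- S \<subseteq> F \<union> {s. poly (lead_coeff R) s = 0}"
  proof
   fix s assume s: "s \<in> - S"
   show "s \<in> F \<union> {s. poly (lead_coeff R) s = 0}"
   proof (cases "s \<in> F")
    case False
    then have "map_poly (\<lambda>p. poly p s) R = 0" using * s by blast
    then show ?thesis by (metis (mono_tags) UnI2 coeff_0 coeff_map_poly mem_Collect_eq poly_0)
   qed simp
  qed
  moreover have "finite {s. poly (lead_coeff R) s = 0}" using nz by (intro poly_roots_finite) simp
  ultimately show ?thesis using finF finite_subset by blast
 qed
qed

text \<open>Euclid's algorithm with pseudo-remainders reduces two equations to one; each step
  disregards the finitely many zeros of a factor \<open>a\<close>.\<close>

lemma finite_or_cofinite:
 fixes P Q H :: "complex poly poly"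
 shows "finite {s. \<exists>t. eval2 P s t = 0 \<and> eval2 Q s t = 0 \<and> eval2 H s t ~= 0} \<or>
  finite (- {s. \<exists>t. eval2 P s t = 0 \<and> eval2 Q s t = 0 \<and> eval2 H s t ~= 0})"
proof (induction "if Q = 0 then 0 else Suc (degree Q)" arbitrary: P Q rule: less_induct)
 case less
 let ?S = "\<lambda>P Q. {s. \<exists>t. eval2 P s t = 0 \<and> eval2 Q s t = 0 \<and> eval2 H s t ~= 0}"
 show ?case
 proof (cases "Q = 0")
  case True
  then show ?thesis using finite_or_cofinite_single[of P H] by (simp add: eval2_zero)
 next
  case False
  define R where "R = pseudo_mod P Q"
  obtain a D where aD: "a ~= 0" "smult a P = Q * D + R" and R: "R = 0 \<or> degree R < degree Q"
   using pseudo_mod[OF False, of P] unfolding R_def by blast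
  have IH: "finite (?S Q R) \<or> finite (- ?S Q R)"
   using less[of R Q] R False by auto
  define F where "F = {s. poly a s = 0}"
  have finF: "finite F" unfolding F_def using aD(1) by (rule poly_roots_finite)
  have *: "s \<in> ?S P Q \<longleftrightarrow> s \<in> ?S Q R" if "s \<notin> F" for s
  proof -
   have "poly a s * eval2 P s t = eval2 Q s t * eval2 D s t + eval2 R s t" for t
    using arg_cong[OF aD(2), of "\<lambda>P. eval2 P s t"] by (simp add: eval2_smult eval2_add eval2_mult)
   then have "eval2 P s t = 0 \<and> eval2 Q s t = 0 \<longleftrightarrow> eval2 Q s t = 0 \<and> eval2 R s t = 0" for t
    using that unfolding F_def by (metis (mono_tags) add_0 add.right_neutral mem_Collect_eq mult_eq_0_iff mult_zero_left)
   then show ?thesis by blast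
  qed
  have "?S P Q \<subseteq> ?S Q R \<union> F" "- ?S P Q \<subseteq> - ?S Q R \<union> F" using * by blast+
  then show ?thesis using IH finF by (meson finite_UnI finite_subset)
 qed
qed

text \<open>The sum in powers of \<open>1 / s\<close> has derivative 1 at the origin, hence is
  injective near it, so two different \<open>s\<close> and \<open>t\<close> cannot both be large.
  The sum in powers of \<open>s\<close> tends to infinity, so a large \<open>s\<close> forces a
  large \<open>t\<close>.\<close>

lemma large_roots_separate:
 assumes "n \<ge> 2" "n' \<ge> 2"
 shows "\<exists>R. \<forall>s t :: complex. s ~= 0 \<and> t ~= 0 \<and> s ~= t \<and> (\<Sum>j<n'. s ^ j) = (\<Sum>j<n'. t ^ j) \<and>
  (\<Sum>j<n. (1 / s) ^ j) = (\<Sum>j<n. (1 / t) ^ j) --> norm s \<le> R"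
proof -
 define q where "q x = (\<Sum>j<n. x ^ j)" for x :: complex
 define p where "p x = (\<Sum>j<n'. x ^ j)" for x :: complex
 have "(q has_field_derivative (\<Sum>j<n. of_nat j * 0 ^ (j - 1))) (at 0)"
  unfolding q_def[abs_def] by (auto intro!: derivative_eq_intros)
 also have "(\<Sum>j<n. of_nat j * 0 ^ (j - 1) :: complex) = (\<Sum>j\<in>{1}. of_nat j * 0 ^ (j - 1))"
  using assms(1) by (intro sum.mono_neutral_right) (auto simp: power_0_left)
 finally have "deriv q 0 = 1" by (intro DERIV_imp_deriv) simp
 moreover have "q holomorphic_on UNIV" unfolding q_def[abs_def] by (intro holomorphic_intros)
 ultimately obtain r where r: "r > 0" "inj_on q (ball 0 r)"
  using has_complex_derivative_locally_injective[of q UNIV 0] by auto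
 \<comment> \<open>Bounds the second sum on the disc of radius \<open>1 / r\<close>, outside which
   the reciprocals lie in the ball of injectivity.\<close>
 define B where "B = (\<Sum>j<n'. (1 / r) ^ j)"
 have n': "{..<n'} = {..n' - 1}" using assms(2) by auto
 have "\<forall>\<^sub>F z in at_infinity. norm (p z) \<ge> B + 1"
 proof -
  have "\<exists>k. k ~= 0 \<and> k \<le> n' - 1 \<and> (1 :: complex) ~= 0" using assms(2) by (intro exI[of _ 1]) auto
  from polyfun_extremal[where c = "\<lambda>_. 1 :: complex", OF this, of "B + 1"] show ?thesis
   unfolding p_def n' by simp
 qed
 then obtain b where b: "\<And>z. norm z \<ge> b ==> norm (p z) \<ge> B + 1"
  unfolding eventually_at_infinity by blast
 show ?thesis
 proof (intro exI[of _ "max b (1 / r)"] allI impI, rule ccontr)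
  fix s t :: complex
  assume st: "s ~= 0 \<and> t ~= 0 \<and> s ~= t \<and> (\<Sum>j<n'. s ^ j) = (\<Sum>j<n'. t ^ j) \<and>
    (\<Sum>j<n. (1 / s) ^ j) = (\<Sum>j<n. (1 / t) ^ j)" and big: "\<not> norm s \<le> max b (1 / r)"
  have t: "norm t > 1 / r"
  proof (rule ccontr)
   assume "\<not> ?thesis"
   then have "norm (p t) \<le> B" unfolding p_def B_def
    by (intro order_trans[OF norm_sum] sum_mono) (auto simp: norm_power intro!: power_mono)
   moreover have "p s = p t" using st by (simp add: p_def)
   moreover have "b \<le> norm s" using big by linarith
   ultimately show False using b[of s] by simp
  qed
  have ball: "1 / z \<in> ball 0 r" if "norm z > 1 / r" for z :: complex
  proof -
   have "0 < norm z" using that r by (meson divide_pos_pos less_trans zero_less_one)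
   then show ?thesis using that r by (simp add: norm_divide field_simps)
  qed
  have "1 / s = 1 / t"
  proof (rule inj_onD[OF r(2)])
   show "q (1 / s) = q (1 / t)" using st by (simp add: q_def)
   show "1 / s \<in> ball 0 r" using big by (intro ball) linarith
  qed (rule ball[OF t])
  then show False using st by simp
 qed
qed

text \<open>The set is a projected constructible set, hence finite or cofinite, and it is bounded;
  together these give finiteness without any elimination theory for the two minors. Divided by
  \<open>(s - 1) * (t - 1)\<close>, the minor at exponents 0, 1, \<open>n'\<close> compares
  geometric sums in \<open>s\<close> and \<open>t\<close>, and the one at 0, \<open>n - 1\<close>,
  \<open>n\<close> compares geometric sums in their inverses.\<close>

lemma finite_minor_ratios:
 assumes "n \<ge> 2" "n' \<ge> 2"
 shows "finite {s :: complex. \<exists>t. s ~= 0 \<and> t ~= 0 \<and> s ~= 1 \<and> t ~= 1 \<and> s ~= t \<and>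
  (s * t ^ n' - t * s ^ n') - (t ^ n' - t) + (s ^ n' - s) = 0 \<and>
  (s ^ (n - 1) * t ^ n - t ^ (n - 1) * s ^ n) - (t ^ n - t ^ (n - 1)) + (s ^ n - s ^ (n - 1)) = 0}" (is "finite ?Z")
proof -
 define S T where "S = ([:[:0, 1:]:] :: complex poly poly)" and "T = ([:0, 1:] :: complex poly poly)"
 define P where "P = (S * T ^ n' - T * S ^ n') - (T ^ n' - T) + (S ^ n' - S)"
 define Q where "Q = (S ^ (n - 1) * T ^ n - T ^ (n - 1) * S ^ n) - (T ^ n - T ^ (n - 1)) + (S ^ n - S ^ (n - 1))"
 define H where "H = S * T * (S - 1) * (T - 1) * (S - T)"
 have ev: "eval2 S s t = s" "eval2 T s t = t" for s t by (simp_all add: S_def T_def eval2_fst eval2_snd)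
 have Z: "?Z = {s. \<exists>t. eval2 P s t = 0 \<and> eval2 Q s t = 0 \<and> eval2 H s t ~= 0}"
  unfolding P_def Q_def H_def eval2_add eval2_diff eval2_mult eval2_power eval2_one ev by auto
 obtain R where R: "\<And>s t :: complex. s ~= 0 ==> t ~= 0 ==> s ~= t ==> (\<Sum>j<n'. s ^ j) = (\<Sum>j<n'. t ^ j) ==>
  (\<Sum>j<n. (1 / s) ^ j) = (\<Sum>j<n. (1 / t) ^ j) ==> norm s \<le> R"
  using large_roots_separate[OF assms] by blast
 have "?Z \<subseteq> cball 0 R"
 proof
  fix s assume "s \<in> ?Z"
  then obtain t where st: "s ~= 0" "t ~= 0" "s ~= 1" "t ~= 1" "s ~= t" and
   A: "(s * t ^ n' - t * s ^ n') - (t ^ n' - t) + (s ^ n' - s) = 0" and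
   B: "(s ^ (n - 1) * t ^ n - t ^ (n - 1) * s ^ n) - (t ^ n - t ^ (n - 1)) + (s ^ n - s ^ (n - 1)) = 0"
   by blast
  have "(s - 1) * (t ^ n' - 1) - (t - 1) * (s ^ n' - 1) = 0" using A by (simp add: algebra_simps)
  then have "(s - 1) * (t - 1) * ((\<Sum>j<n'. t ^ j) - (\<Sum>j<n'. s ^ j)) = 0"
   unfolding power_diff_1_eq by (simp add: algebra_simps)
  then have 1: "(\<Sum>j<n'. s ^ j) = (\<Sum>j<n'. t ^ j)" using st by simp
  obtain m where m: "n = Suc m" using assms(1) by (cases n) auto
  define u where "u = 1 / s"
  define w where "w = 1 / t"
  have us: "u * s = 1" "w * t = 1" using st by (auto simp: u_def w_def)
  have pw: "u ^ k * s ^ k = 1" "w ^ k * t ^ k = 1" for k using us by (metis power_mult_distrib power_one)+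
  \<comment> \<open>The second minor is the mirror image of the first under inversion of
    \<open>s\<close> and \<open>t\<close>; the factor \<open>u ^ n * w ^ n\<close> clears the
    positive powers.\<close>
  have "(1 - w) * (1 - u ^ n) - (1 - u) * (1 - w ^ n) =
    u ^ n * w ^ n * ((s ^ (n - 1) * t ^ n - t ^ (n - 1) * s ^ n) - (t ^ n - t ^ (n - 1)) + (s ^ n - s ^ (n - 1)))"
  proof -
   have a: "u ^ n * s ^ (n - 1) = u" "w ^ n * t ^ (n - 1) = w"
    using pw[of m] by (simp_all add: m mult.assoc)
   have "u ^ n * w ^ n * ((s ^ (n - 1) * t ^ n - t ^ (n - 1) * s ^ n) - (t ^ n - t ^ (n - 1)) + (s ^ n - s ^ (n - 1))) =
    (u ^ n * s ^ (n - 1)) * (w ^ n * t ^ n) - (w ^ n * t ^ (n - 1)) * (u ^ n * s ^ n) - u ^ n * (w ^ n * t ^ n)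
    + u ^ n * (w ^ n * t ^ (n - 1)) + w ^ n * (u ^ n * s ^ n) - w ^ n * (u ^ n * s ^ (n - 1))"
    by (simp add: algebra_simps)
   also have "\<dots> = (1 - w) * (1 - u ^ n) - (1 - u) * (1 - w ^ n)"
    unfolding a pw by (simp add: algebra_simps)
   finally show ?thesis by simp
  qed
  then have "(1 - w) * (1 - u ^ n) - (1 - u) * (1 - w ^ n) = 0" using B by simp
  then have "(1 - w) * (1 - u) * ((\<Sum>j<n. u ^ j) - (\<Sum>j<n. w ^ j)) = 0"
   unfolding one_diff_power_eq by (simp add: algebra_simps)
  moreover have "w ~= 1" "u ~= 1" using st by (auto simp: u_def w_def)
  ultimately have 2: "(\<Sum>j<n. u ^ j) = (\<Sum>j<n. w ^ j)" by simp
  show "s \<in> cball 0 R" using R[OF st(1,2,5) 1 2[unfolded u_def w_def]] by simp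
 qed
 then have "bounded ?Z" using bounded_cball bounded_subset by blast
 moreover have "finite ?Z \<or> finite (- ?Z)" unfolding Z by (rule finite_or_cofinite)
 moreover have "bounded X ==> finite X \<or> finite (- X) ==> finite X" for X :: "complex set"
  using finite_imp_bounded[of "- X"] not_bounded_UNIV[where 'a = complex] bounded_Un[of X "- X"]
  unfolding Compl_partition by blast
 ultimately show ?thesis by blast
qed

section \<open>Minors at the two ends of the exponent sets\<close>

lemma right_gap_elements:
 assumes "finite B" "card B \<ge> 3" "\<not> right_gap B > 1"
 obtains k M where "k \<in> B" "M \<in> B" "M - 1 \<in> B" "k < M - 1"
proof -
 let ?M = "Max B"
 have ne: "B ~= {}" using assms(2) by auto
 have M: "?M \<in> B" using assms(1) ne by simp
 have "card (B - {?M}) \<ge> 2" using assms M by simp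
 then have ne': "B - {?M} ~= {}" by (metis card.empty not_numeral_le_zero)
 have M': "Max (B - {?M}) \<in> B - {?M}" using assms(1) ne' by (intro Max_in) auto
 then have "Max (B - {?M}) < ?M" using assms(1) Max_ge[of B "Max (B - {?M})"] by (simp add: order_less_le)
 then have eq: "Max (B - {?M}) = ?M - 1" using assms(3) by (simp add: right_gap_def)
 have "card (B - {?M} - {?M - 1}) \<ge> 1" using assms M M' eq by simp
 then obtain k where k: "k \<in> B - {?M} - {?M - 1}" by (metis all_not_in_conv card.empty not_one_le_zero)
 then have "k \<le> ?M - 1" using Max_ge[of "B - {?M}" k] assms(1) eq by simp
 then show ?thesis using that[of k ?M] k M M' eq by force
qed

lemma left_gap_elements:
 assumes "finite B" "card B \<ge> 3" "\<not> left_gap B > 1"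
 obtains l m where "m \<in> B" "m + 1 \<in> B" "l \<in> B" "m + 1 < l"
proof -
 let ?m = "Min B"
 have ne: "B ~= {}" using assms(2) by auto
 have m: "?m \<in> B" using assms(1) ne by simp
 have "card (B - {?m}) \<ge> 2" using assms m by simp
 then have ne': "B - {?m} ~= {}" by (metis card.empty not_numeral_le_zero)
 have m': "Min (B - {?m}) \<in> B - {?m}" using assms(1) ne' by (intro Min_in) auto
 then have "?m < Min (B - {?m})" using assms(1) Min_le[of B "Min (B - {?m})"] by (simp add: order_less_le)
 then have eq: "Min (B - {?m}) = ?m + 1" using assms(3) by (simp add: left_gap_def)
 have "card (B - {?m} - {?m + 1}) \<ge> 1" using assms m m' eq by simp
 then obtain l where l: "l \<in> B - {?m} - {?m + 1}" by (metis all_not_in_conv card.empty not_one_le_zero)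
 then have "?m + 1 \<le> l" using Min_le[of "B - {?m}" l] assms(1) eq by simp
 then show ?thesis using that[of ?m l] l m m' eq by force
qed

text \<open>A right gap of one supplies the exponents \<open>k\<close>, \<open>M - 1\<close>,
  \<open>M\<close>, and a left gap of one supplies \<open>m\<close>, \<open>m + 1\<close>,
  \<open>l\<close>. After scaling the first root to 1 these are the two minors of the finiteness
  statement; \<open>Br\<close> and \<open>Bl\<close> may be different sets.\<close>

lemma finite_dependent_ratios:
 assumes Br: "finite Br" "card Br \<ge> 3" "\<not> right_gap Br > 1" and Bl: "finite Bl" "card Bl \<ge> 3" "\<not> left_gap Bl > 1"
 shows "\<exists>F. finite F \<and> (\<forall>z1 z2 z3 :: complex. z1 ~= 0 --> z2 ~= 0 --> z3 ~= 0 --> z1 ~= z2 --> z1 ~= z3 --> z2 ~= z3 -->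
  \<not> indep3 (\<lambda>k. z1 powi k) (\<lambda>k. z2 powi k) (\<lambda>k. z3 powi k) Br -->
  \<not> indep3 (\<lambda>k. z1 powi k) (\<lambda>k. z2 powi k) (\<lambda>k. z3 powi k) Bl --> z2 / z1 \<in> F)"
proof -
 obtain k M where kM: "k \<in> Br" "M \<in> Br" "M - 1 \<in> Br" "k < M - 1" using right_gap_elements[OF Br] .
 obtain l m where lm: "m \<in> Bl" "m + 1 \<in> Bl" "l \<in> Bl" "m + 1 < l" using left_gap_elements[OF Bl] .
 define n where "n = nat (M - k)"
 define n' where "n' = nat (l - m)"
 have n: "n \<ge> 2" "M = k + int n" "M - 1 = k + int (n - 1)" using kM by (auto simp: n_def)
 have n': "n' \<ge> 2" "l = m + int n'" "m + 1 = m + int 1" using lm by (auto simp: n'_def)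
 let ?Z = "{s :: complex. \<exists>t. s ~= 0 \<and> t ~= 0 \<and> s ~= 1 \<and> t ~= 1 \<and> s ~= t \<and>
  (s * t ^ n' - t * s ^ n') - (t ^ n' - t) + (s ^ n' - s) = 0 \<and>
  (s ^ (n - 1) * t ^ n - t ^ (n - 1) * s ^ n) - (t ^ n - t ^ (n - 1)) + (s ^ n - s ^ (n - 1)) = 0}"
 have "z2 / z1 \<in> ?Z"
  if z: "z1 ~= 0" "z2 ~= 0" "z3 ~= 0" "z1 ~= z2" "z1 ~= z3" "z2 ~= z3" and
   dep: "\<not> indep3 (\<lambda>k. z1 powi k) (\<lambda>k. z2 powi k) (\<lambda>k. z3 powi k) Br"
    "\<not> indep3 (\<lambda>k. z1 powi k) (\<lambda>k. z2 powi k) (\<lambda>k. z3 powi k) Bl" for z1 z2 z3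
 proof -
  have scaled: "\<not> indep3 (\<lambda>k. 1 powi k) (\<lambda>k. (z2 / z1) powi k) (\<lambda>k. (z3 / z1) powi k) B"
   if dep: "\<not> indep3 (\<lambda>k. z1 powi k) (\<lambda>k. z2 powi k) (\<lambda>k. z3 powi k) B" for B
  proof -
   obtain u v w where uvw: "\<And>k. k \<in> B ==> u * z1 powi k + v * z2 powi k + w * z3 powi k = 0"
    "\<not> (u = 0 \<and> v = 0 \<and> w = 0)" using dep unfolding indep3_def by blast
   have "u * 1 powi k + v * (z2 / z1) powi k + w * (z3 / z1) powi k = 0" if "k \<in> B" for k
    using uvw(1)[OF that] z(1) by (simp add: power_int_divide_distrib field_simps)
   then show ?thesis using uvw(2) unfolding indep3_def by blast
  qed
  define s where "s = z2 / z1"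
  define t where "t = z3 / z1"
  have st: "s ~= 0" "t ~= 0" "s ~= 1" "t ~= 1" "s ~= t" using z by (auto simp: s_def t_def)
  have "(s ^ 1 * t ^ n' - t ^ 1 * s ^ n') - (1 ^ 1 * t ^ n' - t ^ 1 * 1 ^ n') + (1 ^ 1 * s ^ n' - s ^ 1 * 1 ^ n') = 0"
   by (rule vandermonde_minor_zero[OF scaled[OF dep(2), folded s_def t_def] _ _ _ lm(1,2,3) n'(3,2)]) (use st in auto)
  moreover have "(s ^ (n - 1) * t ^ n - t ^ (n - 1) * s ^ n) - (1 ^ (n - 1) * t ^ n - t ^ (n - 1) * 1 ^ n) +
    (1 ^ (n - 1) * s ^ n - s ^ (n - 1) * 1 ^ n) = 0"
   by (rule vandermonde_minor_zero[OF scaled[OF dep(1), folded s_def t_def] _ _ _ kM(1,3,2) n(3,2)]) (use st in auto)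
  ultimately show ?thesis unfolding s_def[symmetric] using st by (intro CollectI exI[of _ t]) simp
 qed
 then show ?thesis using finite_minor_ratios[OF n(1) n'(1)] by blast
qed

section \<open>Smoothness of the spatial curve\<close>

lemma common_denominator_rat:
 fixes X :: "rat set"
 assumes "finite X"
 shows "\<exists>N::nat. N > 0 \<and> (\<forall>x\<in>X. \<exists>m::int. of_nat N * x = of_int m)"
 using assms
proof (induction X rule: finite_induct)
 case (insert x X)
 then obtain N where N: "N > 0" "\<forall>x\<in>X. \<exists>m::int. of_nat N * x = of_int m" by blast
 obtain a b where ab: "x = of_int a / of_int b" "b > 0" by (metis quotient_of_denom_pos quotient_of_div surj_pair)
 show ?case
 proof (intro exI[of _ "N * nat b"] conjI ballI)
  fix y assume "y \<in> insert x X"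
  then show "\<exists>m::int. of_nat (N * nat b) * y = of_int m"
  proof
   assume "y = x"
   then show ?thesis using ab by (intro exI[of _ "int N * a"]) simp
  next
   assume "y \<in> X"
   then obtain m where "of_nat N * y = of_int m" using N by blast
   then have "of_nat (N * nat b) * y = of_int (b * m)" using ab(2) by (simp add: mult_ac)
   then show ?thesis by blast
  qed
 qed (use N ab in simp)
qed (auto intro: exI[of _ 1])

text \<open>Extending \<open>B\<close> to a basis of the whole space turns coordinates in the span
  into linear forms, so that they can be applied to a vector-valued equation componentwise.\<close>

lemma dual_functionals:
 fixes B :: "(rat^'d) set"
 assumes "vec.independent B"
 shows "\<exists>l. \<forall>w\<in>vec.span B. \<forall>b\<in>B. (\<Sum>d\<in>UNIV. l b d * vec_nth w d) = vec.representation B w b"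
proof -
 define E where "E = vec.extend_basis B"
 have E: "vec.independent E" "B \<subseteq> E" "vec.span E = UNIV"
  using assms by (simp_all add: E_def vec.independent_extend_basis vec.extend_basis_superset)
 define l where "l b d = vec.representation E (axis d 1) b" for b d
 have "(\<Sum>d\<in>UNIV. l b d * vec_nth w d) = vec.representation E w b" for w b
 proof -
  have w: "w = (\<Sum>d\<in>UNIV. vec_nth w d *s axis d 1)" by (simp add: basis_expansion)
  have "vec.representation E (\<Sum>d\<in>S. vec_nth w d *s axis d 1) b = (\<Sum>d\<in>S. l b d * vec_nth w d)" if "finite S" for S
   using that
  proof (induction S rule: finite_induct)
   case empty
   then show ?case by (simp add: vec.representation_zero)
  next
   case (insert x F)
   then show ?case using E
    by (simp add: vec.representation_add vec.representation_scale l_def mult.commute)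
  qed
  from this[of UNIV] show ?thesis using w by simp
 qed
 moreover have "vec.representation E w b = vec.representation B w b" if "w \<in> vec.span B" for w b
  using vec.representation_extend[OF E(1) that E(2)] by simp
 ultimately show ?thesis by (intro exI[of _ l]) simp
qed

text \<open>The linear system \<open>\<Sum> c i * Q i * v i = 0\<close>, whose weights are characters
 \<open>Q i = exp (v i \<bullet> \<Xi>)\<close>, has as many independent equations as the dimension \<open>r\<close> of the span of the \<open>v i\<close>.
 The weights depend on \<open>r\<close> parameters, and only on \<open>r - 1\<close> up to a common factor because the \<open>v i\<close> lie in an
 affine hyperplane.\<close>

lemma generic_no_singular_weights:
 fixes v :: "'i => rat^'d" and u :: "rat^'d"
 assumes I: "finite I" "I0 \<subseteq> I" "I0 ~= {}" and u: "\<And>i. i \<in> I0 ==> (\<Sum>d\<in>UNIV. vec_nth u d * vec_nth (v i) d) = 1"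
 shows "holds_generically I (\<lambda>c :: 'i => complex. \<not> (\<exists>\<Xi> :: 'd => complex. \<forall>d.
  (\<Sum>i\<in>I0. c i * exp (\<Sum>d\<in>UNIV. of_rat (vec_nth (v i) d) * \<Xi> d) * of_rat (vec_nth (v i) d)) = 0))"
proof -
 have finI0: "finite I0" using I finite_subset by blast
 obtain B where B: "B \<subseteq> v ` I0" "vec.independent B" "v ` I0 \<subseteq> vec.span B"
  using vec.maximal_independent_subset by blast
 have finB: "finite B" using B(1) finI0 finite_subset by blast
 have "\<forall>b\<in>B. \<exists>i. i \<in> I0 \<and> v i = b" using B(1) by auto
 from bchoice[OF this] obtain idx where idx: "\<And>b. b \<in> B ==> idx b \<in> I0" "\<And>b. b \<in> B ==> v (idx b) = b" by blast
 have inj: "inj_on idx B" using idx(2) by (metis inj_onI)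
 define K where "K = idx ` B"
 have K: "K \<subseteq> I0" using idx by (auto simp: K_def)
 have vidx: "v i \<in> B" "idx (v i) = i" if "i \<in> K" for i using that idx by (auto simp: K_def)
 define \<phi> where "\<phi> i b = vec.representation B (v i) b" for i b
 have span: "v i \<in> vec.span B" if "i \<in> I0" for i using that B(3) by blast
 obtain l where l: "\<And>w b. w \<in> vec.span B ==> b \<in> B ==> (\<Sum>d\<in>UNIV. l b d * vec_nth w d) = vec.representation B w b"
  using dual_functionals[OF B(2)] by blast
 have rep: "v i = (\<Sum>b\<in>B. \<phi> i b *s b)" if "i \<in> I0" for i
  unfolding \<phi>_def using vec.sum_representation_eq[OF B(2) span[OF that] finB order_refl] by simp
 have repd: "vec_nth (v i) d = (\<Sum>b\<in>B. \<phi> i b * vec_nth b d)" if "i \<in> I0" for i d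
  by (subst rep[OF that]) (simp add: sum_component)
 \<comment> \<open>The coordinates add up to one because both \<open>v i\<close> and the basis
   vectors lie on the affine hyperplane given by \<open>u\<close>. This produces the common factor
   of the weights.\<close>
 have \<phi>1: "(\<Sum>b\<in>B. \<phi> i b) = 1" if "i \<in> I0" for i
 proof -
  have "1 = (\<Sum>d\<in>UNIV. vec_nth u d * (\<Sum>b\<in>B. \<phi> i b * vec_nth b d))" using u[OF that] repd[OF that] by simp
  also have "\<dots> = (\<Sum>b\<in>B. \<phi> i b * (\<Sum>d\<in>UNIV. vec_nth u d * vec_nth b d))"
   unfolding sum_distrib_left by (subst sum.swap) (simp add: mult_ac)
  also have "\<dots> = (\<Sum>b\<in>B. \<phi> i b * 1)"
  proof (intro sum.cong refl arg_cong2[of _ _ _ _ times])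
   fix b assume "b \<in> B"
   then show "(\<Sum>d\<in>UNIV. vec_nth u d * vec_nth b d) = 1" using u[OF idx(1)] idx(2) by force
  qed
  finally show ?thesis by simp
 qed
 have "B ~= {}" using \<phi>1 I(3) by fastforce
 then obtain b0 where b0: "b0 \<in> B" by blast
 \<comment> \<open>A common denominator \<open>N\<close> makes all coordinates integral, so that the
   weights become Laurent monomials in \<open>N\<close>-th roots of the basic weights.\<close>
 have "finite ((\<lambda>(i, b). \<phi> i b) ` (I0 \<times> B))" using finI0 finB by simp
 from common_denominator_rat[OF this] obtain N :: nat where N: "N > 0"
  "\<And>i b. i \<in> I0 ==> b \<in> B ==> \<exists>m::int. of_nat N * \<phi> i b = of_int m" by fastforce
 define m where "m i b = (SOME m::int. of_nat N * \<phi> i b = of_int m)" for i b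
 have m: "of_nat N * \<phi> i b = of_int (m i b)" if "i \<in> I0" "b \<in> B" for i b
  unfolding m_def by (rule someI_ex[OF N(2)[OF that]])
 define U where "U = {s :: 'i => complex. \<forall>k\<in>K. s k ~= 0}"
 define W where "W s i = (\<Prod>b\<in>B. s (idx b) powi m i b)" for s :: "'i => complex" and i
 \<comment> \<open>For \<open>i\<close> in \<open>K\<close> the coordinates are Kronecker deltas, so
   the equation belonging to \<open>v i\<close> contains the coefficients at \<open>K\<close> only
   through \<open>c i\<close>, with weight \<open>s i ^ N\<close>, and can be solved for it. The
   slots \<open>s i\<close> with \<open>i\<close> in \<open>K\<close> are thus free to hold the
   weight parameters.\<close>
 define c' where "c' i s = (if i \<in> K then - (\<Sum>j\<in>I0 - K. s j * W s j * of_rat (\<phi> j (v i))) / s i ^ N else s i)" for i s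
 have reg: "c' i \<in> regular_funs I U" if i: "i \<in> I" for i
 proof (cases "i \<in> K")
  case True
  have "(\<lambda>s. - (\<Sum>j\<in>I0 - K. s j * (\<Prod>b\<in>B. s (idx b) powi m j b) * of_rat (\<phi> j (v i))) / s i ^ N) \<in> regular_funs I U"
   using True K I(2) i idx(1)
   by (intro regular_funs_divide regular_funs_uminus regular_funs_sum regular_funs_mult regular_funs_const
      regular_funs_prod regular_funs_power_int regular_funs_power regular_funs_var)
     (auto simp: U_def K_def)
  then show ?thesis using True unfolding c'_def[abs_def] W_def by simp
 next
  case False
  then show ?thesis unfolding c'_def[abs_def] using i by (simp add: regular_funs_var)
 qed
 have i0: "idx b0 \<in> I" using idx(1)[OF b0] I(2) by blast
 \<comment> \<open>Removing the common factor normalises one weight parameter to 1. This is the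
   hypersurface that makes the count strict.\<close>
 have "\<exists>P\<in>polynomial_funs I. (\<exists>x. P x ~= 0) \<and> (\<forall>s\<in>U. s (idx b0) - 1 = 0 --> P (\<lambda>i. c' i s) = 0)"
  by (rule hypersurface_image[where V = I and ?s0.0 = "\<lambda>_. 0"])
    (use I(1) i0 reg in \<open>auto intro!: polynomial_funs_intros\<close>)
 then obtain P where P: "P \<in> polynomial_funs I" "\<exists>x. P x ~= 0"
  "\<And>s. s \<in> U ==> s (idx b0) = 1 ==> P (\<lambda>i. c' i s) = 0" by auto
 have "P c = 0" if bad: "\<And>d. (\<Sum>i\<in>I0. c i * exp (\<Sum>d\<in>UNIV. of_rat (vec_nth (v i) d) * \<Xi> d) * of_rat (vec_nth (v i) d)) = 0"
  for c :: "'i => complex" and \<Xi> :: "'d => complex"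
 proof -
  define E where "E b = (\<Sum>d\<in>UNIV. of_rat (vec_nth b d) * \<Xi> d)" for b
  \<comment> \<open>An \<open>N\<close>-th root of the ratio of the weight of \<open>b\<close> to
    that of \<open>b0\<close>, chosen through the exponent.\<close>
  define \<sigma> where "\<sigma> b = exp ((E b - E b0) / of_nat N)" for b
  define s where "s i = (if i \<in> K then \<sigma> (v i) else c i)" for i
  have sidx: "s (idx b) = \<sigma> b" if "b \<in> B" for b using that idx(2) by (auto simp: s_def K_def)
  have sU: "s \<in> U" by (auto simp: U_def s_def \<sigma>_def)
  have s0: "s (idx b0) = 1" using sidx[OF b0] by (simp add: \<sigma>_def)
  have Q: "exp (E (v i)) = exp (E b0) * W s i" if i: "i \<in> I0" for i
  proof -
   have "E (v i) = (\<Sum>d\<in>UNIV. (\<Sum>b\<in>B. of_rat (\<phi> i b) * of_rat (vec_nth b d)) * \<Xi> d)"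
    unfolding E_def repd[OF i] of_rat_sum of_rat_mult ..
   also have "\<dots> = (\<Sum>b\<in>B. of_rat (\<phi> i b) * E b)"
    unfolding E_def sum_distrib_left sum_distrib_right by (subst sum.swap) (simp add: mult_ac)
   also have "\<dots> = (\<Sum>b\<in>B. of_rat (\<phi> i b) * (E b - E b0)) + (\<Sum>b\<in>B. of_rat (\<phi> i b)) * E b0"
    by (simp add: right_diff_distrib sum_subtractf sum_distrib_right)
   also have "(\<Sum>b\<in>B. of_rat (\<phi> i b)) = (1 :: complex)"
    using \<phi>1[OF i] by (metis of_rat_1 of_rat_sum)
   finally have "exp (E (v i)) = exp (E b0) * (\<Prod>b\<in>B. exp (of_rat (\<phi> i b) * (E b - E b0)))"
    by (simp add: exp_add exp_sum finB mult.commute)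
   also have "(\<Prod>b\<in>B. exp (of_rat (\<phi> i b) * (E b - E b0))) = W s i"
    unfolding W_def
   proof (rule prod.cong[OF refl])
    fix b assume b: "b \<in> B"
    have "of_nat N * of_rat (\<phi> i b) = (of_int (m i b) :: complex)"
     using m[OF i b] by (metis of_rat_mult of_rat_of_int_eq of_rat_of_nat_eq)
    then have "of_rat (\<phi> i b) = (of_int (m i b) / of_nat N :: complex)"
     using N(1) by (simp add: field_simps)
    then show "exp (of_rat (\<phi> i b) * (E b - E b0)) = s (idx b) powi m i b"
     unfolding sidx[OF b] \<sigma>_def exp_power_int by simp
   qed
   finally show ?thesis .
  qed
  \<comment> \<open>Applying the dual functionals isolates one equation for each basis vector; the
    common factor \<open>exp (E b0)\<close> is then cancelled.\<close>
  have eq: "(\<Sum>i\<in>I0. c i * W s i * of_rat (\<phi> i b)) = 0" if b: "b \<in> B" for b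
  proof -
   have "0 = (\<Sum>d\<in>UNIV. of_rat (l b d) * (\<Sum>i\<in>I0. c i * exp (E (v i)) * of_rat (vec_nth (v i) d)))"
    using bad unfolding E_def by simp
   also have "\<dots> = (\<Sum>i\<in>I0. c i * exp (E (v i)) * (\<Sum>d\<in>UNIV. of_rat (l b d) * of_rat (vec_nth (v i) d)))"
    unfolding sum_distrib_left by (subst sum.swap) (simp add: mult_ac)
   also have "\<dots> = (\<Sum>i\<in>I0. exp (E b0) * (c i * W s i * of_rat (\<phi> i b)))"
   proof (rule sum.cong[OF refl])
    fix i assume i: "i \<in> I0"
    have "(\<Sum>d\<in>UNIV. of_rat (l b d) * of_rat (vec_nth (v i) d)) = (of_rat (\<phi> i b) :: complex)"
     using l[OF span[OF i] b] unfolding \<phi>_def by (metis (no_types, lifting) of_rat_mult of_rat_sum sum.cong)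
    then show "c i * exp (E (v i)) * (\<Sum>d\<in>UNIV. of_rat (l b d) * of_rat (vec_nth (v i) d)) =
     exp (E b0) * (c i * W s i * of_rat (\<phi> i b))" by (simp add: Q[OF i])
   qed
   also have "\<dots> = exp (E b0) * (\<Sum>i\<in>I0. c i * W s i * of_rat (\<phi> i b))" by (simp add: sum_distrib_left)
   finally show ?thesis by simp
  qed
  have delta: "\<phi> i b = (if b = v i then 1 else 0)" if "i \<in> K" for i b
   unfolding \<phi>_def using vec.representation_basis[OF B(2) vidx(1)[OF that]] by simp
  have WK: "W s i = s i ^ N" if i: "i \<in> K" for i
  proof -
   have mi: "m i b = (if b = v i then int N else 0)" if "b \<in> B" for b
   proof -
    have "of_int (m i b) = (of_int (if b = v i then int N else 0) :: rat)"
     using m[OF _ that, of i] K i delta[OF i, of b] by auto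
    then show ?thesis by (simp only: of_int_eq_iff)
   qed
   have "W s i = (\<Prod>b\<in>B. if b = v i then s i ^ N else 1)"
    unfolding W_def using mi vidx[OF i] by (intro prod.cong) auto
   then show ?thesis using finB vidx(1)[OF i] by simp
  qed
  have "c' i s = c i" if "i \<in> I" for i
  proof (cases "i \<in> K")
   case True
   have "(\<Sum>j\<in>I0. c j * W s j * of_rat (\<phi> j (v i))) =
     (\<Sum>j\<in>K. c j * W s j * of_rat (\<phi> j (v i))) + (\<Sum>j\<in>I0 - K. c j * W s j * of_rat (\<phi> j (v i)))"
    unfolding sum.subset_diff[OF K finI0] by (rule add.commute)
   also have "(\<Sum>j\<in>K. c j * W s j * of_rat (\<phi> j (v i))) = (\<Sum>j\<in>K. if j = i then c i * W s i else 0)"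
   proof (rule sum.cong[OF refl])
    fix j assume j: "j \<in> K"
    have "v i = v j \<longleftrightarrow> j = i" using vidx(2)[OF j] vidx(2)[OF True] by metis
    then show "c j * W s j * of_rat (\<phi> j (v i)) = (if j = i then c i * W s i else 0)"
     using delta[OF j, of "v i"] by auto
   qed
   also have "\<dots> = c i * W s i" using True finite_subset[OF K finI0] by simp
   also have "(\<Sum>j\<in>I0 - K. c j * W s j * of_rat (\<phi> j (v i))) = (\<Sum>j\<in>I0 - K. s j * W s j * of_rat (\<phi> j (v i)))"
    by (intro sum.cong) (auto simp: s_def)
   finally have "c i * s i ^ N + (\<Sum>j\<in>I0 - K. s j * W s j * of_rat (\<phi> j (v i))) = 0"
    using eq[OF vidx(1)[OF True]] WK[OF True] by simp
   moreover have "s i ~= 0" using sU True by (auto simp: U_def)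
   ultimately show ?thesis using True by (simp add: c'_def field_simps add_eq_0_iff)
  next
   case False
   then show ?thesis by (simp add: c'_def s_def)
  qed
  then have "P c = P (\<lambda>i. c' i s)" by (intro polynomial_funs_cong[OF P(1)]) simp
  then show ?thesis using P(3)[OF sU s0] by simp
 qed
 then show ?thesis unfolding holds_generically_def using P(1,2) by (intro bexI[of _ P]) auto
qed

lemma sum_bool_3:
 "(\<Sum>d\<in>UNIV. f d) = f (Inl True) + f (Inl False) + (f (Inr 1) + f (Inr 2) + f (Inr (3::3)))"
 for f :: "bool + 3 => 'a::comm_monoid_add"
proof -
 have "(\<Sum>d\<in>UNIV. f d) = (\<Sum>b\<in>UNIV. f (Inl b)) + (\<Sum>t\<in>UNIV. f (Inr t))"
  unfolding UNIV_Plus_UNIV[symmetric] by (subst sum.Plus) auto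
 then show ?thesis by (simp add: UNIV_bool sum_3 ac_simps)
qed

lemma logder_basis:
 "logder A c (x, y, z) (1, 0, 0) = (\<Sum>(i, j, k)\<in>A. c (i, j, k) * x powi i * y powi j * z powi k * of_int i)"
 "logder A c (x, y, z) (0, 1, 0) = (\<Sum>(i, j, k)\<in>A. c (i, j, k) * x powi i * y powi j * z powi k * of_int j)"
 "logder A c (x, y, z) (0, 0, 1) = (\<Sum>(i, j, k)\<in>A. c (i, j, k) * x powi i * y powi j * z powi k * of_int k)"
 by (simp_all add: logder_def)

text \<open>The Cayley trick: \<nu> and \<mu> are treated as two more torus coordinates besides
  \<open>x\<close>, \<open>y\<close>, \<open>z\<close>. Each exponent is extended by a unit vector
  telling which polynomial it belongs to, so its weight is \<nu> or \<mu> times the monomial. The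
  weighted sum of the extended exponents collects the two equations and the three components of the
  gradient relation.\<close>

lemma generic_smooth:
 assumes A: "finite A1" "finite A2" "A1 ~= {}" "A2 ~= {}"
 shows "holds_generically (A1 <+> A2) (\<lambda>c :: _ => complex. \<forall>x y z \<nu> \<mu>. x ~= 0 --> y ~= 0 --> z ~= 0 -->
  laurent A1 (coefl c) (x, y, z) = 0 --> laurent A2 (coefr c) (x, y, z) = 0 -->
  (\<forall>w\<in>{(1, 0, 0), (0, 1, 0), (0, 0, 1)}.
   \<nu> * logder A1 (coefl c) (x, y, z) w + \<mu> * logder A2 (coefr c) (x, y, z) w = 0) --> \<nu> = 0 \<and> \<mu> = 0)"
proof -
 define v :: "exponent + exponent => rat^(bool + 3)" where
  "v e = (\<chi> d. case d of
    Inl b => (case e of Inl _ => if b then 1 else 0 | Inr _ => if b then 0 else 1)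
   | Inr t => (case (case e of Inl a => a | Inr a => a) of
     (i, j, k) => if t = 1 then of_int i else if t = 2 then of_int j else of_int k))" for e
 define u :: "rat^(bool + 3)" where "u = (\<chi> d. case d of Inl _ => 1 | Inr _ => 0)"
 \<comment> \<open>A zero multiplier has no logarithm; its polynomial is then left out of the sum,
   whence the three cases.\<close>
 define part where "part p q = (if p then Inl ` A1 else {}) \<union> (if q then Inr ` A2 else {})" for p q
 have uv: "(\<Sum>d\<in>UNIV. vec_nth u d * vec_nth (v e) d) = 1" for e
  by (cases e) (simp_all add: sum_bool_3 u_def v_def)
 have "holds_generically (A1 <+> A2) (\<lambda>c :: _ => complex. \<not> (\<exists>\<Xi> :: _ => complex. \<forall>d.
  (\<Sum>i\<in>part p q. c i * exp (\<Sum>d\<in>UNIV. of_rat (vec_nth (v i) d) * \<Xi> d) * of_rat (vec_nth (v i) d)) = 0))"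
  if "p \<or> q" for p q
  by (rule generic_no_singular_weights[where u = u]) (use A that uv in \<open>auto simp: part_def Plus_def\<close>)
 then have "holds_generically (A1 <+> A2) (\<lambda>c :: _ => complex. \<forall>pq\<in>{(True, True), (True, False), (False, True)}.
  \<not> (\<exists>\<Xi> :: _ => complex. \<forall>d. (\<Sum>i\<in>part (fst pq) (snd pq). c i *
    exp (\<Sum>d\<in>UNIV. of_rat (vec_nth (v i) d) * \<Xi> d) * of_rat (vec_nth (v i) d)) = 0))"
  by (intro holds_generically_ball) auto
 then show ?thesis
 proof (rule holds_generically_mono, goal_cases main)
  case (main c)
  show ?case
  proof (intro allI impI, rule ccontr)
   fix x y z \<nu> \<mu> :: complex
   assume nz: "x ~= 0" "y ~= 0" "z ~= 0" and
    zero: "laurent A1 (coefl c) (x, y, z) = 0" "laurent A2 (coefr c) (x, y, z) = 0" and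
    rel: "\<forall>w\<in>{(1, 0, 0), (0, 1, 0), (0, 0, 1)}.
     \<nu> * logder A1 (coefl c) (x, y, z) w + \<mu> * logder A2 (coefr c) (x, y, z) w = 0"
    and n0: "\<not> (\<nu> = 0 \<and> \<mu> = 0)"
   define \<Xi> :: "bool + 3 => complex" where
    "\<Xi> d = (case d of Inl b => if b then Ln \<nu> else Ln \<mu> | Inr t => if t = 1 then Ln x else if t = 2 then Ln y else Ln z)" for d
   let ?M = "\<lambda>(i, j, k). x powi i * y powi j * z powi k"
   have mono: "exp (of_int i * Ln x + of_int j * Ln y + of_int k * Ln z) = ?M (i, j, k)" for i j k
    using nz by (simp add: exp_add exp_power_int[symmetric])
   have QL: "exp (\<Sum>d\<in>UNIV. of_rat (vec_nth (v (Inl e)) d) * \<Xi> d) = \<nu> * ?M e" if "\<nu> ~= 0" for e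
    using that mono by (cases e) (simp add: sum_bool_3 v_def \<Xi>_def exp_add)
   have QR: "exp (\<Sum>d\<in>UNIV. of_rat (vec_nth (v (Inr e)) d) * \<Xi> d) = \<mu> * ?M e" if "\<mu> ~= 0" for e
    using that mono by (cases e) (simp add: sum_bool_3 v_def \<Xi>_def exp_add)
   have S: "(\<Sum>i\<in>part (\<nu> ~= 0) (\<mu> ~= 0). c i * exp (\<Sum>d\<in>UNIV. of_rat (vec_nth (v i) d) * \<Xi> d) * of_rat (vec_nth (v i) d)) =
     \<nu> * (\<Sum>e\<in>A1. c (Inl e) * ?M e * of_rat (vec_nth (v (Inl e)) d)) +
     \<mu> * (\<Sum>e\<in>A2. c (Inr e) * ?M e * of_rat (vec_nth (v (Inr e)) d))" for d
   proof -
    let ?g = "\<lambda>i. c i * exp (\<Sum>d\<in>UNIV. of_rat (vec_nth (v i) d) * \<Xi> d) * of_rat (vec_nth (v i) d)"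
    have "(\<Sum>i\<in>part (\<nu> ~= 0) (\<mu> ~= 0). ?g i) =
      (\<Sum>i\<in>(if \<nu> ~= 0 then Inl ` A1 else {}). ?g i) + (\<Sum>i\<in>(if \<mu> ~= 0 then Inr ` A2 else {}). ?g i)"
     unfolding part_def using A by (intro sum.union_disjoint) auto
    also have "(\<Sum>i\<in>(if \<nu> ~= 0 then Inl ` A1 else {}). ?g i) =
      \<nu> * (\<Sum>e\<in>A1. c (Inl e) * ?M e * of_rat (vec_nth (v (Inl e)) d))"
    proof (cases "\<nu> = 0")
     case False
     then have "(\<Sum>i\<in>(if \<nu> ~= 0 then Inl ` A1 else {}). ?g i) = (\<Sum>e\<in>A1. ?g (Inl e))"
      by (simp add: sum.reindex)
     also have "\<dots> = (\<Sum>e\<in>A1. \<nu> * (c (Inl e) * ?M e * of_rat (vec_nth (v (Inl e)) d)))"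
      by (intro sum.cong refl) (unfold QL[OF False], simp only: mult_ac)
     finally show ?thesis by (simp only: sum_distrib_left)
    qed simp
    also have "(\<Sum>i\<in>(if \<mu> ~= 0 then Inr ` A2 else {}). ?g i) =
      \<mu> * (\<Sum>e\<in>A2. c (Inr e) * ?M e * of_rat (vec_nth (v (Inr e)) d))"
    proof (cases "\<mu> = 0")
     case False
     then have "(\<Sum>i\<in>(if \<mu> ~= 0 then Inr ` A2 else {}). ?g i) = (\<Sum>e\<in>A2. ?g (Inr e))"
      by (simp add: sum.reindex)
     also have "\<dots> = (\<Sum>e\<in>A2. \<mu> * (c (Inr e) * ?M e * of_rat (vec_nth (v (Inr e)) d)))"
      by (intro sum.cong refl) (unfold QR[OF False], simp only: mult_ac)
     finally show ?thesis by (simp only: sum_distrib_left)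
    qed simp
    finally show ?thesis .
   qed
   have S0: "(\<Sum>i\<in>part (\<nu> ~= 0) (\<mu> ~= 0). c i * exp (\<Sum>d\<in>UNIV. of_rat (vec_nth (v i) d) * \<Xi> d) * of_rat (vec_nth (v i) d)) = 0" for d
   proof (cases d)
    case (Inl b)
    then show ?thesis unfolding S using zero
     by (cases b) (simp_all add: v_def laurent_def case_prod_unfold mult_ac)
   next
    case (Inr t)
    have L: "(\<Sum>e\<in>A1. c (Inl e) * ?M e * of_rat (vec_nth (v (Inl e)) d)) =
      logder A1 (coefl c) (x, y, z) (if t = 1 then (1, 0, 0) else if t = 2 then (0, 1, 0) else (0, 0, 1))"
     by (cases "t = 1"; cases "t = 2") (simp_all add: v_def Inr logder_basis case_prod_unfold mult_ac)
    have R: "(\<Sum>e\<in>A2. c (Inr e) * ?M e * of_rat (vec_nth (v (Inr e)) d)) =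
      logder A2 (coefr c) (x, y, z) (if t = 1 then (1, 0, 0) else if t = 2 then (0, 1, 0) else (0, 0, 1))"
     by (cases "t = 1"; cases "t = 2") (simp_all add: v_def Inr logder_basis case_prod_unfold mult_ac)
    show ?thesis unfolding S L R by (rule rel[rule_format]) auto
   qed
   have mem: "(\<nu> ~= 0, \<mu> ~= 0) \<in> {(True, True), (True, False), (False, True)}" using n0 by auto
   show False
    by (rule notE[OF bspec[OF main mem, unfolded fst_conv snd_conv]], intro exI[of _ \<Xi>] allI, rule S0)
  qed
 qed
qed

section \<open>The generic conditions\<close>

text \<open>Everything that the local analysis uses, expressed without topology, so that it makes
  sense over any field and passes from complex to real solutions.\<close>

definition nice_pair :: "exponent set => exponent set => (exponent => 'a::field) => (exponent => 'a) => bool" where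
 "nice_pair A1 A2 c1 c2 \<longleftrightarrow> (\<forall>x y. x ~= 0 --> y ~= 0 -->
   (let Z = {z. z ~= 0 \<and> laurent A1 c1 (x, y, z) = 0 \<and> laurent A2 c2 (x, y, z) = 0} in
   (\<forall>z\<in>Z. logder A1 c1 (x, y, z) (0, 0, 1) ~= 0 \<or> logder A2 c2 (x, y, z) (0, 0, 1) ~= 0) \<and>
   (\<forall>z\<in>Z. \<forall>\<nu> \<mu>. (\<forall>w\<in>{(1, 0, 0), (0, 1, 0), (0, 0, 1)}.
     \<nu> * logder A1 c1 (x, y, z) w + \<mu> * logder A2 c2 (x, y, z) w = 0) --> \<nu> = 0 \<and> \<mu> = 0) \<and>
   (\<forall>z\<in>Z. \<forall>z'\<in>Z. \<forall>\<alpha> \<beta> \<gamma> \<gamma>'. z ~= z' -->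
     logder A1 c1 (x, y, z) (\<alpha>, \<beta>, \<gamma>) = 0 --> logder A2 c2 (x, y, z) (\<alpha>, \<beta>, \<gamma>) = 0 -->
     logder A1 c1 (x, y, z') (\<alpha>, \<beta>, \<gamma>') = 0 --> logder A2 c2 (x, y, z') (\<alpha>, \<beta>, \<gamma>') = 0 --> \<alpha> = 0 \<and> \<beta> = 0) \<and>
   (\<forall>z\<in>Z. \<forall>z'\<in>Z. \<forall>z''\<in>Z. z = z' \<or> z = z'' \<or> z' = z'') \<and>
   (\<forall>k\<in>last_coords A1. \<forall>l\<in>last_coords A2. coef A1 c1 k x y = 0 --> coef A2 c2 l x y = 0 -->
     Z = {} \<and> (\<forall>k'\<in>last_coords A1 - {k}. coef A1 c1 k' x y ~= 0) \<and>
     (\<forall>l'\<in>last_coords A2 - {l}. coef A2 c2 l' x y ~= 0) \<and>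
     (\<forall>\<alpha> \<beta>. logder {e \<in> A1. snd (snd e) = k} c1 (x, y, 1) (\<alpha>, \<beta>, 0) = 0 -->
      logder {e \<in> A2. snd (snd e) = l} c2 (x, y, 1) (\<alpha>, \<beta>, 0) = 0 --> \<alpha> = 0 \<and> \<beta> = 0))))"

definition swap_sum :: "'a + 'b => 'b + 'a" where
 "swap_sum = case_sum Inr Inl"

lemma swap_sum_simps [simp]: "swap_sum (Inl a) = Inr a" "swap_sum (Inr b) = Inl b"
 by (simp_all add: swap_sum_def)

lemma holds_generically_swap:
 fixes \<Phi> :: "('b + 'a => 'c::field) => bool"
 assumes "holds_generically (A2 <+> A1) \<Phi>"
 shows "holds_generically (A1 <+> A2) (\<lambda>c. \<Phi> (\<lambda>e. c (swap_sum e)))"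
proof -
 obtain P where P: "P \<in> polynomial_funs (A2 <+> A1)" "\<exists>c. P c ~= 0" "\<And>c. P c ~= 0 ==> \<Phi> c"
  using assms unfolding holds_generically_def by blast
 obtain c where c: "P c ~= 0" using P(2) by blast
 have "swap_sum e \<in> A1 <+> A2" if "e \<in> A2 <+> A1" for e using that by auto
 then have "(\<lambda>c. c (swap_sum e)) \<in> polynomial_funs (A1 <+> A2)" if "e \<in> A2 <+> A1" for e
  using that by (intro polynomial_funs.var)
 then have "(\<lambda>c. P (\<lambda>e. c (swap_sum e))) \<in> polynomial_funs (A1 <+> A2)"
  using polynomial_funs_compose[where g = "\<lambda>e c. c (swap_sum e)" and J = "A1 <+> A2", OF P(1)]
  by blast
 moreover have "P (\<lambda>e. c (swap_sum (swap_sum e))) ~= 0"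
 proof -
  have "swap_sum (swap_sum e) = e" for e :: "'b + 'a" by (cases e) auto
  then show ?thesis using c by simp
 qed
 ultimately show ?thesis unfolding holds_generically_def
  using P(3) by (intro bexI[of _ "\<lambda>c. P (\<lambda>e. c (swap_sum e))"] conjI exI[of _ "\<lambda>e. c (swap_sum e)"]) auto
qed

lemma laurent_scaled:
 assumes "\<And>k. k \<in> last_coords A ==> \<tau> powi k = \<kappa>"
 shows "laurent A c (x, y, \<tau> * z) = \<kappa> * laurent A c (x, y, z)"
  "logder A c (x, y, \<tau> * z) w = \<kappa> * logder A c (x, y, z) w"
proof -
 have k: "\<tau> powi k = \<kappa>" if "(i, j, k) \<in> A" for i j k using that assms by (force simp: last_coords_def)
 show "laurent A c (x, y, \<tau> * z) = \<kappa> * laurent A c (x, y, z)"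
  unfolding laurent_def prod.case sum_distrib_left
  by (intro sum.cong refl) (auto simp: power_int_mult_distrib k mult_ac)
 show "logder A c (x, y, \<tau> * z) w = \<kappa> * logder A c (x, y, z) w"
  by (cases w) (auto simp: logder_def sum_distrib_left power_int_mult_distrib k mult_ac intro!: sum.cong)
qed

lemma logder_add:
 "logder A c q (\<alpha>, \<beta>, \<gamma> + \<gamma>') = logder A c q (\<alpha>, \<beta>, \<gamma>) + \<gamma>' * logder A c q (0, 0, 1)"
 by (cases q) (simp add: logder_def sum_distrib_left sum.distrib[symmetric] case_prod_unfold algebra_simps)

lemma finite_ratio_const:
 assumes "card B \<ge> 2"
 shows "finite {\<tau> :: complex. \<tau> ~= 0 \<and> ratio_const \<tau> B}"
proof -
 obtain k l where kl: "k \<in> B" "l \<in> B" "k < l" using two_elements[OF assms] .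
 define n where "n = nat (l - k)"
 have n: "int n = l - k" "n \<ge> 1" using kl by (auto simp: n_def)
 have "\<tau> ^ n = 1" if "\<tau> ~= 0" "ratio_const \<tau> B" for \<tau> :: complex
  using ratio_const_power[OF that(2,1) kl(2,1)] n(1) by (metis power_int_of_nat)
 then have "{\<tau> :: complex. \<tau> ~= 0 \<and> ratio_const \<tau> B} \<subseteq> {\<tau>. \<tau> ^ n = 1}" by auto
 then show ?thesis using finite_roots_unity[OF n(2)] finite_subset by blast
qed

lemma ratio_const_mult: "ratio_const \<tau> B ==> ratio_const \<tau>' B ==> ratio_const (\<tau> * \<tau>') B"
 unfolding ratio_const_def power_int_mult_distrib by metis

lemma indep2_of_ratio:
 fixes z z' :: "'a::field"
 assumes "z ~= 0" "\<not> ratio_const (z' / z) B"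
 shows "indep2 (\<lambda>k. z powi k) (\<lambda>k. z' powi k) B"
 using eval_rows_indep[OF assms] assms(1) by simp

lemma coef_zero_laurent:
 assumes "finite A" "\<And>k. k \<in> last_coords A ==> coef A c k x y = 0"
 shows "laurent A c (x, y, z) = 0" "logder A c (x, y, z) (0, 0, 1) = 0"
 unfolding laurent_coef[OF assms(1)] sum_deriv_row[OF assms(1), symmetric]
 by (simp_all add: assms(2))

text \<open>Two linear equations for two coefficients; their determinant \<open>D\<close> is nonzero
  because the evaluation rows are independent.\<close>

lemma two_term_vanish:
 fixes z z' :: "'a::field"
 assumes A: "finite A" "card (last_coords A) = 2" and z: "z ~= 0" "z' ~= 0"
  and ind: "indep2 (\<lambda>k. z powi k) (\<lambda>k. z' powi k) (last_coords A)"
  and zero: "laurent A c (x, y, z) = 0" "laurent A c (x, y, z') = 0" and k: "k \<in> last_coords A"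
 shows "coef A c k x y = 0"
proof -
 obtain l where B: "last_coords A = {k, l}" "k ~= l"
  using A(2) k by (auto simp: card_2_iff doubleton_eq_iff)
 let ?F = "\<lambda>k. coef A c k x y"
 have e: "?F k * z powi k + ?F l * z powi l = 0" "?F k * z' powi k + ?F l * z' powi l = 0"
  using zero unfolding laurent_coef[OF A(1)] B(1) using B(2) by simp_all
 define D where "D = z powi k * z' powi l - z' powi k * z powi l"
 have "D ~= 0"
 proof
  assume D: "D = 0"
  have "\<forall>m\<in>last_coords A. z' powi k * z powi m + (- (z powi k)) * z' powi m = 0"
   using D unfolding B(1) D_def by (simp add: mult.commute)
  then have "z' powi k = 0" using ind unfolding indep2_def by blast
  then show False using z by simp
 qed
 moreover have "?F k * D = (?F k * z powi k + ?F l * z powi l) * z' powi l - (?F k * z' powi k + ?F l * z' powi l) * z powi l"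
  by (simp add: D_def algebra_simps)
 ultimately show ?thesis unfolding e by simp
qed

text \<open>Up to a power of \<open>z\<close> this is a polynomial of degree at most two with three
  different roots; divided differences peel off its coefficients.\<close>

lemma three_term_vanish:
 fixes z1 z2 z3 :: "'a::field"
 assumes A: "finite A" "last_coords A ~= {}" "Max (last_coords A) - Min (last_coords A) \<le> 2"
  and z: "z1 ~= 0" "z2 ~= 0" "z3 ~= 0" "z1 ~= z2" "z1 ~= z3" "z2 ~= z3"
  and zero: "laurent A c (x, y, z1) = 0" "laurent A c (x, y, z2) = 0" "laurent A c (x, y, z3) = 0"
  and k: "k \<in> last_coords A"
 shows "coef A c k x y = 0"
proof -
 define m where "m = Min (last_coords A)"
 have fin: "finite (last_coords A)" using A(1) by (rule finite_last_coords)
 have sub: "last_coords A \<subseteq> {m, m + 1, m + 2}"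
 proof
  fix k assume "k \<in> last_coords A"
  then have "m \<le> k" "k \<le> Max (last_coords A)" using fin by (simp_all add: m_def)
  then show "k \<in> {m, m + 1, m + 2}" using A(3) by (auto simp: m_def)
 qed
 define F where "F k = (if k \<in> last_coords A then coef A c k x y else 0)" for k
 have eq: "F m + F (m + 1) * z + F (m + 2) * z\<^sup>2 = 0" if "laurent A c (x, y, z) = 0" "z ~= 0" for z
 proof -
  have "0 = (\<Sum>k\<in>last_coords A. coef A c k x y * z powi k)"
   using that(1) unfolding laurent_coef[OF A(1)] by simp
  also have "\<dots> = (\<Sum>k\<in>{m, m + 1, m + 2}. F k * z powi k)"
   by (intro sum.mono_neutral_cong_left) (use sub in \<open>auto simp: F_def\<close>)
  also have "\<dots> = z powi m * (F m + F (m + 1) * z + F (m + 2) * z\<^sup>2)"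
   using that(2) by (simp add: power_int_add algebra_simps)
  finally show ?thesis using that(2) by simp
 qed
 note e = eq[OF zero(1) z(1)] eq[OF zero(2) z(2)] eq[OF zero(3) z(3)]
 define a where "a = F m"
 define b where "b = F (m + 1)"
 define d where "d = F (m + 2)"
 have "(z1 - z2) * (b + d * (z1 + z2)) = (a + b * z1 + d * z1\<^sup>2) - (a + b * z2 + d * z2\<^sup>2)"
  by (simp add: algebra_simps power2_eq_square)
 then have 1: "b + d * (z1 + z2) = 0" using e(1,2) z(4) by (simp add: a_def b_def d_def)
 have "(z1 - z3) * (b + d * (z1 + z3)) = (a + b * z1 + d * z1\<^sup>2) - (a + b * z3 + d * z3\<^sup>2)"
  by (simp add: algebra_simps power2_eq_square)
 then have 2: "b + d * (z1 + z3) = 0" using e(1,3) z(5) by (simp add: a_def b_def d_def)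
 have "d * (z2 - z3) = (b + d * (z1 + z2)) - (b + d * (z1 + z3))" by (simp add: algebra_simps)
 then have d: "d = 0" using 1 2 z(6) by simp
 then have b: "b = 0" using 1 by simp
 have a: "a = 0" using e(1) b d by (simp add: a_def b_def d_def)
 have "F k = 0" using k sub a b d by (auto simp: a_def b_def d_def)
 then show ?thesis using k by (simp add: F_def)
qed

text \<open>The derivatives of the first polynomial at \<open>z\<close> and
  \<open>\<tau> * z\<close> are proportional, so \<gamma> and \<gamma>' solve the same equation. Its
  \<open>z\<close>-derivative is nonzero by \<open>D\<close>, hence \<gamma> = \<gamma>', and
  \<open>S\<close> applies with a single vertical component.\<close>

lemma scaled_pair_tangent:
 fixes \<tau> :: complex
 assumes \<tau>: "ratio_const \<tau> (last_coords A1)" "\<tau> ~= 0" "last_coords A1 ~= {}"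
  and D: "laurent A1 c1 (x, y, z) = 0 ==> logder A1 c1 (x, y, z) (0, 0, 1) = 0 ==> False"
  and S: "\<And>\<gamma>. \<alpha> ~= 0 \<or> \<beta> ~= 0 ==> laurent A1 c1 (x, y, z) = 0 ==> logder A1 c1 (x, y, z) (\<alpha>, \<beta>, \<gamma>) = 0 ==>
    logder A2 c2 (x, y, z) (\<alpha>, \<beta>, \<gamma>) = 0 ==> logder A2 c2 (x, y, \<tau> * z) (\<alpha>, \<beta>, \<gamma>) = 0 ==> False"
  and zero: "laurent A1 c1 (x, y, z) = 0"
  and der: "logder A1 c1 (x, y, z) (\<alpha>, \<beta>, \<gamma>) = 0" "logder A2 c2 (x, y, z) (\<alpha>, \<beta>, \<gamma>) = 0"
   "logder A1 c1 (x, y, \<tau> * z) (\<alpha>, \<beta>, \<gamma>') = 0" "logder A2 c2 (x, y, \<tau> * z) (\<alpha>, \<beta>, \<gamma>') = 0"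
 shows "\<alpha> = 0 \<and> \<beta> = 0"
proof -
 obtain \<kappa> where \<kappa>: "\<And>k. k \<in> last_coords A1 ==> \<tau> powi k = \<kappa>" using \<tau>(1) by (auto simp: ratio_const_def)
 obtain k where "k \<in> last_coords A1" using \<tau>(3) by blast
 then have "\<kappa> ~= 0" using \<kappa>[of k] \<tau>(2) by (metis power_int_not_zero)
 then have d': "logder A1 c1 (x, y, z) (\<alpha>, \<beta>, \<gamma>') = 0"
  using laurent_scaled(2)[where \<tau> = \<tau> and A = A1 and \<kappa> = \<kappa>, OF \<kappa>] der(3) by simp
 have "(\<gamma>' - \<gamma>) * logder A1 c1 (x, y, z) (0, 0, 1) = 0"
  using logder_add[of A1 c1 "(x, y, z)" \<alpha> \<beta> \<gamma> "\<gamma>' - \<gamma>"] d' der(1) by simp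
 then have "\<gamma>' = \<gamma>" using D[OF zero] by auto
 then show ?thesis using S[OF _ zero der(1,2)] der(4) by blast
qed

section \<open>Tangents of two branches and simultaneous vanishing of coefficients\<close>

context
 fixes A1 A2 :: "exponent set"
 assumes A: "finite A1" "finite A2" and B: "card (last_coords A1) \<ge> 2" "card (last_coords A2) \<ge> 2"
  and lattice: "\<not> common_sublattice (last_coords A1) (last_coords A2)"
begin

lemma ratio_not_const:
 "\<tau> ~= 0 ==> \<tau> ~= (1 :: complex) ==> ratio_const \<tau> (last_coords A1) ==> \<not> ratio_const \<tau> (last_coords A2)"
 "\<tau> ~= 0 ==> \<tau> ~= (1 :: complex) ==> ratio_const \<tau> (last_coords A2) ==> \<not> ratio_const \<tau> (last_coords A1)"
 using ratio_const_common_sublattice[OF B(1), of \<tau> "last_coords A2"] lattice by blast+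

text \<open>Cases on the ratio of the two roots: by condition (1) it cannot be constant on both
  exponent sets. If it is constant on one, it lies in a finite set of roots of unity and the scaled
  count applies; otherwise both pairs of rows are independent and the count with two free roots
  applies.\<close>

lemma generic_distinct_tangents:
 "holds_generically (A1 <+> A2) (\<lambda>c :: _ => complex. \<forall>x y z z' \<alpha> \<beta> \<gamma> \<gamma>'.
   x ~= 0 --> y ~= 0 --> z ~= 0 --> z' ~= 0 --> z ~= z' -->
   laurent A1 (coefl c) (x, y, z) = 0 --> laurent A1 (coefl c) (x, y, z') = 0 -->
   laurent A2 (coefr c) (x, y, z) = 0 --> laurent A2 (coefr c) (x, y, z') = 0 -->
   logder A1 (coefl c) (x, y, z) (\<alpha>, \<beta>, \<gamma>) = 0 --> logder A2 (coefr c) (x, y, z) (\<alpha>, \<beta>, \<gamma>) = 0 -->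
   logder A1 (coefl c) (x, y, z') (\<alpha>, \<beta>, \<gamma>') = 0 --> logder A2 (coefr c) (x, y, z') (\<alpha>, \<beta>, \<gamma>') = 0 -->
   \<alpha> = 0 \<and> \<beta> = 0)"
proof -
 define F where "F B = {\<tau> :: complex. \<tau> ~= 0 \<and> \<tau> ~= 1 \<and> ratio_const \<tau> B}" for B
 have fin: "finite (F B)" if "card B \<ge> 2" for B
  using finite_ratio_const[OF that] by (rule rev_finite_subset) (auto simp: F_def)
 have ne: "last_coords A1 ~= {}" "last_coords A2 ~= {}" using B by auto
 have F1: "\<tau> ~= 0" "\<not> ratio_const \<tau> (last_coords A2)" if "\<tau> \<in> F (last_coords A1)" for \<tau>
  using that ratio_not_const(1)[of \<tau>] by (auto simp: F_def)
 have F2: "\<tau> ~= 0" "\<not> ratio_const \<tau> (last_coords A1)" if "\<tau> \<in> F (last_coords A2)" for \<tau>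
  using that ratio_not_const(2)[of \<tau>] by (auto simp: F_def)
 let ?D = "\<lambda>A A' \<tau> (c1 :: _ => complex) c2. \<forall>x y z. x ~= 0 --> y ~= 0 --> z ~= 0 -->
   laurent A c1 (x, y, z) = 0 --> logder A c1 (x, y, z) (0, 0, 1) = 0 -->
   laurent A' c2 (x, y, z) = 0 --> laurent A' c2 (x, y, \<tau> * z) = 0 --> False"
 let ?S = "\<lambda>A A' \<tau> (c1 :: _ => complex) c2. \<forall>x y z \<alpha> \<beta> \<gamma>. x ~= 0 --> y ~= 0 --> z ~= 0 --> \<alpha> ~= 0 \<or> \<beta> ~= 0 -->
   laurent A c1 (x, y, z) = 0 --> laurent A' c2 (x, y, z) = 0 --> laurent A' c2 (x, y, \<tau> * z) = 0 -->
   logder A c1 (x, y, z) (\<alpha>, \<beta>, \<gamma>) = 0 --> logder A' c2 (x, y, z) (\<alpha>, \<beta>, \<gamma>) = 0 -->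
   logder A' c2 (x, y, \<tau> * z) (\<alpha>, \<beta>, \<gamma>) = 0 --> False"
 have H1: "holds_generically (A1 <+> A2) (\<lambda>c. \<forall>\<tau>\<in>F (last_coords A1). ?D A1 A2 \<tau> (coefl c) (coefr c))"
  by (intro holds_generically_ball[OF fin[OF B(1)]] generic_no_double_root_pair[OF A B(1)] F1)
 have H2: "holds_generically (A1 <+> A2) (\<lambda>c. \<forall>\<tau>\<in>F (last_coords A1). ?S A1 A2 \<tau> (coefl c) (coefr c))"
  by (intro holds_generically_ball[OF fin[OF B(1)]] generic_scaled_pair_regular[OF A ne(1)] F1)
 have H3': "holds_generically (A2 <+> A1) (\<lambda>c. \<forall>\<tau>\<in>F (last_coords A2). ?D A2 A1 \<tau> (coefl c) (coefr c))"
  by (intro holds_generically_ball[OF fin[OF B(2)]] generic_no_double_root_pair[OF A(2,1) B(2)] F2)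
 have H4': "holds_generically (A2 <+> A1) (\<lambda>c. \<forall>\<tau>\<in>F (last_coords A2). ?S A2 A1 \<tau> (coefl c) (coefr c))"
  by (intro holds_generically_ball[OF fin[OF B(2)]] generic_scaled_pair_regular[OF A(2,1) ne(2)] F2)
 note H3 = holds_generically_swap[OF H3', unfolded swap_sum_simps]
  and H4 = holds_generically_swap[OF H4', unfolded swap_sum_simps]
 show ?thesis
 proof (rule holds_generically_mono[OF holds_generically_conj[OF generic_pair_regular[OF A]
    holds_generically_conj[OF H1 holds_generically_conj[OF H2 holds_generically_conj[OF H3 H4]]]]], goal_cases main)
  case (main c)
  note c0 = main[THEN conjunct1] and c1 = main[THEN conjunct2, THEN conjunct1]
   and c2 = main[THEN conjunct2, THEN conjunct2, THEN conjunct1]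
   and c3 = main[THEN conjunct2, THEN conjunct2, THEN conjunct2, THEN conjunct1]
   and c4 = main[THEN conjunct2, THEN conjunct2, THEN conjunct2, THEN conjunct2]
  show ?case
  proof (intro allI impI)
   fix x y z z' \<alpha> \<beta> \<gamma> \<gamma>' :: complex
   let ?c1 = "\<lambda>e. c (Inl e)" and ?c2 = "\<lambda>e. c (Inr e)"
   assume nz: "x ~= 0" "y ~= 0" "z ~= 0" "z' ~= 0" "z ~= z'" and
    zero: "laurent A1 ?c1 (x, y, z) = 0" "laurent A1 ?c1 (x, y, z') = 0"
     "laurent A2 ?c2 (x, y, z) = 0" "laurent A2 ?c2 (x, y, z') = 0" and
    der: "logder A1 ?c1 (x, y, z) (\<alpha>, \<beta>, \<gamma>) = 0" "logder A2 ?c2 (x, y, z) (\<alpha>, \<beta>, \<gamma>) = 0"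
     "logder A1 ?c1 (x, y, z') (\<alpha>, \<beta>, \<gamma>') = 0" "logder A2 ?c2 (x, y, z') (\<alpha>, \<beta>, \<gamma>') = 0"
   define \<tau> where "\<tau> = z' / z"
   have \<tau>: "\<tau> ~= 0" "\<tau> ~= 1" and z': "z' = \<tau> * z" using nz by (auto simp: \<tau>_def)
   consider "ratio_const \<tau> (last_coords A1)" | "ratio_const \<tau> (last_coords A2)"
    | "\<not> ratio_const \<tau> (last_coords A1)" "\<not> ratio_const \<tau> (last_coords A2)" by blast
   then show "\<alpha> = 0 \<and> \<beta> = 0"
   proof cases
    case 1
    then have mem: "\<tau> \<in> F (last_coords A1)" using \<tau> by (simp add: F_def)
    show ?thesis
     by (rule scaled_pair_tangent[OF 1 \<tau>(1) ne(1) _ _ zero(1) der(1,2) der(3,4)[unfolded z']])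
      (use c1[rule_format, OF mem nz(1-3)] c2[rule_format, OF mem nz(1-3)] zero(3,4)[unfolded z'] in blast)+
   next
    case 2
    then have mem: "\<tau> \<in> F (last_coords A2)" using \<tau> by (simp add: F_def)
    show ?thesis
     by (rule scaled_pair_tangent[OF 2 \<tau>(1) ne(2) _ _ zero(3) der(2,1) der(4,3)[unfolded z']])
      (use c3[rule_format, OF mem nz(1-3)] c4[rule_format, OF mem nz(1-3)] zero(1,2)[unfolded z'] in blast)+
   next
    case 3
    note ind = indep2_of_ratio[OF nz(3) 3(1)[unfolded \<tau>_def]] indep2_of_ratio[OF nz(3) 3(2)[unfolded \<tau>_def]]
    show ?thesis
     using c0[rule_format, OF nz(1-4) _ ind zero der(1) der(3) der(2) der(4)] by blast
   qed
  qed
 qed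
qed

text \<open>Two vanishing coefficients already determine finitely many nondegenerate points of the
  plane for generic \<open>c\<close>, so any further equation on such a point is excluded.\<close>

lemma generic_ends:
 "holds_generically (A1 <+> A2) (\<lambda>c :: _ => complex. \<forall>k\<in>last_coords A1. \<forall>l\<in>last_coords A2. \<forall>x y. x ~= 0 --> y ~= 0 -->
   coef A1 (coefl c) k x y = 0 --> coef A2 (coefr c) l x y = 0 -->
   (\<forall>z. z ~= 0 --> laurent A1 (coefl c) (x, y, z) = 0 --> laurent A2 (coefr c) (x, y, z) ~= 0) \<and>
   (\<forall>k'\<in>last_coords A1 - {k}. coef A1 (coefl c) k' x y ~= 0) \<and>
   (\<forall>l'\<in>last_coords A2 - {l}. coef A2 (coefr c) l' x y ~= 0) \<and>
   (\<forall>\<alpha> \<beta>. logder {e \<in> A1. snd (snd e) = k} (coefl c) (x, y, 1) (\<alpha>, \<beta>, 0) = 0 -->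
    logder {e \<in> A2. snd (snd e) = l} (coefr c) (x, y, 1) (\<alpha>, \<beta>, 0) = 0 --> \<alpha> = 0 \<and> \<beta> = 0))"
proof (intro holds_generically_ball finite_last_coords A)
 fix k l assume kl: "k \<in> last_coords A1" "l \<in> last_coords A2"
 have fin: "finite (last_coords A1 - {k})" "finite (last_coords A2 - {l})" using A by (simp_all add: finite_last_coords)
 have T1: "holds_generically (A1 <+> A2) (\<lambda>c :: _ => complex. \<forall>k'\<in>last_coords A1 - {k}. \<forall>x y. x ~= 0 --> y ~= 0 -->
   coef A1 (coefl c) k x y = 0 --> coef A1 (coefl c) k' x y = 0 -->
   coef A2 (coefr c) l x y = 0 --> False)"
  using kl by (intro holds_generically_ball[OF fin(1)] generic_no_three_ends A) auto
 have T2': "holds_generically (A2 <+> A1) (\<lambda>c :: _ => complex. \<forall>l'\<in>last_coords A2 - {l}. \<forall>x y. x ~= 0 --> y ~= 0 -->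
   coef A2 (coefl c) l x y = 0 --> coef A2 (coefl c) l' x y = 0 -->
   coef A1 (coefr c) k x y = 0 --> False)"
  using kl by (intro holds_generically_ball[OF fin(2)] generic_no_three_ends A) auto
 note T2 = holds_generically_swap[OF T2', unfolded swap_sum_simps]
 show "holds_generically (A1 <+> A2) (\<lambda>c :: _ => complex. \<forall>x y. x ~= 0 --> y ~= 0 -->
   coef A1 (coefl c) k x y = 0 --> coef A2 (coefr c) l x y = 0 -->
   (\<forall>z. z ~= 0 --> laurent A1 (coefl c) (x, y, z) = 0 --> laurent A2 (coefr c) (x, y, z) ~= 0) \<and>
   (\<forall>k'\<in>last_coords A1 - {k}. coef A1 (coefl c) k' x y ~= 0) \<and>
   (\<forall>l'\<in>last_coords A2 - {l}. coef A2 (coefr c) l' x y ~= 0) \<and>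
   (\<forall>\<alpha> \<beta>. logder {e \<in> A1. snd (snd e) = k} (coefl c) (x, y, 1) (\<alpha>, \<beta>, 0) = 0 -->
    logder {e \<in> A2. snd (snd e) = l} (coefr c) (x, y, 1) (\<alpha>, \<beta>, 0) = 0 --> \<alpha> = 0 \<and> \<beta> = 0))"
 proof (rule holds_generically_mono[OF holds_generically_conj[OF generic_no_root_at_end[OF A B kl]
    holds_generically_conj[OF generic_ends_regular[OF A kl] holds_generically_conj[OF T1 T2]]]], goal_cases main)
  case (main c)
  note m1 = main[THEN conjunct1, rule_format] and m2 = main[THEN conjunct2, THEN conjunct1, rule_format]
   and m3 = main[THEN conjunct2, THEN conjunct2, THEN conjunct1, rule_format]
   and m4 = main[THEN conjunct2, THEN conjunct2, THEN conjunct2, rule_format]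
  show ?case
  proof (intro allI impI conjI ballI notI)
   fix x y :: complex
   assume nz: "x ~= 0" "y ~= 0" and z: "coef A1 (coefl c) k x y = 0" "coef A2 (coefr c) l x y = 0"
   show False if "z ~= 0" "laurent A1 (coefl c) (x, y, z) = 0" "laurent A2 (coefr c) (x, y, z) = 0" for z
    by (rule m1[OF nz that(1) z(1) that(2) z(2) that(3)])
   show False if "k' \<in> last_coords A1 - {k}" "coef A1 (coefl c) k' x y = 0" for k'
    by (rule m3[OF that(1) nz z(1) that(2) z(2)])
   show False if "l' \<in> last_coords A2 - {l}" "coef A2 (coefr c) l' x y = 0" for l'
    by (rule m4[OF that(1) nz z(2) that(2) z(1)])
   fix \<alpha> \<beta>
   assume d: "logder {e \<in> A1. snd (snd e) = k} (coefl c) (x, y, 1) (\<alpha>, \<beta>, 0) = 0"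
    "logder {e \<in> A2. snd (snd e) = l} (coefr c) (x, y, 1) (\<alpha>, \<beta>, 0) = 0"
   show "\<alpha> = 0" by (rule ccontr) (rule m2[OF nz disjI1 z d])
   show "\<beta> = 0" by (rule ccontr) (rule m2[OF nz disjI2 z d])
  qed
 qed
qed

end

section \<open>Excluding three common roots over a point\<close>

abbreviation common_roots :: "exponent set => exponent set => (exponent + exponent => 'a::field) => 'a => 'a => 'a set => bool" where
 "common_roots A1 A2 c x y Z \<equiv>
   \<forall>\<zeta>\<in>Z. laurent A1 (coefl c) (x, y, \<zeta>) = 0 \<and> laurent A2 (coefr c) (x, y, \<zeta>) = 0"

text \<open>All three roots give one and the same equation for the first polynomial, so the second
  must supply three independent ones. Dependence there would put the exponent sets into case (1) or
  (2), and only finitely many pairs of ratios occur.\<close>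

lemma generic_no_constant_triple:
 assumes A: "finite A1" "finite A2" and B: "card (last_coords A1) \<ge> 2" "card (last_coords A2) \<ge> 2"
  and lattice: "\<not> common_sublattice (last_coords A1) (last_coords A2)"
   "\<not> split_sublattice (last_coords A2) (last_coords A1)"
 shows "holds_generically (A1 <+> A2) (\<lambda>c :: _ => complex. \<forall>x y z z' z''. x ~= 0 --> y ~= 0 -->
   z ~= 0 --> z' ~= 0 --> z'' ~= 0 --> z ~= z' --> z ~= z'' --> z' ~= z'' -->
   ratio_const (z' / z) (last_coords A1) --> ratio_const (z'' / z) (last_coords A1) -->
   common_roots A1 A2 c x y {z, z', z''} --> False)"
proof -
 define F where "F = {\<tau> :: complex. \<tau> ~= 0 \<and> ratio_const \<tau> (last_coords A1)}"
 define S where "S = {t \<in> F \<times> F. fst t ~= 1 \<and> snd t ~= 1 \<and> fst t ~= snd t}"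
 have "finite F" unfolding F_def by (rule finite_ratio_const[OF B(1)])
 then have S: "finite S" unfolding S_def by simp
 have ne: "last_coords A1 ~= {}" "last_coords A2 ~= {}" using B by auto
 have ind: "indep3 (\<lambda>k. 1) (\<lambda>k. fst t powi k) (\<lambda>k. snd t powi k) (last_coords A2)" if "t \<in> S" for t
  unfolding indep3_def
 proof (intro allI impI, rule ccontr)
  fix u v w assume rel: "\<forall>k\<in>last_coords A2. u * 1 + v * fst t powi k + w * snd t powi k = 0"
   and n0: "\<not> (u = 0 \<and> v = 0 \<and> w = 0)"
  have t: "fst t ~= 0" "snd t ~= 0" "fst t ~= 1" "snd t ~= 1" "fst t ~= snd t"
   "ratio_const (fst t) (last_coords A1)" "ratio_const (snd t) (last_coords A1)"
   using that by (auto simp: S_def F_def)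
  have "common_sublattice (last_coords A1) (last_coords A2) \<or> split_sublattice (last_coords A2) (last_coords A1)"
   by (rule dependent_triple_split[OF B(1) ne(2) t, of u v w]) (use rel n0 in auto)
  then show False using lattice by blast
 qed
 have "holds_generically (A1 <+> A2) (\<lambda>c :: _ => complex. \<forall>t\<in>S. \<forall>x y z. x ~= 0 --> y ~= 0 --> z ~= 0 -->
   laurent A1 (coefl c) (x, y, z) = 0 --> laurent A2 (coefr c) (x, y, z) = 0 -->
   laurent A2 (coefr c) (x, y, fst t * z) = 0 --> laurent A2 (coefr c) (x, y, snd t * z) = 0 --> False)"
  by (intro holds_generically_ball[OF S] generic_no_scaled_triple[OF A ne(1)] ind)
 then show ?thesis
 proof (rule holds_generically_mono, goal_cases main)
  case (main c)
  show ?case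
  proof (intro allI impI)
   fix x y z z' z'' :: complex
   assume nz: "x ~= 0" "y ~= 0" "z ~= 0" "z' ~= 0" "z'' ~= 0" "z ~= z'" "z ~= z''" "z' ~= z''"
    and rc: "ratio_const (z' / z) (last_coords A1)" "ratio_const (z'' / z) (last_coords A1)"
    and zero: "common_roots A1 A2 c x y {z, z', z''}"
   have mem: "(z' / z, z'' / z) \<in> S" using nz rc by (auto simp: S_def F_def)
   have e: "fst (z' / z, z'' / z) * z = z'" "snd (z' / z, z'' / z) * z = z''" using nz by simp_all
   show False by (rule main[rule_format, OF mem nz(1-3), unfolded e]) (use zero in auto)
  qed
 qed
qed

lemma three_elements:
 fixes B :: "int set"
 assumes "card B \<ge> 3"
 obtains k l m where "k \<in> B" "l \<in> B" "m \<in> B" "k < l" "l < m"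
proof -
 have fin: "finite B" and "B ~= {}" using assms by (auto intro: card_ge_0_finite)
 have "card (B - {Min B, Max B}) \<ge> 1"
 proof -
  have "card B - card {Min B, Max B} \<le> card (B - {Min B, Max B})" by (rule diff_card_le_card_Diff) simp
  moreover have "card {Min B, Max B} \<le> 2" by (simp add: card_insert_if)
  ultimately show ?thesis using assms by linarith
 qed
 then have "B - {Min B, Max B} ~= {}" by (metis card.empty not_one_le_zero)
 then obtain l where l: "l \<in> B" "l ~= Min B" "l ~= Max B" by blast
 have "Min B \<le> l" "l \<le> Max B" using fin l(1) by simp_all
 then have "Min B < l" "l < Max B" using l by linarith+
 then show ?thesis using that[OF Min_in l(1) Max_in] fin \<open>B ~= {}\<close> by blast
qed

text \<open>A binomial with two roots of non-constant ratio has vanishing coefficients at the point;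
  so does a polynomial of width at most two with three roots. Then every \<open>z\<close> is a
  double root of both, contrary to the generic absence of double roots.\<close>

lemma generic_no_two_term_triple:
 assumes A: "finite A1" "finite A2" and B: "card (last_coords A1) = 2" "card (last_coords A2) \<ge> 2"
  and len: "Max (last_coords A2) - Min (last_coords A2) \<le> 2"
 shows "holds_generically (A1 <+> A2) (\<lambda>c :: _ => complex. \<forall>x y z z' z''. x ~= 0 --> y ~= 0 -->
   z ~= 0 --> z' ~= 0 --> z'' ~= 0 --> z ~= z' --> z ~= z'' --> z' ~= z'' -->
   \<not> ratio_const (z' / z) (last_coords A1) --> common_roots A1 A2 c x y {z, z', z''} --> False)"
proof (rule holds_generically_mono[OF generic_no_double_root[OF A _ B(2)]], goal_cases card main)
 case (main c)
 show ?case
 proof (intro allI impI)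
  fix x y z z' z'' :: complex
  assume nz: "x ~= 0" "y ~= 0" "z ~= 0" "z' ~= 0" "z'' ~= 0" "z ~= z'" "z ~= z''" "z' ~= z''"
   and rc: "\<not> ratio_const (z' / z) (last_coords A1)"
   and zero: "common_roots A1 A2 c x y {z, z', z''}"
  have ne: "last_coords A2 ~= {}" using B by auto
  have z1: "\<zeta> \<in> {z, z', z''} ==> laurent A1 (coefl c) (x, y, \<zeta>) = 0"
   and z2: "\<zeta> \<in> {z, z', z''} ==> laurent A2 (coefr c) (x, y, \<zeta>) = 0" for \<zeta>
   using zero by auto
  have v1: "coef A1 (coefl c) k x y = 0" if "k \<in> last_coords A1" for k
   by (rule two_term_vanish[OF A(1) B(1) nz(3,4) indep2_of_ratio[OF nz(3) rc] z1 z1 that]) simp_all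
  have v2: "coef A2 (coefr c) k x y = 0" if "k \<in> last_coords A2" for k
   by (rule three_term_vanish[OF A(2) ne len nz(3-8) z2 z2 z2 that]) simp_all
  show False
   by (rule main[rule_format, OF nz(1-3) coef_zero_laurent[OF A(1)] coef_zero_laurent[OF A(2)]]) (fact v1 v2)+
 qed
qed (use B in simp)

text \<open>Cases on the dependence of the two row triples. If both are dependent, the ratio of the
  first two roots lies in the finite set \<open>F0\<close>, and this pair alone is already
  overdetermined; if one is dependent, its minor is the excess condition; if none is, there are six
  equations.\<close>

lemma generic_no_long_triple:
 assumes A: "finite A1" "finite A2" and B: "card (last_coords A1) \<ge> 3" "card (last_coords A2) \<ge> 3"
  and gap: "\<not> (left_gap (last_coords A1) > 1 \<and> left_gap (last_coords A2) > 1)"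
   "\<not> (right_gap (last_coords A1) > 1 \<and> right_gap (last_coords A2) > 1)"
 shows "holds_generically (A1 <+> A2) (\<lambda>c :: _ => complex. \<forall>x y z z' z''. x ~= 0 --> y ~= 0 -->
   z ~= 0 --> z' ~= 0 --> z'' ~= 0 --> z ~= z' --> z ~= z'' --> z' ~= z'' -->
   \<not> ratio_const (z' / z) (last_coords A1) --> \<not> ratio_const (z' / z) (last_coords A2) -->
   common_roots A1 A2 c x y {z, z', z''} --> False)"
proof -
 let ?B1 = "last_coords A1" and ?B2 = "last_coords A2"
 let ?dep = "\<lambda>z z' z'' :: complex. \<lambda>B. \<not> indep3 (\<lambda>k. z powi k) (\<lambda>k. z' powi k) (\<lambda>k. z'' powi k) B"
 have fin: "finite ?B1" "finite ?B2" using A by (simp_all add: finite_last_coords)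
 \<comment> \<open>By the failure of (4) and of (3) some set has a right gap of one and some set,
   possibly the other, a left gap of one.\<close>
 obtain Br where Br: "finite Br" "card Br \<ge> 3" "\<not> right_gap Br > 1" "Br = ?B1 \<or> Br = ?B2"
  using gap(2) fin B by blast
 obtain Bl where Bl: "finite Bl" "card Bl \<ge> 3" "\<not> left_gap Bl > 1" "Bl = ?B1 \<or> Bl = ?B2"
  using gap(1) fin B by blast
 obtain F0 where F0: "finite F0" and dep: "\<forall>z z' z''. z ~= 0 --> z' ~= 0 --> z'' ~= 0 --> z ~= z' --> z ~= z'' --> z' ~= z'' -->
  ?dep z z' z'' Br --> ?dep z z' z'' Bl --> z' / z \<in> F0"
  using finite_dependent_ratios[OF Br(1-3) Bl(1-3)] by (elim exE conjE) (rule that)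
 define F where "F = {\<tau> \<in> F0. \<tau> ~= 0 \<and> \<not> ratio_const \<tau> ?B1 \<and> \<not> ratio_const \<tau> ?B2}"
 have F: "finite F" using F0 by (simp add: F_def)
 obtain k l m where klm: "k \<in> ?B1" "l \<in> ?B1" "m \<in> ?B1" "k < l" "l < m" using three_elements[OF B(1)] .
 obtain k' l' m' where klm': "k' \<in> ?B2" "l' \<in> ?B2" "m' \<in> ?B2" "k' < l'" "l' < m'" using three_elements[OF B(2)] .
 have H1: "holds_generically (A1 <+> A2) (\<lambda>c :: _ => complex. \<forall>\<tau>\<in>F. \<forall>x y z. x ~= 0 --> y ~= 0 --> z ~= 0 -->
   laurent A1 (coefl c) (x, y, z) = 0 --> laurent A1 (coefl c) (x, y, \<tau> * z) = 0 -->
   laurent A2 (coefr c) (x, y, z) = 0 --> laurent A2 (coefr c) (x, y, \<tau> * z) = 0 --> False)"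
  by (intro holds_generically_ball[OF F] generic_no_two_pairs[OF A]) (simp_all add: F_def)
 note H4 = holds_generically_swap[OF generic_no_semidependent_triple[OF A(2,1) klm'], unfolded swap_sum_simps]
 show ?thesis
 proof (rule holds_generically_mono[OF holds_generically_conj[OF H1 holds_generically_conj[OF
    generic_no_independent_triple[OF A] holds_generically_conj[OF generic_no_semidependent_triple[OF A klm] H4]]]], goal_cases main)
  case (main c)
  note m1 = main[THEN conjunct1, rule_format] and m2 = main[THEN conjunct2, THEN conjunct1, rule_format]
   and m3 = main[THEN conjunct2, THEN conjunct2, THEN conjunct1, rule_format]
   and m4 = main[THEN conjunct2, THEN conjunct2, THEN conjunct2, rule_format]
  show ?case
  proof (intro allI impI)
   fix x y z z' z'' :: complex
   assume nz: "x ~= 0" "y ~= 0" "z ~= 0" "z' ~= 0" "z'' ~= 0" "z ~= z'" "z ~= z''" "z' ~= z''"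
    and rc: "\<not> ratio_const (z' / z) ?B1" "\<not> ratio_const (z' / z) ?B2"
    and zero: "common_roots A1 A2 c x y {z, z', z''}"
   note ind = indep2_of_ratio[OF nz(3) rc(1)] indep2_of_ratio[OF nz(3) rc(2)]
   have z1: "\<zeta> \<in> {z, z', z''} ==> laurent A1 (coefl c) (x, y, \<zeta>) = 0"
    and z2: "\<zeta> \<in> {z, z', z''} ==> laurent A2 (coefr c) (x, y, \<zeta>) = 0" for \<zeta>
    using zero by auto
   show False
   proof (cases "?dep z z' z'' ?B1")
    case d1: True
    show False
    proof (cases "?dep z z' z'' ?B2")
     case True
     have "?dep z z' z'' Br" using Br(4) d1 True by metis
     moreover have "?dep z z' z'' Bl" using Bl(4) d1 True by metis
     ultimately have "z' / z \<in> F0" by (rule dep[rule_format, OF nz(3-8)])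
     then have mem: "z' / z \<in> F" using rc nz by (simp add: F_def)
     have e: "z' / z * z = z'" using nz by simp
     show False by (rule m1[OF mem nz(1-3), unfolded e]) (intro z1 z2; simp)+
    next
     case False
     show False by (rule m3[OF nz(1-5) d1 ind(1) notnotD[OF False]]) (intro ballI conjI z1 z2; assumption)+
    qed
   next
    case i1: False
    show False
    proof (cases "?dep z z' z'' ?B2")
     case True
     show False by (rule m4[OF nz(1-5) True ind(2) notnotD[OF i1]]) (intro ballI conjI z1 z2; assumption)+
    next
     case False
     show False by (rule m2[OF nz(1-5) notnotD[OF i1] notnotD[OF False]]) (intro ballI conjI z1 z2; assumption)+
    qed
   qed
  qed
 qed
qed

text \<open>Each of the three pairwise ratios must be constant on one of the two exponent sets. Two
  of them are constant on the same set, and by multiplicativity so are all ratios to the first root,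
  which is the excluded constant triple.\<close>

lemma generic_no_triple:
 assumes A: "finite A1" "finite A2" and B: "card (last_coords A1) \<ge> 2" "card (last_coords A2) \<ge> 2"
  and lattice: "\<not> common_sublattice (last_coords A1) (last_coords A2)"
   "\<not> split_sublattice (last_coords A1) (last_coords A2)" "\<not> split_sublattice (last_coords A2) (last_coords A1)"
  and gap: "\<not> (left_gap (last_coords A1) > 1 \<and> left_gap (last_coords A2) > 1)"
   "\<not> (right_gap (last_coords A1) > 1 \<and> right_gap (last_coords A2) > 1)"
  and len: "\<not> two_and_long (last_coords A1) (last_coords A2)" "\<not> two_and_long (last_coords A2) (last_coords A1)"
 shows "holds_generically (A1 <+> A2) (\<lambda>c :: _ => complex. \<forall>x y z z' z''. x ~= 0 --> y ~= 0 -->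
   z ~= 0 --> z' ~= 0 --> z'' ~= 0 --> z ~= z' --> z ~= z'' --> z' ~= z'' -->
   common_roots A1 A2 c x y {z, z', z''} --> False)"
proof -
 let ?B1 = "last_coords A1" and ?B2 = "last_coords A2"
 have lattice': "\<not> common_sublattice ?B2 ?B1" using lattice(1) unfolding common_sublattice_def by blast
 note C1 = generic_no_constant_triple[OF A B lattice(1,3)]
 note C2 = holds_generically_swap[OF generic_no_constant_triple[OF A(2,1) B(2,1) lattice' lattice(2)], unfolded swap_sum_simps]
 have T: "holds_generically (A1 <+> A2) (\<lambda>c :: _ => complex. \<forall>x y z z' z''. x ~= 0 --> y ~= 0 -->
   z ~= 0 --> z' ~= 0 --> z'' ~= 0 --> z ~= z' --> z ~= z'' --> z' ~= z'' -->
   \<not> ratio_const (z' / z) ?B1 --> \<not> ratio_const (z' / z) ?B2 -->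
   common_roots A1 A2 c x y {z, z', z''} --> False)"
 proof -
  consider "card ?B1 = 2" | "card ?B2 = 2" | "card ?B1 \<ge> 3" "card ?B2 \<ge> 3" using B by linarith
  then show ?thesis
  proof cases
   case 1
   have l: "Max ?B2 - Min ?B2 \<le> 2" using len(1) 1 by (simp add: two_and_long_def)
   show ?thesis
   proof (rule holds_generically_mono[OF generic_no_two_term_triple[OF A 1 B(2) l]], intro allI impI, goal_cases main)
    case (main c x y z z' z'')
    show False by (rule main(1)[rule_format, OF main(2-10)]) (use main(12) in blast)+
   qed
  next
   case 2
   have l: "Max ?B1 - Min ?B1 \<le> 2" using len(2) 2 by (simp add: two_and_long_def)
   show ?thesis
   proof (rule holds_generically_mono[OF holds_generically_swap[OF generic_no_two_term_triple[OF A(2,1) 2 B(1) l], unfolded swap_sum_simps]],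
     intro allI impI, goal_cases main)
    case (main c x y z z' z'')
    show False by (rule main(1)[rule_format, OF main(2-9) main(11)]) (use main(12) in blast)+
   qed
  next
   case 3
   show ?thesis by (rule generic_no_long_triple[OF A 3 gap])
  qed
 qed
 show ?thesis
 proof (rule holds_generically_mono[OF holds_generically_conj[OF C1 holds_generically_conj[OF C2 T]]], goal_cases main)
  case (main c)
  note c1 = main[THEN conjunct1, rule_format] and c2 = main[THEN conjunct2, THEN conjunct1, rule_format]
   and t = main[THEN conjunct2, THEN conjunct2, rule_format]
  show ?case
  proof (intro allI impI)
   fix x y z1 z2 z3 :: complex
   assume nz: "x ~= 0" "y ~= 0" "z1 ~= 0" "z2 ~= 0" "z3 ~= 0" "z1 ~= z2" "z1 ~= z3" "z2 ~= z3"
    and zero: "common_roots A1 A2 c x y {z1, z2, z3}"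
   have z1: "\<zeta> \<in> {z1, z2, z3} ==> laurent A1 (coefl c) (x, y, \<zeta>) = 0"
    and z2: "\<zeta> \<in> {z1, z2, z3} ==> laurent A2 (coefr c) (x, y, \<zeta>) = 0" for \<zeta>
    using zero by auto
   have n1: "\<not> (ratio_const (z2 / z1) ?B1 \<and> ratio_const (z3 / z1) ?B1)"
   proof
    assume r: "ratio_const (z2 / z1) ?B1 \<and> ratio_const (z3 / z1) ?B1"
    show False by (rule c1[OF nz r[THEN conjunct1] r[THEN conjunct2]]) (intro conjI z1 z2; assumption)+
   qed
   have n2: "\<not> (ratio_const (z2 / z1) ?B2 \<and> ratio_const (z3 / z1) ?B2)"
   proof
    assume r: "ratio_const (z2 / z1) ?B2 \<and> ratio_const (z3 / z1) ?B2"
    show False by (rule c2[OF nz r[THEN conjunct1] r[THEN conjunct2]]) (intro conjI z1 z2; assumption)+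
   qed
   have tr: "ratio_const (z3 / z1) B" if "ratio_const (z2 / z1) B" "ratio_const (z3 / z2) B" for B
    using ratio_const_mult[OF that] nz by simp
   have tr': "ratio_const (z2 / z1) B" if "ratio_const (z3 / z1) B" "ratio_const (z3 / z2) B" for B
    using ratio_const_divide[OF that(2,1)] nz by simp
   have not12: "ratio_const (z2 / z1) ?B1 \<or> ratio_const (z2 / z1) ?B2"
   proof (rule ccontr)
    assume "\<not> ?thesis"
    then have n: "\<not> ratio_const (z2 / z1) ?B1" "\<not> ratio_const (z2 / z1) ?B2" by blast+
    show False by (rule t[OF nz]) (rule n | (intro conjI z1 z2; assumption))+
   qed
   have not13: "ratio_const (z3 / z1) ?B1 \<or> ratio_const (z3 / z1) ?B2"
   proof (rule ccontr)
    assume "\<not> ?thesis"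
    then have n: "\<not> ratio_const (z3 / z1) ?B1" "\<not> ratio_const (z3 / z1) ?B2" by blast+
    have e: "{z1, z3, z2} = {z1, z2, z3}" by blast
    show False by (rule t[OF nz(1,2,3,5,4,7,6) nz(8)[symmetric], unfolded e]) (rule n | (intro conjI z1 z2; assumption))+
   qed
   have not23: "ratio_const (z3 / z2) ?B1 \<or> ratio_const (z3 / z2) ?B2"
   proof (rule ccontr)
    assume "\<not> ?thesis"
    then have n: "\<not> ratio_const (z3 / z2) ?B1" "\<not> ratio_const (z3 / z2) ?B2" by blast+
    have e: "{z2, z3, z1} = {z1, z2, z3}" by blast
    show False by (rule t[OF nz(1,2,4,5,3,8) nz(6)[symmetric] nz(7)[symmetric], unfolded e]) (rule n | (intro conjI z1 z2; assumption))+
   qed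
   show False using n1 n2 tr[of ?B1] tr[of ?B2] tr'[of ?B1] tr'[of ?B2] not12 not13 not23 by argo
  qed
 qed
qed

lemma generic_nice_pair:
 assumes A: "finite A1" "finite A2" and B: "card (last_coords A1) \<ge> 2" "card (last_coords A2) \<ge> 2"
  and lattice: "\<not> common_sublattice (last_coords A1) (last_coords A2)"
   "\<not> split_sublattice (last_coords A1) (last_coords A2)" "\<not> split_sublattice (last_coords A2) (last_coords A1)"
  and gap: "\<not> (left_gap (last_coords A1) > 1 \<and> left_gap (last_coords A2) > 1)"
   "\<not> (right_gap (last_coords A1) > 1 \<and> right_gap (last_coords A2) > 1)"
  and len: "\<not> two_and_long (last_coords A1) (last_coords A2)" "\<not> two_and_long (last_coords A2) (last_coords A1)"
 shows "holds_generically (A1 <+> A2) (\<lambda>c :: _ => complex. nice_pair A1 A2 (coefl c) (coefr c))"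
proof -
 have ne: "A1 ~= {}" "A2 ~= {}" using B by (auto simp: last_coords_def)
 show ?thesis
 proof (rule holds_generically_mono[OF holds_generically_conj[OF generic_no_double_root[OF A B] holds_generically_conj[OF
   generic_smooth[OF A ne] holds_generically_conj[OF generic_distinct_tangents[OF A B lattice(1)]
   holds_generically_conj[OF generic_no_triple[OF assms] generic_ends[OF A B lattice(1)]]]]]], goal_cases main)
  case (main c)
  note m1 = main[THEN conjunct1, rule_format] and m2 = main[THEN conjunct2, THEN conjunct1, rule_format]
   and m3 = main[THEN conjunct2, THEN conjunct2, THEN conjunct1, rule_format]
   and m4 = main[THEN conjunct2, THEN conjunct2, THEN conjunct2, THEN conjunct1, rule_format]
   and m5 = main[THEN conjunct2, THEN conjunct2, THEN conjunct2, THEN conjunct2]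
  show ?case
   unfolding nice_pair_def Let_def
  proof (intro allI impI conjI ballI, goal_cases)
   case (1 x y z)
   then show ?case using m1[of x y z] by blast
  next
   case (2 x y z \<nu> \<mu>)
   then have "\<nu> = 0 \<and> \<mu> = 0" by (intro m2[of x y z]) auto
   then show ?case by blast
  next
   case (3 x y z \<nu> \<mu>)
   then have "\<nu> = 0 \<and> \<mu> = 0" by (intro m2[of x y z]) auto
   then show ?case by blast
  next
   case (4 x y z z' \<alpha> \<beta> \<gamma> \<gamma>')
   then have "\<alpha> = 0 \<and> \<beta> = 0" by (intro m3[of x y z z' \<alpha> \<beta> \<gamma> \<gamma>']) auto
   then show ?case by blast
  next
   case (5 x y z z' \<alpha> \<beta> \<gamma> \<gamma>')
   then have "\<alpha> = 0 \<and> \<beta> = 0" by (intro m3[of x y z z' \<alpha> \<beta> \<gamma> \<gamma>']) auto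
   then show ?case by blast
  next
   case (6 x y z z' z'')
   then show ?case using m4[of x y z z' z''] by blast
  next
   case (7 x y k l)
   then show ?case using m5[THEN bspec[of _ _ k], THEN bspec[of _ _ l], THEN spec[of _ x], THEN spec[of _ y]] by blast
  next
   case (8 x y k l)
   then show ?case using m5[THEN bspec[of _ _ k], THEN bspec[of _ _ l], THEN spec[of _ x], THEN spec[of _ y]] by blast
  next
   case (9 x y k l)
   then show ?case using m5[THEN bspec[of _ _ k], THEN bspec[of _ _ l], THEN spec[of _ x], THEN spec[of _ y]] by blast
  next
   case (10 x y k l \<alpha> \<beta>)
   then show ?case using m5[THEN bspec[of _ _ k], THEN bspec[of _ _ l], THEN spec[of _ x], THEN spec[of _ y]] by blast
  next
   case (11 x y k l \<alpha> \<beta>)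
   then show ?case using m5[THEN bspec[of _ _ k], THEN bspec[of _ _ l], THEN spec[of _ x], THEN spec[of _ y]] by blast
  qed
 qed
qed

section \<open>From complex to real coefficients\<close>

lemma polynomial_funs_real_imag:
 assumes "P \<in> polynomial_funs I"
 shows "\<exists>R\<in>polynomial_funs I. \<exists>S\<in>polynomial_funs I. \<forall>c :: 'i => real.
  P (\<lambda>i. complex_of_real (c i)) = complex_of_real (R c) + \<i> * complex_of_real (S c)"
 using assms
proof (induction P rule: polynomial_funs.induct)
 case (const s)
 show ?case
  by (intro bexI[of _ "\<lambda>_. Re s"] bexI[of _ "\<lambda>_. Im s"] polynomial_funs.const) (simp add: complex_eq)
next
 case (var i)
 show ?case
  by (intro bexI[of _ "\<lambda>c. c i"] bexI[of _ "\<lambda>_. 0"] polynomial_funs.const polynomial_funs.var var) simp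
next
 case (add P Q)
 then obtain R S R' S' where m: "R \<in> polynomial_funs I" "S \<in> polynomial_funs I" "R' \<in> polynomial_funs I" "S' \<in> polynomial_funs I"
  and e: "\<And>c. P (\<lambda>i. complex_of_real (c i)) = complex_of_real (R c) + \<i> * complex_of_real (S c)"
   "\<And>c. Q (\<lambda>i. complex_of_real (c i)) = complex_of_real (R' c) + \<i> * complex_of_real (S' c)" by blast
 show ?case
  by (intro bexI[of _ "\<lambda>c. R c + R' c"] bexI[of _ "\<lambda>c. S c + S' c"] polynomial_funs.add m) (simp add: e algebra_simps)
next
 case (mult P Q)
 then obtain R S R' S' where m: "R \<in> polynomial_funs I" "S \<in> polynomial_funs I" "R' \<in> polynomial_funs I" "S' \<in> polynomial_funs I"
  and e: "\<And>c. P (\<lambda>i. complex_of_real (c i)) = complex_of_real (R c) + \<i> * complex_of_real (S c)"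
   "\<And>c. Q (\<lambda>i. complex_of_real (c i)) = complex_of_real (R' c) + \<i> * complex_of_real (S' c)" by blast
 show ?case
  by (intro bexI[of _ "\<lambda>c. R c * R' c + (-1) * (S c * S' c)"] bexI[of _ "\<lambda>c. R c * S' c + S c * R' c"]
    polynomial_funs.add polynomial_funs.mult polynomial_funs.const m) (simp add: e algebra_simps complex_eq_iff)
qed

text \<open>The coordinates are made real one at a time: along each of them a nonzero univariate
  polynomial has finitely many roots, while there are infinitely many real values.\<close>

lemma polynomial_funs_nonzero_real:
 fixes P :: "('i => complex) => complex"
 assumes "finite I" "P \<in> polynomial_funs I" "P c ~= 0"
 shows "\<exists>c. P (\<lambda>i. complex_of_real (c i)) ~= 0"
proof -
 have "\<exists>c. (\<forall>i\<in>J. c i \<in> \<real>) \<and> P c ~= 0" if "finite J" for J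
  using that
 proof (induction J rule: finite_induct)
  case empty
  then show ?case using assms(3) by blast
 next
  case (insert j J)
  then obtain c where c: "\<forall>i\<in>J. c i \<in> \<real>" "P c ~= 0" by blast
  obtain p where p: "\<And>t. P (\<lambda>i. c i + t * (if i = j then 1 else 0)) = poly p t"
   using polynomial_funs_line[OF assms(2), of c "\<lambda>i. if i = j then 1 else 0"] by blast
  have "poly p 0 ~= 0" using p[of 0] c(2) by simp
  then have "finite {t. poly p t = 0}" by (intro poly_roots_finite) auto
  moreover have "infinite (range (\<lambda>r. complex_of_real r - c j))"
  proof
   assume "finite (range (\<lambda>r. complex_of_real r - c j))"
   moreover have "inj (\<lambda>r. complex_of_real r - c j)" by (intro injI) simp
   ultimately have "finite (UNIV :: real set)" by (rule finite_imageD)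
   then show False using infinite_UNIV_char_0 by blast
  qed
  ultimately have "\<not> range (\<lambda>r. complex_of_real r - c j) \<subseteq> {t. poly p t = 0}" using finite_subset by blast
  then obtain r where r: "poly p (complex_of_real r - c j) ~= 0" by blast
  show ?case
   by (intro exI[of _ "\<lambda>i. c i + (complex_of_real r - c j) * (if i = j then 1 else 0)"] conjI)
    (use c insert(2) r p in auto)
 qed
 then obtain c where c: "\<forall>i\<in>I. c i \<in> \<real>" "P c ~= 0" using assms(1) by blast
 have "P (\<lambda>i. complex_of_real (Re (c i))) = P c"
  by (rule polynomial_funs_cong[OF assms(2)]) (use c in auto)
 then show ?thesis using c(2) by (intro exI[of _ "\<lambda>i. Re (c i)"]) simp
qed

text \<open>At real coefficients the real polynomial \<open>R c * R c + S c * S c\<close> is the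
  squared modulus of \<open>P\<close>, hence vanishes exactly where \<open>P\<close> does.\<close>

lemma holds_generically_real:
 fixes \<Phi> :: "('i => complex) => bool"
 assumes "finite I" "holds_generically I \<Phi>"
 shows "holds_generically I (\<lambda>c. \<Phi> (\<lambda>i. complex_of_real (c i)))"
proof -
 obtain P c where P: "P \<in> polynomial_funs I" "P c ~= 0" "\<And>c. P c ~= 0 ==> \<Phi> c"
  using assms(2) unfolding holds_generically_def by blast
 obtain R S where m: "R \<in> polynomial_funs I" "S \<in> polynomial_funs I"
  and e: "\<And>c. P (\<lambda>i. complex_of_real (c i)) = complex_of_real (R c) + \<i> * complex_of_real (S c)"
  using polynomial_funs_real_imag[OF P(1)] by blast
 obtain c' where c': "P (\<lambda>i. complex_of_real (c' i)) ~= 0" using polynomial_funs_nonzero_real[OF assms(1) P(1,2)] by blast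
 have iff: "R c * R c + S c * S c ~= 0 \<longleftrightarrow> P (\<lambda>i. complex_of_real (c i)) ~= 0" for c
  by (simp add: e complex_eq_iff sum_squares_eq_zero_iff)
 show ?thesis unfolding holds_generically_def
  by (intro bexI[of _ "\<lambda>c. R c * R c + S c * S c"] polynomial_funs.add polynomial_funs.mult m conjI exI[of _ c'] allI impI)
   (use c' P(3) iff in blast)+
qed

lemma of_real_laurent:
 "laurent A (\<lambda>e. complex_of_real (c e)) (complex_of_real x, complex_of_real y, complex_of_real z) = complex_of_real (laurent A c (x, y, z))"
 "logder A (\<lambda>e. complex_of_real (c e)) (complex_of_real x, complex_of_real y, complex_of_real z)
   (complex_of_real \<alpha>, complex_of_real \<beta>, complex_of_real \<gamma>) = complex_of_real (logder A c (x, y, z) (\<alpha>, \<beta>, \<gamma>))"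
 "coef A (\<lambda>e. complex_of_real (c e)) k (complex_of_real x) (complex_of_real y) = complex_of_real (coef A c k x y)"
 by (simp_all add: laurent_def logder_def coef_def case_prod_unfold of_real_power_int)


section \<open>Unpacking the generic conditions and passing to the reals\<close>

lemma nice_pairD:
 fixes c1 c2 :: "exponent => 'a::field"
 assumes nice: "nice_pair A1 A2 c1 c2" and xy: "x ~= 0" "y ~= 0"
 shows "z ~= 0 ==> laurent A1 c1 (x, y, z) = 0 ==> laurent A2 c2 (x, y, z) = 0 ==>
   logder A1 c1 (x, y, z) (0, 0, 1) ~= 0 \<or> logder A2 c2 (x, y, z) (0, 0, 1) ~= 0"
  and "z ~= 0 ==> laurent A1 c1 (x, y, z) = 0 ==> laurent A2 c2 (x, y, z) = 0 ==>
   (\<And>w. w \<in> {(1, 0, 0), (0, 1, 0), (0, 0, 1)} ==> \<nu> * logder A1 c1 (x, y, z) w + \<mu> * logder A2 c2 (x, y, z) w = 0) ==>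
   \<nu> = 0 \<and> \<mu> = 0"
  and "z ~= 0 ==> laurent A1 c1 (x, y, z) = 0 ==> laurent A2 c2 (x, y, z) = 0 ==>
   z' ~= 0 ==> laurent A1 c1 (x, y, z') = 0 ==> laurent A2 c2 (x, y, z') = 0 ==> z ~= z' ==>
   logder A1 c1 (x, y, z) (\<alpha>, \<beta>, \<gamma>) = 0 ==> logder A2 c2 (x, y, z) (\<alpha>, \<beta>, \<gamma>) = 0 ==>
   logder A1 c1 (x, y, z') (\<alpha>, \<beta>, \<gamma>') = 0 ==> logder A2 c2 (x, y, z') (\<alpha>, \<beta>, \<gamma>') = 0 ==> \<alpha> = 0 \<and> \<beta> = 0"
  and "z ~= 0 ==> laurent A1 c1 (x, y, z) = 0 ==> laurent A2 c2 (x, y, z) = 0 ==>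
   z' ~= 0 ==> laurent A1 c1 (x, y, z') = 0 ==> laurent A2 c2 (x, y, z') = 0 ==>
   z'' ~= 0 ==> laurent A1 c1 (x, y, z'') = 0 ==> laurent A2 c2 (x, y, z'') = 0 ==> z = z' \<or> z = z'' \<or> z' = z''"
proof -
 note n = nice[unfolded nice_pair_def Let_def, rule_format, OF xy]
 show "z ~= 0 ==> laurent A1 c1 (x, y, z) = 0 ==> laurent A2 c2 (x, y, z) = 0 ==>
   logder A1 c1 (x, y, z) (0, 0, 1) ~= 0 \<or> logder A2 c2 (x, y, z) (0, 0, 1) ~= 0"
  using n[THEN conjunct1] by blast
 show "z ~= 0 ==> laurent A1 c1 (x, y, z) = 0 ==> laurent A2 c2 (x, y, z) = 0 ==>
   (\<And>w. w \<in> {(1, 0, 0), (0, 1, 0), (0, 0, 1)} ==> \<nu> * logder A1 c1 (x, y, z) w + \<mu> * logder A2 c2 (x, y, z) w = 0) ==>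
   \<nu> = 0 \<and> \<mu> = 0"
  by (rule n[THEN conjunct2, THEN conjunct1, THEN bspec[of _ _ z], THEN spec[of _ \<nu>], THEN spec[of _ \<mu>], THEN mp]) blast+
 show "z ~= 0 ==> laurent A1 c1 (x, y, z) = 0 ==> laurent A2 c2 (x, y, z) = 0 ==>
   z' ~= 0 ==> laurent A1 c1 (x, y, z') = 0 ==> laurent A2 c2 (x, y, z') = 0 ==> z ~= z' ==>
   logder A1 c1 (x, y, z) (\<alpha>, \<beta>, \<gamma>) = 0 ==> logder A2 c2 (x, y, z) (\<alpha>, \<beta>, \<gamma>) = 0 ==>
   logder A1 c1 (x, y, z') (\<alpha>, \<beta>, \<gamma>') = 0 ==> logder A2 c2 (x, y, z') (\<alpha>, \<beta>, \<gamma>') = 0 ==> \<alpha> = 0 \<and> \<beta> = 0"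
  using n[THEN conjunct2, THEN conjunct2, THEN conjunct1] by blast
 show "z ~= 0 ==> laurent A1 c1 (x, y, z) = 0 ==> laurent A2 c2 (x, y, z) = 0 ==>
   z' ~= 0 ==> laurent A1 c1 (x, y, z') = 0 ==> laurent A2 c2 (x, y, z') = 0 ==>
   z'' ~= 0 ==> laurent A1 c1 (x, y, z'') = 0 ==> laurent A2 c2 (x, y, z'') = 0 ==> z = z' \<or> z = z'' \<or> z' = z''"
  using n[THEN conjunct2, THEN conjunct2, THEN conjunct2, THEN conjunct1] by blast
qed

lemma nice_pair_ends:
 fixes c1 c2 :: "exponent => 'a::field"
 assumes nice: "nice_pair A1 A2 c1 c2" and xy: "x ~= 0" "y ~= 0"
  and kl: "k \<in> last_coords A1" "l \<in> last_coords A2" and zero: "coef A1 c1 k x y = 0" "coef A2 c2 l x y = 0"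
 shows "z ~= 0 ==> laurent A1 c1 (x, y, z) = 0 ==> laurent A2 c2 (x, y, z) ~= 0"
  and "k' \<in> last_coords A1 - {k} ==> coef A1 c1 k' x y ~= 0"
  and "l' \<in> last_coords A2 - {l} ==> coef A2 c2 l' x y ~= 0"
  and "logder {e \<in> A1. snd (snd e) = k} c1 (x, y, 1) (\<alpha>, \<beta>, 0) = 0 ==>
   logder {e \<in> A2. snd (snd e) = l} c2 (x, y, 1) (\<alpha>, \<beta>, 0) = 0 ==> \<alpha> = 0 \<and> \<beta> = 0"
proof -
 note n = nice[unfolded nice_pair_def Let_def, rule_format, OF xy, THEN conjunct2, THEN conjunct2, THEN conjunct2, THEN conjunct2,
   THEN bspec, OF kl(1), THEN bspec, OF kl(2), THEN mp, OF zero(1), THEN mp, OF zero(2)]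
 show "z ~= 0 ==> laurent A1 c1 (x, y, z) = 0 ==> laurent A2 c2 (x, y, z) ~= 0"
  using n[THEN conjunct1, THEN equals0D, of z] by simp
 show "k' \<in> last_coords A1 - {k} ==> coef A1 c1 k' x y ~= 0" by (rule n[THEN conjunct2, THEN conjunct1, THEN bspec])
 show "l' \<in> last_coords A2 - {l} ==> coef A2 c2 l' x y ~= 0" by (rule n[THEN conjunct2, THEN conjunct2, THEN conjunct1, THEN bspec])
 show "logder {e \<in> A1. snd (snd e) = k} c1 (x, y, 1) (\<alpha>, \<beta>, 0) = 0 ==>
   logder {e \<in> A2. snd (snd e) = l} c2 (x, y, 1) (\<alpha>, \<beta>, 0) = 0 ==> \<alpha> = 0 \<and> \<beta> = 0"
  by (rule n[THEN conjunct2, THEN conjunct2, THEN conjunct2, THEN spec, THEN spec, THEN mp, THEN mp])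
qed

text \<open>Real roots, multipliers and directions are special complex ones, so each condition is
  the complex one read at real arguments.\<close>

lemma nice_pair_real:
 assumes "nice_pair A1 A2 (\<lambda>e. complex_of_real (c1 e)) (\<lambda>e. complex_of_real (c2 e))"
 shows "nice_pair A1 A2 c1 c2"
proof -
 have nz: "complex_of_real x ~= 0" if "x ~= 0" for x using that by simp
 note n = nice_pairD[OF assms nz nz] and m = nice_pair_ends[OF assms nz nz]
 have rows: "\<nu> = 0 \<and> \<mu> = 0" if "x ~= 0" "y ~= 0" and z: "z \<in> {z. z ~= 0 \<and> laurent A1 c1 (x, y, z) = 0 \<and> laurent A2 c2 (x, y, z) = 0}"
   and w: "\<forall>w\<in>{(1, 0, 0), (0, 1, 0), (0, 0, 1)}. \<nu> * logder A1 c1 (x, y, z) w + \<mu> * logder A2 c2 (x, y, z) w = 0"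
  for x y z \<nu> \<mu>
 proof -
  note L = of_real_laurent(2)[of _ _ x y z 1 0 0, unfolded of_real_1 of_real_0] of_real_laurent(2)[of _ _ x y z 0 1 0, unfolded of_real_1 of_real_0]
   of_real_laurent(2)[of _ _ x y z 0 0 1, unfolded of_real_1 of_real_0]
  have "complex_of_real \<nu> = 0 \<and> complex_of_real \<mu> = 0"
   by (rule n(2)[of x y "complex_of_real z"])
    (use that in \<open>auto simp: of_real_laurent(1) L simp flip: of_real_mult of_real_add\<close>)
  then show ?thesis by simp
 qed
 show ?thesis
  unfolding nice_pair_def Let_def
 proof (intro allI impI conjI ballI, goal_cases)
  case (1 x y z)
  then show ?case
   using n(1)[of x y "complex_of_real z" ] of_real_laurent(2)[of A1 c1 x y z 0 0 1] of_real_laurent(2)[of A2 c2 x y z 0 0 1]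
   by (simp add: of_real_laurent(1))
 next
  case (2 x y z \<nu> \<mu>)
  then show ?case using rows[of x y z \<nu> \<mu>] by blast
 next
  case (3 x y z \<nu> \<mu>)
  then show ?case using rows[of x y z \<nu> \<mu>] by blast
 next
  case (4 x y z z' \<alpha> \<beta> \<gamma> \<gamma>')
  then have "complex_of_real \<alpha> = 0 \<and> complex_of_real \<beta> = 0"
   by (intro n(3)[of x y z z' _ _ "complex_of_real \<gamma>" "complex_of_real \<gamma>'"]) (simp_all add: of_real_laurent)
  then show ?case by simp
 next
  case (5 x y z z' \<alpha> \<beta> \<gamma> \<gamma>')
  then have "complex_of_real \<alpha> = 0 \<and> complex_of_real \<beta> = 0"
   by (intro n(3)[of x y z z' _ _ "complex_of_real \<gamma>" "complex_of_real \<gamma>'"]) (simp_all add: of_real_laurent)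
  then show ?case by simp
 next
  case (6 x y z z' z'')
  then show ?case using n(4)[of x y z z' z''] by (simp add: of_real_laurent)
 next
  case (7 x y k l)
  then show ?case using m(1)[of x y k l] by (auto simp: of_real_laurent(3)) (metis of_real_laurent(1) of_real_0 nz)
 next
  case (8 x y k l k')
  then show ?case using m(2)[of x y k l k'] by (simp add: of_real_laurent)
 next
  case (9 x y k l l')
  then show ?case using m(3)[of x y k l l'] by (simp add: of_real_laurent)
 next
  case (10 x y k l \<alpha> \<beta>)
  then have "complex_of_real \<alpha> = 0 \<and> complex_of_real \<beta> = 0"
   by (intro m(4)[of x y k l]) (simp_all add: of_real_laurent(3) of_real_laurent(2)[of _ _ _ _ 1 _ _ 0, unfolded of_real_1 of_real_0])
  then show ?case by simp
 next
  case (11 x y k l \<alpha> \<beta>)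
  then have "complex_of_real \<alpha> = 0 \<and> complex_of_real \<beta> = 0"
   by (intro m(4)[of x y k l]) (simp_all add: of_real_laurent(3) of_real_laurent(2)[of _ _ _ _ 1 _ _ 0, unfolded of_real_1 of_real_0])
  then show ?case by simp
 qed
qed

section \<open>Analytic functions of two variables\<close>

text \<open>Removes the constant term and divides by the variable; the values at 0 of its iterates
  are the Taylor coefficients.\<close>

definition diff_quot :: "(complex => complex) => complex => complex" where
 "diff_quot f z = (if z = 0 then deriv f 0 else (f z - f 0) / z)"

lemma diff_quot_eq: "f z = f 0 + z * diff_quot f z"
 by (simp add: diff_quot_def)

text \<open>For |z| at least R/2 the quotient is at most 2M / (R/2), whence the factor 4/R; the
  maximum principle carries the bound to the inner disc.\<close>

lemma diff_quot_bounded: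
 assumes f: "f holomorphic_on ball 0 R" "\<And>z. norm z < R ==> norm (f z) \<le> M" and "R > 0"
 shows "diff_quot f holomorphic_on ball 0 R" "norm z < R ==> norm (diff_quot f z) \<le> M * (4 / R)"
proof -
 have e: "diff_quot f = (\<lambda>z. if z = 0 then deriv f 0 else (f z - f 0) / (z - 0))"
  by (simp add: diff_quot_def fun_eq_iff)
 show hol: "diff_quot f holomorphic_on ball 0 R"
  unfolding e using f(1) by (rule pole_lemma_open) simp
 have "norm (f 0) \<le> M" using f(2)[of 0] \<open>R > 0\<close> by simp
 then have "M \<ge> 0" using norm_ge_zero order_trans by blast
 have far: "norm (diff_quot f z) \<le> M * (4 / R)" if "norm z < R" "norm z \<ge> R / 2" for z
 proof -
  have "norm (f z - f 0) \<le> M + M"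
   by (rule order_trans[OF norm_triangle_ineq4]) (use f(2)[OF that(1)] \<open>norm (f 0) \<le> M\<close> in linarith)
  then have "norm (f z - f 0) / norm z \<le> (M + M) / (R / 2)"
   using that \<open>R > 0\<close> \<open>M \<ge> 0\<close> by (intro frac_le) auto
  then show ?thesis using that \<open>R > 0\<close> by (auto simp: diff_quot_def norm_divide field_simps)
 qed
 show "norm (diff_quot f z) \<le> M * (4 / R)" if z: "norm z < R"
 proof (cases "norm z \<ge> R / 2")
  case False
  have sub: "cball 0 (R / 2) \<subseteq> ball (0 :: complex) R" using \<open>R > 0\<close> by auto
  have "norm (diff_quot f z) \<le> M * (4 / R)"
  proof (rule maximum_modulus_frontier[of "diff_quot f" "cball 0 (R / 2)"])
   show "diff_quot f holomorphic_on interior (cball 0 (R / 2))"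
    by (rule holomorphic_on_subset[OF hol]) (use sub in auto)
   show "continuous_on (closure (cball 0 (R / 2))) (diff_quot f)"
    using continuous_on_subset[OF holomorphic_on_imp_continuous_on[OF hol] sub] by simp
   show "norm (diff_quot f w) \<le> M * (4 / R)" if "w \<in> frontier (cball 0 (R / 2))" for w
    by (rule far) (use that \<open>R > 0\<close> in auto)
  qed (use False in auto)
  then show ?thesis .
 qed (use far z in blast)
qed

text \<open>The recursion telescopes, leaving the remainder \<open>z ^ N * F N\<close>, which tends
  to zero by the geometric bound.\<close>

lemma power_series_of_quotients:
 fixes F :: "nat => complex"
 assumes F: "\<And>n. F n = a n + z * F (Suc n)" "\<And>n. norm (F n) \<le> M * C ^ n" and z: "norm z * C < 1" "C \<ge> 0"
 shows "(\<lambda>n. a n * z ^ n) sums F 0"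
proof -
 have part: "(\<Sum>n<N. a n * z ^ n) = F 0 - z ^ N * F N" for N
 proof (induction N)
  case (Suc N)
  show ?case using F(1)[of N] by (simp add: Suc algebra_simps)
 qed simp
 have "M \<ge> 0" using order_trans[OF norm_ge_zero F(2)[of 0]] by simp
 have "(\<lambda>N. z ^ N * F N) \<longlonglongrightarrow> 0"
 proof (rule Lim_null_comparison)
  show "\<forall>\<^sub>F N in sequentially. norm (z ^ N * F N) \<le> M * (norm z * C) ^ N"
  proof (intro always_eventually allI)
   fix N
   have "norm z ^ N * norm (F N) \<le> norm z ^ N * (M * C ^ N)" by (intro mult_left_mono F(2)) simp
   then show "norm (z ^ N * F N) \<le> M * (norm z * C) ^ N"
    by (simp add: norm_mult norm_power power_mult_distrib mult_ac)
  qed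
  have "(\<lambda>N. (norm z * C) ^ N) \<longlonglongrightarrow> 0" using z by (intro LIMSEQ_realpow_zero) auto
  then show "(\<lambda>N. M * (norm z * C) ^ N) \<longlonglongrightarrow> 0" by (rule tendsto_mult_right_zero)
 qed
 then have "(\<lambda>N. F 0 - z ^ N * F N) \<longlonglongrightarrow> F 0 - 0" by (intro tendsto_intros)
 then show ?thesis unfolding sums_def part by simp
qed

lemma bounded_power_series:
 assumes f: "f holomorphic_on ball 0 R" "\<And>z. norm z < R ==> norm (f z) \<le> M" and "R > 0"
 shows "\<exists>a. (\<forall>n. norm (a n) \<le> M * (4 / R) ^ n) \<and> (\<forall>z. norm z < R / 4 --> (\<lambda>n. a n * z ^ n) sums f z)"
proof -
 define F where "F n = (diff_quot ^^ n) f" for n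
 have F: "F n holomorphic_on ball 0 R \<and> (\<forall>z. norm z < R --> norm (F n z) \<le> M * (4 / R) ^ n)" for n
 proof (induction n)
  case 0
  then show ?case using f by (simp add: F_def)
 next
  case (Suc n)
  have "F (Suc n) = diff_quot (F n)" by (simp add: F_def)
  then show ?case
   using diff_quot_bounded[of "F n" R "M * (4 / R) ^ n"] Suc \<open>R > 0\<close> by (simp add: mult_ac)
 qed
 have S: "(\<lambda>n. F n 0 * z ^ n) sums f z" if "norm z < R / 4" for z
 proof -
  have "(\<lambda>n. F n 0 * z ^ n) sums F 0 z"
  proof (rule power_series_of_quotients[where C = "4 / R" and M = M])
   show "F n z = F n 0 + z * F (Suc n) z" for n by (simp add: F_def diff_quot_eq[symmetric])
   show "norm (F n z) \<le> M * (4 / R) ^ n" for n using F that \<open>R > 0\<close> by auto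
  qed (use that \<open>R > 0\<close> in \<open>auto simp: field_simps\<close>)
  then show ?thesis by (simp add: F_def)
 qed
 show ?thesis by (rule exI[of _ "\<lambda>n. F n 0"]) (use F S \<open>R > 0\<close> in simp)
qed

section \<open>Bounded separately holomorphic functions of two variables\<close>

definition sep_holomorphic :: "real => (complex \<times> complex => complex) => bool" where
 "sep_holomorphic R f \<longleftrightarrow> (\<forall>k\<in>ball 0 R. (\<lambda>h. f (h, k)) holomorphic_on ball 0 R) \<and>
   (\<forall>h\<in>ball 0 R. (\<lambda>k. f (h, k)) holomorphic_on ball 0 R)"

text \<open>Holomorphy in \<open>k\<close> is clear for nonzero \<open>h\<close>. At
  \<open>h = 0\<close> the quotient is a uniform limit of the quotients at small nonzero
  \<open>h\<close>, with a rate obtained from the bound on the second difference quotient.\<close>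

lemma sep_holomorphic_quot:
 assumes f: "sep_holomorphic R f" "\<And>h k. norm h < R ==> norm k < R ==> norm (f (h, k)) \<le> M" and R: "R > 0"
 defines "g \<equiv> \<lambda>(h, k). diff_quot (\<lambda>h. f (h, k)) h"
 shows "sep_holomorphic R g" "norm h < R ==> norm k < R ==> norm (g (h, k)) \<le> M * (4 / R)"
proof -
 have fh: "(\<lambda>h. f (h, k)) holomorphic_on ball 0 R" if "norm k < R" for k
  using f(1) that unfolding sep_holomorphic_def by simp
 have fk: "(\<lambda>k. f (h, k)) holomorphic_on ball 0 R" if "norm h < R" for h
  using f(1) that unfolding sep_holomorphic_def by simp
 have gh: "(\<lambda>h. g (h, k)) holomorphic_on ball 0 R" if "norm k < R" for k
  using diff_quot_bounded(1)[OF fh[OF that] _ R, of M] f(2) that by (simp add: g_def)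
 show bd: "norm (g (h, k)) \<le> M * (4 / R)" if "norm h < R" "norm k < R" for h k
  using diff_quot_bounded(2)[OF fh[OF that(2)] _ R, of M] f(2) that by (simp add: g_def)
 have gk: "(\<lambda>k. g (h, k)) holomorphic_on ball 0 R" if h: "norm h < R" "h ~= 0" for h
 proof -
  have "(\<lambda>k. (f (h, k) - f (0, k)) / h) holomorphic_on ball 0 R"
   using fk[OF h(1)] fk[of 0] R h(2) by (intro holomorphic_intros) auto
  then show ?thesis using h(2) by (simp add: g_def diff_quot_def)
 qed
 \<comment> \<open>Any nonzero sequence in the ball that tends to 0 would serve; the summand 2 keeps
   every term inside.\<close>
 define h :: "nat => complex" where "h n = of_real (R / real (n + 2))" for n :: nat
 have nh: "norm (h n) < R" "h n ~= 0" for n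
 proof -
  have "R * 1 < R * real (n + 2)" using R by (intro mult_strict_left_mono) auto
  then have "R / real (n + 2) < R" by (simp add: divide_less_eq del: of_nat_add)
  then show "norm (h n) < R" using R unfolding h_def norm_of_real by simp
  show "h n ~= 0" using R unfolding h_def of_real_eq_0_iff by simp
 qed
 have lim: "(\<lambda>n. norm (h n)) \<longlonglongrightarrow> 0"
 proof -
  have "(\<lambda>n. R / real (n + 2)) \<longlonglongrightarrow> 0"
   using LIMSEQ_ignore_initial_segment[OF lim_const_over_n, of R 2] by simp
  moreover have "norm (h n) = R / real (n + 2)" for n unfolding h_def norm_of_real using R by simp
  ultimately show ?thesis by (simp only:)
 qed
 \<comment> \<open>The increment from 0 to \<open>h n\<close> is \<open>h n\<close> times the
   difference quotient of \<open>g\<close>, whose bound does not depend on \<open>k\<close>.\<close>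
 have close: "norm (g (h n, k) - g (0, k)) \<le> M * (4 / R) * (4 / R) * norm (h n)" if "norm k < R" for n k
 proof -
  have "norm (diff_quot (\<lambda>h. g (h, k)) (h n)) \<le> M * (4 / R) * (4 / R)"
   by (rule diff_quot_bounded(2)[OF gh[OF that] _ R nh(1)]) (use bd that in auto)
  then have "norm (h n) * norm (diff_quot (\<lambda>h. g (h, k)) (h n)) \<le> norm (h n) * (M * (4 / R) * (4 / R))"
   by (rule mult_left_mono) simp
  moreover have "g (h n, k) - g (0, k) = h n * diff_quot (\<lambda>h. g (h, k)) (h n)"
   using nh(2) by (simp add: diff_quot_def)
  ultimately show ?thesis by (simp only: norm_mult mult.commute)
 qed
 have g0: "(\<lambda>k. g (0, k)) holomorphic_on ball 0 R"
 proof (rule holomorphic_uniform_sequence[where f = "\<lambda>n k. g (h n, k)"])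
  fix x :: complex assume x: "x \<in> ball 0 R"
  obtain d where d: "d > 0" "cball x d \<subseteq> ball 0 R"
   using open_contains_cball[THEN iffD1, OF open_ball, THEN bspec, OF x] by blast
  have "uniform_limit (cball x d) (\<lambda>n k. g (h n, k)) (\<lambda>k. g (0, k)) sequentially"
   unfolding uniform_limit_iff
  proof (intro allI impI)
   fix e :: real assume e: "e > 0"
   have "(\<lambda>n. M * (4 / R) * (4 / R) * norm (h n)) \<longlonglongrightarrow> M * (4 / R) * (4 / R) * 0"
    by (intro tendsto_mult tendsto_const lim)
   then have "\<forall>\<^sub>F n in sequentially. M * (4 / R) * (4 / R) * norm (h n) < e"
    using e by (intro order_tendstoD) auto
   then show "\<forall>\<^sub>F n in sequentially. \<forall>k\<in>cball x d. dist (g (h n, k)) (g (0, k)) < e"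
   proof (rule eventually_mono, intro ballI)
    fix n k assume "M * (4 / R) * (4 / R) * norm (h n) < e" "k \<in> cball x d"
    then show "dist (g (h n, k)) (g (0, k)) < e"
     using close[of k n] d(2) by (auto simp: dist_norm subset_iff)
   qed
  qed
  with d show "\<exists>d>0. cball x d \<subseteq> ball 0 R \<and> uniform_limit (cball x d) (\<lambda>n k. g (h n, k)) (\<lambda>k. g (0, k)) sequentially"
   by blast
 qed (use gk nh in auto)
 show "sep_holomorphic R g" unfolding sep_holomorphic_def
 proof (intro conjI ballI)
  fix h assume "h \<in> ball (0 :: complex) R"
  then show "(\<lambda>k. g (h, k)) holomorphic_on ball 0 R" using gk[of h] g0 by (cases "h = 0") auto
 qed (use gh in auto)
qed

lemma has_sum_double_power_series:
 fixes a :: "nat \<times> nat => 'a::{real_normed_field, banach}"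
 assumes a: "\<And>m n. norm (a (m, n)) \<le> M * C ^ m * C ^ n" and hk: "norm h * C \<le> 1 / 2" "norm k * C \<le> 1 / 2" "C \<ge> 0"
 shows "(\<lambda>mn. norm (a mn * h ^ fst mn * k ^ snd mn)) summable_on UNIV"
proof -
 have "M \<ge> 0" using order_trans[OF norm_ge_zero a[of 0 0]] by simp
 have half: "((\<lambda>n. (1 / 2) ^ n) has_sum (2 :: real)) (UNIV :: nat set)"
  using geometric_sums[of "1 / 2 :: real"] by (intro sums_nonneg_imp_has_sum) auto
 have "(\<lambda>(m, n). M * (1 / 2) ^ m * (1 / 2) ^ n :: real) summable_on (UNIV :: nat set) \<times> (UNIV :: nat set)"
 proof (rule summable_on_SigmaI)
  show "((\<lambda>n. case (m, n) of (m, n) => M * (1 / 2) ^ m * (1 / 2) ^ n) has_sum (M * (1 / 2) ^ m * 2)) UNIV" for m :: nat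
   using has_sum_cmult_right[OF half, of "M * (1 / 2) ^ m"] by simp
  show "(\<lambda>m. M * (1 / 2) ^ m * 2) summable_on (UNIV :: nat set)"
   using has_sum_imp_summable[OF has_sum_cmult_right[OF has_sum_cmult_left[OF half, of 2], of M]] by (simp add: mult.assoc)
 qed (use \<open>M \<ge> 0\<close> in auto)
 then have S: "(\<lambda>(m, n). M * (1 / 2) ^ m * (1 / 2) ^ n :: real) summable_on (UNIV :: (nat \<times> nat) set)" by simp
 show ?thesis
 proof (rule summable_on_comparison_test[OF S])
  fix mn :: "nat \<times> nat"
  obtain m n where mn: "mn = (m, n)" by (cases mn)
  have "norm (a (m, n) * h ^ m * k ^ n) \<le> (M * C ^ m * C ^ n) * norm h ^ m * norm k ^ n"
   unfolding norm_mult norm_power by (intro mult_right_mono a) auto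
  also have "\<dots> = M * (norm h * C) ^ m * (norm k * C) ^ n" by (simp add: power_mult_distrib)
  also have "\<dots> \<le> M * (1 / 2) ^ m * (1 / 2) ^ n"
   using hk \<open>M \<ge> 0\<close> by (intro mult_mono power_mono mult_nonneg_nonneg) auto
  finally show "norm (a mn * h ^ fst mn * k ^ snd mn) \<le> (case mn of (m, n) => M * (1 / 2) ^ m * (1 / 2) ^ n)"
   by (simp add: mn)
 qed simp
qed

text \<open>Osgood's lemma for bounded functions: iterated quotients in \<open>h\<close> give
  coefficients that are holomorphic in \<open>k\<close> with geometric bounds, and these are
  expanded in turn. Radius R/8 makes both ratios at most 1/2, so the double series converges
  absolutely and can be summed in either grouping.\<close>

lemma sep_holomorphic_analytic2:
 assumes f: "sep_holomorphic R (\<lambda>(h, k). g (x + h, y + k))"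
  "\<And>h k. norm h < R ==> norm k < R ==> norm (g (x + h, y + k)) \<le> M" and R: "R > 0"
 shows "analytic2_at g (x, y)"
proof -
 define Q :: "(complex \<times> complex => complex) => complex \<times> complex => complex" where
  "Q f = (\<lambda>(h, k). diff_quot (\<lambda>h. f (h, k)) h)" for f
 define F where "F m = (Q ^^ m) (\<lambda>(h, k). g (x + h, y + k))" for m
 have F: "sep_holomorphic R (F m) \<and> (\<forall>h k. norm h < R --> norm k < R --> norm (F m (h, k)) \<le> M * (4 / R) ^ m)" for m
 proof (induction m)
  case 0
  then show ?case using f by (simp add: F_def)
 next
  case (Suc m)
  have "F (Suc m) = Q (F m)" by (simp add: F_def)
  then show ?case
   using sep_holomorphic_quot[of R "F m" "M * (4 / R) ^ m"] Suc R by (simp add: Q_def mult_ac)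
 qed
 have "\<exists>a. (\<forall>n. norm (a n) \<le> M * (4 / R) ^ m * (4 / R) ^ n) \<and>
   (\<forall>k. norm k < R / 4 --> (\<lambda>n. a n * k ^ n) sums F m (0, k))" for m
  using F[of m] R by (intro bounded_power_series) (auto simp: sep_holomorphic_def)
 then obtain a where a: "\<And>m n. norm (a m n) \<le> M * (4 / R) ^ m * (4 / R) ^ n"
  and ak: "\<And>m k. norm k < R / 4 ==> (\<lambda>n. a m n * k ^ n) sums F m (0, k)" by metis
 define b where "b = (\<lambda>(m, n). a m n)"
 have "((\<lambda>(m, n). b (m, n) * h ^ m * k ^ n) has_sum g (x + h, y + k)) UNIV" if hk: "norm h < R / 8" "norm k < R / 8" for h k
 proof -
  have abs: "(\<lambda>mn. norm (b mn * h ^ fst mn * k ^ snd mn)) summable_on UNIV"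
   by (rule has_sum_double_power_series[where C = "4 / R" and M = M]) (use a hk R in \<open>auto simp: b_def field_simps\<close>)
  have abs': "(\<lambda>(m, n). b (m, n) * h ^ m * k ^ n) summable_on UNIV \<times> UNIV"
   using abs_summable_summable[OF abs] by (simp add: case_prod_unfold)
  have inner: "((\<lambda>n. case (m, n) of (m, n) => b (m, n) * h ^ m * k ^ n) has_sum (F m (0, k) * h ^ m)) UNIV" for m
  proof -
   have "(\<lambda>n. b (m, n) * h ^ m * k ^ n) summable_on UNIV"
    using summable_on_SigmaD1[where f = "\<lambda>m n. b (m, n) * h ^ m * k ^ n", OF abs' UNIV_I] .
   then obtain S where S: "((\<lambda>n. b (m, n) * h ^ m * k ^ n) has_sum S) UNIV" by (auto simp: summable_on_def)
   have "(\<lambda>n. a m n * k ^ n * h ^ m) sums (F m (0, k) * h ^ m)"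
    by (rule sums_mult2[OF ak]) (use hk R in auto)
   then have "(\<lambda>n. b (m, n) * h ^ m * k ^ n) sums (F m (0, k) * h ^ m)" by (simp add: b_def mult_ac)
   then have "S = F m (0, k) * h ^ m" using has_sum_imp_sums[OF S] sums_unique2 by blast
   then show ?thesis using S by simp
  qed
  have lim: "(\<lambda>m. F m (0, k) * h ^ m) sums F 0 (h, k)"
  proof (rule power_series_of_quotients[where C = "4 / R" and M = M])
   show "F m (h, k) = F m (0, k) + h * F (Suc m) (h, k)" for m
    using diff_quot_eq[of "\<lambda>h. F m (h, k)" h] by (simp add: F_def Q_def)
   show "norm (F m (h, k)) \<le> M * (4 / R) ^ m" for m using F hk R by auto
  qed (use hk R in \<open>auto simp: field_simps\<close>)
  obtain T where T: "((\<lambda>(m, n). b (m, n) * h ^ m * k ^ n) has_sum T) (UNIV \<times> UNIV)"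
   using abs' by (auto simp: summable_on_def)
  have outer: "((\<lambda>m. F m (0, k) * h ^ m) has_sum T) UNIV" by (rule has_sum_SigmaD[OF T inner])
  have "T = F 0 (h, k)" using has_sum_imp_sums[OF outer] lim sums_unique2 by blast
  then show ?thesis using T by (simp add: F_def)
 qed
 then show ?thesis unfolding analytic2_at_def using R
  by (intro exI[of _ b] exI[of _ "R / 8"]) auto
qed

section \<open>First-order expansion of double power series\<close>

lemma summable_bounded_terms:
 fixes f :: "'b => 'a::real_normed_vector"
 assumes "(f has_sum S) UNIV"
 shows "\<exists>M. \<forall>x. norm (f x) \<le> M"
proof -
 have "\<forall>\<^sub>F F in finite_subsets_at_top UNIV. dist (sum f F) S < 1"
  using assms unfolding has_sum_def by (rule tendstoD) simp
 then obtain F where F: "finite F" "\<And>G. finite G ==> F \<subseteq> G ==> dist (sum f G) S < 1"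
  unfolding eventually_finite_subsets_at_top by auto
 have "norm (f x) \<le> 2 + (\<Sum>y\<in>F. norm (f y))" for x
 proof (cases "x \<in> F")
  case True
  then have "norm (f x) \<le> (\<Sum>y\<in>F. norm (f y))" using F(1) by (intro member_le_sum) auto
  then show ?thesis by simp
 next
  case False
  then have "f x = sum f (insert x F) - sum f F" using F(1) by simp
  then have "norm (f x) = dist (sum f (insert x F)) (sum f F)" by (simp add: dist_norm)
  also have "\<dots> \<le> dist (sum f (insert x F)) S + dist (sum f F) S" by (rule dist_triangle2)
  also have "\<dots> \<le> 1 + 1" using F(2)[of "insert x F", OF _ subset_insertI] F(2)[of F] F(1)
   by (intro add_mono less_imp_le) auto
  also have "\<dots> \<le> 2 + (\<Sum>y\<in>F. norm (f y))" by (simp add: sum_nonneg)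
  finally show ?thesis .
 qed
 then show ?thesis by blast
qed

text \<open>In total degree at least two, \<open>s ^ (m + n)\<close> is
  \<open>(2 * s) ^ (m + n)\<close> times a power of 1/2, hence at most \<open>4 * s\<^sup>2\<close>
  times that power. Summing the two geometric series gives another factor 4, in all 16.\<close>

lemma double_power_series_remainder:
 fixes a :: "nat \<times> nat => 'a::{real_normed_field, banach}"
 assumes a: "\<And>m n. norm (a (m, n)) * \<rho> ^ m * \<rho> ^ n \<le> M" and \<rho>: "\<rho> > 0"
  and hk: "norm h \<le> s * \<rho>" "norm k \<le> s * \<rho>" "s \<le> 1 / 2"
  and S: "((\<lambda>(m, n). a (m, n) * h ^ m * k ^ n) has_sum S) UNIV"
 shows "norm (S - (a (0, 0) + a (1, 0) * h + a (0, 1) * k)) \<le> 16 * M * s\<^sup>2"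
proof -
 let ?f = "\<lambda>(m, n). a (m, n) * h ^ m * k ^ n"
 let ?E = "{(0, 0), (1, 0), (0, 1)} :: (nat \<times> nat) set"
 have "M \<ge> 0" using order_trans[OF _ a[of 0 0]] by simp
 have "s \<ge> 0" using order_trans[OF norm_ge_zero hk(1)] \<rho> by (simp add: zero_le_mult_iff)
 have "(?f has_sum (\<Sum>mn\<in>?E. ?f mn)) ?E" by (rule has_sum_finite) simp
 then have rest: "(?f has_sum (S - (\<Sum>mn\<in>?E. ?f mn))) (UNIV - ?E)" by (rule has_sum_Diff[OF S]) simp
 have half: "((\<lambda>n. (1 / 2) ^ n) has_sum (2 :: real)) (UNIV :: nat set)"
  using geometric_sums[of "1 / 2 :: real"] by (intro sums_nonneg_imp_has_sum) auto
 define G where "G = (\<lambda>(m, n). 4 * M * s\<^sup>2 * ((1 / 2) ^ m * (1 / 2) ^ n) :: real)"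
 have inner: "((\<lambda>n. G (m, n)) has_sum (4 * M * s\<^sup>2 * (1 / 2) ^ m * 2)) UNIV" for m :: nat
  using has_sum_cmult_right[OF half, of "4 * M * s\<^sup>2 * (1 / 2) ^ m"] by (simp add: G_def mult.assoc)
 have outer: "((\<lambda>m. 4 * M * s\<^sup>2 * (1 / 2) ^ m * 2) has_sum (16 * M * s\<^sup>2)) (UNIV :: nat set)"
  using has_sum_cmult_right[OF half, of "8 * M * s\<^sup>2"] by (simp add: mult_ac)
 have G0: "G mn \<ge> 0" for mn using \<open>M \<ge> 0\<close> by (simp add: G_def case_prod_unfold)
 have Gs: "G summable_on UNIV \<times> UNIV"
  by (rule summable_on_SigmaI[OF inner has_sum_imp_summable[OF outer]]) (rule G0)
 have GS: "(G has_sum (16 * M * s\<^sup>2)) UNIV" using has_sum_SigmaI[OF inner outer Gs] by simp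
 have bound: "norm (?f mn) \<le> G mn" if "mn \<in> UNIV - ?E" for mn
 proof -
  obtain m n where mn: "mn = (m, n)" by (cases mn)
  have mn2: "m + n \<ge> 2" using that unfolding mn by (cases m; cases n) auto
  have "norm (?f mn) \<le> norm (a (m, n)) * (s * \<rho>) ^ m * (s * \<rho>) ^ n"
   unfolding mn prod.case norm_mult norm_power
   by (intro mult_mono power_mono hk mult_nonneg_nonneg) (use \<open>s \<ge> 0\<close> \<rho> in auto)
  also have "\<dots> = (norm (a (m, n)) * \<rho> ^ m * \<rho> ^ n) * s ^ (m + n)" by (simp add: power_mult_distrib power_add)
  also have "\<dots> \<le> M * s ^ (m + n)" by (intro mult_right_mono a) (use \<open>s \<ge> 0\<close> in auto)
  also have "s ^ (m + n) = (2 * s) ^ (m + n) * (1 / 2) ^ (m + n)" by (subst power_mult_distrib[symmetric]) simp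
  also have "M * \<dots> \<le> M * ((2 * s)\<^sup>2 * (1 / 2) ^ (m + n))"
   using \<open>s \<ge> 0\<close> hk(3) mn2 \<open>M \<ge> 0\<close> by (intro mult_left_mono mult_right_mono power_decreasing) auto
  finally show ?thesis by (simp add: mn G_def power_add power_mult_distrib mult_ac)
 qed
 have fs: "?f abs_summable_on UNIV - ?E"
  by (rule summable_on_comparison_test[OF summable_on_subset_banach[OF has_sum_imp_summable[OF GS]] bound]) auto
 have "norm (S - (\<Sum>mn\<in>?E. ?f mn)) = norm (infsum ?f (UNIV - ?E))" using infsumI[OF rest] by simp
 also have "\<dots> \<le> infsum (\<lambda>mn. norm (?f mn)) (UNIV - ?E)" by (rule norm_infsum_bound[OF fs])
 also have "\<dots> \<le> infsum G UNIV"
  by (rule infsum_mono_neutral[OF fs has_sum_imp_summable[OF GS]]) (use bound G0 in auto)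
 also have "\<dots> = 16 * M * s\<^sup>2" by (rule infsumI[OF GS])
 finally show ?thesis by (simp add: add.assoc)
qed

lemma analytic2_at_has_derivative:
 fixes g :: "'a \<times> 'a => 'a::{real_normed_field, banach}"
 assumes "analytic2_at g (x, y)"
 shows "\<exists>u v. (g has_derivative (\<lambda>(h, k). u * h + v * k)) (at (x, y))"
proof -
 obtain a r where r: "r > 0" and sum0: "\<forall>h k. norm h < r \<and> norm k < r -->
   ((\<lambda>(m, n). a (m, n) * h ^ m * k ^ n) has_sum g (x + h, y + k)) UNIV"
  using assms unfolding analytic2_at_def fst_conv snd_conv by (elim exE conjE) (rule that, assumption+)
 note sum = sum0[rule_format, OF conjI]
 \<comment> \<open>Convergence at the interior point with both increments \<rho> bounds the terms
   there and hence controls the coefficients.\<close>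
 define \<rho> where "\<rho> = r / 2"
 have \<rho>: "\<rho> > 0" "\<rho> < r" using r by (auto simp: \<rho>_def)
 obtain M where M: "\<And>mn. norm (case mn of (m, n) => a (m, n) * of_real \<rho> ^ m * of_real \<rho> ^ n) \<le> M"
  using summable_bounded_terms[OF sum[of "of_real \<rho>" "of_real \<rho>"]] \<rho> by auto
 have M': "norm (a (m, n)) * \<rho> ^ m * \<rho> ^ n \<le> M" for m n
  using M[of "(m, n)"] \<rho> by (simp add: norm_mult norm_power)
 have g0: "g (x, y) = a (0, 0)"
 proof -
  have "norm (g (x + 0, y + 0) - (a (0, 0) + a (1, 0) * 0 + a (0, 1) * 0)) \<le> 16 * M * 0\<^sup>2"
   by (rule double_power_series_remainder[OF M' \<rho>(1) _ _ _ sum]) (use r in auto)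
  then show ?thesis by simp
 qed
 have "(g has_derivative (\<lambda>(h, k). a (1, 0) * h + a (0, 1) * k)) (at (x, y))"
 proof (rule has_derivativeI_sandwich[where e = "\<rho> / 2" and H = "\<lambda>q. 16 * M / \<rho>\<^sup>2 * norm (q - (x, y))"])
  show "bounded_linear (\<lambda>(h, k). a (1, 0) * h + a (0, 1) * k)"
   unfolding case_prod_unfold
   by (intro bounded_linear_add bounded_linear_const_mult bounded_linear_fst bounded_linear_snd)
  have "((\<lambda>q. 16 * M / \<rho>\<^sup>2 * norm (q - (x, y))) \<longlongrightarrow> 16 * M / \<rho>\<^sup>2 * norm ((x, y) - (x, y))) (at (x, y))"
   by (intro tendsto_intros)
  then show "((\<lambda>q. 16 * M / \<rho>\<^sup>2 * norm (q - (x, y))) \<longlongrightarrow> 0) (at (x, y))" by simp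
  fix q assume q: "q ~= (x, y)" "dist q (x, y) < \<rho> / 2"
  define h where "h = fst q - x"
  define k where "k = snd q - y"
  have qe: "q - (x, y) = (h, k)" "q = (x + h, y + k)" by (auto simp: h_def k_def prod_eq_iff)
  define s where "s = norm (h, k) / \<rho>"
  have s: "s \<le> 1 / 2" "norm (h, k) = s * \<rho>" using q(2) \<rho> by (auto simp: s_def dist_norm qe field_simps)
  have hk: "norm h \<le> s * \<rho>" "norm k \<le> s * \<rho>"
   using norm_fst_le[of h k] norm_snd_le[of k h] s(2) by simp_all
  have lt: "norm h < r" "norm k < r"
   using hk mult_right_mono[OF s(1) less_imp_le[OF \<rho>(1)]] \<rho> by linarith+
  have "norm (g q - g (x, y) - (a (1, 0) * h + a (0, 1) * k)) \<le> 16 * M * s\<^sup>2"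
   using double_power_series_remainder[OF M' \<rho>(1) hk s(1) sum[OF lt]] by (simp add: qe(2) g0 algebra_simps)
  also have "\<dots> = 16 * M / \<rho>\<^sup>2 * norm (h, k) * norm (h, k)"
   using \<rho> by (simp add: s_def power2_eq_square)
  finally show "norm (g q - g (x, y) - (case q - (x, y) of (h, k) => a (1, 0) * h + a (0, 1) * k)) / norm (q - (x, y))
    \<le> 16 * M / \<rho>\<^sup>2 * norm (q - (x, y))"
   using q(1) unfolding qe(1) prod.case by (subst pos_divide_le_eq) (auto simp: qe(2) zero_prod_def)
 qed (use \<rho> in auto)
 then show ?thesis by blast
qed

text \<open>Taking real parts of the coefficients of the complex expansion gives the real expansion,
  since the increments are real.\<close>

lemma analytic2_at_real:
 fixes g :: "real \<times> real => real"
 assumes "analytic2_at gc (complex_of_real x, complex_of_real y)" and r: "r > 0"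
  and eq: "\<And>h k. norm h < r ==> norm k < r ==>
   gc (complex_of_real (x + h), complex_of_real (y + k)) = complex_of_real (g (x + h, y + k))"
 shows "analytic2_at g (x, y)"
proof -
 obtain a r' where r': "r' > 0" and sum0: "\<forall>h k. norm h < r' \<and> norm k < r' -->
   ((\<lambda>(m, n). a (m, n) * h ^ m * k ^ n) has_sum gc (complex_of_real x + h, complex_of_real y + k)) UNIV"
  using assms(1) unfolding analytic2_at_def fst_conv snd_conv by (elim exE conjE) (rule that, assumption+)
 note sum = sum0[rule_format, OF conjI]
 have "((\<lambda>(m, n). Re (a (m, n)) * h ^ m * k ^ n) has_sum g (x + h, y + k)) UNIV"
  if "norm h < min r r'" "norm k < min r r'" for h k
 proof -
  have Re: "Re (a mn * complex_of_real h ^ fst mn * complex_of_real k ^ snd mn) = Re (a mn) * h ^ fst mn * k ^ snd mn" for mn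
   by (simp flip: of_real_power)
  show ?thesis
   using has_sum_Re[OF sum[of "complex_of_real h" "complex_of_real k"]] that eq[of h k]
   by (simp add: case_prod_unfold Re)
 qed
 then show ?thesis unfolding analytic2_at_def using r r'
  by (intro exI[of _ "\<lambda>mn. Re (a mn)"] exI[of _ "min r r'"]) auto
qed

section \<open>Implicit functions\<close>

definition laurent_dom :: "exponent set => ('a::field \<times> 'a \<times> 'a) set" where
 "laurent_dom A = {(x, y, w). x ~= 0 \<and> y ~= 0 \<and> (w ~= 0 \<or> (\<forall>e\<in>A. snd (snd e) \<ge> 0))}"

text \<open>The ordinary differential; unlike \<open>logder\<close> it detects the linear term in
  \<open>w\<close> at \<open>w = 0\<close>.\<close>

definition dlaurent :: "exponent set => (exponent => 'a::field) => 'a \<times> 'a \<times> 'a => 'a \<times> 'a \<times> 'a => 'a" where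
 "dlaurent A c = (\<lambda>(x, y, w) (a, b, d). \<Sum>(i, j, k)\<in>A. c (i, j, k) *
   (of_int i * x powi (i - 1) * y powi j * w powi k * a + of_int j * x powi i * y powi (j - 1) * w powi k * b +
   of_int k * x powi i * y powi j * w powi (k - 1) * d))"

lemma laurent_has_derivative:
 fixes c :: "exponent => 'a::real_normed_field"
 assumes "q \<in> laurent_dom A"
 shows "(laurent A c has_derivative dlaurent A c q) (at q)"
proof -
 obtain x y w where q: "q = (x, y, w)" by (cases q)
 have xy: "x ~= 0" "y ~= 0" using assms by (auto simp: q laurent_dom_def)
 have "((\<lambda>q. case e of (i, j, k) => c (i, j, k) * fst q powi i * fst (snd q) powi j * snd (snd q) powi k) has_derivative
  (\<lambda>(a, b, d). case e of (i, j, k) => c (i, j, k) *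
   (of_int i * x powi (i - 1) * y powi j * w powi k * a + of_int j * x powi i * y powi (j - 1) * w powi k * b +
   of_int k * x powi i * y powi j * w powi (k - 1) * d))) (at q)" if "e \<in> A" for e
 proof -
  obtain i j k where e: "e = (i, j, k)" by (cases e)
  have w: "k \<ge> 0 \<or> w ~= 0" using assms that by (auto simp: q laurent_dom_def e)
  have "((\<lambda>w. w powi k) has_field_derivative of_int k * w powi (k - 1) * 1) (at w)"
   by (rule DERIV_power_int[OF DERIV_ident w])
  then have "((\<lambda>w. w powi k) has_derivative (\<lambda>d. of_int k * w powi (k - 1) * d)) (at w)"
   by (simp add: has_field_derivative_def)
  then have W: "((\<lambda>q. snd (snd q) powi k) has_derivative (\<lambda>d. of_int k * w powi (k - 1) * snd (snd d))) (at q)"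
   using has_derivative_compose[where g = "\<lambda>w. w powi k" and f = "\<lambda>q. snd (snd q)", of "\<lambda>d. snd (snd d)" q UNIV]
   by (simp add: q has_derivative_snd has_derivative_ident)
  have X: "((\<lambda>q. fst q powi i) has_derivative (\<lambda>d. fst d * (of_int i * x powi (i - 1)))) (at q)"
   using has_derivative_power_int[of fst q fst UNIV i] xy by (simp add: q has_derivative_fst has_derivative_ident)
  have Y: "((\<lambda>q. fst (snd q) powi j) has_derivative (\<lambda>d. fst (snd d) * (of_int j * y powi (j - 1)))) (at q)"
   using has_derivative_power_int[of "\<lambda>q. fst (snd q)" q "\<lambda>q. fst (snd q)" UNIV j] xy
   by (simp add: q has_derivative_fst has_derivative_snd has_derivative_ident)
  show ?thesis
   unfolding e prod.case
   by (rule has_derivative_eq_rhs[OF has_derivative_mult[OF has_derivative_mult[OF has_derivative_mult[OF has_derivative_const X] Y] W]])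
    (simp add: q fun_eq_iff algebra_simps)
 qed
 then have "((\<lambda>q. \<Sum>e\<in>A. case e of (i, j, k) => c (i, j, k) * fst q powi i * fst (snd q) powi j * snd (snd q) powi k) has_derivative
  (\<lambda>d. \<Sum>e\<in>A. case d of (a, b, d) => case e of (i, j, k) => c (i, j, k) *
   (of_int i * x powi (i - 1) * y powi j * w powi k * a + of_int j * x powi i * y powi (j - 1) * w powi k * b +
   of_int k * x powi i * y powi j * w powi (k - 1) * d))) (at q)"
  by (intro has_derivative_sum)
 moreover have "laurent A c = (\<lambda>q. \<Sum>e\<in>A. case e of (i, j, k) => c (i, j, k) * fst q powi i * fst (snd q) powi j * snd (snd q) powi k)"
  by (simp add: fun_eq_iff laurent_def)
 moreover have "dlaurent A c q = (\<lambda>d. \<Sum>e\<in>A. case d of (a, b, d) => case e of (i, j, k) => c (i, j, k) *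
   (of_int i * x powi (i - 1) * y powi j * w powi k * a + of_int j * x powi i * y powi (j - 1) * w powi k * b +
   of_int k * x powi i * y powi j * w powi (k - 1) * d))"
  by (simp add: fun_eq_iff dlaurent_def q)
 ultimately show ?thesis by simp
qed

lemma dlaurent_linear:
 "dlaurent A c q (a, b, d) = a * dlaurent A c q (1, 0, 0) + b * dlaurent A c q (0, 1, 0) + d * dlaurent A c q (0, 0, 1)"
 by (cases q) (simp add: dlaurent_def sum_distrib_left sum.distrib[symmetric] case_prod_unfold algebra_simps)


lemma dlaurent_last:
 fixes c :: "exponent => 'a::real_normed_field"
 assumes "(x, y, w) \<in> laurent_dom A"
 shows "((\<lambda>w. laurent A c (x, y, w)) has_field_derivative dlaurent A c (x, y, w) (0, 0, 1)) (at w)"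
proof -
 have "((\<lambda>w. (x, y, w)) has_derivative (\<lambda>d. (0, 0, d))) (at w)"
  by (intro derivative_intros)
 from has_derivative_compose[OF this laurent_has_derivative[OF assms]]
 have "((\<lambda>w. laurent A c (x, y, w)) has_derivative (\<lambda>d. dlaurent A c (x, y, w) (0, 0, d))) (at w)" .
 moreover have "(\<lambda>d. dlaurent A c (x, y, w) (0, 0, d)) = times (dlaurent A c (x, y, w) (0, 0, 1))"
 proof
  fix d
  show "dlaurent A c (x, y, w) (0, 0, d) = dlaurent A c (x, y, w) (0, 0, 1) * d"
   using dlaurent_linear[of A c "(x, y, w)" 0 0 d] by (simp only: mult_zero_left add_0 mult.commute)
 qed
 ultimately show ?thesis by (simp only: has_field_derivative_def)
qed

lemma isCont_laurent:
 fixes c :: "exponent => 'a::real_normed_field"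
 shows "q \<in> laurent_dom A ==> isCont (laurent A c) q"
 using laurent_has_derivative by (rule has_derivative_continuous)

lemma isCont_dlaurent_last:
 fixes c :: "exponent => 'a::real_normed_field"
 assumes "q \<in> laurent_dom A"
 shows "isCont (\<lambda>q. dlaurent A c q (0, 0, 1)) q"
proof -
 obtain x y w where q: "q = (x, y, w)" by (cases q)
 have xy: "x ~= 0" "y ~= 0" using assms by (auto simp: q laurent_dom_def)
 have "isCont (\<lambda>q. case e of (i, j, k) => c (i, j, k) * (of_int k * fst q powi i * fst (snd q) powi j * snd (snd q) powi (k - 1))) q"
  if "e \<in> A" for e
 proof -
  obtain i j k where e: "e = (i, j, k)" by (cases e)
  have w: "k \<ge> 0 \<or> w ~= 0" using assms that by (auto simp: q laurent_dom_def e)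
  show ?thesis
  \<comment> \<open>For \<open>k = 0\<close> the power \<open>w powi (k - 1)\<close> is
    discontinuous at \<open>w = 0\<close>, but it carries the factor zero.\<close>
  proof (cases "k = 0")
   case False
   have "isCont (\<lambda>w. w powi (k - 1)) (snd (snd q))"
    unfolding q snd_conv by (rule DERIV_isCont[OF DERIV_power_int[OF DERIV_ident]]) (use w False in auto)
   then have W: "isCont (\<lambda>q. snd (snd q) powi (k - 1)) q"
    by (rule isCont_o2[where g = "\<lambda>w. w powi (k - 1)" and f = "\<lambda>q. snd (snd q)", rotated]) (intro continuous_snd continuous_ident)
   have X: "isCont (\<lambda>q :: 'a \<times> 'a \<times> 'a. fst q powi i) q"
    by (rule continuous_at_within_power_int[OF continuous_fst[OF continuous_ident]]) (simp add: q xy)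
   have Y: "isCont (\<lambda>q :: 'a \<times> 'a \<times> 'a. fst (snd q) powi j) q"
    by (rule continuous_at_within_power_int[OF continuous_fst[OF continuous_snd[OF continuous_ident]]]) (simp add: q xy)
   show ?thesis unfolding e prod.case by (intro continuous_mult continuous_const W X Y)
  qed (simp add: e)
 qed
 then have "isCont (\<lambda>q. \<Sum>e\<in>A. case e of (i, j, k) => c (i, j, k) * (of_int k * fst q powi i * fst (snd q) powi j * snd (snd q) powi (k - 1))) q"
  by (intro continuous_sum)
 moreover have "(\<lambda>q. dlaurent A c q (0, 0, 1)) = (\<lambda>q. \<Sum>e\<in>A. case e of (i, j, k) => c (i, j, k) * (of_int k * fst q powi i * fst (snd q) powi j * snd (snd q) powi (k - 1)))"
  by (simp add: fun_eq_iff dlaurent_def)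
 ultimately show ?thesis by simp
qed

lemma isCont_tendsto_nhds: "isCont f x ==> (f \<longlongrightarrow> f x) (nhds x)"
 unfolding isCont_def by (rule tendsto_at_iff_tendsto_nhds[THEN iffD1])

lemma eventually_nhds_box:
 fixes x y w :: "'a::real_normed_vector"
 assumes "eventually P (nhds (x, y, w))"
 shows "\<exists>\<delta>>0. \<forall>h k d. norm h \<le> \<delta> --> norm k \<le> \<delta> --> norm d \<le> \<delta> --> P (x + h, y + k, w + d)"
proof -
 obtain e where e: "e > 0" "\<And>q. dist q (x, y, w) < e ==> P q"
  using assms unfolding eventually_nhds_metric by blast
 have "P (x + h, y + k, w + d)" if "norm h \<le> e / 4" "norm k \<le> e / 4" "norm d \<le> e / 4" for h k d
 proof (rule e(2))
  have "dist (x + h, y + k, w + d) (x, y, w) = norm (h, k, d)" by (simp add: dist_norm)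
  also have "\<dots> \<le> norm h + (norm k + norm d)"
   by (rule order_trans[OF norm_Pair_le]) (simp add: norm_Pair_le)
  also have "\<dots> < e" using that e(1) by linarith
  finally show "dist (x + h, y + k, w + d) (x, y, w) < e" .
 qed
 then show ?thesis using e(1) by (intro exI[of _ "e / 4"]) auto
qed

lemma eventually_laurent_dom:
 fixes q :: "'a::real_normed_field \<times> 'a \<times> 'a"
 assumes "q \<in> laurent_dom A"
 shows "eventually (\<lambda>q. q \<in> laurent_dom A) (nhds q)"
proof -
 obtain x y w where q: "q = (x, y, w)" by (cases q)
 have xy: "x ~= 0" "y ~= 0" "w ~= 0 \<or> (\<forall>e\<in>A. snd (snd e) \<ge> 0)" using assms by (auto simp: q laurent_dom_def)
 have 1: "eventually (\<lambda>q :: 'a \<times> 'a \<times> 'a. fst q ~= 0) (nhds q)"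
  by (rule tendsto_imp_eventually_ne[OF tendsto_fst[OF filterlim_ident]]) (simp add: q xy)
 have 2: "eventually (\<lambda>q :: 'a \<times> 'a \<times> 'a. fst (snd q) ~= 0) (nhds q)"
  by (rule tendsto_imp_eventually_ne[OF tendsto_fst[OF tendsto_snd[OF filterlim_ident]]]) (simp add: q xy)
 show ?thesis
 proof (cases "w = 0")
  case True
  with xy have nonneg: "\<forall>e\<in>A. snd (snd e) \<ge> 0" by simp
  show ?thesis using 1 2 by eventually_elim (use nonneg in \<open>auto simp: laurent_dom_def\<close>)
 next
  case False
  then have "eventually (\<lambda>q :: 'a \<times> 'a \<times> 'a. snd (snd q) ~= 0) (nhds q)"
   by (intro tendsto_imp_eventually_ne[OF tendsto_snd[OF tendsto_snd[OF filterlim_ident]]]) (simp add: q)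
  with 1 2 show ?thesis by eventually_elim (auto simp: laurent_dom_def)
 qed
qed

text \<open>Newton's method with the derivative frozen at the base point: each iterate is then a
  holomorphic expression in \<open>x\<close> and \<open>y\<close>, with the constant denominator
  \<open>D\<close>.\<close>

definition newton_step :: "exponent set => (exponent => 'a::field) => 'a => 'a => 'a => 'a => 'a" where
 "newton_step A c D x y w = w - laurent A c (x, y, w) / D"

text \<open>The derivative of the step in \<open>w\<close> is \<open>1 - dlaurent / D\<close>, zero
  at the base point and at most 1/2 nearby, so the step contracts. A small \<delta> makes the first
  displacement at most \<epsilon>/2, so the closed ball is mapped into itself and Banach's theorem
  applies.\<close>

lemma newton_step_converges:
 fixes c :: "exponent => 'a::{real_normed_field, banach}"
 assumes dom: "(x0, y0, w0) \<in> laurent_dom A" and zero: "laurent A c (x0, y0, w0) = 0"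
  and D: "D = dlaurent A c (x0, y0, w0) (0, 0, 1)" "D ~= 0"
 shows "\<exists>\<epsilon>0>0. \<forall>\<epsilon>. 0 < \<epsilon> --> \<epsilon> \<le> \<epsilon>0 --> (\<exists>\<delta>>0. \<forall>h k. norm h \<le> \<delta> --> norm k \<le> \<delta> -->
  (\<forall>w\<in>cball w0 \<epsilon>. (x0 + h, y0 + k, w) \<in> laurent_dom A) \<and>
  (\<exists>\<phi>\<in>cball w0 \<epsilon>. (\<forall>w\<in>cball w0 \<epsilon>. laurent A c (x0 + h, y0 + k, w) = 0 \<longleftrightarrow> w = \<phi>) \<and>
   (\<forall>n. (newton_step A c D (x0 + h) (y0 + k) ^^ n) w0 \<in> cball w0 \<epsilon> \<and>
    dist ((newton_step A c D (x0 + h) (y0 + k) ^^ n) w0) \<phi> \<le> (1 / 2) ^ n * \<epsilon>)))"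
proof -
 have "((\<lambda>q. 1 - dlaurent A c q (0, 0, 1) / D) \<longlongrightarrow> 1 - dlaurent A c (x0, y0, w0) (0, 0, 1) / D) (nhds (x0, y0, w0))"
  by (intro tendsto_intros isCont_tendsto_nhds[OF isCont_dlaurent_last[OF dom]] D)
 then have "((\<lambda>q. norm (1 - dlaurent A c q (0, 0, 1) / D)) \<longlongrightarrow> 0) (nhds (x0, y0, w0))"
  by (intro tendsto_norm_zero) (use D in simp)
 then have "eventually (\<lambda>q. norm (1 - dlaurent A c q (0, 0, 1) / D) < 1 / 2) (nhds (x0, y0, w0))"
  by (rule order_tendstoD) simp
 then have "eventually (\<lambda>q. q \<in> laurent_dom A \<and> norm (1 - dlaurent A c q (0, 0, 1) / D) \<le> 1 / 2) (nhds (x0, y0, w0))"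
  using eventually_laurent_dom[OF dom] by eventually_elim auto
 from eventually_nhds_box[OF this] obtain e where e: "e > 0" and box: "\<forall>h k d. norm h \<le> e --> norm k \<le> e --> norm d \<le> e -->
   (x0 + h, y0 + k, w0 + d) \<in> laurent_dom A \<and> norm (1 - dlaurent A c (x0 + h, y0 + k, w0 + d) (0, 0, 1) / D) \<le> 1 / 2"
  by (elim exE conjE) (rule that)
 have "\<exists>\<delta>>0. \<forall>h k. norm h \<le> \<delta> --> norm k \<le> \<delta> -->
  (\<forall>w\<in>cball w0 \<epsilon>. (x0 + h, y0 + k, w) \<in> laurent_dom A) \<and>
  (\<exists>\<phi>\<in>cball w0 \<epsilon>. (\<forall>w\<in>cball w0 \<epsilon>. laurent A c (x0 + h, y0 + k, w) = 0 \<longleftrightarrow> w = \<phi>) \<and>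
   (\<forall>n. (newton_step A c D (x0 + h) (y0 + k) ^^ n) w0 \<in> cball w0 \<epsilon> \<and>
    dist ((newton_step A c D (x0 + h) (y0 + k) ^^ n) w0) \<phi> \<le> (1 / 2) ^ n * \<epsilon>))"
  if \<epsilon>: "0 < \<epsilon>" "\<epsilon> \<le> e" for \<epsilon>
 proof -
  have "((\<lambda>q. laurent A c q / D) \<longlongrightarrow> laurent A c (x0, y0, w0) / D) (nhds (x0, y0, w0))"
   by (intro tendsto_intros isCont_tendsto_nhds[OF isCont_laurent[OF dom]] D)
  then have "((\<lambda>q. norm (laurent A c q / D)) \<longlongrightarrow> 0) (nhds (x0, y0, w0))"
   by (intro tendsto_norm_zero) (use zero in simp)
  then have "eventually (\<lambda>q. norm (laurent A c q / D) < \<epsilon> / 2) (nhds (x0, y0, w0))"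
   by (rule order_tendstoD) (use \<epsilon> in simp)
  from eventually_nhds_box[OF this] obtain \<delta>0 where \<delta>0: "\<delta>0 > 0" and small: "\<forall>h k d. norm h \<le> \<delta>0 --> norm k \<le> \<delta>0 --> norm d \<le> \<delta>0 -->
   norm (laurent A c (x0 + h, y0 + k, w0 + d) / D) < \<epsilon> / 2"
   by (elim exE conjE) (rule that)
  define \<delta> where "\<delta> = min e \<delta>0"
  have \<delta>: "\<delta> > 0" "\<delta> \<le> e" "\<delta> \<le> \<delta>0" using e \<delta>0 by (auto simp: \<delta>_def)
  show ?thesis
  proof (intro exI[of _ \<delta>] conjI allI impI \<delta>(1))
   fix h k :: 'a assume hk: "norm h \<le> \<delta>" "norm k \<le> \<delta>"
   have in_box: "(x0 + h, y0 + k, w) \<in> laurent_dom A" "norm (1 - dlaurent A c (x0 + h, y0 + k, w) (0, 0, 1) / D) \<le> 1 / 2"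
    if "w \<in> cball w0 \<epsilon>" for w
    using box[rule_format, of h k "w - w0"] that hk \<delta>(2) \<epsilon> by (auto simp: dist_norm norm_minus_commute)
   then show "\<forall>w\<in>cball w0 \<epsilon>. (x0 + h, y0 + k, w) \<in> laurent_dom A" by blast
   define T where "T = newton_step A c D (x0 + h) (y0 + k)"
   have T': "(T has_field_derivative (1 - dlaurent A c (x0 + h, y0 + k, w) (0, 0, 1) / D)) (at w within cball w0 \<epsilon>)"
    if "w \<in> cball w0 \<epsilon>" for w
    unfolding T_def newton_step_def
    by (intro DERIV_diff DERIV_ident DERIV_cdivide has_field_derivative_at_within[OF dlaurent_last] in_box that)
   have lip: "dist (T w) (T w') \<le> 1 / 2 * dist w w'" if "w \<in> cball w0 \<epsilon>" "w' \<in> cball w0 \<epsilon>" for w w'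
    unfolding dist_norm
    by (rule field_differentiable_bound[OF convex_cball T' in_box(2) that])
   have "dist (T w0) w0 \<le> \<epsilon> / 2"
    using small[rule_format, of h k 0] hk \<delta> \<delta>0 by (simp add: T_def newton_step_def dist_norm)
   have self: "T w \<in> cball w0 \<epsilon>" if "w \<in> cball w0 \<epsilon>" for w
   proof -
    have "dist (T w) w0 \<le> dist (T w) (T w0) + dist (T w0) w0" by (rule dist_triangle)
    also have "\<dots> \<le> 1 / 2 * dist w w0 + \<epsilon> / 2"
     using lip[OF that, of w0] \<open>dist (T w0) w0 \<le> \<epsilon> / 2\<close> \<epsilon> by auto
    also have "\<dots> \<le> \<epsilon>" using that by (simp add: dist_commute)
    finally show ?thesis by (simp add: dist_commute)
   qed
   have "\<exists>!w\<in>cball w0 \<epsilon>. T w = w"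
    by (rule Banach_fix[of _ "1 / 2"]) (use self lip \<epsilon> in \<open>auto simp: compact_imp_complete complete_eq_closed\<close>)
   then obtain \<phi> where \<phi>: "\<phi> \<in> cball w0 \<epsilon>" "T \<phi> = \<phi>" and uniq: "\<And>w. w \<in> cball w0 \<epsilon> ==> T w = w ==> w = \<phi>" by blast
   have root: "T w = w \<longleftrightarrow> laurent A c (x0 + h, y0 + k, w) = 0" for w
    using D(2) by (simp add: T_def newton_step_def)
   have iter: "(T ^^ n) w0 \<in> cball w0 \<epsilon> \<and> dist ((T ^^ n) w0) \<phi> \<le> (1 / 2) ^ n * \<epsilon>" for n
   proof (induction n)
    case 0
    then show ?case using \<phi>(1) \<epsilon> by simp
   next
    case (Suc n)
    have "dist (T ((T ^^ n) w0)) (T \<phi>) \<le> 1 / 2 * dist ((T ^^ n) w0) \<phi>" by (rule lip) (use Suc \<phi> in auto)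
    then show ?case using Suc self \<phi>(2) by auto
   qed
   show "\<exists>\<phi>\<in>cball w0 \<epsilon>. (\<forall>w\<in>cball w0 \<epsilon>. laurent A c (x0 + h, y0 + k, w) = 0 \<longleftrightarrow> w = \<phi>) \<and>
    (\<forall>n. (newton_step A c D (x0 + h) (y0 + k) ^^ n) w0 \<in> cball w0 \<epsilon> \<and>
     dist ((newton_step A c D (x0 + h) (y0 + k) ^^ n) w0) \<phi> \<le> (1 / 2) ^ n * \<epsilon>)"
    unfolding T_def[symmetric]
   proof (rule bexI[OF _ \<phi>(1)], rule conjI)
    show "\<forall>w\<in>cball w0 \<epsilon>. laurent A c (x0 + h, y0 + k, w) = 0 \<longleftrightarrow> w = \<phi>"
    proof
     fix w assume "w \<in> cball w0 \<epsilon>"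
     from uniq[OF this] have "T w = w \<longleftrightarrow> w = \<phi>" using \<phi>(2) by blast
     then show "laurent A c (x0 + h, y0 + k, w) = 0 \<longleftrightarrow> w = \<phi>" unfolding root .
    qed
    show "\<forall>n. (T ^^ n) w0 \<in> cball w0 \<epsilon> \<and> dist ((T ^^ n) w0) \<phi> \<le> (1 / 2) ^ n * \<epsilon>"
     by (rule allI) (rule iter)
   qed
  qed
 qed
 then show ?thesis using e by blast
qed

lemma laurent_holomorphic:
 assumes "u holomorphic_on S" "v holomorphic_on S" "w holomorphic_on S"
  and dom: "\<And>z. z \<in> S ==> (u z, v z, w z) \<in> laurent_dom A"
 shows "(\<lambda>z. laurent A c (u z, v z, w z)) holomorphic_on S"
proof -
 have "(\<lambda>z. case e of (i, j, k) => c (i, j, k) * u z powi i * v z powi j * w z powi k) holomorphic_on S" if "e \<in> A" for e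
 proof -
  obtain i j k where e: "e = (i, j, k)" by (cases e)
  have uv: "u z ~= 0" "v z ~= 0" if "z \<in> S" for z using dom[OF that] by (auto simp: laurent_dom_def)
  have "(\<lambda>z. w z powi k) holomorphic_on S"
  proof (cases "k \<ge> 0")
   case True
   then obtain n where "k = int n" using nonneg_int_cases by blast
   then show ?thesis using assms(3) by (simp add: holomorphic_on_power)
  next
   case False
   then have "w z ~= 0" if "z \<in> S" for z using dom[OF that] \<open>e \<in> A\<close> by (auto simp: laurent_dom_def e)
   then show ?thesis using assms(3) by (intro holomorphic_on_power_int) auto
  qed
  moreover have "(\<lambda>z. u z powi i) holomorphic_on S" "(\<lambda>z. v z powi j) holomorphic_on S"
   using assms(1,2) uv by (auto intro!: holomorphic_on_power_int)
  ultimately show ?thesis unfolding e prod.case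
   by (intro holomorphic_on_mult holomorphic_on_const)
 qed
 then show ?thesis unfolding laurent_def prod.case by (intro holomorphic_on_sum)
qed

lemma newton_step_holomorphic:
 assumes uv: "u holomorphic_on S" "v holomorphic_on S"
  and dom: "\<And>z n. z \<in> S ==> (u z, v z, (newton_step A c D (u z) (v z) ^^ n) w0) \<in> laurent_dom A"
 shows "(\<lambda>z. (newton_step A c D (u z) (v z) ^^ n) w0) holomorphic_on S"
proof (induction n)
 case (Suc n)
 have "(\<lambda>z. (newton_step A c D (u z) (v z) ^^ n) w0 -
   laurent A c (u z, v z, (newton_step A c D (u z) (v z) ^^ n) w0) * inverse D) holomorphic_on S"
  by (intro holomorphic_on_diff holomorphic_on_mult holomorphic_on_const laurent_holomorphic Suc uv dom)
 moreover have "(newton_step A c D (u z) (v z) ^^ Suc n) w0 = (newton_step A c D (u z) (v z) ^^ n) w0 -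
   laurent A c (u z, v z, (newton_step A c D (u z) (v z) ^^ n) w0) * inverse D" for z
  unfolding funpow.simps comp_apply by (subst newton_step_def) (simp only: divide_inverse)
 ultimately show ?case by (simp only:)
qed simp

text \<open>The geometric error bound is uniform in \<open>z\<close>, so the limit of the
  holomorphic iterates is holomorphic.\<close>

lemma newton_limit_holomorphic:
 assumes S: "open S" and uv: "u holomorphic_on S" "v holomorphic_on S"
  and dom: "\<And>z n. z \<in> S ==> (u z, v z, (newton_step A c D (u z) (v z) ^^ n) w0) \<in> laurent_dom A"
  and lim: "\<And>z n. z \<in> S ==> dist ((newton_step A c D (u z) (v z) ^^ n) w0) (\<phi> z) \<le> (1 / 2) ^ n * \<epsilon>"
 shows "\<phi> holomorphic_on S"
proof (rule holomorphic_uniform_sequence[OF S newton_step_holomorphic[OF uv dom]])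
 fix x assume x: "x \<in> S"
 obtain d where d: "d > 0" "cball x d \<subseteq> S" using S x open_contains_cball by blast
 have "uniform_limit (cball x d) (\<lambda>n z. (newton_step A c D (u z) (v z) ^^ n) w0) \<phi> sequentially"
  unfolding uniform_limit_iff
 proof (intro allI impI)
  fix e :: real assume e: "e > 0"
  have "(\<lambda>n. (1 / 2 :: real) ^ n * \<epsilon>) \<longlonglongrightarrow> 0" by (intro tendsto_mult_left_zero LIMSEQ_realpow_zero) auto
  then have "\<forall>\<^sub>F n in sequentially. (1 / 2) ^ n * \<epsilon> < e" using e by (rule order_tendstoD)
  then show "\<forall>\<^sub>F n in sequentially. \<forall>z\<in>cball x d. dist ((newton_step A c D (u z) (v z) ^^ n) w0) (\<phi> z) < e"
   by (rule eventually_mono) (use lim d in \<open>blast intro: le_less_trans\<close>)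
 qed
 with d show "\<exists>d>0. cball x d \<subseteq> S \<and> uniform_limit (cball x d) (\<lambda>n z. (newton_step A c D (u z) (v z) ^^ n) w0) \<phi> sequentially"
  by blast
qed

definition newton_limit :: "exponent set => (exponent => 'a::real_normed_field) => 'a => 'a => 'a \<times> 'a => 'a" where
 "newton_limit A c D w0 = (\<lambda>(x, y). lim (\<lambda>n. (newton_step A c D x y ^^ n) w0))"

text \<open>The same limit of Newton iterates describes the root over both fields, which is how
 analyticity passes from \<open>\<complex>\<close> to \<open>\<real>\<close>.\<close>

lemma newton_limit_root:
 fixes c :: "exponent => 'a::{real_normed_field, banach}"
 assumes dom: "(x0, y0, w0) \<in> laurent_dom A" and zero: "laurent A c (x0, y0, w0) = 0"
  and D: "D = dlaurent A c (x0, y0, w0) (0, 0, 1)" "D ~= 0" and e: "e > 0"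
 shows "\<exists>\<epsilon>>0. \<epsilon> \<le> e \<and> (\<exists>\<delta>>0. \<delta> \<le> e \<and> (\<forall>h k. norm h \<le> \<delta> --> norm k \<le> \<delta> -->
  (\<forall>w\<in>cball w0 \<epsilon>. (x0 + h, y0 + k, w) \<in> laurent_dom A) \<and>
  newton_limit A c D w0 (x0 + h, y0 + k) \<in> cball w0 \<epsilon> \<and>
  (\<forall>w\<in>cball w0 \<epsilon>. laurent A c (x0 + h, y0 + k, w) = 0 \<longleftrightarrow> w = newton_limit A c D w0 (x0 + h, y0 + k)) \<and>
  (\<forall>n. (newton_step A c D (x0 + h) (y0 + k) ^^ n) w0 \<in> cball w0 \<epsilon> \<and>
   dist ((newton_step A c D (x0 + h) (y0 + k) ^^ n) w0) (newton_limit A c D w0 (x0 + h, y0 + k)) \<le> (1 / 2) ^ n * \<epsilon>)))"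
proof -
 obtain \<epsilon>0 where \<epsilon>0: "\<epsilon>0 > 0" and conv: "\<And>\<epsilon>. 0 < \<epsilon> ==> \<epsilon> \<le> \<epsilon>0 ==> (\<exists>\<delta>>0. \<forall>h k. norm h \<le> \<delta> --> norm k \<le> \<delta> -->
  (\<forall>w\<in>cball w0 \<epsilon>. (x0 + h, y0 + k, w) \<in> laurent_dom A) \<and>
  (\<exists>\<phi>\<in>cball w0 \<epsilon>. (\<forall>w\<in>cball w0 \<epsilon>. laurent A c (x0 + h, y0 + k, w) = 0 \<longleftrightarrow> w = \<phi>) \<and>
   (\<forall>n. (newton_step A c D (x0 + h) (y0 + k) ^^ n) w0 \<in> cball w0 \<epsilon> \<and>
    dist ((newton_step A c D (x0 + h) (y0 + k) ^^ n) w0) \<phi> \<le> (1 / 2) ^ n * \<epsilon>)))"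
  using newton_step_converges[OF dom zero D] by (elim exE conjE) (rule that, assumption, blast)
 define \<epsilon> where "\<epsilon> = min \<epsilon>0 e"
 have \<epsilon>: "0 < \<epsilon>" "\<epsilon> \<le> \<epsilon>0" "\<epsilon> \<le> e" using \<epsilon>0 e by (auto simp: \<epsilon>_def)
 obtain \<delta> where \<delta>: "\<delta> > 0" and c: "\<forall>h k. norm h \<le> \<delta> --> norm k \<le> \<delta> -->
  (\<forall>w\<in>cball w0 \<epsilon>. (x0 + h, y0 + k, w) \<in> laurent_dom A) \<and>
  (\<exists>\<phi>\<in>cball w0 \<epsilon>. (\<forall>w\<in>cball w0 \<epsilon>. laurent A c (x0 + h, y0 + k, w) = 0 \<longleftrightarrow> w = \<phi>) \<and>
   (\<forall>n. (newton_step A c D (x0 + h) (y0 + k) ^^ n) w0 \<in> cball w0 \<epsilon> \<and>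
    dist ((newton_step A c D (x0 + h) (y0 + k) ^^ n) w0) \<phi> \<le> (1 / 2) ^ n * \<epsilon>))"
  using conv[OF \<epsilon>(1,2)] by (elim exE conjE) (rule that)
 show ?thesis
 proof (rule exI[of _ \<epsilon>], intro conjI \<epsilon>(1,3), rule exI[of _ "min \<delta> e"], intro conjI allI impI)
  fix h k :: 'a assume hk: "norm h \<le> min \<delta> e" "norm k \<le> min \<delta> e"
  then have hk': "norm h \<le> \<delta>" "norm k \<le> \<delta>" by auto
  note ck = c[rule_format, OF hk']
  show "\<forall>w\<in>cball w0 \<epsilon>. (x0 + h, y0 + k, w) \<in> laurent_dom A" by (rule ck[THEN conjunct1])
  obtain \<phi> where \<phi>: "\<phi> \<in> cball w0 \<epsilon>" "\<forall>w\<in>cball w0 \<epsilon>. laurent A c (x0 + h, y0 + k, w) = 0 \<longleftrightarrow> w = \<phi>"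
   and it: "\<forall>n. (newton_step A c D (x0 + h) (y0 + k) ^^ n) w0 \<in> cball w0 \<epsilon> \<and>
    dist ((newton_step A c D (x0 + h) (y0 + k) ^^ n) w0) \<phi> \<le> (1 / 2) ^ n * \<epsilon>"
   using ck[THEN conjunct2] by (elim bexE conjE) (rule that)
  have "(\<lambda>n. (newton_step A c D (x0 + h) (y0 + k) ^^ n) w0) \<longlonglongrightarrow> \<phi>"
  proof (rule metric_tendsto_imp_tendsto)
   show "(\<lambda>n. (1 / 2 :: real) ^ n * \<epsilon>) \<longlonglongrightarrow> 0" by (intro tendsto_mult_left_zero LIMSEQ_realpow_zero) auto
   show "\<forall>\<^sub>F n in sequentially. dist ((newton_step A c D (x0 + h) (y0 + k) ^^ n) w0) \<phi> \<le> dist ((1 / 2 :: real) ^ n * \<epsilon>) 0"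
    using it \<epsilon> by (intro always_eventually) auto
  qed
  then have e: "newton_limit A c D w0 (x0 + h, y0 + k) = \<phi>" unfolding newton_limit_def prod.case by (rule limI)
  show "newton_limit A c D w0 (x0 + h, y0 + k) \<in> cball w0 \<epsilon>"
   "\<forall>w\<in>cball w0 \<epsilon>. laurent A c (x0 + h, y0 + k, w) = 0 \<longleftrightarrow> w = newton_limit A c D w0 (x0 + h, y0 + k)"
   "(newton_step A c D (x0 + h) (y0 + k) ^^ n) w0 \<in> cball w0 \<epsilon>"
   "dist ((newton_step A c D (x0 + h) (y0 + k) ^^ n) w0) (newton_limit A c D w0 (x0 + h, y0 + k)) \<le> (1 / 2) ^ n * \<epsilon>" for n
   unfolding e using \<phi> it by blast+
 qed (use \<delta> e in auto)
qed

text \<open>Both functions are bounded near the point and holomorphic in each variable separately,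
  because one variable at a time may be frozen in the Newton iteration.\<close>

lemma complex_newton_limit_analytic:
 fixes c1 c2 :: "exponent => complex"
 assumes dom: "(x0, y0, w0) \<in> laurent_dom A1" "(x0, y0, w0) \<in> laurent_dom A2" and zero: "laurent A1 c1 (x0, y0, w0) = 0"
  and D: "D = dlaurent A1 c1 (x0, y0, w0) (0, 0, 1)" "D ~= 0"
 shows "analytic2_at (newton_limit A1 c1 D w0) (x0, y0)"
  and "analytic2_at (\<lambda>(x, y). laurent A2 c2 (x, y, newton_limit A1 c1 D w0 (x, y))) (x0, y0)"
proof -
 define M where "M = norm (laurent A2 c2 (x0, y0, w0)) + 1"
 let ?\<phi> = "newton_limit A1 c1 D w0"
 have "((\<lambda>q. norm (laurent A2 c2 q)) \<longlongrightarrow> norm (laurent A2 c2 (x0, y0, w0))) (nhds (x0, y0, w0))"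
  by (intro tendsto_intros isCont_tendsto_nhds[OF isCont_laurent[OF dom(2)]])
 then have "eventually (\<lambda>q. norm (laurent A2 c2 q) < M) (nhds (x0, y0, w0))" by (rule order_tendstoD) (simp add: M_def)
 then have "eventually (\<lambda>q. q \<in> laurent_dom A2 \<and> norm (laurent A2 c2 q) \<le> M) (nhds (x0, y0, w0))"
  using eventually_laurent_dom[OF dom(2)] by eventually_elim auto
 from eventually_nhds_box[OF this] obtain e where e: "e > 0" and box: "\<forall>h k d. norm h \<le> e --> norm k \<le> e --> norm d \<le> e -->
   (x0 + h, y0 + k, w0 + d) \<in> laurent_dom A2 \<and> norm (laurent A2 c2 (x0 + h, y0 + k, w0 + d)) \<le> M"
  by (elim exE conjE) (rule that)
 obtain \<epsilon> \<delta> where \<epsilon>: "\<epsilon> > 0" "\<epsilon> \<le> e" and \<delta>: "\<delta> > 0" "\<delta> \<le> e" and nl: "\<forall>h k. norm h \<le> \<delta> --> norm k \<le> \<delta> -->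
  (\<forall>w\<in>cball w0 \<epsilon>. (x0 + h, y0 + k, w) \<in> laurent_dom A1) \<and> ?\<phi> (x0 + h, y0 + k) \<in> cball w0 \<epsilon> \<and>
  (\<forall>w\<in>cball w0 \<epsilon>. laurent A1 c1 (x0 + h, y0 + k, w) = 0 \<longleftrightarrow> w = ?\<phi> (x0 + h, y0 + k)) \<and>
  (\<forall>n. (newton_step A1 c1 D (x0 + h) (y0 + k) ^^ n) w0 \<in> cball w0 \<epsilon> \<and>
   dist ((newton_step A1 c1 D (x0 + h) (y0 + k) ^^ n) w0) (?\<phi> (x0 + h, y0 + k)) \<le> (1 / 2) ^ n * \<epsilon>)"
  using newton_limit_root[OF dom(1) zero D e] by (elim exE conjE) (rule that[rotated 4], assumption+)
 have nl': "(x0 + h, y0 + k, (newton_step A1 c1 D (x0 + h) (y0 + k) ^^ n) w0) \<in> laurent_dom A1"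
   "dist ((newton_step A1 c1 D (x0 + h) (y0 + k) ^^ n) w0) (?\<phi> (x0 + h, y0 + k)) \<le> (1 / 2) ^ n * \<epsilon>"
   "?\<phi> (x0 + h, y0 + k) \<in> cball w0 \<epsilon>"
  if "norm h < \<delta>" "norm k < \<delta>" for h k n
  using nl[rule_format, OF less_imp_le[OF that(1)] less_imp_le[OF that(2)]] by blast+
 have h: "(\<lambda>h. ?\<phi> (x0 + h, y0 + k)) holomorphic_on ball 0 \<delta>" if "norm k < \<delta>" for k
  by (rule newton_limit_holomorphic[where u = "\<lambda>h. x0 + h" and v = "\<lambda>_. y0 + k" and A = A1 and c = c1 and D = D and ?w0.0 = w0 and \<epsilon> = \<epsilon>])
   (use nl' that in \<open>auto intro!: holomorphic_intros\<close>)
 have k: "(\<lambda>k. ?\<phi> (x0 + h, y0 + k)) holomorphic_on ball 0 \<delta>" if "norm h < \<delta>" for h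
  by (rule newton_limit_holomorphic[where u = "\<lambda>_. x0 + h" and v = "\<lambda>k. y0 + k" and A = A1 and c = c1 and D = D and ?w0.0 = w0 and \<epsilon> = \<epsilon>])
   (use nl' that in \<open>auto intro!: holomorphic_intros\<close>)
 have dom2: "(x0 + h, y0 + k, ?\<phi> (x0 + h, y0 + k)) \<in> laurent_dom A2 \<and>
   norm (laurent A2 c2 (x0 + h, y0 + k, ?\<phi> (x0 + h, y0 + k))) \<le> M" if "norm h < \<delta>" "norm k < \<delta>" for h k
 proof -
  have "norm (?\<phi> (x0 + h, y0 + k) - w0) \<le> e" using nl'(3)[OF that] \<epsilon> by (simp add: dist_norm norm_minus_commute)
  then show ?thesis using box[rule_format, of h k "?\<phi> (x0 + h, y0 + k) - w0"] that \<delta> by simp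
 qed
 show "analytic2_at ?\<phi> (x0, y0)"
 proof (rule sep_holomorphic_analytic2[where R = \<delta> and M = "norm w0 + \<epsilon>"])
  show "sep_holomorphic \<delta> (\<lambda>(h, k). ?\<phi> (x0 + h, y0 + k))"
   unfolding sep_holomorphic_def using h k by simp
  show "norm (?\<phi> (x0 + h, y0 + k)) \<le> norm w0 + \<epsilon>" if "norm h < \<delta>" "norm k < \<delta>" for h k
   using nl'(3)[OF that] norm_triangle_sub[of "?\<phi> (x0 + h, y0 + k)" w0] by (simp add: dist_norm norm_minus_commute)
 qed (rule \<delta>(1))
 show "analytic2_at (\<lambda>(x, y). laurent A2 c2 (x, y, ?\<phi> (x, y))) (x0, y0)"
 proof (rule sep_holomorphic_analytic2[where R = \<delta> and M = M])
  show "sep_holomorphic \<delta> (\<lambda>(h, k). case (x0 + h, y0 + k) of (x, y) => laurent A2 c2 (x, y, ?\<phi> (x, y)))"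
   unfolding sep_holomorphic_def prod.case
   by (intro conjI ballI laurent_holomorphic h k holomorphic_intros) (use dom2 in auto)
 qed (use dom2 \<delta> in auto)
qed

text \<open>The first polynomial is solved for \<open>w\<close> by \<phi>; the second, restricted to
  the graph of \<phi>, will be the local equation of the branch, hence its analyticity is recorded
  too.\<close>

definition implicit_branch :: "exponent set => (exponent => 'a::real_normed_field) => exponent set => (exponent => 'a) =>
  'a \<times> 'a \<times> 'a => bool" where
 "implicit_branch A1 c1 A2 c2 = (\<lambda>(x0, y0, w0). \<exists>\<phi> \<epsilon>0. \<epsilon>0 > 0 \<and> \<phi> (x0, y0) = w0 \<and> analytic2_at \<phi> (x0, y0) \<and>
   analytic2_at (\<lambda>(x, y). laurent A2 c2 (x, y, \<phi> (x, y))) (x0, y0) \<and>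
   (\<forall>\<^sub>F q in nhds (x0, y0). \<forall>w\<in>cball w0 \<epsilon>0. laurent A1 c1 (fst q, snd q, w) = 0 \<longleftrightarrow> w = \<phi> q))"

lemma newton_limit_implicit_branch:
 fixes c1 c2 :: "exponent => 'a::{real_normed_field, banach}"
 assumes dom: "(x0, y0, w0) \<in> laurent_dom A1" and zero: "laurent A1 c1 (x0, y0, w0) = 0"
  and D: "D = dlaurent A1 c1 (x0, y0, w0) (0, 0, 1)" "D ~= 0"
  and an: "analytic2_at (newton_limit A1 c1 D w0) (x0, y0)"
   "analytic2_at (\<lambda>(x, y). laurent A2 c2 (x, y, newton_limit A1 c1 D w0 (x, y))) (x0, y0)"
 shows "implicit_branch A1 c1 A2 c2 (x0, y0, w0)"
proof -
 let ?\<phi> = "newton_limit A1 c1 D w0"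
 obtain \<epsilon> \<delta> where \<epsilon>: "\<epsilon> > 0" and \<delta>: "\<delta> > 0" and nl: "\<forall>h k. norm h \<le> \<delta> --> norm k \<le> \<delta> -->
  (\<forall>w\<in>cball w0 \<epsilon>. (x0 + h, y0 + k, w) \<in> laurent_dom A1) \<and> ?\<phi> (x0 + h, y0 + k) \<in> cball w0 \<epsilon> \<and>
  (\<forall>w\<in>cball w0 \<epsilon>. laurent A1 c1 (x0 + h, y0 + k, w) = 0 \<longleftrightarrow> w = ?\<phi> (x0 + h, y0 + k)) \<and>
  (\<forall>n. (newton_step A1 c1 D (x0 + h) (y0 + k) ^^ n) w0 \<in> cball w0 \<epsilon> \<and>
   dist ((newton_step A1 c1 D (x0 + h) (y0 + k) ^^ n) w0) (?\<phi> (x0 + h, y0 + k)) \<le> (1 / 2) ^ n * \<epsilon>)"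
  using newton_limit_root[OF dom zero D zero_less_one] by (elim exE conjE) (rule that[rotated 2], assumption+)
 have root: "laurent A1 c1 (x0 + h, y0 + k, w) = 0 \<longleftrightarrow> w = ?\<phi> (x0 + h, y0 + k)"
  if "norm h \<le> \<delta>" "norm k \<le> \<delta>" "w \<in> cball w0 \<epsilon>" for h k w
  using nl[rule_format, OF that(1,2), THEN conjunct2, THEN conjunct2, THEN conjunct1] that(3) by blast
 have "?\<phi> (x0, y0) = w0" using root[of 0 0 w0] zero \<epsilon> \<delta> by simp
 moreover have "\<forall>\<^sub>F q in nhds (x0, y0). \<forall>w\<in>cball w0 \<epsilon>. laurent A1 c1 (fst q, snd q, w) = 0 \<longleftrightarrow> w = ?\<phi> q"
  unfolding eventually_nhds_metric
 proof (intro exI[of _ \<delta>] conjI allI impI ballI)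
  fix q :: "'a \<times> 'a" and w assume "dist q (x0, y0) < \<delta>" "w \<in> cball w0 \<epsilon>"
  then show "laurent A1 c1 (fst q, snd q, w) = 0 \<longleftrightarrow> w = ?\<phi> q"
   using root[of "fst q - x0" "snd q - y0" w] dist_fst_le[of q "(x0, y0)"] dist_snd_le[of q "(x0, y0)"]
   by (simp add: dist_norm)
 qed (rule \<delta>)
 ultimately show ?thesis unfolding implicit_branch_def prod.case using an \<epsilon> by (intro exI[of _ ?\<phi>] exI[of _ \<epsilon>]) simp
qed

lemma implicit_branch_complex:
 fixes c1 c2 :: "exponent => complex"
 assumes dom: "(x0, y0, w0) \<in> laurent_dom A1" "(x0, y0, w0) \<in> laurent_dom A2" and zero: "laurent A1 c1 (x0, y0, w0) = 0"
  and D: "dlaurent A1 c1 (x0, y0, w0) (0, 0, 1) ~= 0"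
 shows "implicit_branch A1 c1 A2 c2 (x0, y0, w0)"
 using newton_limit_implicit_branch[OF dom(1) zero refl D] complex_newton_limit_analytic[OF dom zero refl D] by blast

lemma of_real_dlaurent:
 "dlaurent A (\<lambda>e. complex_of_real (c e)) (complex_of_real x, complex_of_real y, complex_of_real w)
   (complex_of_real a, complex_of_real b, complex_of_real d) = complex_of_real (dlaurent A c (x, y, w) (a, b, d))"
 by (simp add: dlaurent_def case_prod_unfold of_real_power_int)

lemma of_real_newton_step:
 "(newton_step A (\<lambda>e. complex_of_real (c e)) (complex_of_real D) (complex_of_real x) (complex_of_real y) ^^ n) (complex_of_real w) =
   complex_of_real ((newton_step A c D x y ^^ n) w)"
 by (induction n) (simp_all add: newton_step_def of_real_laurent)

text \<open>Newton iterates started from real data stay real, so the complex root function restricts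
  to the real one, and its expansion has a real counterpart.\<close>

lemma implicit_branch_real:
 fixes c1 c2 :: "exponent => real"
 assumes dom: "(x0, y0, w0) \<in> laurent_dom A1" "(x0, y0, w0) \<in> laurent_dom A2" and zero: "laurent A1 c1 (x0, y0, w0) = 0"
  and D: "dlaurent A1 c1 (x0, y0, w0) (0, 0, 1) ~= 0"
 shows "implicit_branch A1 c1 A2 c2 (x0, y0, w0)"
proof -
 define D where "D = dlaurent A1 c1 (x0, y0, w0) (0, 0, 1)"
 have dom': "(complex_of_real x0, complex_of_real y0, complex_of_real w0) \<in> laurent_dom A1"
  "(complex_of_real x0, complex_of_real y0, complex_of_real w0) \<in> laurent_dom A2"
  using dom by (auto simp: laurent_dom_def)
 have zero': "laurent A1 (\<lambda>e. complex_of_real (c1 e)) (complex_of_real x0, complex_of_real y0, complex_of_real w0) = 0"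
  by (simp add: of_real_laurent zero)
 have D': "complex_of_real D = dlaurent A1 (\<lambda>e. complex_of_real (c1 e)) (complex_of_real x0, complex_of_real y0, complex_of_real w0) (0, 0, 1)"
  using of_real_dlaurent[of A1 c1 x0 y0 w0 0 0 1] by (simp add: D_def)
 have D0: "complex_of_real D ~= 0" using D by (simp add: D_def)
 let ?\<phi> = "newton_limit A1 c1 D w0"
 let ?\<psi> = "newton_limit A1 (\<lambda>e. complex_of_real (c1 e)) (complex_of_real D) (complex_of_real w0)"
 obtain \<epsilon> \<delta> where \<delta>: "\<delta> > 0" and nl: "\<forall>h k. norm h \<le> \<delta> --> norm k \<le> \<delta> -->
  (\<forall>w\<in>cball w0 \<epsilon>. (x0 + h, y0 + k, w) \<in> laurent_dom A1) \<and> ?\<phi> (x0 + h, y0 + k) \<in> cball w0 \<epsilon> \<and>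
  (\<forall>w\<in>cball w0 \<epsilon>. laurent A1 c1 (x0 + h, y0 + k, w) = 0 \<longleftrightarrow> w = ?\<phi> (x0 + h, y0 + k)) \<and>
  (\<forall>n. (newton_step A1 c1 D (x0 + h) (y0 + k) ^^ n) w0 \<in> cball w0 \<epsilon> \<and>
   dist ((newton_step A1 c1 D (x0 + h) (y0 + k) ^^ n) w0) (?\<phi> (x0 + h, y0 + k)) \<le> (1 / 2) ^ n * \<epsilon>)"
  using newton_limit_root[OF dom(1) zero D_def D[folded D_def] zero_less_one] by (elim exE conjE) (rule that[rotated 1], assumption+)
 have eq: "?\<psi> (complex_of_real (x0 + h), complex_of_real (y0 + k)) = complex_of_real (?\<phi> (x0 + h, y0 + k))"
  if "norm h < \<delta>" "norm k < \<delta>" for h k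
 proof -
  have "(\<lambda>n. (newton_step A1 c1 D (x0 + h) (y0 + k) ^^ n) w0) \<longlonglongrightarrow> ?\<phi> (x0 + h, y0 + k)"
  proof (rule metric_tendsto_imp_tendsto)
   show "(\<lambda>n. (1 / 2 :: real) ^ n * \<epsilon>) \<longlonglongrightarrow> 0" by (intro tendsto_mult_left_zero LIMSEQ_realpow_zero) auto
   show "\<forall>\<^sub>F n in sequentially. dist ((newton_step A1 c1 D (x0 + h) (y0 + k) ^^ n) w0) (?\<phi> (x0 + h, y0 + k)) \<le> dist ((1 / 2 :: real) ^ n * \<epsilon>) 0"
   proof (intro always_eventually allI)
    fix n
    have "dist ((newton_step A1 c1 D (x0 + h) (y0 + k) ^^ n) w0) (?\<phi> (x0 + h, y0 + k)) \<le> (1 / 2) ^ n * \<epsilon>"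
     using nl[rule_format, OF less_imp_le[OF that(1)] less_imp_le[OF that(2)], THEN conjunct2, THEN conjunct2, THEN conjunct2] by blast
    then show "dist ((newton_step A1 c1 D (x0 + h) (y0 + k) ^^ n) w0) (?\<phi> (x0 + h, y0 + k)) \<le> dist ((1 / 2 :: real) ^ n * \<epsilon>) 0"
     by simp
   qed
  qed
  then have "(\<lambda>n. complex_of_real ((newton_step A1 c1 D (x0 + h) (y0 + k) ^^ n) w0)) \<longlonglongrightarrow> complex_of_real (?\<phi> (x0 + h, y0 + k))"
   by (rule tendsto_of_real)
  then show ?thesis
   unfolding newton_limit_def[of A1 "\<lambda>e. complex_of_real (c1 e)"] prod.case of_real_newton_step by (rule limI)
 qed
 show ?thesis
 proof (rule newton_limit_implicit_branch[OF dom(1) zero D_def D[folded D_def]])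
  show "analytic2_at ?\<phi> (x0, y0)"
   by (rule analytic2_at_real[OF complex_newton_limit_analytic(1)[OF dom' zero' D' D0] \<delta> eq])
  show "analytic2_at (\<lambda>(x, y). laurent A2 c2 (x, y, ?\<phi> (x, y))) (x0, y0)"
   by (rule analytic2_at_real[OF complex_newton_limit_analytic(2)[OF dom' zero' D' D0, of "\<lambda>e. complex_of_real (c2 e)"] \<delta>])
    (simp only: prod.case eq of_real_laurent)
 qed
qed

section \<open>Local branches\<close>

text \<open>The closed ball for \<open>w\<close> is what makes the set closed near the base
  point.\<close>

definition branch_set :: "exponent set => (exponent => 'a::real_normed_field) => exponent set => (exponent => 'a) =>
  'a => real => ('a \<times> 'a) set" where
 "branch_set A1 c1 A2 c2 w0 \<epsilon> =
   {q. \<exists>w\<in>cball w0 \<epsilon>. laurent A1 c1 (fst q, snd q, w) = 0 \<and> laurent A2 c2 (fst q, snd q, w) = 0}"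

lemma branch_set_swap: "branch_set A2 c2 A1 c1 w0 \<epsilon> = branch_set A1 c1 A2 c2 w0 \<epsilon>"
 unfolding branch_set_def by blast

lemma graph_has_derivative:
 fixes c :: "exponent => 'a::real_normed_field"
 assumes \<phi>: "(\<phi> has_derivative (\<lambda>(a, b). u * a + v * b)) (at (x0, y0))"
  and dom: "(x0, y0, \<phi> (x0, y0)) \<in> laurent_dom A"
 shows "((\<lambda>q. laurent A c (fst q, snd q, \<phi> q)) has_derivative
  (\<lambda>(a, b). dlaurent A c (x0, y0, \<phi> (x0, y0)) (a, b, u * a + v * b))) (at (x0, y0))"
proof -
 have "((\<lambda>q. (fst q, snd q, \<phi> q)) has_derivative (\<lambda>d. (fst d, snd d, case d of (a, b) => u * a + v * b))) (at (x0, y0))"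
  by (intro has_derivative_Pair has_derivative_fst has_derivative_snd has_derivative_ident \<phi>)
 moreover have "(laurent A c has_derivative dlaurent A c (x0, y0, \<phi> (x0, y0))) (at (fst (x0, y0), snd (x0, y0), \<phi> (x0, y0)))"
  unfolding fst_conv snd_conv by (rule laurent_has_derivative[OF dom])
 ultimately have "((\<lambda>q. laurent A c (fst q, snd q, \<phi> q)) has_derivative
  (\<lambda>d. dlaurent A c (x0, y0, \<phi> (x0, y0)) (fst d, snd d, case d of (a, b) => u * a + v * b))) (at (x0, y0))"
  by (rule has_derivative_compose)
 then show ?thesis by (simp only: case_prod_unfold)
qed

text \<open>The branch is the zero set of the second polynomial on the graph of the root function,
  and kernel vectors of its differential lift to tangent vectors of the spatial curve. The germ is
  the same for all small \<epsilon>, because the root function is continuous and eventually enters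
  every ball about \<open>w0\<close>.\<close>

lemma implicit_branch_smooth:
 fixes c1 c2 :: "exponent => 'a::{real_normed_field, banach}"
 assumes br: "implicit_branch A1 c1 A2 c2 (x0, y0, w0)"
  and dom: "(x0, y0, w0) \<in> laurent_dom A1" "(x0, y0, w0) \<in> laurent_dom A2"
  and zero: "laurent A1 c1 (x0, y0, w0) = 0" "laurent A2 c2 (x0, y0, w0) = 0"
  and D: "dlaurent A1 c1 (x0, y0, w0) (0, 0, 1) ~= 0"
  and rows: "\<And>\<nu> \<mu>. (\<forall>d\<in>{(1, 0, 0), (0, 1, 0), (0, 0, 1)}.
   \<nu> * dlaurent A1 c1 (x0, y0, w0) d + \<mu> * dlaurent A2 c2 (x0, y0, w0) d = 0) ==> \<nu> = 0 \<and> \<mu> = 0"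
 shows "\<exists>u v e. e > 0 \<and> (\<forall>a b. u * a + v * b = 0 -->
   (\<exists>d. dlaurent A1 c1 (x0, y0, w0) (a, b, d) = 0 \<and> dlaurent A2 c2 (x0, y0, w0) (a, b, d) = 0)) \<and>
  (\<forall>\<epsilon>. 0 < \<epsilon> --> \<epsilon> \<le> e --> smooth_branch_at (branch_set A1 c1 A2 c2 w0 \<epsilon>) (x0, y0) (u, v))"
proof -
 obtain \<phi> e where e: "e > 0" and \<phi>0: "\<phi> (x0, y0) = w0" and an: "analytic2_at \<phi> (x0, y0)"
   "analytic2_at (\<lambda>(x, y). laurent A2 c2 (x, y, \<phi> (x, y))) (x0, y0)"
  and root: "\<forall>\<^sub>F q in nhds (x0, y0). \<forall>w\<in>cball w0 e. laurent A1 c1 (fst q, snd q, w) = 0 \<longleftrightarrow> w = \<phi> q"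
  using br unfolding implicit_branch_def prod.case by (elim exE conjE) (rule that)
 obtain u1 v1 where \<phi>': "(\<phi> has_derivative (\<lambda>(a, b). u1 * a + v1 * b)) (at (x0, y0))"
  using analytic2_at_has_derivative[OF an(1)] by blast
 define g where "g = (\<lambda>q. laurent A2 c2 (fst q, snd q, \<phi> q))"
 have g: "analytic2_at g (x0, y0)" using an(2) by (simp add: g_def case_prod_unfold)
 let ?d1 = "dlaurent A1 c1 (x0, y0, w0)" and ?d2 = "dlaurent A2 c2 (x0, y0, w0)"
 have g': "(g has_derivative (\<lambda>(a, b). ?d2 (a, b, u1 * a + v1 * b))) (at (x0, y0))"
  using graph_has_derivative[OF \<phi>', of A2 c2] dom(2) unfolding g_def \<phi>0 by blast
 have f': "((\<lambda>q. laurent A1 c1 (fst q, snd q, \<phi> q)) has_derivative (\<lambda>(a, b). ?d1 (a, b, u1 * a + v1 * b))) (at (x0, y0))"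
  using graph_has_derivative[OF \<phi>', of A1 c1] dom(1) unfolding \<phi>0 by blast
 have near: "\<forall>\<^sub>F q in nhds (x0, y0). \<phi> q \<in> cball w0 \<epsilon>" if "\<epsilon> > 0" for \<epsilon>
 proof -
  have "(\<phi> \<longlongrightarrow> w0) (nhds (x0, y0))"
   using isCont_tendsto_nhds[OF has_derivative_continuous[OF \<phi>']] unfolding \<phi>0 .
  then have "\<forall>\<^sub>F q in nhds (x0, y0). dist (\<phi> q) w0 < \<epsilon>" by (rule tendstoD[OF _ that])
  then show ?thesis by eventually_elim (simp add: dist_commute)
 qed
 have f0: "\<forall>\<^sub>F q in nhds (x0, y0). laurent A1 c1 (fst q, snd q, \<phi> q) = 0"
  using root near[OF e] by eventually_elim blast
 \<comment> \<open>Implicit differentiation: the first polynomial vanishes identically along the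
   graph.\<close>
 have "((\<lambda>_. 0) has_derivative (\<lambda>(a, b). ?d1 (a, b, u1 * a + v1 * b))) (at (x0, y0))"
 proof (rule has_derivative_transform_eventually[OF f'])
  show "\<forall>\<^sub>F q in at (x0, y0). laurent A1 c1 (fst q, snd q, \<phi> q) = 0"
   using f0 by (rule eventually_at_filter[THEN iffD2, OF eventually_mono]) blast
  show "laurent A1 c1 (fst (x0, y0), snd (x0, y0), \<phi> (x0, y0)) = 0" using zero(1) \<phi>0 by simp
 qed simp
 then have "(\<lambda>(a, b). ?d1 (a, b, u1 * a + v1 * b)) = (\<lambda>_. 0)"
  by (rule has_derivative_unique) (rule has_derivative_const)
 then have k1: "?d1 (a, b, u1 * a + v1 * b) = 0" for a b by (drule_tac x = "(a, b)" in fun_cong) simp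
 define u where "u = ?d2 (1, 0, u1)"
 define v where "v = ?d2 (0, 1, v1)"
 have k2: "?d2 (a, b, u1 * a + v1 * b) = u * a + v * b" for a b
  unfolding u_def v_def dlaurent_linear[of A2 c2 _ a b] dlaurent_linear[of A2 c2 _ 1 0 u1] dlaurent_linear[of A2 c2 _ 0 1 v1]
  by (simp add: algebra_simps)
 have uv: "(u, v) ~= (0, 0)"
 proof
  assume "(u, v) = (0, 0)"
  then have uv0: "u = 0" "v = 0" by auto
  have a1: "?d1 (1, 0, 0) = - (u1 * ?d1 (0, 0, 1))"
   using k1[of 1 0] dlaurent_linear[of A1 c1 "(x0, y0, w0)" 1 0 u1] by (simp add: eq_neg_iff_add_eq_0)
  have b1: "?d1 (0, 1, 0) = - (v1 * ?d1 (0, 0, 1))"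
   using k1[of 0 1] dlaurent_linear[of A1 c1 "(x0, y0, w0)" 0 1 v1] by (simp add: eq_neg_iff_add_eq_0)
  have a2: "?d2 (1, 0, 0) = - (u1 * ?d2 (0, 0, 1))"
   using uv0(1) dlaurent_linear[of A2 c2 "(x0, y0, w0)" 1 0 u1] by (simp add: u_def eq_neg_iff_add_eq_0)
  have b2: "?d2 (0, 1, 0) = - (v1 * ?d2 (0, 0, 1))"
   using uv0(2) dlaurent_linear[of A2 c2 "(x0, y0, w0)" 0 1 v1] by (simp add: v_def eq_neg_iff_add_eq_0)
  \<comment> \<open>With a zero differential both gradients are multiples of
    \<open>(- u1, - v1, 1)\<close>, so crosswise multiples by their last components give a row
    relation.\<close>
  have "?d2 (0, 0, 1) = 0 \<and> - ?d1 (0, 0, 1) = 0"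
   by (rule rows) (simp add: a1 b1 a2 b2 mult.commute mult.left_commute)
  then show False using D by simp
 qed
 have smooth: "smooth_branch_at (branch_set A1 c1 A2 c2 w0 \<epsilon>) (x0, y0) (u, v)" if \<epsilon>: "0 < \<epsilon>" "\<epsilon> \<le> e" for \<epsilon>
  unfolding smooth_branch_at_def prod.case
 proof (intro conjI uv exI[of _ g] g)
  show "g (x0, y0) = 0" using zero(2) \<phi>0 by (simp add: g_def)
  show "(g has_derivative (\<lambda>(h, k). u * h + v * k)) (at (x0, y0))" using g' by (simp only: k2)
  show "\<forall>\<^sub>F q in nhds (x0, y0). (q \<in> branch_set A1 c1 A2 c2 w0 \<epsilon>) = (g q = 0)"
   using root near[OF \<epsilon>(1)]
  proof eventually_elim
   case (elim q)
   have "laurent A1 c1 (fst q, snd q, w) = 0 \<longleftrightarrow> w = \<phi> q" if "w \<in> cball w0 \<epsilon>" for w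
    using elim(1) that \<epsilon>(2) by auto
   then show ?case using elim(2) unfolding branch_set_def g_def by blast
  qed
 qed
 have ker: "\<exists>d. ?d1 (a, b, d) = 0 \<and> ?d2 (a, b, d) = 0" if "u * a + v * b = 0" for a b
  using k1[of a b] k2[of a b] unfolding that by blast
 show ?thesis
  by (rule exI[of _ u], rule exI[of _ v], rule exI[of _ e], intro conjI allI impI e ker smooth; assumption)
qed

lemma smooth_branch_at_cong:
 assumes "smooth_branch_at S p w" "\<forall>\<^sub>F q in nhds p. q \<in> T \<longleftrightarrow> q \<in> S"
 shows "smooth_branch_at T p w"
proof -
 obtain u v where w: "w = (u, v)" by (cases w)
 obtain g where g: "(u, v) ~= (0, 0)" "analytic2_at g p" "g p = 0" "(g has_derivative (\<lambda>(h, k). u * h + v * k)) (at p)"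
   "\<forall>\<^sub>F q in nhds p. q \<in> S \<longleftrightarrow> g q = 0"
  using assms(1) unfolding w smooth_branch_at_def prod.case by (elim exE conjE) (rule that)
 have "\<forall>\<^sub>F q in nhds p. q \<in> T \<longleftrightarrow> g q = 0" using assms(2) g(5) by eventually_elim blast
 then show ?thesis unfolding w smooth_branch_at_def prod.case using g by (intro conjI exI[of _ g])
qed

section \<open>Local closedness and the closure of the image\<close>

definition closed_near :: "'a::metric_space set => 'a => bool" where
 "closed_near T p \<longleftrightarrow> (\<exists>\<delta>>0. closed (T \<inter> cball p \<delta>))"

lemma closed_near_Un:
 assumes "closed_near S p" "closed_near T p"
 shows "closed_near (S \<union> T) p"
proof -
 obtain \<delta> \<delta>' where d: "\<delta> > 0" "closed (S \<inter> cball p \<delta>)" "\<delta>' > 0" "closed (T \<inter> cball p \<delta>')"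
  using assms unfolding closed_near_def by blast
 have "(S \<union> T) \<inter> cball p (min \<delta> \<delta>') = (S \<inter> cball p \<delta> \<union> T \<inter> cball p \<delta>') \<inter> cball p (min \<delta> \<delta>')" by auto
 then have "closed ((S \<union> T) \<inter> cball p (min \<delta> \<delta>'))" using d by auto
 then show ?thesis unfolding closed_near_def using d by (intro exI[of _ "min \<delta> \<delta>'"]) auto
qed

text \<open>Near \<open>p\<close> the closure of \<open>S\<close> stays inside the locally closed
  \<open>T\<close>. Conversely \<open>T\<close> may add to \<open>S\<close> at most \<open>p\<close>
  itself, which lies in the closure; this covers a root sitting at zero or infinity over
  \<open>p\<close>.\<close>

lemma closure_near:
 fixes p :: "'a::metric_space"
 assumes T: "closed_near T p" and ST: "\<forall>\<^sub>F q in nhds p. q \<in> S --> q \<in> T" and TS: "\<forall>\<^sub>F q in nhds p. q \<in> T --> q \<in> S \<or> q = p"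
  and p: "p \<in> closure S"
 shows "\<forall>\<^sub>F q in nhds p. q \<in> closure S \<longleftrightarrow> q \<in> T"
proof -
 obtain \<delta> where \<delta>: "\<delta> > 0" "closed (T \<inter> cball p \<delta>)" using T unfolding closed_near_def by blast
 obtain U where U: "open U" "p \<in> U" "\<And>q. q \<in> U ==> q \<in> S ==> q \<in> T" using ST unfolding eventually_nhds by blast
 have "closure S \<inter> (U \<inter> ball p \<delta>) \<subseteq> closure (S \<inter> (U \<inter> ball p \<delta>))"
  using open_Int_closure_subset[of "U \<inter> ball p \<delta>" S] U(1) by (auto simp: Int_ac)
 also have "\<dots> \<subseteq> T \<inter> cball p \<delta>" by (rule closure_minimal[OF _ \<delta>(2)]) (use U(3) in auto)
 finally have sub: "closure S \<inter> (U \<inter> ball p \<delta>) \<subseteq> T" by blast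
 have "\<forall>\<^sub>F q in nhds p. q \<in> U \<inter> ball p \<delta>"
  by (rule eventually_nhds_in_open) (use U \<delta> in auto)
 with TS show ?thesis
  by eventually_elim (use sub p closure_subset in blast)
qed

text \<open>Locally the branch set is the projection of the compact set of common zeros in a product
  of closed balls.\<close>

lemma closed_near_branch_set:
 fixes c1 c2 :: "exponent => 'a::{real_normed_field, heine_borel}"
 assumes dom: "(x0, y0, w0) \<in> laurent_dom A1" "(x0, y0, w0) \<in> laurent_dom A2"
 shows "\<exists>e>0. \<forall>\<epsilon>. 0 < \<epsilon> --> \<epsilon> \<le> e --> closed_near (branch_set A1 c1 A2 c2 w0 \<epsilon>) (x0, y0)"
proof -
 have "\<forall>\<^sub>F q in nhds (x0, y0, w0). q \<in> laurent_dom A1 \<inter> laurent_dom A2"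
  using eventually_laurent_dom[OF dom(1)] eventually_laurent_dom[OF dom(2)] by eventually_elim blast
 from eventually_nhds_box[OF this] obtain e where e: "e > 0" and box: "\<forall>h k d. norm h \<le> e --> norm k \<le> e --> norm d \<le> e -->
   (x0 + h, y0 + k, w0 + d) \<in> laurent_dom A1 \<inter> laurent_dom A2"
  by (elim exE conjE) (rule that)
 have "closed_near (branch_set A1 c1 A2 c2 w0 \<epsilon>) (x0, y0)" if \<epsilon>: "0 < \<epsilon>" "\<epsilon> \<le> e" for \<epsilon>
  unfolding closed_near_def
 proof (intro exI[of _ e] conjI e)
  define K where "K = cball x0 e \<times> cball y0 e \<times> cball w0 \<epsilon>"
  have K: "compact K" unfolding K_def by (intro compact_Times compact_cball)
  have Kdom: "q \<in> laurent_dom A1 \<and> q \<in> laurent_dom A2" if q: "q \<in> K" for q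
  proof -
   obtain x y w where xyw: "q = (x, y, w)" by (cases q)
   have "norm (x - x0) \<le> e" "norm (y - y0) \<le> e" "norm (w - w0) \<le> e"
    using q \<epsilon> by (auto simp: xyw K_def dist_norm norm_minus_commute)
   then show ?thesis using box[rule_format, of "x - x0" "y - y0" "w - w0"] by (simp add: xyw)
  qed
  have cont: "continuous_on K (laurent A1 c1)" "continuous_on K (laurent A2 c2)"
   using Kdom isCont_laurent by (blast intro: continuous_at_imp_continuous_on)+
  have "closed (K \<inter> laurent A1 c1 -` {0})" "closed (K \<inter> laurent A2 c2 -` {0})"
   by (rule continuous_closed_preimage[OF _ compact_imp_closed[OF K] closed_singleton]; rule cont)+
  then have "compact (K \<inter> ((K \<inter> laurent A1 c1 -` {0}) \<inter> (K \<inter> laurent A2 c2 -` {0})))"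
   by (rule compact_Int_closed[OF K closed_Int])
  then have "compact ((\<lambda>q. (fst q, fst (snd q))) ` (K \<inter> ((K \<inter> laurent A1 c1 -` {0}) \<inter> (K \<inter> laurent A2 c2 -` {0}))))"
   by (rule compact_continuous_image[rotated]) (intro continuous_intros)
  then have "closed ((\<lambda>q. (fst q, fst (snd q))) ` (K \<inter> ((K \<inter> laurent A1 c1 -` {0}) \<inter> (K \<inter> laurent A2 c2 -` {0}))) \<inter> cball (x0, y0) e)"
   by (intro closed_Int compact_imp_closed closed_cball)
  moreover have "branch_set A1 c1 A2 c2 w0 \<epsilon> \<inter> cball (x0, y0) e =
    (\<lambda>q. (fst q, fst (snd q))) ` (K \<inter> ((K \<inter> laurent A1 c1 -` {0}) \<inter> (K \<inter> laurent A2 c2 -` {0}))) \<inter> cball (x0, y0) e" (is "?L = ?R")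
  proof (intro equalityI subsetI)
   fix q assume q: "q \<in> ?L"
   then obtain w where w: "w \<in> cball w0 \<epsilon>" "laurent A1 c1 (fst q, snd q, w) = 0" "laurent A2 c2 (fst q, snd q, w) = 0"
    unfolding branch_set_def by blast
   have "dist (x0, y0) q \<le> e" using q by simp
   then have "(fst q, snd q, w) \<in> K"
    using w(1) dist_fst_le[of "(x0, y0)" q] dist_snd_le[of "(x0, y0)" q] by (auto simp: K_def)
   then show "q \<in> ?R" using q w by (auto intro!: image_eqI[of _ _ "(fst q, snd q, w)"])
  next
   fix q assume "q \<in> ?R"
   then show "q \<in> ?L" unfolding branch_set_def K_def by auto
  qed
  ultimately show "closed (branch_set A1 c1 A2 c2 w0 \<epsilon> \<inter> cball (x0, y0) e)" by simp
 qed
 then show ?thesis using e by blast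
qed

section \<open>Roots near zero and infinity\<close>

text \<open>With \<open>w = z powi s\<close>, \<open>s = \<plusminus>1\<close>, and after division by \<open>z powi m\<close>, the extreme exponent \<open>m\<close>
 becomes \<open>0\<close>; thus \<open>w = 0\<close> stands for \<open>z = 0\<close> or \<open>z = \<infinity>\<close>.\<close>

definition shift_exps :: "int => int => exponent set => exponent set" where
 "shift_exps s m A = (\<lambda>(i, j, k). (i, j, s * (k - m))) ` A"

definition shift_coeffs :: "int => int => (exponent => 'a) => exponent => 'a" where
 "shift_coeffs s m c = (\<lambda>(i, j, l). c (i, j, m + s * l))"

lemma sum_shift_exps:
 assumes s: "s = 1 \<or> s = -1"
 shows "(\<Sum>(i, j, l)\<in>shift_exps s m A. F i j l (shift_coeffs s m c (i, j, l))) = (\<Sum>(i, j, k)\<in>A. F i j (s * (k - m)) (c (i, j, k)))"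
proof -
 have inj: "inj_on (\<lambda>(i, j, k). (i, j, s * (k - m))) A" using s by (auto simp: inj_on_def)
 have ss: "s * (s * t) = t" for t using s by auto
 show ?thesis unfolding shift_exps_def sum.reindex[OF inj]
  by (intro sum.cong refl) (auto simp: shift_coeffs_def ss)
qed

text \<open>For \<open>w\<close> nonzero the new polynomial is the old one times a unit. At
  \<open>w = 0\<close> only the exponent \<open>m\<close> survives, because \<open>0 powi l\<close>
  is zero for every nonzero \<open>l\<close>.\<close>

lemma laurent_shift:
 fixes c :: "exponent => 'a::field"
 assumes s: "s = 1 \<or> s = -1" and A: "finite A"
 shows "w ~= 0 ==> laurent (shift_exps s m A) (shift_coeffs s m c) (x, y, w) = w powi (- (s * m)) * laurent A c (x, y, w powi s)"
  and "laurent (shift_exps s m A) (shift_coeffs s m c) (x, y, 0) = coef A c m x y"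
proof -
 have e: "laurent (shift_exps s m A) (shift_coeffs s m c) (x, y, w) = (\<Sum>(i, j, k)\<in>A. c (i, j, k) * x powi i * y powi j * w powi (s * (k - m)))" for w
  unfolding laurent_def prod.case
  by (rule sum_shift_exps[OF s, of "\<lambda>i j l d. d * x powi i * y powi j * w powi l"])
 show "laurent (shift_exps s m A) (shift_coeffs s m c) (x, y, w) = w powi (- (s * m)) * laurent A c (x, y, w powi s)" if "w ~= 0"
 proof -
  have "w powi (s * (k - m)) = w powi (- (s * m)) * (w powi s) powi k" for k
   using that unfolding power_int_mult[symmetric] by (simp add: power_int_add[symmetric] algebra_simps)
  then show ?thesis unfolding e unfolding laurent_def prod.case sum_distrib_left
   by (intro sum.cong refl) (simp add: case_prod_unfold mult_ac)
 qed
 show "laurent (shift_exps s m A) (shift_coeffs s m c) (x, y, 0) = coef A c m x y"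
  unfolding e coef_def using A s
  by (intro sum.mono_neutral_cong_right) (auto simp: power_int_0_left_if split: if_splits)
qed

lemma laurent_dom_shift:
 "(\<And>k. k \<in> last_coords A ==> s * (k - m) \<ge> 0) ==> x ~= 0 ==> y ~= 0 ==> (x, y, w) \<in> laurent_dom (shift_exps s m A)"
 by (force simp: laurent_dom_def shift_exps_def last_coords_def)

text \<open>At \<open>w = 0\<close> the horizontal part sees only exponent \<open>m\<close>, and the
  vertical part only the linear term, which is the coefficient next to the extreme one.\<close>

lemma dlaurent_shift:
 fixes c :: "exponent => 'a::field"
 assumes s: "s = 1 \<or> s = -1" and A: "finite A" and xy: "x ~= 0" "y ~= 0"
 shows "dlaurent (shift_exps s m A) (shift_coeffs s m c) (x, y, 0) (a, b, d) =
  logder {e \<in> A. snd (snd e) = m} c (x, y, 1) (a / x, b / y, 0) + d * coef A c (m + s) x y"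
proof -
 have e: "dlaurent (shift_exps s m A) (shift_coeffs s m c) (x, y, 0) (a, b, d) = (\<Sum>(i, j, k)\<in>A. c (i, j, k) *
   (of_int i * x powi (i - 1) * y powi j * 0 powi (s * (k - m)) * a + of_int j * x powi i * y powi (j - 1) * 0 powi (s * (k - m)) * b +
   of_int (s * (k - m)) * x powi i * y powi j * 0 powi (s * (k - m) - 1) * d))"
  unfolding dlaurent_def prod.case
  by (rule sum_shift_exps[OF s, of "\<lambda>i j l e. e * (of_int i * x powi (i - 1) * y powi j * 0 powi l * a +
   of_int j * x powi i * y powi (j - 1) * 0 powi l * b + of_int l * x powi i * y powi j * 0 powi (l - 1) * d)"])
 have p: "x powi (i - 1) = x powi i / x" "y powi (i - 1) = y powi i / y" for i using xy by (simp_all add: power_int_diff)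
 have 1: "(\<Sum>(i, j, k)\<in>A. c (i, j, k) * (of_int i * x powi (i - 1) * y powi j * 0 powi (s * (k - m)) * a +
   of_int j * x powi i * y powi (j - 1) * 0 powi (s * (k - m)) * b)) = logder {e \<in> A. snd (snd e) = m} c (x, y, 1) (a / x, b / y, 0)"
  unfolding logder_def prod.case using A s
  by (intro sum.mono_neutral_cong_right) (auto simp: power_int_0_left_if p algebra_simps split: if_splits)
 have 2: "(\<Sum>(i, j, k)\<in>A. c (i, j, k) * (of_int (s * (k - m)) * x powi i * y powi j * 0 powi (s * (k - m) - 1) * d)) = d * coef A c (m + s) x y"
  unfolding coef_def sum_distrib_left using A s
  by (intro sum.mono_neutral_cong_right) (auto simp: power_int_0_left_if split: if_splits)
 show ?thesis unfolding e 1[symmetric] 2[symmetric] sum.distrib[symmetric]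
  by (intro sum.cong refl) (auto simp: algebra_simps)
qed

lemma dlaurent_logder:
 fixes c :: "exponent => 'a::field"
 assumes "x ~= 0" "y ~= 0" "z ~= 0"
 shows "dlaurent A c (x, y, z) (a, b, d) = logder A c (x, y, z) (a / x, b / y, d / z)"
 unfolding dlaurent_def logder_def prod.case
 by (intro sum.cong refl) (use assms in \<open>auto simp: power_int_diff field_simps\<close>)

lemma tube_lemma_box:
 fixes x0 y0 :: "'a::real_normed_vector"
 assumes K: "compact (K :: 'a set)" and P: "\<And>z. z \<in> K ==> \<forall>\<^sub>F q in nhds (x0, y0, z). P q"
 shows "\<forall>\<^sub>F q in nhds (x0, y0). \<forall>z\<in>K. P (fst q, snd q, z)"
proof -
 have "\<forall>z\<in>K. \<exists>\<delta>>0. \<forall>h k d. norm h \<le> \<delta> --> norm k \<le> \<delta> --> norm d \<le> \<delta> --> P (x0 + h, y0 + k, z + d)"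
  using P by (intro ballI eventually_nhds_box)
 from bchoice[OF this] obtain r where r: "\<forall>z\<in>K. r z > 0 \<and> (\<forall>h k d. norm h \<le> r z --> norm k \<le> r z --> norm d \<le> r z --> P (x0 + h, y0 + k, z + d))"
  by (elim exE) (rule that)
 have "K \<subseteq> (\<Union>z\<in>K. ball z (r z))" using r by force
 then obtain F where F: "F \<subseteq> K" "finite F" "K \<subseteq> (\<Union>z\<in>F. ball z (r z))"
  using compactE_image[OF K, of K "\<lambda>z. ball z (r z)"] by (metis open_ball)
 have "\<forall>z\<in>F. \<forall>\<^sub>F q in nhds (x0, y0). dist q (x0, y0) < r z"
  using r F(1) by (intro ballI tendstoD[OF filterlim_ident]) auto
 then have "\<forall>\<^sub>F q in nhds (x0, y0). \<forall>z\<in>F. dist q (x0, y0) < r z" using F(2) by (simp add: eventually_ball_finite_distrib)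
 then show ?thesis
 proof (rule eventually_mono, intro ballI)
  fix q z assume q: "\<forall>z\<in>F. dist q (x0, y0) < r z" and z: "z \<in> K"
  obtain z' where z': "z' \<in> F" "dist z' z < r z'" using F(3) z by auto
  have "norm (fst q - x0) \<le> r z'" "norm (snd q - y0) \<le> r z'" "norm (z - z') \<le> r z'"
   using q[rule_format, OF z'(1)] dist_fst_le[of q "(x0, y0)"] dist_snd_le[of q "(x0, y0)"] z'(2)
   by (auto simp: dist_norm norm_minus_commute)
  then have "P (x0 + (fst q - x0), y0 + (snd q - y0), z' + (z - z'))"
   using r[rule_format, THEN conjunct2, rule_format, of z' "fst q - x0" "snd q - y0" "z - z'"] z' F(1) by blast
  then show "P (fst q, snd q, z)" by simp
 qed
qed

lemma no_common_root_nearby: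
 fixes c1 c2 :: "exponent => 'a::real_normed_field"
 assumes dom: "(x0, y0, w) \<in> laurent_dom A1" "(x0, y0, w) \<in> laurent_dom A2"
  and nz: "laurent A1 c1 (x0, y0, w) ~= 0 \<or> laurent A2 c2 (x0, y0, w) ~= 0"
 shows "\<forall>\<^sub>F q in nhds (x0, y0, w). \<not> (laurent A1 c1 q = 0 \<and> laurent A2 c2 q = 0)"
 using nz
proof
 assume "laurent A1 c1 (x0, y0, w) ~= 0"
 from tendsto_imp_eventually_ne[OF isCont_tendsto_nhds[OF isCont_laurent[OF dom(1)]] this]
 show ?thesis by eventually_elim blast
next
 assume "laurent A2 c2 (x0, y0, w) ~= 0"
 from tendsto_imp_eventually_ne[OF isCont_tendsto_nhds[OF isCont_laurent[OF dom(2)]] this]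
 show ?thesis by eventually_elim blast
qed

text \<open>In the chart \<open>w = z powi s\<close> a common root near the end would be a common
  root near \<open>w = 0\<close>, where one polynomial is nonzero. The bound keeps roots away from
  zero for \<open>s = 1\<close> and from infinity for \<open>s = -1\<close>.\<close>

lemma no_roots_near_end:
 fixes c1 c2 :: "exponent => 'a::{real_normed_field, heine_borel}"
 assumes A: "finite A1" "finite A2" and s: "s = 1 \<or> s = -1"
  and m: "\<And>k. k \<in> last_coords A1 ==> s * (k - m1) \<ge> 0" "\<And>k. k \<in> last_coords A2 ==> s * (k - m2) \<ge> 0"
  and xy: "x0 ~= 0" "y0 ~= 0" and nz: "coef A1 c1 m1 x0 y0 ~= 0 \<or> coef A2 c2 m2 x0 y0 ~= 0"
 shows "\<exists>r>0. \<forall>\<^sub>F q in nhds (x0, y0). \<forall>z. z ~= 0 --> laurent A1 c1 (fst q, snd q, z) = 0 --> laurent A2 c2 (fst q, snd q, z) = 0 -->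
  norm (z powi s) > r"
proof -
 have "\<forall>\<^sub>F q in nhds (x0, y0, 0). \<not> (laurent (shift_exps s m1 A1) (shift_coeffs s m1 c1) q = 0 \<and>
   laurent (shift_exps s m2 A2) (shift_coeffs s m2 c2) q = 0)"
  by (rule no_common_root_nearby[OF laurent_dom_shift[OF m(1) xy] laurent_dom_shift[OF m(2) xy]], assumption+,
   unfold laurent_shift(2)[OF s A(1)] laurent_shift(2)[OF s A(2)], rule nz)
 from eventually_nhds_box[OF this] obtain r where r: "r > 0" and box: "\<forall>h k d. norm h \<le> r --> norm k \<le> r --> norm d \<le> r -->
   \<not> (laurent (shift_exps s m1 A1) (shift_coeffs s m1 c1) (x0 + h, y0 + k, 0 + d) = 0 \<and>
   laurent (shift_exps s m2 A2) (shift_coeffs s m2 c2) (x0 + h, y0 + k, 0 + d) = 0)"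
  by (elim exE conjE) (rule that)
 have "\<forall>\<^sub>F q in nhds (x0, y0). dist q (x0, y0) < r" by (rule tendstoD[OF filterlim_ident r])
 then have "\<forall>\<^sub>F q in nhds (x0, y0). \<forall>z. z ~= 0 --> laurent A1 c1 (fst q, snd q, z) = 0 --> laurent A2 c2 (fst q, snd q, z) = 0 -->
  norm (z powi s) > r"
 proof (rule eventually_mono, intro allI impI)
  fix q z assume q: "dist q (x0, y0) < r" and z: "z ~= 0" "laurent A1 c1 (fst q, snd q, z) = 0" "laurent A2 c2 (fst q, snd q, z) = 0"
  have ss: "(z powi s) powi s = z" using s z(1) by (auto simp: power_int_minus)
  have w: "z powi s ~= 0" using z(1) by simp
  have "norm (fst q - x0) \<le> r" "norm (snd q - y0) \<le> r"
   using q dist_fst_le[of q "(x0, y0)"] dist_snd_le[of q "(x0, y0)"] by (auto simp: dist_norm)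
  then show "norm (z powi s) > r"
   using box[rule_format, of "fst q - x0" "snd q - y0" "z powi s"]
   by (intro not_le_imp_less notI) (simp add: laurent_shift(1)[OF s A(1) w] laurent_shift(1)[OF s A(2) w] ss z)
 qed
 then show ?thesis using r by blast
qed

text \<open>The annulus minus open balls about the points of \<open>Z\<close> is compact and free of
  common roots over the base point, hence also over nearby points.\<close>

lemma roots_near_finite_set:
 fixes c1 c2 :: "exponent => 'a::{real_normed_field, heine_borel}"
 assumes xy: "x0 ~= 0" "y0 ~= 0" and \<epsilon>: "\<epsilon> > 0" and r: "r > 0"
  and Z: "\<And>z. z ~= 0 ==> laurent A1 c1 (x0, y0, z) = 0 ==> laurent A2 c2 (x0, y0, z) = 0 ==> z \<in> Z"
 shows "\<forall>\<^sub>F q in nhds (x0, y0). \<forall>z. r \<le> norm z --> norm z \<le> R --> laurent A1 c1 (fst q, snd q, z) = 0 -->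
  laurent A2 c2 (fst q, snd q, z) = 0 --> (\<exists>z0\<in>Z. z \<in> cball z0 \<epsilon>)"
proof -
 define K where "K = (cball 0 R - ball 0 r) - (\<Union>z\<in>Z. ball z \<epsilon>)"
 have "compact K" unfolding K_def by (intro compact_diff compact_cball open_ball open_UN ballI)
 moreover have "\<forall>\<^sub>F q in nhds (x0, y0, z). \<not> (laurent A1 c1 q = 0 \<and> laurent A2 c2 q = 0)" if "z \<in> K" for z
 proof (rule no_common_root_nearby)
  have z: "z ~= 0" "z \<notin> Z" using that r \<epsilon> by (auto simp: K_def)
  show "(x0, y0, z) \<in> laurent_dom A1" "(x0, y0, z) \<in> laurent_dom A2" using xy z by (auto simp: laurent_dom_def)
  show "laurent A1 c1 (x0, y0, z) ~= 0 \<or> laurent A2 c2 (x0, y0, z) ~= 0" using Z[OF z(1)] z(2) by blast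
 qed
 ultimately have "\<forall>\<^sub>F q in nhds (x0, y0). \<forall>z\<in>K. \<not> (laurent A1 c1 (fst q, snd q, z) = 0 \<and> laurent A2 c2 (fst q, snd q, z) = 0)"
  by (rule tube_lemma_box)
 then show ?thesis
 proof (rule eventually_mono, intro allI impI)
  fix q z assume q: "\<forall>z\<in>K. \<not> (laurent A1 c1 (fst q, snd q, z) = 0 \<and> laurent A2 c2 (fst q, snd q, z) = 0)"
   and z: "r \<le> norm z" "norm z \<le> R" "laurent A1 c1 (fst q, snd q, z) = 0" "laurent A2 c2 (fst q, snd q, z) = 0"
  then have "z \<notin> K" by blast
  then have "z \<in> (\<Union>z\<in>Z. ball z \<epsilon>)" using z(1,2) by (auto simp: K_def)
  then show "\<exists>z0\<in>Z. z \<in> cball z0 \<epsilon>" by force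
 qed
qed

section \<open>The branches of the projected curve\<close>

lemma logder_linear:
 "logder A c q (a, b, d) = a * logder A c q (1, 0, 0) + b * logder A c q (0, 1, 0) + d * logder A c q (0, 0, 1)"
 by (cases q) (simp add: logder_def sum_distrib_left sum.distrib[symmetric] case_prod_unfold algebra_simps)

text \<open>The only ingredient proved separately for the two fields; everything below is uniform in
  the field.\<close>

definition analytic_branches :: "'a::real_normed_field itself => bool" where
 "analytic_branches _ \<longleftrightarrow> (\<forall>A1 A2 (c1 :: exponent => 'a) c2 q. q \<in> laurent_dom A1 --> q \<in> laurent_dom A2 -->
   laurent A1 c1 q = 0 --> dlaurent A1 c1 q (0, 0, 1) ~= 0 --> implicit_branch A1 c1 A2 c2 q)"

text \<open>A place is a finite root or an end in its chart. The polynomial with nonzero derivative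
  in \<open>w\<close> is solved first; the roles may be exchanged since the branch set is symmetric
  in the two polynomials.\<close>

lemma place_branch:
 fixes c1 c2 :: "exponent => 'a::{real_normed_field, euclidean_space}"
 assumes impl: "analytic_branches TYPE('a)"
  and dom: "(x0, y0, w0) \<in> laurent_dom A1" "(x0, y0, w0) \<in> laurent_dom A2"
  and zero: "laurent A1 c1 (x0, y0, w0) = 0" "laurent A2 c2 (x0, y0, w0) = 0"
  and D: "dlaurent A1 c1 (x0, y0, w0) (0, 0, 1) ~= 0 \<or> dlaurent A2 c2 (x0, y0, w0) (0, 0, 1) ~= 0"
  and independent: "\<forall>\<nu> \<mu>. (\<forall>d\<in>{(1, 0, 0), (0, 1, 0), (0, 0, 1)}.
   \<nu> * dlaurent A1 c1 (x0, y0, w0) d + \<mu> * dlaurent A2 c2 (x0, y0, w0) d = 0) --> \<nu> = 0 \<and> \<mu> = 0"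
 shows "\<exists>u v e. e > 0 \<and> (\<forall>a b. u * a + v * b = 0 -->
   (\<exists>d. dlaurent A1 c1 (x0, y0, w0) (a, b, d) = 0 \<and> dlaurent A2 c2 (x0, y0, w0) (a, b, d) = 0)) \<and>
  (\<forall>\<epsilon>. 0 < \<epsilon> --> \<epsilon> \<le> e --> smooth_branch_at (branch_set A1 c1 A2 c2 w0 \<epsilon>) (x0, y0) (u, v) \<and>
   closed_near (branch_set A1 c1 A2 c2 w0 \<epsilon>) (x0, y0))"
proof -
 note impl = impl[unfolded analytic_branches_def, rule_format]
 have rows: "\<nu> = 0 \<and> \<mu> = 0" if "\<forall>d\<in>{(1, 0, 0), (0, 1, 0), (0, 0, 1)}.
   \<nu> * dlaurent A1 c1 (x0, y0, w0) d + \<mu> * dlaurent A2 c2 (x0, y0, w0) d = 0" for \<nu> \<mu>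
  using independent[THEN spec, THEN spec, THEN mp, OF that] .
 have "\<exists>u v e. e > 0 \<and> (\<forall>a b. u * a + v * b = 0 -->
   (\<exists>d. dlaurent A1 c1 (x0, y0, w0) (a, b, d) = 0 \<and> dlaurent A2 c2 (x0, y0, w0) (a, b, d) = 0)) \<and>
  (\<forall>\<epsilon>. 0 < \<epsilon> --> \<epsilon> \<le> e --> smooth_branch_at (branch_set A1 c1 A2 c2 w0 \<epsilon>) (x0, y0) (u, v))"
 proof (cases "dlaurent A1 c1 (x0, y0, w0) (0, 0, 1) = 0")
  case False
  show ?thesis by (rule implicit_branch_smooth[OF impl[OF dom zero(1) False] dom zero False rows])
 next
  case True
  then have D2: "dlaurent A2 c2 (x0, y0, w0) (0, 0, 1) ~= 0" using D by blast
  have rows': "\<nu> = 0 \<and> \<mu> = 0" if "\<forall>d\<in>{(1, 0, 0), (0, 1, 0), (0, 0, 1)}.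
   \<nu> * dlaurent A2 c2 (x0, y0, w0) d + \<mu> * dlaurent A1 c1 (x0, y0, w0) d = 0" for \<nu> \<mu>
   using rows[of \<mu> \<nu>] that by (simp add: add.commute)
  show ?thesis
   using implicit_branch_smooth[OF impl[OF dom(2,1) zero(2) D2] dom(2,1) zero(2,1) D2 rows']
   unfolding branch_set_swap[of A2 c2 A1 c1] conj_commute[of "dlaurent A2 c2 _ _ = 0"] .
 qed
 then obtain u v e where e: "e > 0" and ker: "\<forall>a b. u * a + v * b = 0 -->
   (\<exists>d. dlaurent A1 c1 (x0, y0, w0) (a, b, d) = 0 \<and> dlaurent A2 c2 (x0, y0, w0) (a, b, d) = 0)" and
  sm: "\<forall>\<epsilon>. 0 < \<epsilon> --> \<epsilon> \<le> e --> smooth_branch_at (branch_set A1 c1 A2 c2 w0 \<epsilon>) (x0, y0) (u, v)"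
  by (elim exE conjE) (rule that)
 obtain e' where e': "e' > 0" and cl: "\<forall>\<epsilon>. 0 < \<epsilon> --> \<epsilon> \<le> e' --> closed_near (branch_set A1 c1 A2 c2 w0 \<epsilon>) (x0, y0)"
  using closed_near_branch_set[OF dom, of c1 c2] by (elim exE conjE) (rule that)
 show ?thesis
  by (rule exI[of _ u], rule exI[of _ v], rule exI[of _ "min e e'"], intro conjI ker, use e e' in simp)
   (intro allI impI conjI sm[rule_format] cl[rule_format]; simp)
qed

text \<open>Both statements express that the determinant is nonzero: if it vanished,
  \<open>(q1, - p1)\<close> and \<open>(q2, - p2)\<close> would lie in the kernel, making the matrix
  zero.\<close>

lemma injective_2x2_rows:
 fixes p1 p2 q1 q2 :: "'a::field"
 assumes inj: "\<And>a b. a * p1 + b * q1 = 0 ==> a * p2 + b * q2 = 0 ==> a = 0 \<and> b = 0"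
  and rel: "\<nu> * p1 + \<mu> * p2 = 0" "\<nu> * q1 + \<mu> * q2 = 0"
 shows "\<nu> = 0 \<and> \<mu> = 0"
proof -
 have "p1 * q2 - p2 * q1 ~= 0"
 proof
  assume d: "p1 * q2 - p2 * q1 = 0"
  have "q1 = 0 \<and> - p1 = 0" by (rule inj) (use d in \<open>auto simp: algebra_simps\<close>)
  moreover have "q2 = 0 \<and> - p2 = 0" by (rule inj) (use d in \<open>auto simp: algebra_simps\<close>)
  ultimately show False using inj[of 1 0] by simp
 qed
 moreover have "\<nu> * (p1 * q2 - p2 * q1) = (\<nu> * p1 + \<mu> * p2) * q2 - (\<nu> * q1 + \<mu> * q2) * p2" by (simp add: algebra_simps)
 moreover have "\<mu> * (p1 * q2 - p2 * q1) = (\<nu> * q1 + \<mu> * q2) * p1 - (\<nu> * p1 + \<mu> * p2) * q1" by (simp add: algebra_simps)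
 ultimately show ?thesis unfolding rel by simp
qed

text \<open>Cramer's rule on two columns with nonzero minor. If all minors vanished, each column
  would provide a row relation, hence be zero.\<close>

lemma independent_rows_surj:
 fixes p1 p2 q1 q2 s1 s2 :: "'a::field"
 assumes rows: "\<And>\<nu> \<mu>. \<nu> * p1 + \<mu> * p2 = 0 ==> \<nu> * q1 + \<mu> * q2 = 0 ==> \<nu> * s1 + \<mu> * s2 = 0 ==> \<nu> = 0 \<and> \<mu> = 0"
 shows "\<exists>a b d. a * p1 + b * q1 + d * s1 = \<alpha> \<and> a * p2 + b * q2 + d * s2 = \<beta>"
proof -
 have cramer: "\<exists>a b. a * p1 + b * q1 = \<alpha> \<and> a * p2 + b * q2 = \<beta>" if "p1 * q2 - p2 * q1 ~= 0" for p1 p2 q1 q2 :: 'a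
 proof (intro exI conjI)
  let ?d = "p1 * q2 - p2 * q1"
  have "(\<alpha> * q2 - \<beta> * q1) / ?d * p1 + (p1 * \<beta> - p2 * \<alpha>) / ?d * q1 = \<alpha> * ?d / ?d"
   by (simp add: add_divide_distrib[symmetric] algebra_simps)
  then show "(\<alpha> * q2 - \<beta> * q1) / ?d * p1 + (p1 * \<beta> - p2 * \<alpha>) / ?d * q1 = \<alpha>" using that by simp
  have "(\<alpha> * q2 - \<beta> * q1) / ?d * p2 + (p1 * \<beta> - p2 * \<alpha>) / ?d * q2 = \<beta> * ?d / ?d"
   by (simp add: add_divide_distrib[symmetric] algebra_simps)
  then show "(\<alpha> * q2 - \<beta> * q1) / ?d * p2 + (p1 * \<beta> - p2 * \<alpha>) / ?d * q2 = \<beta>" using that by simp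
 qed
 consider "p1 * q2 - p2 * q1 ~= 0" | "p1 * s2 - p2 * s1 ~= 0" | "q1 * s2 - q2 * s1 ~= 0"
  | "p1 * q2 = p2 * q1" "p1 * s2 = p2 * s1" "q1 * s2 = q2 * s1" by auto
 then show ?thesis
 proof cases
  case 1
  from cramer[OF this] obtain a b where "a * p1 + b * q1 = \<alpha>" "a * p2 + b * q2 = \<beta>" by blast
  then show ?thesis by (intro exI[of _ a] exI[of _ b] exI[of _ 0]) simp
 next
  case 2
  from cramer[OF this] obtain a b where "a * p1 + b * s1 = \<alpha>" "a * p2 + b * s2 = \<beta>" by blast
  then show ?thesis by (intro exI[of _ a] exI[of _ 0] exI[of _ b]) simp
 next
  case 3
  from cramer[OF this] obtain a b where "a * q1 + b * s1 = \<alpha>" "a * q2 + b * s2 = \<beta>" by blast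
  then show ?thesis by (intro exI[of _ 0] exI[of _ a] exI[of _ b]) simp
 next
  case 4
  have "p2 = 0 \<and> - p1 = 0" by (rule rows) (use 4 in \<open>simp_all add: mult.commute\<close>)
  moreover have "q2 = 0 \<and> - q1 = 0" by (rule rows) (use 4 in \<open>simp_all add: mult.commute\<close>)
  moreover have "s2 = 0 \<and> - s1 = 0" by (rule rows) (use 4 in \<open>simp_all add: mult.commute\<close>)
  ultimately show ?thesis using rows[of 1 0] by simp
 qed
qed

text \<open>By compactness of the unit sphere an injective differential is bounded below by
  \<open>B * norm d\<close>, which beats the error \<open>B / 2 * norm d\<close> of the linear
  approximation.\<close>

lemma derivative_injective_isolated:
 fixes f :: "'a::euclidean_space => 'b::real_normed_vector"
 assumes f: "(f has_derivative D) (at p)" "f p = 0" and inj: "\<And>d. D d = 0 ==> d = 0"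
 shows "\<forall>\<^sub>F q in nhds p. f q = 0 --> q = p"
proof -
 have lin: "linear D" using has_derivative_linear[OF f(1)] .
 have "compact (sphere (0 :: 'a) 1)" by simp
 have "continuous_on (sphere 0 1) (\<lambda>d. norm (D d))"
  by (intro continuous_on_norm linear_continuous_on has_derivative_bounded_linear[OF f(1)])
 show ?thesis
 proof (cases "sphere (0 :: 'a) 1 = {}")
  case True
  have "d = 0" for d :: 'a
  proof (rule ccontr)
   assume "d ~= 0"
   then have "d /\<^sub>R norm d \<in> sphere 0 1" by simp
   then show False using True by blast
  qed
  then have "q = p" for q by (metis eq_iff_diff_eq_0)
  then show ?thesis by simp
 next
  case False
  obtain m where m: "m \<in> sphere 0 1" "\<And>d. d \<in> sphere 0 1 ==> norm (D m) \<le> norm (D d)"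
   using continuous_attains_inf[OF \<open>compact (sphere (0 :: 'a) 1)\<close> False \<open>continuous_on (sphere 0 1) (\<lambda>d. norm (D d))\<close>] by blast
  define B where "B = norm (D m)"
  have B: "B > 0" using m(1) inj[of m] by (auto simp: B_def)
  have low: "B * norm d \<le> norm (D d)" for d
  proof (cases "d = 0")
   case False
   have "B \<le> norm (D (d /\<^sub>R norm d))" unfolding B_def by (rule m(2)) (use False in simp)
   also have "\<dots> = norm (D d) / norm d" using linear_scale[OF lin] by (simp add: divide_inverse mult.commute)
   finally show ?thesis using False by (simp add: field_simps)
  qed simp
  obtain r where r: "r > 0" "\<And>q. norm (q - p) < r ==> norm (f q - f p - D (q - p)) \<le> B / 2 * norm (q - p)"
   using f(1)[unfolded has_derivative_at_alt, THEN conjunct2, rule_format, of "B / 2"] B by auto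
  have "q = p" if "dist q p < r" "f q = 0" for q
  proof (rule ccontr)
   assume "q ~= p"
   then have "0 < norm (q - p)" by simp
   then have "B / 2 * norm (q - p) < B * norm (q - p)" using B by simp
   moreover have "norm (D (q - p)) \<le> B / 2 * norm (q - p)" using r(2)[of q] that f(2) by (simp add: dist_norm)
   ultimately show False using low[of "q - p"] by linarith
  qed
  then show ?thesis unfolding eventually_nhds_metric using r(1) by blast
 qed
qed

lemma gap_one:
 fixes B :: "int set"
 assumes B: "finite B" "card B \<ge> 2"
 shows "\<not> right_gap B > 1 ==> Max B - 1 \<in> B" "\<not> left_gap B > 1 ==> Min B + 1 \<in> B"
proof -
 have ne: "B ~= {}" "finite B" using B by auto
 have "B - {m} ~= {}" for m
 proof
  assume "B - {m} = {}"
  then have "B \<subseteq> {m}" by blast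
  then have "card B \<le> card {m}" by (intro card_mono) auto
  then show False using B(2) by simp
 qed
 then have in': "Max (B - {Max B}) \<in> B - {Max B}" "Min (B - {Min B}) \<in> B - {Min B}" using B by (auto intro!: Max_in Min_in simp del: Diff_iff)
 then have lt: "Max (B - {Max B}) < Max B" "Min B < Min (B - {Min B})"
  using Max_ge[OF ne(2), of "Max (B - {Max B})"] Min_le[OF ne(2), of "Min (B - {Min B})"] by auto
 show "Max B - 1 \<in> B" if "\<not> right_gap B > 1"
 proof -
  have "Max (B - {Max B}) = Max B - 1" using that \<open>Max (B - {Max B}) < Max B\<close> by (simp add: right_gap_def)
  then show ?thesis using in'(1) by simp
 qed
 show "Min B + 1 \<in> B" if "\<not> left_gap B > 1"
 proof -
  have "Min (B - {Min B}) = Min B + 1" using that \<open>Min B < Min (B - {Min B})\<close> by (simp add: left_gap_def)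
  then show ?thesis using in'(2) by simp
 qed
qed

lemma norm_powi_minus_one:
 fixes z :: "'a::real_normed_field"
 shows "norm (z powi (- 1)) = 1 / norm z"
 by (simp add: power_int_minus norm_inverse divide_inverse)

lemma finite_place:
 fixes c1 c2 :: "exponent => 'a::{real_normed_field, euclidean_space}"
 assumes impl: "analytic_branches TYPE('a)"
  and nice: "nice_pair A1 A2 c1 c2" and xy: "x0 ~= 0" "y0 ~= 0"
  and z: "z ~= 0" "laurent A1 c1 (x0, y0, z) = 0" "laurent A2 c2 (x0, y0, z) = 0"
 shows "\<exists>u v e. e > 0 \<and> (\<forall>a b. u * a + v * b = 0 -->
   (\<exists>d. logder A1 c1 (x0, y0, z) (a / x0, b / y0, d) = 0 \<and> logder A2 c2 (x0, y0, z) (a / x0, b / y0, d) = 0)) \<and>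
  (\<forall>\<epsilon>. 0 < \<epsilon> --> \<epsilon> \<le> e --> smooth_branch_at (branch_set A1 c1 A2 c2 z \<epsilon>) (x0, y0) (u, v) \<and>
   closed_near (branch_set A1 c1 A2 c2 z \<epsilon>) (x0, y0))"
proof -
 have dom: "(x0, y0, z) \<in> laurent_dom A" for A using xy z by (simp add: laurent_dom_def)
 have dl: "dlaurent A c (x0, y0, z) (1, 0, 0) = logder A c (x0, y0, z) (1, 0, 0) / x0"
  "dlaurent A c (x0, y0, z) (0, 1, 0) = logder A c (x0, y0, z) (0, 1, 0) / y0"
  "dlaurent A c (x0, y0, z) (0, 0, 1) = logder A c (x0, y0, z) (0, 0, 1) / z" for A and c :: "exponent => 'a"
  unfolding dlaurent_logder[OF xy z(1)]
  using logder_linear[of A c "(x0, y0, z)" "1 / x0" 0 0] logder_linear[of A c "(x0, y0, z)" 0 "1 / y0" 0]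
   logder_linear[of A c "(x0, y0, z)" 0 0 "1 / z"] by simp_all
 have D: "dlaurent A1 c1 (x0, y0, z) (0, 0, 1) ~= 0 \<or> dlaurent A2 c2 (x0, y0, z) (0, 0, 1) ~= 0"
  using nice_pairD(1)[OF nice xy z] z(1) by (simp add: dl)
 have row: "\<nu> = 0 \<and> \<mu> = 0" if r: "\<forall>d\<in>{(1, 0, 0), (0, 1, 0), (0, 0, 1)}.
   \<nu> * dlaurent A1 c1 (x0, y0, z) d + \<mu> * dlaurent A2 c2 (x0, y0, z) d = 0" for \<nu> \<mu>
 proof (rule nice_pairD(2)[OF nice xy z])
  have e: "\<nu> * a + \<mu> * b = 0" if "\<nu> * (a / t) + \<mu> * (b / t) = 0" "t ~= 0" for a b t
   using that by (simp add: add_divide_distrib[symmetric])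
  fix d assume "d \<in> {(1, 0, 0), (0, 1, 0), (0 :: 'a, 0 :: 'a, 1 :: 'a)}"
  then show "\<nu> * logder A1 c1 (x0, y0, z) d + \<mu> * logder A2 c2 (x0, y0, z) d = 0"
   using r e[of _ x0] e[of _ y0] e[of _ z] xy z(1) by (auto simp: dl)
 qed
 have rows: "\<forall>\<nu> \<mu>. (\<forall>d\<in>{(1, 0, 0), (0, 1, 0), (0, 0, 1)}.
   \<nu> * dlaurent A1 c1 (x0, y0, z) d + \<mu> * dlaurent A2 c2 (x0, y0, z) d = 0) --> \<nu> = 0 \<and> \<mu> = 0"
  by (intro allI impI) (rule row)
 obtain u v e where e: "e > 0" and ker: "\<forall>a b. u * a + v * b = 0 -->
   (\<exists>d. dlaurent A1 c1 (x0, y0, z) (a, b, d) = 0 \<and> dlaurent A2 c2 (x0, y0, z) (a, b, d) = 0)" and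
  sm: "\<forall>\<epsilon>. 0 < \<epsilon> --> \<epsilon> \<le> e --> smooth_branch_at (branch_set A1 c1 A2 c2 z \<epsilon>) (x0, y0) (u, v) \<and>
   closed_near (branch_set A1 c1 A2 c2 z \<epsilon>) (x0, y0)"
  using place_branch[OF impl dom dom z(2,3) D rows] by (elim exE conjE) (rule that)
 have "\<forall>a b. u * a + v * b = 0 -->
   (\<exists>d. logder A1 c1 (x0, y0, z) (a / x0, b / y0, d) = 0 \<and> logder A2 c2 (x0, y0, z) (a / x0, b / y0, d) = 0)"
  using ker unfolding dlaurent_logder[OF xy z(1)] by blast
 then show ?thesis
  by (intro exI[of _ u] exI[of _ v] exI[of _ e] conjI e sm)
qed

text \<open>In the chart at the end, the coefficient at distance one from the extreme exponent is
  nonzero for one of the polynomials, so the root \<open>w = 0\<close> is simple for it; this is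
  where (3) and (4) enter. Transversality of the two extreme coefficients gives independence of the
  rows.\<close>

lemma end_place:
 fixes c1 c2 :: "exponent => 'a::{real_normed_field, euclidean_space}"
 assumes impl: "analytic_branches TYPE('a)"
  and A: "finite A1" "finite A2" and nice: "nice_pair A1 A2 c1 c2" and xy: "x0 ~= 0" "y0 ~= 0"
  and s: "s = 1 \<or> s = -1" and m: "m1 \<in> last_coords A1" "m2 \<in> last_coords A2"
   "\<forall>k\<in>last_coords A1. s * (k - m1) \<ge> 0" "\<forall>k\<in>last_coords A2. s * (k - m2) \<ge> 0"
  and zero: "coef A1 c1 m1 x0 y0 = 0" "coef A2 c2 m2 x0 y0 = 0"
  and gap: "m1 + s \<in> last_coords A1 \<or> m2 + s \<in> last_coords A2"
 shows "\<exists>w e. e > 0 \<and> (\<forall>\<epsilon>. 0 < \<epsilon> --> \<epsilon> \<le> e -->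
   smooth_branch_at (branch_set (shift_exps s m1 A1) (shift_coeffs s m1 c1) (shift_exps s m2 A2) (shift_coeffs s m2 c2) 0 \<epsilon>) (x0, y0) w \<and>
   closed_near (branch_set (shift_exps s m1 A1) (shift_coeffs s m1 c1) (shift_exps s m2 A2) (shift_coeffs s m2 c2) 0 \<epsilon>) (x0, y0))"
proof -
 let ?A1 = "shift_exps s m1 A1" and ?c1 = "shift_coeffs s m1 c1" and ?A2 = "shift_exps s m2 A2" and ?c2 = "shift_coeffs s m2 c2"
 let ?L1 = "logder {e \<in> A1. snd (snd e) = m1} c1 (x0, y0, 1)" and ?L2 = "logder {e \<in> A2. snd (snd e) = m2} c2 (x0, y0, 1)"
 have dom: "(x0, y0, 0) \<in> laurent_dom ?A1" "(x0, y0, 0) \<in> laurent_dom ?A2"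
  by (rule laurent_dom_shift[OF bspec[OF m(3)] xy], assumption, rule laurent_dom_shift[OF bspec[OF m(4)] xy], assumption)
 have z: "laurent ?A1 ?c1 (x0, y0, 0) = 0" "laurent ?A2 ?c2 (x0, y0, 0) = 0"
  unfolding laurent_shift(2)[OF s A(1)] laurent_shift(2)[OF s A(2)] by (fact zero)+
 note ends = nice_pair_ends[OF nice xy m(1,2) zero]
 have L0: "logder A c q (0, 0, 0) = 0" for A and c :: "exponent => 'a" and q
  using logder_linear[of A c q 0 0 0] by simp
 have D: "dlaurent ?A1 ?c1 (x0, y0, 0) (0, 0, 1) ~= 0 \<or> dlaurent ?A2 ?c2 (x0, y0, 0) (0, 0, 1) ~= 0"
  unfolding dlaurent_shift[OF s A(1) xy] dlaurent_shift[OF s A(2) xy]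
  using gap ends(2)[of "m1 + s"] ends(3)[of "m2 + s"] s by (auto simp: L0)
 have row: "\<nu> = 0 \<and> \<mu> = 0" if r: "\<forall>d\<in>{(1, 0, 0), (0, 1, 0), (0, 0, 1)}.
   \<nu> * dlaurent ?A1 ?c1 (x0, y0, 0) d + \<mu> * dlaurent ?A2 ?c2 (x0, y0, 0) d = 0" for \<nu> \<mu>
 proof (rule injective_2x2_rows)
  have lin: "?L1 (a / x0, b / y0, 0) = a * ?L1 (1 / x0, 0, 0) + b * ?L1 (0, 1 / y0, 0)"
   "?L2 (a / x0, b / y0, 0) = a * ?L2 (1 / x0, 0, 0) + b * ?L2 (0, 1 / y0, 0)" for a b
   by (simp_all add: logder_linear[of _ _ _ "_ / _" _ 0] logder_linear[of _ _ _ 0 "_ / _" 0])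
  show "a = 0 \<and> b = 0" if "a * ?L1 (1 / x0, 0, 0) + b * ?L1 (0, 1 / y0, 0) = 0"
   "a * ?L2 (1 / x0, 0, 0) + b * ?L2 (0, 1 / y0, 0) = 0" for a b
  proof -
   have "a / x0 = 0 \<and> b / y0 = 0" by (rule ends(4)) (simp_all only: lin that)
   then show ?thesis using xy by simp
  qed
  show "\<nu> * ?L1 (1 / x0, 0, 0) + \<mu> * ?L2 (1 / x0, 0, 0) = 0"
   using bspec[OF r, of "(1, 0, 0)"] unfolding dlaurent_shift[OF s A(1) xy] dlaurent_shift[OF s A(2) xy] by simp
  show "\<nu> * ?L1 (0, 1 / y0, 0) + \<mu> * ?L2 (0, 1 / y0, 0) = 0"
   using bspec[OF r, of "(0, 1, 0)"] unfolding dlaurent_shift[OF s A(1) xy] dlaurent_shift[OF s A(2) xy] by simp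
 qed
 have rows: "\<forall>\<nu> \<mu>. (\<forall>d\<in>{(1, 0, 0), (0, 1, 0), (0, 0, 1)}.
   \<nu> * dlaurent ?A1 ?c1 (x0, y0, 0) d + \<mu> * dlaurent ?A2 ?c2 (x0, y0, 0) d = 0) --> \<nu> = 0 \<and> \<mu> = 0"
  by (intro allI impI) (rule row)
 obtain u v e where "e > 0"
  "\<forall>\<epsilon>. 0 < \<epsilon> --> \<epsilon> \<le> e --> smooth_branch_at (branch_set ?A1 ?c1 ?A2 ?c2 0 \<epsilon>) (x0, y0) (u, v) \<and>
   closed_near (branch_set ?A1 ?c1 ?A2 ?c2 0 \<epsilon>) (x0, y0)"
  using place_branch[OF impl dom z D rows] by (elim exE conjE) (rule that)
 then show ?thesis by (intro exI[of _ "(u, v)"] exI[of _ e] conjI)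
qed

section \<open>The image near a point over which a root escapes\<close>

context
 fixes A1 A2 :: "exponent set" and c1 c2 :: "exponent => 'a::{real_normed_field, euclidean_space}"
 assumes impl: "analytic_branches TYPE('a)"
  and A: "finite A1" "finite A2" and nice: "nice_pair A1 A2 c1 c2"
begin

abbreviation (input) curve_image :: "('a \<times> 'a) set" where
 "curve_image \<equiv> (\<lambda>(x, y, z). (x, y)) ` spatial_curve (laurent A1 c1) (laurent A2 c2)"

abbreviation (input) C :: "('a \<times> 'a) set" where "C \<equiv> projected_curve (laurent A1 c1) (laurent A2 c2)"

lemma curve_image_iff:
 "q \<in> curve_image \<longleftrightarrow> fst q ~= 0 \<and> snd q ~= 0 \<and> (\<exists>z. z ~= 0 \<and> laurent A1 c1 (fst q, snd q, z) = 0 \<and> laurent A2 c2 (fst q, snd q, z) = 0)"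
 unfolding spatial_curve_def by (cases q) (force simp: image_iff)

lemma eventually_torus:
 assumes "x0 ~= (0 :: 'a)" "y0 ~= (0 :: 'a)"
 shows "\<forall>\<^sub>F q in nhds (x0, y0). fst q ~= 0 \<and> snd q ~= 0"
proof -
 have "\<forall>\<^sub>F q in nhds (x0, y0). fst q ~= 0"
  by (rule tendsto_imp_eventually_ne[OF tendsto_fst[OF filterlim_ident]]) (simp add: assms)
 moreover have "\<forall>\<^sub>F q in nhds (x0, y0). snd q ~= 0"
  by (rule tendsto_imp_eventually_ne[OF tendsto_snd[OF filterlim_ident]]) (simp add: assms)
 ultimately show ?thesis by (rule eventually_conj)
qed

lemma curve_near:
 assumes xy: "x0 ~= 0" "y0 ~= 0" and p: "(x0, y0) \<in> C" and T: "closed_near T (x0, y0)"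
  and ST: "\<forall>\<^sub>F q in nhds (x0, y0). q \<in> curve_image --> q \<in> T" and TS: "\<forall>\<^sub>F q in nhds (x0, y0). q \<in> T --> q \<in> curve_image \<or> q = (x0, y0)"
 shows "\<forall>\<^sub>F q in nhds (x0, y0). q \<in> C \<longleftrightarrow> q \<in> T"
proof -
 have p': "(x0, y0) \<in> closure curve_image" using p unfolding projected_curve_def by blast
 show ?thesis using closure_near[OF T ST TS p'] eventually_torus[OF xy]
  by eventually_elim (auto simp: projected_curve_def)
qed

text \<open>When both extreme coefficients at one end vanish, there is no finite root over the point
  and no escape to the other end, where \<open>n1\<close> has a nonzero coefficient. All roots over
  nearby points are therefore close to this end and belong to its single smooth branch.\<close>

lemma end_branch:
 assumes xy: "x0 ~= 0" "y0 ~= 0" and p: "(x0, y0) \<in> C"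
  and s: "s = 1 \<or> s = -1" and m: "m1 \<in> last_coords A1" "m2 \<in> last_coords A2"
   "\<forall>k\<in>last_coords A1. s * (k - m1) \<ge> 0" "\<forall>k\<in>last_coords A2. s * (k - m2) \<ge> 0"
  and zero: "coef A1 c1 m1 x0 y0 = 0" "coef A2 c2 m2 x0 y0 = 0"
  and gap: "m1 + s \<in> last_coords A1 \<or> m2 + s \<in> last_coords A2"
  and n: "n1 \<in> last_coords A1" "n1 ~= m1"
   "\<forall>k\<in>last_coords A1. - s * (k - n1) \<ge> 0" "\<forall>k\<in>last_coords A2. - s * (k - n2) \<ge> 0"
 shows "\<exists>w. smooth_branch_at C (x0, y0) w"
proof -
 note ends = nice_pair_ends[OF nice xy m(1,2) zero]
 let ?T = "branch_set (shift_exps s m1 A1) (shift_coeffs s m1 c1) (shift_exps s m2 A2) (shift_coeffs s m2 c2) 0"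
 obtain w e where e: "e > 0" and br: "\<forall>\<epsilon>. 0 < \<epsilon> --> \<epsilon> \<le> e --> smooth_branch_at (?T \<epsilon>) (x0, y0) w \<and> closed_near (?T \<epsilon>) (x0, y0)"
  using end_place[OF impl A nice xy s m zero gap] by (elim exE conjE) (rule that)
 note br_e = br[rule_format, OF e order_refl]
 have sinv: "(w powi s) powi s = w" if "w ~= 0" for w :: 'a using s that by (auto simp: power_int_minus)
 have s': "- s = 1 \<or> - s = -1" using s by auto
 have "coef A1 c1 n1 x0 y0 ~= 0 \<or> coef A2 c2 n2 x0 y0 ~= 0" using ends(2)[of n1] n(1,2) by blast
 then have "\<exists>r>0. \<forall>\<^sub>F q in nhds (x0, y0). \<forall>z. z ~= 0 --> laurent A1 c1 (fst q, snd q, z) = 0 --> laurent A2 c2 (fst q, snd q, z) = 0 --> norm (z powi (- s)) > r"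
  by (intro no_roots_near_end[OF A s' _ _ xy]) (use n(3,4) in blast)+
 then obtain r where r: "r > 0"
  and far: "\<forall>\<^sub>F q in nhds (x0, y0). \<forall>z. z ~= 0 --> laurent A1 c1 (fst q, snd q, z) = 0 --> laurent A2 c2 (fst q, snd q, z) = 0 --> norm (z powi (- s)) > r"
  by (elim exE conjE) (rule that)
 \<comment> \<open>The set of finite roots over the point is empty, so the annulus contains no roots
   over nearby points; the radius 1 is arbitrary.\<close>
 have mid: "\<forall>\<^sub>F q in nhds (x0, y0). \<forall>z. min e r \<le> norm z --> norm z \<le> 1 / min e r --> laurent A1 c1 (fst q, snd q, z) = 0 -->
  laurent A2 c2 (fst q, snd q, z) = 0 --> (\<exists>z0\<in>{}. z \<in> cball z0 1)"
  by (rule roots_near_finite_set[OF xy]) (use e r ends(1) in auto)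
 have ST: "\<forall>\<^sub>F q in nhds (x0, y0). q \<in> curve_image --> q \<in> ?T e"
  using far mid
 proof eventually_elim
  case (elim q)
  show ?case
  proof
   assume "q \<in> curve_image"
   then obtain z where z: "z ~= 0" "laurent A1 c1 (fst q, snd q, z) = 0" "laurent A2 c2 (fst q, snd q, z) = 0"
    unfolding curve_image_iff by blast
   have w: "z powi s ~= 0" using z(1) by simp
   have "r < norm (z powi (- s))" using elim(1) z by blast
   moreover have "\<not> (min e r \<le> norm z \<and> norm z \<le> 1 / min e r)" using elim(2) z by blast
   ultimately have "norm (z powi s) \<le> e"
    using s
   proof (elim disjE)
    assume s: "s = 1" and *: "r < norm (z powi (- s))" "\<not> (min e r \<le> norm z \<and> norm z \<le> 1 / min e r)"
    have "r * norm z < 1" using *(1) z(1) unfolding s norm_powi_minus_one by (simp add: field_simps)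
    moreover have "min e r * norm z \<le> r * norm z" by (intro mult_right_mono) auto
    ultimately have "norm z \<le> 1 / min e r" using e r by (simp add: field_simps)
    then show ?thesis using *(2) s by simp
   next
    assume s: "s = - 1" and *: "r < norm (z powi (- s))" "\<not> (min e r \<le> norm z \<and> norm z \<le> 1 / min e r)"
    have "1 / min e r < norm z" using * s by auto
    then have "1 < min e r * norm z" using e r by (simp add: field_simps)
    also have "\<dots> \<le> e * norm z" by (intro mult_right_mono) auto
    finally show ?thesis using z(1) unfolding s norm_powi_minus_one by (simp add: field_simps)
   qed
   then show "q \<in> ?T e"
    unfolding branch_set_def by (intro CollectI bexI[of _ "z powi s"])
     (simp_all add: laurent_shift(1)[OF s A(1) w] laurent_shift(1)[OF s A(2) w] sinv z)
  qed
 qed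
 define h where "h q = (laurent {e \<in> A1. snd (snd e) = m1} c1 (fst q, snd q, 1), laurent {e \<in> A2. snd (snd e) = m2} c2 (fst q, snd q, 1))" for q
 have hc: "h q = (coef A1 c1 m1 (fst q) (snd q), coef A2 c2 m2 (fst q) (snd q))" for q
  unfolding h_def by (simp only: coef_laurent[OF A])
 have one: "((\<lambda>_ :: 'a \<times> 'a. 1 :: 'a) has_derivative (\<lambda>(a, b). 0 * a + 0 * b)) (at (x0, y0))"
  by (simp add: case_prod_unfold)
 have dom1: "(x0, y0, 1) \<in> laurent_dom A" for A using xy by (simp add: laurent_dom_def)
 have "(h has_derivative (\<lambda>d. (case d of (a, b) => dlaurent {e \<in> A1. snd (snd e) = m1} c1 (x0, y0, 1) (a, b, 0 * a + 0 * b),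
   case d of (a, b) => dlaurent {e \<in> A2. snd (snd e) = m2} c2 (x0, y0, 1) (a, b, 0 * a + 0 * b)))) (at (x0, y0))"
  unfolding h_def by (rule has_derivative_Pair; rule graph_has_derivative[OF one dom1])
 moreover have "h (x0, y0) = 0" unfolding hc by (simp add: zero zero_prod_def)
 \<comment> \<open>Points of the branch with \<open>w = 0\<close> need not come from the spatial
   curve; they are common zeros of the two extreme coefficients, and the base point is the only one
   nearby.\<close>
 ultimately have isolated: "\<forall>\<^sub>F q in nhds (x0, y0). h q = 0 --> q = (x0, y0)"
 proof (rule derivative_injective_isolated)
  fix d assume d: "(case d of (a, b) => dlaurent {e \<in> A1. snd (snd e) = m1} c1 (x0, y0, 1) (a, b, 0 * a + 0 * b),
   case d of (a, b) => dlaurent {e \<in> A2. snd (snd e) = m2} c2 (x0, y0, 1) (a, b, 0 * a + 0 * b)) = 0"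
  obtain a b where ab: "d = (a, b)" by (cases d)
  have "a / x0 = 0 \<and> b / y0 = 0"
   by (rule ends(4)) (use d in \<open>simp_all add: ab zero_prod_def dlaurent_logder[OF xy]\<close>)
  then show "d = 0" using xy by (simp add: ab zero_prod_def)
 qed
 have TS: "\<forall>\<^sub>F q in nhds (x0, y0). q \<in> ?T e --> q \<in> curve_image \<or> q = (x0, y0)"
  using isolated eventually_torus[OF xy]
 proof eventually_elim
  case (elim q)
  show ?case
  proof
   assume "q \<in> ?T e"
   then obtain w where w: "laurent (shift_exps s m1 A1) (shift_coeffs s m1 c1) (fst q, snd q, w) = 0"
    "laurent (shift_exps s m2 A2) (shift_coeffs s m2 c2) (fst q, snd q, w) = 0"
    unfolding branch_set_def by blast
   show "q \<in> curve_image \<or> q = (x0, y0)"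
   proof (cases "w = 0")
    case True
    have "h q = 0" using w unfolding True laurent_shift(2)[OF s A(1)] laurent_shift(2)[OF s A(2)] hc by (simp add: zero_prod_def)
    then show ?thesis using elim(1) by blast
   next
    case False
    have "laurent A1 c1 (fst q, snd q, w powi s) = 0" "laurent A2 c2 (fst q, snd q, w powi s) = 0" "w powi s ~= 0"
     using w False unfolding laurent_shift(1)[OF s A(1) False] laurent_shift(1)[OF s A(2) False] by simp_all
    then show ?thesis unfolding curve_image_iff using elim(2) by blast
   qed
  qed
 qed
 have "\<forall>\<^sub>F q in nhds (x0, y0). q \<in> C \<longleftrightarrow> q \<in> ?T e"
  by (rule curve_near[OF xy p br_e[THEN conjunct2] ST TS])
 from smooth_branch_at_cong[OF br_e[THEN conjunct1] this] show ?thesis by blast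
qed

end

text \<open>Over a singular point no root escapes, since that would give a smooth branch. Roots over
  nearby points thus stay in a compact annulus and cluster at the finite roots, of which there are
  one or two; a single one would again give a smooth branch, so there are two with different
  tangents.\<close>

lemma only_A1_singularities_nice_pair:
 fixes c1 c2 :: "exponent => 'a::{real_normed_field, euclidean_space}"
 assumes impl: "analytic_branches TYPE('a)"
  and A: "finite A1" "finite A2" and nice: "nice_pair A1 A2 c1 c2"
  and B: "card (last_coords A1) \<ge> 2" "card (last_coords A2) \<ge> 2"
  and gap: "\<not> (left_gap (last_coords A1) > 1 \<and> left_gap (last_coords A2) > 1)"
   "\<not> (right_gap (last_coords A1) > 1 \<and> right_gap (last_coords A2) > 1)"
 shows "only_A1_singularities (projected_curve (laurent A1 c1) (laurent A2 c2))"
 unfolding only_A1_singularities_def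
proof (intro allI impI)
 let ?B1 = "last_coords A1" and ?B2 = "last_coords A2"
 let ?C = "projected_curve (laurent A1 c1) (laurent A2 c2)"
 let ?S = "(\<lambda>(x, y, z). (x, y)) ` spatial_curve (laurent A1 c1) (laurent A2 c2)"
 fix p assume sing: "singular_point ?C p"
 obtain x0 y0 where p_eq: "p = (x0, y0)" by (cases p)
 have p: "(x0, y0) \<in> ?C" and no_branch: "\<not> (\<exists>w. smooth_branch_at ?C (x0, y0) w)"
  using sing unfolding singular_point_def p_eq by blast+
 have xy: "x0 ~= 0" "y0 ~= 0" and closure: "(x0, y0) \<in> closure ?S" using p by (auto simp: projected_curve_def)
 have fin: "finite ?B1" "finite ?B2" using A by (simp_all add: finite_last_coords)
 have ne: "?B1 ~= {}" "?B2 ~= {}" using B by auto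
 have MinMax: "Min B ~= Max B" if "finite B" "card B \<ge> 2" for B :: "int set"
 proof
  assume e: "Min B = Max B"
  have "B \<subseteq> {Max B}"
  proof
   fix b assume "b \<in> B"
   then have "Min B \<le> b" "b \<le> Max B" using that(1) by simp_all
   then show "b \<in> {Max B}" using e by simp
  qed
  then have "card B \<le> card {Max B}" by (intro card_mono) auto
  then show False using that(2) by simp
 qed
 note mem = Max_in[OF fin(1) ne(1)] Max_in[OF fin(2) ne(2)] Min_in[OF fin(1) ne(1)] Min_in[OF fin(2) ne(2)]
 have up: "\<forall>k\<in>?B1. - 1 * (k - Max ?B1) \<ge> 0" "\<forall>k\<in>?B2. - 1 * (k - Max ?B2) \<ge> 0"
  "\<forall>k\<in>?B1. 1 * (k - Min ?B1) \<ge> 0" "\<forall>k\<in>?B2. 1 * (k - Min ?B2) \<ge> 0"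
  "\<forall>k\<in>?B1. - (- 1) * (k - Min ?B1) \<ge> 0" "\<forall>k\<in>?B2. - (- 1) * (k - Min ?B2) \<ge> 0"
  using fin by simp_all
 \<comment> \<open>The top coefficients cannot both vanish at a singular point, for the end branch
   would make the point smooth; the same argument applies to the bottom coefficients.\<close>
 have max_nz: "coef A1 c1 (Max ?B1) x0 y0 ~= 0 \<or> coef A2 c2 (Max ?B2) x0 y0 ~= 0"
 proof (rule ccontr)
  assume "\<not> ?thesis"
  then have z: "coef A1 c1 (Max ?B1) x0 y0 = 0" "coef A2 c2 (Max ?B2) x0 y0 = 0" by blast+
  have "Max ?B1 - 1 \<in> ?B1 \<or> Max ?B2 - 1 \<in> ?B2"
   using gap(2) gap_one(1)[OF fin(1) B(1)] gap_one(1)[OF fin(2) B(2)] by blast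
  then have g: "Max ?B1 + (- 1) \<in> ?B1 \<or> Max ?B2 + (- 1) \<in> ?B2" by simp
  have "\<exists>w. smooth_branch_at ?C (x0, y0) w"
   by (rule end_branch[OF impl A nice xy p _ mem(1,2) up(1,2) z g mem(3) MinMax[OF fin(1) B(1)] up(5,6)]) simp
  then show False using no_branch by blast
 qed
 have min_nz: "coef A1 c1 (Min ?B1) x0 y0 ~= 0 \<or> coef A2 c2 (Min ?B2) x0 y0 ~= 0"
 proof (rule ccontr)
  assume "\<not> ?thesis"
  then have z: "coef A1 c1 (Min ?B1) x0 y0 = 0" "coef A2 c2 (Min ?B2) x0 y0 = 0" by blast+
  have g: "Min ?B1 + 1 \<in> ?B1 \<or> Min ?B2 + 1 \<in> ?B2"
   using gap(1) gap_one(2)[OF fin(1) B(1)] gap_one(2)[OF fin(2) B(2)] by blast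
  have "\<exists>w. smooth_branch_at ?C (x0, y0) w"
   by (rule end_branch[OF impl A nice xy p _ mem(3,4) up(3,4) z g mem(1) MinMax[OF fin(1) B(1), symmetric] up(1,2)]) simp
  then show False using no_branch by blast
 qed
 define Z where "Z = {z. z ~= 0 \<and> laurent A1 c1 (x0, y0, z) = 0 \<and> laurent A2 c2 (x0, y0, z) = 0}"
 have "\<exists>r>0. \<forall>\<^sub>F q in nhds (x0, y0). \<forall>z. z ~= 0 --> laurent A1 c1 (fst q, snd q, z) = 0 --> laurent A2 c2 (fst q, snd q, z) = 0 --> norm (z powi (- 1)) > r"
  by (rule no_roots_near_end[OF A _ _ _ xy max_nz]) (use up(1,2) in blast)+
 then obtain r1 where r1: "r1 > 0" and far: "\<forall>\<^sub>F q in nhds (x0, y0). \<forall>z. z ~= 0 --> laurent A1 c1 (fst q, snd q, z) = 0 --> laurent A2 c2 (fst q, snd q, z) = 0 --> norm (z powi (- 1)) > r1"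
  by (elim exE conjE) (rule that)
 have "\<exists>r>0. \<forall>\<^sub>F q in nhds (x0, y0). \<forall>z. z ~= 0 --> laurent A1 c1 (fst q, snd q, z) = 0 --> laurent A2 c2 (fst q, snd q, z) = 0 --> norm (z powi 1) > r"
  by (rule no_roots_near_end[OF A _ _ _ xy min_nz]) (use up(3,4) in blast)+
 then obtain r2 where r2: "r2 > 0" and near: "\<forall>\<^sub>F q in nhds (x0, y0). \<forall>z. z ~= 0 --> laurent A1 c1 (fst q, snd q, z) = 0 --> laurent A2 c2 (fst q, snd q, z) = 0 --> norm (z powi 1) > r2"
  by (elim exE conjE) (rule that)
 \<comment> \<open>The two end bounds confine the roots to an annulus, on which they are close to
   \<open>Z\<close>.\<close>
 have ST: "\<forall>\<^sub>F q in nhds (x0, y0). q \<in> ?S --> q \<in> (\<Union>z\<in>Z. branch_set A1 c1 A2 c2 z \<epsilon>)" if "\<epsilon> > 0" for \<epsilon>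
 proof -
  have "\<forall>\<^sub>F q in nhds (x0, y0). \<forall>z. r2 \<le> norm z --> norm z \<le> 1 / r1 --> laurent A1 c1 (fst q, snd q, z) = 0 -->
   laurent A2 c2 (fst q, snd q, z) = 0 --> (\<exists>z0\<in>Z. z \<in> cball z0 \<epsilon>)"
   by (rule roots_near_finite_set[OF xy that r2]) (simp add: Z_def)
  with far near show ?thesis
  proof eventually_elim
   case (elim q)
   show ?case
   proof
    assume "q \<in> ?S"
    then obtain z where z: "z ~= 0" "laurent A1 c1 (fst q, snd q, z) = 0" "laurent A2 c2 (fst q, snd q, z) = 0"
     unfolding curve_image_iff[OF impl A nice] by blast
    have "r1 * norm z < 1" using elim(1)[rule_format, OF z] z(1) unfolding norm_powi_minus_one by (simp add: field_simps)
    then have z_hi: "norm z \<le> 1 / r1" using r1 by (simp add: field_simps)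
    have z_lo: "r2 \<le> norm z" using elim(2)[rule_format, OF z] by simp
    obtain z0 where z0: "z0 \<in> Z" "z \<in> cball z0 \<epsilon>" using elim(3)[rule_format, OF z_lo z_hi z(2,3)] by blast
    have "q \<in> branch_set A1 c1 A2 c2 z0 \<epsilon>"
     unfolding branch_set_def by (rule CollectI, rule bexI[OF _ z0(2)], rule conjI[OF z(2,3)])
    then show "q \<in> (\<Union>z\<in>Z. branch_set A1 c1 A2 c2 z \<epsilon>)" by (rule UN_I[OF z0(1)])
   qed
  qed
 qed
 have TS: "\<forall>\<^sub>F q in nhds (x0, y0). q \<in> branch_set A1 c1 A2 c2 z \<epsilon> --> q \<in> ?S" if "\<epsilon> < norm z" for z \<epsilon>
  using eventually_torus[OF impl A nice xy]
 proof eventually_elim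
  case (elim q)
  show ?case
  proof
   assume "q \<in> branch_set A1 c1 A2 c2 z \<epsilon>"
   then obtain w where w: "w \<in> cball z \<epsilon>" "laurent A1 c1 (fst q, snd q, w) = 0" "laurent A2 c2 (fst q, snd q, w) = 0"
    unfolding branch_set_def by blast
   have "w ~= 0" using w(1) that by auto
   then show "q \<in> ?S" unfolding curve_image_iff[OF impl A nice] using elim w by blast
  qed
 qed
 have place: "\<exists>u v e. e > 0 \<and> (\<forall>a b. u * a + v * b = 0 -->
   (\<exists>d. logder A1 c1 (x0, y0, z) (a / x0, b / y0, d) = 0 \<and> logder A2 c2 (x0, y0, z) (a / x0, b / y0, d) = 0)) \<and>
  (\<forall>\<epsilon>. 0 < \<epsilon> --> \<epsilon> \<le> e --> smooth_branch_at (branch_set A1 c1 A2 c2 z \<epsilon>) (x0, y0) (u, v) \<and>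
   closed_near (branch_set A1 c1 A2 c2 z \<epsilon>) (x0, y0))" if "z \<in> Z" for z
  using that unfolding Z_def by (intro finite_place[OF impl nice xy]) blast+
 \<comment> \<open>The point lies in the closure of the image, and roots over nearby points have to
   cluster somewhere in the annulus.\<close>
 have "Z ~= {}"
 proof
  assume "Z = {}"
  then have "\<forall>\<^sub>F q in nhds (x0, y0). q \<notin> ?S" using ST[OF zero_less_one] by simp
  then obtain U where U: "open U" "(x0, y0) \<in> U" "\<And>q. q \<in> U ==> q \<notin> ?S" unfolding eventually_nhds by blast
  have "U \<inter> closure ?S = {}" using U(1,3) by (subst open_Int_closure_eq_empty) blast+
  then show False using U(2) closure by blast
 qed
 then obtain z where z: "z \<in> Z" by blast
 obtain u v e where e: "e > 0" and ker: "\<forall>a b. u * a + v * b = 0 -->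
   (\<exists>d. logder A1 c1 (x0, y0, z) (a / x0, b / y0, d) = 0 \<and> logder A2 c2 (x0, y0, z) (a / x0, b / y0, d) = 0)"
  and br: "\<forall>\<epsilon>. 0 < \<epsilon> --> \<epsilon> \<le> e --> smooth_branch_at (branch_set A1 c1 A2 c2 z \<epsilon>) (x0, y0) (u, v) \<and>
   closed_near (branch_set A1 c1 A2 c2 z \<epsilon>) (x0, y0)"
  using place[OF z] by (elim exE conjE) (rule that)
 have z0: "z ~= 0" "laurent A1 c1 (x0, y0, z) = 0" "laurent A2 c2 (x0, y0, z) = 0" using z by (auto simp: Z_def)
 show "type_A1_at ?C p"
 proof (cases "Z = {z}")
  case True
  \<comment> \<open>A radius below \<open>norm z\<close> keeps \<open>w = 0\<close> out of the ball,
    so every point of the branch in the torus comes from the spatial curve.\<close>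
  define \<epsilon> where "\<epsilon> = min e (norm z / 2)"
  have \<epsilon>: "0 < \<epsilon>" "\<epsilon> \<le> e" "\<epsilon> < norm z" using e z0(1) by (auto simp: \<epsilon>_def min_less_iff_disj)
  note b = br[rule_format, OF \<epsilon>(1,2)]
  have "\<forall>\<^sub>F q in nhds (x0, y0). q \<in> ?C \<longleftrightarrow> q \<in> branch_set A1 c1 A2 c2 z \<epsilon>"
  proof (rule curve_near[OF impl A nice xy p b[THEN conjunct2]])
   show "\<forall>\<^sub>F q in nhds (x0, y0). q \<in> ?S --> q \<in> branch_set A1 c1 A2 c2 z \<epsilon>" using ST[OF \<epsilon>(1)] unfolding True by simp
   show "\<forall>\<^sub>F q in nhds (x0, y0). q \<in> branch_set A1 c1 A2 c2 z \<epsilon> --> q \<in> ?S \<or> q = (x0, y0)"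
    using TS[OF \<epsilon>(3)] by eventually_elim blast
  qed
  from smooth_branch_at_cong[OF b[THEN conjunct1] this] show ?thesis using no_branch by blast
 next
  case False
  then obtain z' where z': "z' \<in> Z" "z ~= z'" using z by blast
  have z0': "z' ~= 0" "laurent A1 c1 (x0, y0, z') = 0" "laurent A2 c2 (x0, y0, z') = 0" using z' by (auto simp: Z_def)
  have Z2: "Z = {z, z'}"
  proof (intro equalityI subsetI)
   fix z'' assume "z'' \<in> Z"
   then have "z = z' \<or> z = z'' \<or> z' = z''" unfolding Z_def by (intro nice_pairD(4)[OF nice xy z0 z0']) auto
   then show "z'' \<in> {z, z'}" using z'(2) by blast
  qed (use z z' in auto)
  obtain u' v' e' where e': "e' > 0" and ker': "\<forall>a b. u' * a + v' * b = 0 -->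
    (\<exists>d. logder A1 c1 (x0, y0, z') (a / x0, b / y0, d) = 0 \<and> logder A2 c2 (x0, y0, z') (a / x0, b / y0, d) = 0)"
   and br': "\<forall>\<epsilon>. 0 < \<epsilon> --> \<epsilon> \<le> e' --> smooth_branch_at (branch_set A1 c1 A2 c2 z' \<epsilon>) (x0, y0) (u', v') \<and>
    closed_near (branch_set A1 c1 A2 c2 z' \<epsilon>) (x0, y0)"
   using place[OF z'(1)] by (elim exE conjE) (rule that)
  define \<epsilon> where "\<epsilon> = min (min e e') (min (norm z / 2) (norm z' / 2))"
  have \<epsilon>: "0 < \<epsilon>" "\<epsilon> \<le> e" "\<epsilon> \<le> e'" "\<epsilon> < norm z" "\<epsilon> < norm z'" using e e' z0(1) z0'(1) by (auto simp: \<epsilon>_def min_less_iff_disj min_le_iff_disj)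
  note b = br[rule_format, OF \<epsilon>(1,2)] and b' = br'[rule_format, OF \<epsilon>(1,3)]
  let ?T = "branch_set A1 c1 A2 c2 z \<epsilon>" and ?T' = "branch_set A1 c1 A2 c2 z' \<epsilon>"
  have union: "\<forall>\<^sub>F q in nhds (x0, y0). q \<in> ?C \<longleftrightarrow> q \<in> ?T \<union> ?T'"
  proof (rule curve_near[OF impl A nice xy p closed_near_Un[OF b[THEN conjunct2] b'[THEN conjunct2]]])
   show "\<forall>\<^sub>F q in nhds (x0, y0). q \<in> ?S --> q \<in> ?T \<union> ?T'" using ST[OF \<epsilon>(1)] unfolding Z2 by simp
   show "\<forall>\<^sub>F q in nhds (x0, y0). q \<in> ?T \<union> ?T' --> q \<in> ?S \<or> q = (x0, y0)"
    using TS[OF \<epsilon>(4)] TS[OF \<epsilon>(5)] by eventually_elim blast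
  qed
  have nz: "(u, v) ~= (0, 0)" using b[THEN conjunct1] unfolding smooth_branch_at_def prod.case by blast
  have "u * v' - v * u' ~= 0"
  proof
   assume d: "u * v' - v * u' = 0"
   \<comment> \<open>The vector \<open>(v, - u)\<close> spans the kernel of \<open>(u, v)\<close>;
     if the determinant vanishes, it also lies in the kernel of \<open>(u', v')\<close> and is a
     tangent direction of both branches.\<close>
   have 1: "u * v + v * (- u) = 0" "u' * v + v' * (- u) = 0" using d by (simp_all add: algebra_simps)
   obtain d1 where d1: "logder A1 c1 (x0, y0, z) (v / x0, - u / y0, d1) = 0" "logder A2 c2 (x0, y0, z) (v / x0, - u / y0, d1) = 0"
    using ker 1(1) by blast
   obtain d2 where d2: "logder A1 c1 (x0, y0, z') (v / x0, - u / y0, d2) = 0" "logder A2 c2 (x0, y0, z') (v / x0, - u / y0, d2) = 0"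
    using ker' 1(2) by blast
   have "v / x0 = 0 \<and> - u / y0 = 0" by (rule nice_pairD(3)[OF nice xy z0 z0' z'(2) d1 d2])
   then show False using xy nz by simp
  qed
  then show ?thesis unfolding type_A1_at_def p_eq
   using b[THEN conjunct1] b'[THEN conjunct1] union
   by (intro exI[of _ ?T] exI[of _ ?T'] exI[of _ u] exI[of _ v] exI[of _ u'] exI[of _ v']) simp
 qed
qed

text \<open>Logarithmic gradients differ from ordinary ones by scaling with the nonzero coordinates;
  independent rows of the 2x3 matrix make the differential onto.\<close>

lemma defines_smooth_curve_nice_pair:
 fixes c1 c2 :: "exponent => 'a::real_normed_field"
 assumes nice: "nice_pair A1 A2 c1 c2"
 shows "defines_smooth_curve (laurent A1 c1) (laurent A2 c2)"
 unfolding defines_smooth_curve_def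
proof
 fix q assume "q \<in> spatial_curve (laurent A1 c1) (laurent A2 c2)"
 then obtain x y z where q: "q = (x, y, z)" and nz: "x ~= 0" "y ~= 0" "z ~= 0"
  and zero: "laurent A1 c1 (x, y, z) = 0" "laurent A2 c2 (x, y, z) = 0" unfolding spatial_curve_def by blast
 have dom: "q \<in> laurent_dom A" for A using nz by (simp add: q laurent_dom_def)
 define D where "D d = (dlaurent A1 c1 q d, dlaurent A2 c2 q d)" for d
 have "((\<lambda>q. (laurent A1 c1 q, laurent A2 c2 q)) has_derivative D) (at q)"
  unfolding D_def by (intro has_derivative_Pair laurent_has_derivative dom)
 moreover have "surj D"
 proof -
  have "\<exists>d. D d = (\<alpha>, \<beta>)" for \<alpha> \<beta>
  proof -
   let ?l1 = "logder A1 c1 (x, y, z)" and ?l2 = "logder A2 c2 (x, y, z)"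
   have "\<exists>a b d. a * ?l1 (1, 0, 0) + b * ?l1 (0, 1, 0) + d * ?l1 (0, 0, 1) = \<alpha> \<and>
     a * ?l2 (1, 0, 0) + b * ?l2 (0, 1, 0) + d * ?l2 (0, 0, 1) = \<beta>"
   proof (rule independent_rows_surj)
    fix \<nu> \<mu> assume r: "\<nu> * ?l1 (1, 0, 0) + \<mu> * ?l2 (1, 0, 0) = 0" "\<nu> * ?l1 (0, 1, 0) + \<mu> * ?l2 (0, 1, 0) = 0"
     "\<nu> * ?l1 (0, 0, 1) + \<mu> * ?l2 (0, 0, 1) = 0"
    show "\<nu> = 0 \<and> \<mu> = 0" by (rule nice_pairD(2)[OF nice nz(1,2,3) zero]) (use r in auto)
   qed
   then obtain a b d where "?l1 (a, b, d) = \<alpha>" "?l2 (a, b, d) = \<beta>" unfolding logder_linear[of _ _ _ _ _ "_", symmetric] by blast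
   then have "D (a * x, b * y, d * z) = (\<alpha>, \<beta>)" using nz by (simp add: D_def q dlaurent_logder[OF nz])
   then show ?thesis by blast
  qed
  then show ?thesis unfolding surj_def by (metis surj_pair)
 qed
 ultimately show "\<exists>D. ((\<lambda>q. (laurent A1 c1 q, laurent A2 c2 q)) has_derivative D) (at q) \<and> surj D" by blast
qed

lemma analytic_branches_complex: "analytic_branches TYPE(complex)"
 unfolding analytic_branches_def by (auto intro: implicit_branch_complex)

lemma analytic_branches_real: "analytic_branches TYPE(real)"
 unfolding analytic_branches_def by (auto intro: implicit_branch_real)

theorem theorem1p8:
  fixes A1 A2 :: "exponent set" and B1 B2 :: "int set"
  assumes "finite A1" and "finite A2"
    and "B1 = last_coords A1" and "B2 = last_coords A2"
    and "card B1 \<ge> 2" and "card B2 \<ge> 2"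
    and "\<not> common_sublattice B1 B2"
    and "\<not> (split_sublattice B1 B2 \<or> split_sublattice B2 B1)"
    and "\<not> (left_gap B1 > 1 \<and> left_gap B2 > 1)"
    and "\<not> (right_gap B1 > 1 \<and> right_gap B2 > 1)"
    and "\<not> (two_and_long B1 B2 \<or> two_and_long B2 B1)"
  shows "holds_generically (A1 <+> A2) (\<lambda>c :: exponent + exponent \<Rightarrow> complex.
           let f1 = laurent A1 (\<lambda>e. c (Inl e)); f2 = laurent A2 (\<lambda>e. c (Inr e))
           in defines_smooth_curve f1 f2 \<and> only_A1_singularities (projected_curve f1 f2))
       \<and> holds_generically (A1 <+> A2) (\<lambda>c :: exponent + exponent \<Rightarrow> real.
           let f1 = laurent A1 (\<lambda>e. c (Inl e)); f2 = laurent A2 (\<lambda>e. c (Inr e))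
           in defines_smooth_curve f1 f2 \<and> only_A1_singularities (projected_curve f1 f2))"
proof -
 note B = assms(3,4)
 have card: "card (last_coords A1) \<ge> 2" "card (last_coords A2) \<ge> 2"
  and gap: "\<not> (left_gap (last_coords A1) > 1 \<and> left_gap (last_coords A2) > 1)"
   "\<not> (right_gap (last_coords A1) > 1 \<and> right_gap (last_coords A2) > 1)"
  using assms unfolding B by blast+
 have complex: "holds_generically (A1 <+> A2) (\<lambda>c :: _ => complex. nice_pair A1 A2 (coefl c) (coefr c))"
  by (rule generic_nice_pair) (use assms in blast)+
 have "finite (A1 <+> A2)" using assms(1,2) by (rule finite_Plus)
 then have real: "holds_generically (A1 <+> A2) (\<lambda>c :: _ => real. nice_pair A1 A2 (coefl c) (coefr c))"
  by (rule holds_generically_mono[OF holds_generically_real[OF _ complex]]) (rule nice_pair_real)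
 show ?thesis unfolding Let_def
 proof
  show "holds_generically (A1 <+> A2) (\<lambda>c :: exponent + exponent => complex.
   defines_smooth_curve (laurent A1 (coefl c)) (laurent A2 (coefr c)) \<and>
   only_A1_singularities (projected_curve (laurent A1 (coefl c)) (laurent A2 (coefr c))))"
   by (rule holds_generically_mono[OF complex])
    (rule conjI[OF defines_smooth_curve_nice_pair
     only_A1_singularities_nice_pair[OF analytic_branches_complex assms(1,2) _ card gap]])
  show "holds_generically (A1 <+> A2) (\<lambda>c :: exponent + exponent => real.
   defines_smooth_curve (laurent A1 (coefl c)) (laurent A2 (coefr c)) \<and>
   only_A1_singularities (projected_curve (laurent A1 (coefl c)) (laurent A2 (coefr c))))"
   by (rule holds_generically_mono[OF real])
    (rule conjI[OF defines_smooth_curve_nice_pair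
     only_A1_singularities_nice_pair[OF analytic_branches_real assms(1,2) _ card gap]])
 qed
qed

end
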